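(* Let $A$ be a small category, let $P$ be a small poset, and let $f\colon A\to P$ be a functor. For $p\in P$ let $\iota_{\le p}\colon A_{\le p}\to A$ be the inclusion of the full subcategory $A_{\le p}=\{x\in A\mid f(x)\le p\}$. Then the filtration $$F_f\colon P\to\mathrm{Sub}(A),\qquad p\mapsto A_{\le p},$$ is a left filtration of $A$. In particular, for every derivator $\mathscr D$ there is a decomposition morphism (a morphism of derivators) $d\colon\mathscr D^A\to\mathscr D^P$ such that for every $X\in\mathscr D^A$ (i) there is a canonical isomorphism $\operatorname{colim}_P dX\xrightarrow{\sim}\operatorname{colim}_A X$, and (ii) for every $p\in P$ there is a canonical isomorphism $(dX)_p\xrightarrow{\sim}\operatorname{colim}_{A_{\le p}}\iota_{\le p}^*X$.
   Context: Derivators. $\mathrm{Cat}$ is the 2-category of small categories, $\mathrm{CAT}$ that of not necessarily small categories, $\mathbb 1$ the terminal category. A prederivator is a strict 2-functor $\mathscr D\colon\mathrm{Cat}^{\mathrm{op}}\to\mathrm{CAT}$ (1-cells reversed); write $u^*=\mathscr D(u)$. It is a derivator if: (Der1) $\mathscr D(\coprod_i A_i)\to\prod_i\mathscr D(A_i)$ is an equivalence; (Der2) a morphism $f$ of $\mathscr D(A)$ is invertible iff $f_a:=a^*f$ is invertible for all objects $a\colon\mathbb 1\to A$; (Der3) every $u^*$ has a left adjoint $u_!$ and a right adjoint $u_*$; (Der4) for $u\colon A\to B$ and $b\in B$ the canonical maps $\operatorname{colim}_{(u/b)}p^*X\to (u_!X)_b$ and $(u_*X)_b\to\lim_{(b/u)}q^*X$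 are isomorphisms, where $p\colon(u/b)\to A$, $q\colon (b/u)\to A$ are the projections and $\operatorname{colim}_A=\pi_!$, $\lim_A=\pi_*$ for $\pi\colon A\to\mathbb 1$. Morphisms of derivators are pseudo-natural transformations; natural transformations between them are modifications. For $A\in\mathrm{Cat}$, $\mathscr D^A$ is the derivator $B\mapsto\mathscr D(A\times B)$; a functor $u\colon A\to B$ induces morphisms of derivators $u^*\colon\mathscr D^B\to\mathscr D^A$ and $u_!,u_*\colon\mathscr D^A\to\mathscr D^B$. "$X\in\mathscr D^A$" means $X\in\mathscr D^A(B)$ for some $B\in\mathrm{Cat}$ (objects with parameters), and $X_a=a^*X$. A functor $u\colon A\to B$ in $\mathrm{Cat}$ is homotopy final if for every derivator $\mathscr D$ the canonical map $\operatorname{colim}_A u^*X\to\operatorname{colim}_B X$ is an isomorphism for all $X\in\mathscr D^B$ (equivalently, all slice categories $(b/u)$ have weakly contractible nerve). Filtrations. $\mathrm{Sub}(A)$ is the category whose objects are subcategories $A'\to A$ and whose morphisms are functors $A'\to A''$ compatible with the inclusions into $A$. A filtration of $A$ is a pair $(C,F)$ with $C$ a small category and $F\colon C\to\mathrm{Sub}(A)$ a functor. For $F$ viewed as a functor to $\mathrm{Cat}$, the Grothendieck construction $\int_C F$ has objects $(c,x)$ with $c\in C$, $x\in F(c)$, and morphisms $(c,x)\to(c',x')$ the pairs $(f\colon c\to c', g\colon F(f)(x)\to x')$. The inclusions $F(c)\to A$ induce a functor $u_{C,F}\colon\int_C F\to C\times A\to A$, $(c,x)\mapsto x$. The filtration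 $(C,F)$ is a left filtration if $u_{C,F}$ is homotopy final. *)

theory Defs
  imports Main "HOL-Library.FuncSet"
begin

section \<open>Categories, functors, natural transformations\<close>

text \<open>
  A category may have arbitrary types of objects and arrows (such categories are the objects of
  CAT); only the values of the operations on the carriers matter. Functors and
  natural transformations are extensional on their carriers, so that equality of functors is
  equality in HOL and strict 2-functoriality can be stated by equations.
\<close>

record ('o, 'm) cat =
  Ob :: "'o set"
  Ar :: "'m set"
  Dom :: "'m \<Rightarrow> 'o"
  Cod :: "'m \<Rightarrow> 'o"
  Id :: "'o \<Rightarrow> 'm"
  Comp :: "'m \<Rightarrow> 'm \<Rightarrow> 'm"  (infixl "\<cdot>\<index>" 70)

definition hom :: "('o, 'm) cat \<Rightarrow> 'o \<Rightarrow> 'o \<Rightarrow> 'm set" where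
  "hom C x y = {f \<in> Ar C. Dom C f = x \<and> Cod C f = y}"

definition category :: "('o, 'm) cat \<Rightarrow> bool" where
  "category C \<longleftrightarrow>
     (\<forall>f \<in> Ar C. Dom C f \<in> Ob C \<and> Cod C f \<in> Ob C) \<and>
     (\<forall>x \<in> Ob C. Id C x \<in> hom C x x) \<and>
     (\<forall>f \<in> Ar C. \<forall>g \<in> Ar C. Dom C g = Cod C f \<longrightarrow> g \<cdot>\<^bsub>C\<^esub> f \<in> hom C (Dom C f) (Cod C g)) \<and>
     (\<forall>f \<in> Ar C. f \<cdot>\<^bsub>C\<^esub> Id C (Dom C f) = f \<and> Id C (Cod C f) \<cdot>\<^bsub>C\<^esub> f = f) \<and>
     (\<forall>f \<in> Ar C. \<forall>g \<in> Ar C. \<forall>h \<in> Ar C. Dom C g = Cod C f \<and> Dom C h = Cod C g \<longrightarrow>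
        h \<cdot>\<^bsub>C\<^esub> (g \<cdot>\<^bsub>C\<^esub> f) = (h \<cdot>\<^bsub>C\<^esub> g) \<cdot>\<^bsub>C\<^esub> f)"

definition isomorphism :: "('o, 'm) cat \<Rightarrow> 'm \<Rightarrow> bool" where
  "isomorphism C f \<longleftrightarrow> f \<in> Ar C \<and>
     (\<exists>g \<in> hom C (Cod C f) (Dom C f).
        g \<cdot>\<^bsub>C\<^esub> f = Id C (Dom C f) \<and> f \<cdot>\<^bsub>C\<^esub> g = Id C (Cod C f))"

record ('o, 'm, 'p, 'n) func =
  FSrc :: "('o, 'm) cat"
  FTgt :: "('p, 'n) cat"
  onOb :: "'o \<Rightarrow> 'p"
  onAr :: "'m \<Rightarrow> 'n"

definition is_functor :: "('o, 'm, 'p, 'n) func \<Rightarrow> bool" where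
  "is_functor F \<longleftrightarrow> category (FSrc F) \<and> category (FTgt F) \<and>
     onOb F \<in> Ob (FSrc F) \<rightarrow>\<^sub>E Ob (FTgt F) \<and>
     onAr F \<in> extensional (Ar (FSrc F)) \<and>
     (\<forall>f \<in> Ar (FSrc F).
        onAr F f \<in> hom (FTgt F) (onOb F (Dom (FSrc F) f)) (onOb F (Cod (FSrc F) f))) \<and>
     (\<forall>x \<in> Ob (FSrc F). onAr F (Id (FSrc F) x) = Id (FTgt F) (onOb F x)) \<and>
     (\<forall>f \<in> Ar (FSrc F). \<forall>g \<in> Ar (FSrc F). Dom (FSrc F) g = Cod (FSrc F) f \<longrightarrow>
        onAr F (g \<cdot>\<^bsub>FSrc F\<^esub> f) = onAr F g \<cdot>\<^bsub>FTgt F\<^esub> onAr F f)"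

definition Fun :: "('o, 'm) cat \<Rightarrow> ('p, 'n) cat \<Rightarrow> ('o, 'm, 'p, 'n) func set" where
  "Fun C D = {F. is_functor F \<and> FSrc F = C \<and> FTgt F = D}"

definition idF :: "('o, 'm) cat \<Rightarrow> ('o, 'm, 'o, 'm) func" where
  "idF C = \<lparr>FSrc = C, FTgt = C, onOb = (\<lambda>x\<in>Ob C. x), onAr = (\<lambda>f\<in>Ar C. f)\<rparr>"

definition compF :: "('p, 'n, 'q, 'k) func \<Rightarrow> ('o, 'm, 'p, 'n) func \<Rightarrow> ('o, 'm, 'q, 'k) func"
    (infixl "\<odot>" 75) where
  "G \<odot> F = \<lparr>FSrc = FSrc F, FTgt = FTgt G,
             onOb = (\<lambda>x\<in>Ob (FSrc F). onOb G (onOb F x)),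
             onAr = (\<lambda>f\<in>Ar (FSrc F). onAr G (onAr F f))\<rparr>"

record ('o, 'm, 'p, 'n) nat_trans =
  NSrc :: "('o, 'm, 'p, 'n) func"
  NTgt :: "('o, 'm, 'p, 'n) func"
  cmp :: "'o \<Rightarrow> 'n"

definition Nat :: "('o, 'm, 'p, 'n) func \<Rightarrow> ('o, 'm, 'p, 'n) func \<Rightarrow> ('o, 'm, 'p, 'n) nat_trans set" where
  "Nat F G = {\<alpha>. is_functor F \<and> is_functor G \<and> FSrc F = FSrc G \<and> FTgt F = FTgt G \<and>
     NSrc \<alpha> = F \<and> NTgt \<alpha> = G \<and>
     cmp \<alpha> \<in> extensional (Ob (FSrc F)) \<and>
     (\<forall>x \<in> Ob (FSrc F). cmp \<alpha> x \<in> hom (FTgt F) (onOb F x) (onOb G x)) \<and>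
     (\<forall>f \<in> Ar (FSrc F).
        onAr G f \<cdot>\<^bsub>FTgt F\<^esub> cmp \<alpha> (Dom (FSrc F) f) = cmp \<alpha> (Cod (FSrc F) f) \<cdot>\<^bsub>FTgt F\<^esub> onAr F f)}"

definition natural_iso :: "('o, 'm, 'p, 'n) func \<Rightarrow> ('o, 'm, 'p, 'n) func \<Rightarrow> ('o, 'm, 'p, 'n) nat_trans \<Rightarrow> bool" where
  "natural_iso F G \<alpha> \<longleftrightarrow> \<alpha> \<in> Nat F G \<and> (\<forall>x \<in> Ob (FSrc F). isomorphism (FTgt F) (cmp \<alpha> x))"

definition idN :: "('o, 'm, 'p, 'n) func \<Rightarrow> ('o, 'm, 'p, 'n) nat_trans" where
  "idN F = \<lparr>NSrc = F, NTgt = F, cmp = (\<lambda>x\<in>Ob (FSrc F). Id (FTgt F) (onOb F x))\<rparr>"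

definition vcomp :: "('o, 'm, 'p, 'n) nat_trans \<Rightarrow> ('o, 'm, 'p, 'n) nat_trans \<Rightarrow> ('o, 'm, 'p, 'n) nat_trans" where
  "vcomp \<beta> \<alpha> = \<lparr>NSrc = NSrc \<alpha>, NTgt = NTgt \<beta>,
     cmp = (\<lambda>x\<in>Ob (FSrc (NSrc \<alpha>)). cmp \<beta> x \<cdot>\<^bsub>FTgt (NSrc \<alpha>)\<^esub> cmp \<alpha> x)\<rparr>"

definition hcomp :: "('p, 'n, 'q, 'k) nat_trans \<Rightarrow> ('o, 'm, 'p, 'n) nat_trans \<Rightarrow> ('o, 'm, 'q, 'k) nat_trans" where
  "hcomp \<beta> \<alpha> = \<lparr>NSrc = NSrc \<beta> \<odot> NSrc \<alpha>, NTgt = NTgt \<beta> \<odot> NTgt \<alpha>,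
     cmp = (\<lambda>x\<in>Ob (FSrc (NSrc \<alpha>)).
       cmp \<beta> (onOb (NTgt \<alpha>) x) \<cdot>\<^bsub>FTgt (NSrc \<beta>)\<^esub> onAr (NSrc \<beta>) (cmp \<alpha> x))\<rparr>"

definition adjunction ::
  "('o, 'm, 'p, 'n) func \<Rightarrow> ('p, 'n, 'o, 'm) func \<Rightarrow> ('o, 'm, 'o, 'm) nat_trans \<Rightarrow> ('p, 'n, 'p, 'n) nat_trans \<Rightarrow> bool" where
  "adjunction L R \<eta> \<epsilon> \<longleftrightarrow>
     L \<in> Fun (FTgt R) (FSrc R) \<and> R \<in> Fun (FTgt L) (FSrc L) \<and>
     \<eta> \<in> Nat (idF (FSrc L)) (R \<odot> L) \<and> \<epsilon> \<in> Nat (L \<odot> R) (idF (FSrc R)) \<and>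
     (\<forall>x \<in> Ob (FSrc L). cmp \<epsilon> (onOb L x) \<cdot>\<^bsub>FTgt L\<^esub> onAr L (cmp \<eta> x) = Id (FTgt L) (onOb L x)) \<and>
     (\<forall>y \<in> Ob (FSrc R). onAr R (cmp \<epsilon> y) \<cdot>\<^bsub>FTgt R\<^esub> cmp \<eta> (onOb R y) = Id (FTgt R) (onOb R y))"

definition equivalence_functor :: "('o, 'm, 'p, 'n) func \<Rightarrow> bool" where
  "equivalence_functor F \<longleftrightarrow> is_functor F \<and>
     (\<exists>G \<eta> \<epsilon>. G \<in> Fun (FTgt F) (FSrc F) \<and>
        natural_iso (idF (FSrc F)) (G \<odot> F) \<eta> \<and> natural_iso (F \<odot> G) (idF (FTgt F)) \<epsilon>)"

definition prod_family :: "'i set \<Rightarrow> ('i \<Rightarrow> ('o, 'm) cat) \<Rightarrow> ('i \<Rightarrow> 'o, 'i \<Rightarrow> 'm) cat" where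
  "prod_family I C = \<lparr>
     Ob = (\<Pi>\<^sub>E i\<in>I. Ob (C i)), Ar = (\<Pi>\<^sub>E i\<in>I. Ar (C i)),
     Dom = (\<lambda>f. \<lambda>i\<in>I. Dom (C i) (f i)), Cod = (\<lambda>f. \<lambda>i\<in>I. Cod (C i) (f i)),
     Id = (\<lambda>x. \<lambda>i\<in>I. Id (C i) (x i)), Comp = (\<lambda>g f. \<lambda>i\<in>I. g i \<cdot>\<^bsub>C i\<^esub> f i)\<rparr>"

section \<open>Small categories\<close>

text \<open>
  Smallness is relative to a universe: a type \<open>'u\<close> with a notion of small subset
  that contains an infinite set and is closed under subsets, replacement and small unions.
  A Grothendieck universe containing an infinite set, with its members as the small sets, is
  an instance. Closure under power sets is not demanded, because none of the notions below uses it. A small category has small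
  sets of objects and arrows in \<open>'u\<close>.
\<close>

class universe =
  fixes small :: "'a set \<Rightarrow> bool"
  assumes small_infinity: "\<exists>X. small X \<and> infinite X"
    and small_subset: "small X \<Longrightarrow> Y \<subseteq> X \<Longrightarrow> small Y"
    and small_image: "small X \<Longrightarrow> small (f ` X)"
    and small_Union: "small I \<Longrightarrow> (\<And>i. i \<in> I \<Longrightarrow> small (S i)) \<Longrightarrow> small (\<Union>i\<in>I. S i)"

type_synonym 'u scat = "('u, 'u) cat"
type_synonym 'u sfunc = "('u, 'u, 'u, 'u) func"
type_synonym 'u snat = "('u, 'u, 'u, 'u) nat_trans"

definition small_category :: "'u::universe scat \<Rightarrow> bool" where
  "small_category A \<longleftrightarrow> category A \<and> small (Ob A) \<and> small (Ar A)"

text \<open>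
  Since \<open>'u\<close> is infinite, it has a pairing function. It is used to encode the
  objects and arrows of products, coproducts, slices and Grothendieck constructions in
  \<open>'u\<close>.
\<close>

definition pairing :: "'u::universe \<times> 'u \<Rightarrow> 'u" where
  "pairing = (SOME g. inj g)"

definition pr :: "'u::universe \<Rightarrow> 'u \<Rightarrow> 'u" ("\<lblot>_,/ _\<rblot>") where
  "\<lblot>x, y\<rblot> = pairing (x, y)"

definition p1 :: "'u::universe \<Rightarrow> 'u" where "p1 z = fst (inv pairing z)"
definition p2 :: "'u::universe \<Rightarrow> 'u" where "p2 z = snd (inv pairing z)"

lemma inj_pairing: "inj (pairing :: 'u::universe \<times> 'u \<Rightarrow> 'u)"
proof -
  have "infinite (UNIV :: 'u set)"
    using small_infinity infinite_super[OF subset_UNIV] by metis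
  then have "\<exists>g :: 'u \<times> 'u \<Rightarrow> 'u. bij_betw g (UNIV \<times> UNIV) UNIV"
    unfolding card_of_ordIso by (rule card_of_Times_same_infinite)
  then obtain g :: "'u \<times> 'u \<Rightarrow> 'u" where "bij_betw g (UNIV \<times> UNIV) UNIV"
    ..
  then have "inj g"
    by (simp add: bij_betw_def)
  then show ?thesis
    unfolding pairing_def by (rule someI[where P = inj])
qed

lemma p1_pr [simp]: "p1 \<lblot>x, y\<rblot> = x" and p2_pr [simp]: "p2 \<lblot>x, y\<rblot> = y"
  by (simp_all add: p1_def p2_def pr_def inj_pairing)

lemma pr_eq_iff [simp]: "\<lblot>x, y\<rblot> = \<lblot>x', y'\<rblot> \<longleftrightarrow> x = x' \<and> y = y'"
  by (metis p1_pr p2_pr)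

definition one_cat :: "'u::universe scat" where
  "one_cat = \<lparr>Ob = {undefined}, Ar = {undefined}, Dom = (\<lambda>_. undefined), Cod = (\<lambda>_. undefined),
     Id = (\<lambda>_. undefined), Comp = (\<lambda>_ _. undefined)\<rparr>"

definition to_one :: "'u::universe scat \<Rightarrow> 'u sfunc" where
  "to_one A = \<lparr>FSrc = A, FTgt = one_cat,
     onOb = (\<lambda>x\<in>Ob A. undefined), onAr = (\<lambda>f\<in>Ar A. undefined)\<rparr>"

definition point :: "'u::universe scat \<Rightarrow> 'u \<Rightarrow> 'u sfunc" where
  "point A a = \<lparr>FSrc = one_cat, FTgt = A,
     onOb = (\<lambda>x\<in>Ob one_cat. a), onAr = (\<lambda>f\<in>Ar one_cat. Id A a)\<rparr>"

definition prod_cat :: "'u::universe scat \<Rightarrow> 'u scat \<Rightarrow> 'u scat"  (infixr "\<times>\<^sub>c" 80) where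
  "A \<times>\<^sub>c B = \<lparr>
     Ob = {\<lblot>a, b\<rblot> | a b. a \<in> Ob A \<and> b \<in> Ob B},
     Ar = {\<lblot>f, g\<rblot> | f g. f \<in> Ar A \<and> g \<in> Ar B},
     Dom = (\<lambda>k. \<lblot>Dom A (p1 k), Dom B (p2 k)\<rblot>),
     Cod = (\<lambda>k. \<lblot>Cod A (p1 k), Cod B (p2 k)\<rblot>),
     Id = (\<lambda>x. \<lblot>Id A (p1 x), Id B (p2 x)\<rblot>),
     Comp = (\<lambda>l k. \<lblot>p1 l \<cdot>\<^bsub>A\<^esub> p1 k, p2 l \<cdot>\<^bsub>B\<^esub> p2 k\<rblot>)\<rparr>"

definition prodF :: "'u::universe sfunc \<Rightarrow> 'u sfunc \<Rightarrow> 'u sfunc"  (infixr "\<times>\<^sub>f" 80) where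
  "u \<times>\<^sub>f v = \<lparr>FSrc = FSrc u \<times>\<^sub>c FSrc v, FTgt = FTgt u \<times>\<^sub>c FTgt v,
     onOb = (\<lambda>x\<in>Ob (FSrc u \<times>\<^sub>c FSrc v). \<lblot>onOb u (p1 x), onOb v (p2 x)\<rblot>),
     onAr = (\<lambda>k\<in>Ar (FSrc u \<times>\<^sub>c FSrc v). \<lblot>onAr u (p1 k), onAr v (p2 k)\<rblot>)\<rparr>"

definition prodN :: "'u::universe snat \<Rightarrow> 'u snat \<Rightarrow> 'u snat"  (infixr "\<times>\<^sub>n" 80) where
  "\<alpha> \<times>\<^sub>n \<beta> = \<lparr>NSrc = NSrc \<alpha> \<times>\<^sub>f NSrc \<beta>, NTgt = NTgt \<alpha> \<times>\<^sub>f NTgt \<beta>,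
     cmp = (\<lambda>x\<in>Ob (FSrc (NSrc \<alpha>) \<times>\<^sub>c FSrc (NSrc \<beta>)). \<lblot>cmp \<alpha> (p1 x), cmp \<beta> (p2 x)\<rblot>)\<rparr>"

definition proj2 :: "'u::universe scat \<Rightarrow> 'u scat \<Rightarrow> 'u sfunc" where
  "proj2 A B = \<lparr>FSrc = A \<times>\<^sub>c B, FTgt = B,
     onOb = (\<lambda>x\<in>Ob (A \<times>\<^sub>c B). p2 x), onAr = (\<lambda>k\<in>Ar (A \<times>\<^sub>c B). p2 k)\<rparr>"

definition section_at :: "'u::universe scat \<Rightarrow> 'u \<Rightarrow> 'u scat \<Rightarrow> 'u sfunc" where
  "section_at A a B = \<lparr>FSrc = B, FTgt = A \<times>\<^sub>c B,
     onOb = (\<lambda>b\<in>Ob B. \<lblot>a, b\<rblot>), onAr = (\<lambda>g\<in>Ar B. \<lblot>Id A a, g\<rblot>)\<rparr>"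

definition coprod_cat :: "'u::universe set \<Rightarrow> ('u \<Rightarrow> 'u scat) \<Rightarrow> 'u scat" where
  "coprod_cat I A = \<lparr>
     Ob = {\<lblot>i, x\<rblot> | i x. i \<in> I \<and> x \<in> Ob (A i)},
     Ar = {\<lblot>i, f\<rblot> | i f. i \<in> I \<and> f \<in> Ar (A i)},
     Dom = (\<lambda>k. \<lblot>p1 k, Dom (A (p1 k)) (p2 k)\<rblot>),
     Cod = (\<lambda>k. \<lblot>p1 k, Cod (A (p1 k)) (p2 k)\<rblot>),
     Id = (\<lambda>x. \<lblot>p1 x, Id (A (p1 x)) (p2 x)\<rblot>),
     Comp = (\<lambda>l k. \<lblot>p1 k, p2 l \<cdot>\<^bsub>A (p1 k)\<^esub> p2 k\<rblot>)\<rparr>"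

definition coproj :: "'u::universe set \<Rightarrow> ('u \<Rightarrow> 'u scat) \<Rightarrow> 'u \<Rightarrow> 'u sfunc" where
  "coproj I A i = \<lparr>FSrc = A i, FTgt = coprod_cat I A,
     onOb = (\<lambda>x\<in>Ob (A i). \<lblot>i, x\<rblot>), onAr = (\<lambda>f\<in>Ar (A i). \<lblot>i, f\<rblot>)\<rparr>"

text \<open>
  A category given by a set of objects and sets of labels \<open>H x y\<close>: an arrow is a
  triple of source, label and target.
\<close>

definition labelled_cat ::
  "'u::universe set \<Rightarrow> ('u \<Rightarrow> 'u \<Rightarrow> 'u set) \<Rightarrow> ('u \<Rightarrow> 'u) \<Rightarrow> ('u \<Rightarrow> 'u \<Rightarrow> 'u) \<Rightarrow> 'u scat" where
  "labelled_cat X H i c = \<lparr>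
     Ob = X,
     Ar = {\<lblot>x, \<lblot>l, y\<rblot>\<rblot> | x l y. x \<in> X \<and> y \<in> X \<and> l \<in> H x y},
     Dom = p1,
     Cod = (\<lambda>k. p2 (p2 k)),
     Id = (\<lambda>x. \<lblot>x, \<lblot>i x, x\<rblot>\<rblot>),
     Comp = (\<lambda>k' k. \<lblot>p1 k, \<lblot>c (p1 (p2 k')) (p1 (p2 k)), p2 (p2 k')\<rblot>\<rblot>)\<rparr>"

text \<open>
  The slice categories \<open>(u/b)\<close>, with objects \<open>(a, h: u a \<rightarrow> b)\<close>,
  and \<open>(b/u)\<close>, with objects \<open>(a, h: b \<rightarrow> u a)\<close>, and the
  projection to the source of \<open>u\<close>.
\<close>

definition slice_over :: "'u::universe sfunc \<Rightarrow> 'u \<Rightarrow> 'u scat" where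
  "slice_over u b = labelled_cat
     {\<lblot>a, h\<rblot> | a h. a \<in> Ob (FSrc u) \<and> h \<in> hom (FTgt u) (onOb u a) b}
     (\<lambda>x y. {g \<in> hom (FSrc u) (p1 x) (p1 y). p2 y \<cdot>\<^bsub>FTgt u\<^esub> onAr u g = p2 x})
     (\<lambda>x. Id (FSrc u) (p1 x))
     (Comp (FSrc u))"

definition slice_under :: "'u::universe \<Rightarrow> 'u sfunc \<Rightarrow> 'u scat" where
  "slice_under b u = labelled_cat
     {\<lblot>a, h\<rblot> | a h. a \<in> Ob (FSrc u) \<and> h \<in> hom (FTgt u) b (onOb u a)}
     (\<lambda>x y. {g \<in> hom (FSrc u) (p1 x) (p1 y). onAr u g \<cdot>\<^bsub>FTgt u\<^esub> p2 x = p2 y})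
     (\<lambda>x. Id (FSrc u) (p1 x))
     (Comp (FSrc u))"

definition slice_over_proj :: "'u::universe sfunc \<Rightarrow> 'u \<Rightarrow> 'u sfunc" where
  "slice_over_proj u b = \<lparr>FSrc = slice_over u b, FTgt = FSrc u,
     onOb = (\<lambda>x\<in>Ob (slice_over u b). p1 x), onAr = (\<lambda>k\<in>Ar (slice_over u b). p1 (p2 k))\<rparr>"

definition slice_under_proj :: "'u::universe \<Rightarrow> 'u sfunc \<Rightarrow> 'u sfunc" where
  "slice_under_proj b u = \<lparr>FSrc = slice_under b u, FTgt = FSrc u,
     onOb = (\<lambda>x\<in>Ob (slice_under b u). p1 x), onAr = (\<lambda>k\<in>Ar (slice_under b u). p1 (p2 k))\<rparr>"

text \<open>
  The tautological 2-cells \<open>u p \<Rightarrow> b \<pi>\<close> and \<open>b \<pi> \<Rightarrow> u q\<close>,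
  whose component at \<open>(a, h)\<close> is \<open>h\<close>.
\<close>

definition slice_over_cell :: "'u::universe sfunc \<Rightarrow> 'u \<Rightarrow> 'u snat" where
  "slice_over_cell u b = \<lparr>NSrc = u \<odot> slice_over_proj u b,
     NTgt = point (FTgt u) b \<odot> to_one (slice_over u b), cmp = (\<lambda>x\<in>Ob (slice_over u b). p2 x)\<rparr>"

definition slice_under_cell :: "'u::universe \<Rightarrow> 'u sfunc \<Rightarrow> 'u snat" where
  "slice_under_cell b u = \<lparr>NSrc = point (FTgt u) b \<odot> to_one (slice_under b u),
     NTgt = u \<odot> slice_under_proj b u, cmp = (\<lambda>x\<in>Ob (slice_under b u). p2 x)\<rparr>"

section \<open>Derivators\<close>

record ('u, 'o, 'm) prederiv =
  val :: "'u scat \<Rightarrow> ('o, 'm) cat"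
  pull :: "'u sfunc \<Rightarrow> ('o, 'm, 'o, 'm) func"
  pull2 :: "'u snat \<Rightarrow> ('o, 'm, 'o, 'm) nat_trans"

definition prederivator :: "('u::universe, 'o, 'm) prederiv \<Rightarrow> bool" where
  "prederivator D \<longleftrightarrow>
     (\<forall>A. small_category A \<longrightarrow> category (val D A)) \<and>
     (\<forall>A B u. small_category A \<and> small_category B \<and> u \<in> Fun A B \<longrightarrow>
        pull D u \<in> Fun (val D B) (val D A)) \<and>
     (\<forall>A B u v \<alpha>. small_category A \<and> small_category B \<and> u \<in> Fun A B \<and> v \<in> Fun A B \<and> \<alpha> \<in> Nat u v \<longrightarrow>
        pull2 D \<alpha> \<in> Nat (pull D u) (pull D v)) \<and>
     (\<forall>A. small_category A \<longrightarrow> pull D (idF A) = idF (val D A)) \<and>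
     (\<forall>A B C u v. small_category A \<and> small_category B \<and> small_category C \<and>
        u \<in> Fun A B \<and> v \<in> Fun B C \<longrightarrow> pull D (v \<odot> u) = pull D u \<odot> pull D v) \<and>
     (\<forall>A B u. small_category A \<and> small_category B \<and> u \<in> Fun A B \<longrightarrow>
        pull2 D (idN u) = idN (pull D u)) \<and>
     (\<forall>A B u v w \<alpha> \<beta>. small_category A \<and> small_category B \<and>
        u \<in> Fun A B \<and> v \<in> Fun A B \<and> w \<in> Fun A B \<and> \<alpha> \<in> Nat u v \<and> \<beta> \<in> Nat v w \<longrightarrow>
        pull2 D (vcomp \<beta> \<alpha>) = vcomp (pull2 D \<beta>) (pull2 D \<alpha>)) \<and>
     (\<forall>A B C u u' v v' \<alpha> \<beta>. small_category A \<and> small_category B \<and> small_category C \<and>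
        u \<in> Fun A B \<and> u' \<in> Fun A B \<and> v \<in> Fun B C \<and> v' \<in> Fun B C \<and>
        \<alpha> \<in> Nat u u' \<and> \<beta> \<in> Nat v v' \<longrightarrow>
        pull2 D (hcomp \<beta> \<alpha>) = hcomp (pull2 D \<alpha>) (pull2 D \<beta>))"

text \<open>
  A choice of left adjoint \<open>u\<^sub>!\<close> and right adjoint \<open>u\<^sub>*\<close>
  of \<open>u\<^sup>*\<close>, with unit and counit. It is only meaningful if these adjoints exist.
\<close>

definition lan_data where
  "lan_data D u = (SOME (L, \<eta>, \<epsilon>). adjunction L (pull D u) \<eta> \<epsilon>)"
definition ran_data where
  "ran_data D u = (SOME (R, \<eta>, \<epsilon>). adjunction (pull D u) R \<eta> \<epsilon>)"

definition lan :: "('u::universe, 'o, 'm) prederiv \<Rightarrow> 'u sfunc \<Rightarrow> ('o, 'm, 'o, 'm) func" where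
  "lan D u = fst (lan_data D u)"
definition lan_unit :: "('u::universe, 'o, 'm) prederiv \<Rightarrow> 'u sfunc \<Rightarrow> ('o, 'm, 'o, 'm) nat_trans" where
  "lan_unit D u = fst (snd (lan_data D u))"
definition lan_counit :: "('u::universe, 'o, 'm) prederiv \<Rightarrow> 'u sfunc \<Rightarrow> ('o, 'm, 'o, 'm) nat_trans" where
  "lan_counit D u = snd (snd (lan_data D u))"

definition ran :: "('u::universe, 'o, 'm) prederiv \<Rightarrow> 'u sfunc \<Rightarrow> ('o, 'm, 'o, 'm) func" where
  "ran D u = fst (ran_data D u)"
definition ran_unit :: "('u::universe, 'o, 'm) prederiv \<Rightarrow> 'u sfunc \<Rightarrow> ('o, 'm, 'o, 'm) nat_trans" where
  "ran_unit D u = fst (snd (ran_data D u))"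
definition ran_counit :: "('u::universe, 'o, 'm) prederiv \<Rightarrow> 'u sfunc \<Rightarrow> ('o, 'm, 'o, 'm) nat_trans" where
  "ran_counit D u = snd (snd (ran_data D u))"

text \<open>
  All canonical maps are obtained from the following one. For functors \<open>p: S \<rightarrow> A\<close>,
  \<open>q: S \<rightarrow> T\<close>, \<open>u: A \<rightarrow> B\<close>, \<open>v: T \<rightarrow> B\<close> and a 2-cell
  \<open>\<alpha>: u p \<Rightarrow> v q\<close>, its mate is the map
  \<open>q\<^sub>! p\<^sup>* X \<rightarrow> q\<^sub>! p\<^sup>* u\<^sup>* u\<^sub>! X \<rightarrow> q\<^sub>! q\<^sup>* v\<^sup>* u\<^sub>! X \<rightarrow> v\<^sup>* u\<^sub>! X\<close>
  formed from the unit of \<open>u\<close>, from \<open>\<alpha>\<^sup>*\<close> and from the counit of \<open>q\<close>.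
\<close>

definition mate ::
  "('u::universe, 'o, 'm) prederiv \<Rightarrow> 'u sfunc \<Rightarrow> 'u sfunc \<Rightarrow> 'u sfunc \<Rightarrow> 'u sfunc \<Rightarrow> 'u snat
     \<Rightarrow> ('o, 'm, 'o, 'm) nat_trans" where
  "mate D p q u v \<alpha> = \<lparr>NSrc = lan D q \<odot> pull D p, NTgt = pull D v \<odot> lan D u,
     cmp = (\<lambda>X\<in>Ob (val D (FSrc u)).
       cmp (lan_counit D q) (onOb (pull D v) (onOb (lan D u) X)) \<cdot>\<^bsub>val D (FTgt q)\<^esub>
       onAr (lan D q)
         (cmp (pull2 D \<alpha>) (onOb (lan D u) X) \<cdot>\<^bsub>val D (FSrc q)\<^esub>
          onAr (pull D p) (cmp (lan_unit D u) X)))\<rparr>"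

text \<open>
  Dually, for \<open>\<alpha>: v q \<Rightarrow> u p\<close>, the map
  \<open>v\<^sup>* u\<^sub>* X \<rightarrow> q\<^sub>* q\<^sup>* v\<^sup>* u\<^sub>* X \<rightarrow> q\<^sub>* p\<^sup>* u\<^sup>* u\<^sub>* X \<rightarrow> q\<^sub>* p\<^sup>* X\<close>.
\<close>

definition comate ::
  "('u::universe, 'o, 'm) prederiv \<Rightarrow> 'u sfunc \<Rightarrow> 'u sfunc \<Rightarrow> 'u sfunc \<Rightarrow> 'u sfunc \<Rightarrow> 'u snat
     \<Rightarrow> ('o, 'm, 'o, 'm) nat_trans" where
  "comate D p q u v \<alpha> = \<lparr>NSrc = pull D v \<odot> ran D u, NTgt = ran D q \<odot> pull D p,
     cmp = (\<lambda>X\<in>Ob (val D (FSrc u)).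
       onAr (ran D q)
         (onAr (pull D p) (cmp (ran_counit D u) X) \<cdot>\<^bsub>val D (FSrc q)\<^esub>
          cmp (pull2 D \<alpha>) (onOb (ran D u) X)) \<cdot>\<^bsub>val D (FTgt q)\<^esub>
       cmp (ran_unit D q) (onOb (pull D v) (onOb (ran D u) X)))\<rparr>"

definition coprod_comparison ::
  "('u::universe, 'o, 'm) prederiv \<Rightarrow> 'u set \<Rightarrow> ('u \<Rightarrow> 'u scat) \<Rightarrow> ('o, 'm, 'u \<Rightarrow> 'o, 'u \<Rightarrow> 'm) func" where
  "coprod_comparison D I A = \<lparr>FSrc = val D (coprod_cat I A), FTgt = prod_family I (\<lambda>i. val D (A i)),
     onOb = (\<lambda>X\<in>Ob (val D (coprod_cat I A)). \<lambda>i\<in>I. onOb (pull D (coproj I A i)) X),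
     onAr = (\<lambda>f\<in>Ar (val D (coprod_cat I A)). \<lambda>i\<in>I. onAr (pull D (coproj I A i)) f)\<rparr>"

definition Der1 :: "('u::universe, 'o, 'm) prederiv \<Rightarrow> bool" where
  "Der1 D \<longleftrightarrow> (\<forall>I A. small I \<and> (\<forall>i\<in>I. small_category (A i)) \<longrightarrow>
     equivalence_functor (coprod_comparison D I A))"

definition Der2 :: "('u::universe, 'o, 'm) prederiv \<Rightarrow> bool" where
  "Der2 D \<longleftrightarrow> (\<forall>A. small_category A \<longrightarrow> (\<forall>f \<in> Ar (val D A).
     isomorphism (val D A) f \<longleftrightarrow>
     (\<forall>a \<in> Ob A. isomorphism (val D one_cat) (onAr (pull D (point A a)) f))))"

definition Der3 :: "('u::universe, 'o, 'm) prederiv \<Rightarrow> bool" where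
  "Der3 D \<longleftrightarrow> (\<forall>A B u. small_category A \<and> small_category B \<and> u \<in> Fun A B \<longrightarrow>
     (\<exists>L \<eta> \<epsilon>. adjunction L (pull D u) \<eta> \<epsilon>) \<and>
     (\<exists>R \<eta> \<epsilon>. adjunction (pull D u) R \<eta> \<epsilon>))"

definition Der4 :: "('u::universe, 'o, 'm) prederiv \<Rightarrow> bool" where
  "Der4 D \<longleftrightarrow> (\<forall>A B u. small_category A \<and> small_category B \<and> u \<in> Fun A B \<longrightarrow>
     (\<forall>b \<in> Ob B. \<forall>X \<in> Ob (val D A).
        isomorphism (val D one_cat)
          (cmp (mate D (slice_over_proj u b) (to_one (slice_over u b)) u (point B b)
                  (slice_over_cell u b)) X) \<and>
        isomorphism (val D one_cat)
          (cmp (comate D (slice_under_proj b u) (to_one (slice_under b u)) u (point B b)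
                  (slice_under_cell b u)) X)))"

definition derivator :: "('u::universe, 'o, 'm) prederiv \<Rightarrow> bool" where
  "derivator D \<longleftrightarrow> prederivator D \<and> Der1 D \<and> Der2 D \<and> Der3 D \<and> Der4 D"

definition shift :: "('u::universe, 'o, 'm) prederiv \<Rightarrow> 'u scat \<Rightarrow> ('u, 'o, 'm) prederiv" where
  "shift D A = \<lparr>val = (\<lambda>B. val D (A \<times>\<^sub>c B)), pull = (\<lambda>w. pull D (idF A \<times>\<^sub>f w)),
     pull2 = (\<lambda>\<alpha>. pull2 D (idN (idF A) \<times>\<^sub>n \<alpha>))\<rparr>"

section \<open>Morphisms of derivators and modifications\<close>

text \<open>
  A morphism \<open>F: D \<rightarrow> E\<close> has components \<open>F\<^sub>B: D(B) \<rightarrow> E(B)\<close> and, for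
  \<open>w: B \<rightarrow> C\<close>, structure isomorphisms \<open>F\<^sub>B w\<^sup>* \<rightarrow> w\<^sup>* F\<^sub>C\<close>.
\<close>

record ('u, 'o, 'm, 'p, 'n) mor =
  mfun :: "'u scat \<Rightarrow> ('o, 'm, 'p, 'n) func"
  mstr :: "'u sfunc \<Rightarrow> ('o, 'm, 'p, 'n) nat_trans"

definition derivator_morphism ::
  "('u::universe, 'o, 'm) prederiv \<Rightarrow> ('u, 'p, 'n) prederiv \<Rightarrow> ('u, 'o, 'm, 'p, 'n) mor \<Rightarrow> bool" where
  "derivator_morphism D E F \<longleftrightarrow>
     (\<forall>B. small_category B \<longrightarrow> mfun F B \<in> Fun (val D B) (val E B)) \<and>
     (\<forall>B C w. small_category B \<and> small_category C \<and> w \<in> Fun B C \<longrightarrow>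
        natural_iso (mfun F B \<odot> pull D w) (pull E w \<odot> mfun F C) (mstr F w)) \<and>
     (\<forall>B. small_category B \<longrightarrow> mstr F (idF B) = idN (mfun F B)) \<and>
     (\<forall>A B C v w. small_category A \<and> small_category B \<and> small_category C \<and>
        v \<in> Fun A B \<and> w \<in> Fun B C \<longrightarrow> (\<forall>X \<in> Ob (val D C).
        cmp (mstr F (w \<odot> v)) X =
          onAr (pull E v) (cmp (mstr F w) X) \<cdot>\<^bsub>val E A\<^esub> cmp (mstr F v) (onOb (pull D w) X))) \<and>
     (\<forall>B C v w \<alpha>. small_category B \<and> small_category C \<and>
        v \<in> Fun B C \<and> w \<in> Fun B C \<and> \<alpha> \<in> Nat v w \<longrightarrow> (\<forall>X \<in> Ob (val D C).
        cmp (pull2 E \<alpha>) (onOb (mfun F C) X) \<cdot>\<^bsub>val E B\<^esub> cmp (mstr F v) X =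
          cmp (mstr F w) X \<cdot>\<^bsub>val E B\<^esub> onAr (mfun F B) (cmp (pull2 D \<alpha>) X)))"

definition comp_mor ::
  "('u::universe, 'p, 'n, 'q, 'k) mor \<Rightarrow> ('u, 'o, 'm, 'p, 'n) mor \<Rightarrow> ('u, 'o, 'm, 'q, 'k) mor"
    (infixl "\<odot>\<^sub>m" 75) where
  "G \<odot>\<^sub>m F = \<lparr>mfun = (\<lambda>B. mfun G B \<odot> mfun F B),
     mstr = (\<lambda>w. vcomp (hcomp (mstr G w) (idN (mfun F (FTgt w))))
                        (hcomp (idN (mfun G (FSrc w))) (mstr F w)))\<rparr>"

definition modification ::
  "('u::universe, 'o, 'm) prederiv \<Rightarrow> ('u, 'p, 'n) prederiv
     \<Rightarrow> ('u, 'o, 'm, 'p, 'n) mor \<Rightarrow> ('u, 'o, 'm, 'p, 'n) mor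
     \<Rightarrow> ('u scat \<Rightarrow> ('o, 'm, 'p, 'n) nat_trans) \<Rightarrow> bool" where
  "modification D E F G \<mu> \<longleftrightarrow>
     (\<forall>B. small_category B \<longrightarrow> \<mu> B \<in> Nat (mfun F B) (mfun G B)) \<and>
     (\<forall>B C w. small_category B \<and> small_category C \<and> w \<in> Fun B C \<longrightarrow> (\<forall>X \<in> Ob (val D C).
        onAr (pull E w) (cmp (\<mu> C) X) \<cdot>\<^bsub>val E B\<^esub> cmp (mstr F w) X =
          cmp (mstr G w) X \<cdot>\<^bsub>val E B\<^esub> cmp (\<mu> B) (onOb (pull D w) X)))"

definition invertible_modification where
  "invertible_modification D E F G \<mu> \<longleftrightarrow> modification D E F G \<mu> \<and>
     (\<exists>\<nu>. modification D E G F \<nu> \<and> (\<forall>B. small_category B \<longrightarrow>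
        vcomp (\<nu> B) (\<mu> B) = idN (mfun F B) \<and> vcomp (\<mu> B) (\<nu> B) = idN (mfun G B)))"

text \<open>
  For \<open>u: A \<rightarrow> B\<close>, the morphisms \<open>u\<^sup>*: D\<^sup>B \<rightarrow> D\<^sup>A\<close> (which is
  strict) and \<open>u\<^sub>!: D\<^sup>A \<rightarrow> D\<^sup>B\<close>. The structure maps of the latter are
  the mates of the identity 2-cells \<open>(u \<times> C') (A \<times> w) = (B \<times> w) (u \<times> C)\<close> for
  \<open>w: C \<rightarrow> C'\<close>.
\<close>

definition pull_mor :: "('u::universe, 'o, 'm) prederiv \<Rightarrow> 'u sfunc \<Rightarrow> ('u, 'o, 'm, 'o, 'm) mor" where
  "pull_mor D u = \<lparr>mfun = (\<lambda>C. pull D (u \<times>\<^sub>f idF C)),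
     mstr = (\<lambda>w. idN (pull D (u \<times>\<^sub>f idF (FSrc w)) \<odot> pull D (idF (FTgt u) \<times>\<^sub>f w)))\<rparr>"

definition lan_mor :: "('u::universe, 'o, 'm) prederiv \<Rightarrow> 'u sfunc \<Rightarrow> ('u, 'o, 'm, 'o, 'm) mor" where
  "lan_mor D u = \<lparr>mfun = (\<lambda>C. lan D (u \<times>\<^sub>f idF C)),
     mstr = (\<lambda>w. mate D (idF (FSrc u) \<times>\<^sub>f w) (u \<times>\<^sub>f idF (FSrc w))
                        (u \<times>\<^sub>f idF (FTgt w)) (idF (FTgt u) \<times>\<^sub>f w)
                        (idN ((u \<times>\<^sub>f idF (FTgt w)) \<odot> (idF (FSrc u) \<times>\<^sub>f w))))\<rparr>"

text \<open>
  The morphism \<open>colim\<^sub>A: D\<^sup>A \<rightarrow> D\<close> (that is, \<open>\<pi>\<^sub>!\<close> with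
  \<open>D\<^sup>1\<close> identified with \<open>D\<close>): with parameters in \<open>B\<close> it is the left
  adjoint of restriction along the projection \<open>A \<times> B \<rightarrow> B\<close>. The morphism
  \<open>X \<mapsto> X\<^sub>a\<close> from \<open>D\<^sup>A\<close> to \<open>D\<close> is strict.
\<close>

definition colim_mor :: "('u::universe, 'o, 'm) prederiv \<Rightarrow> 'u scat \<Rightarrow> ('u, 'o, 'm, 'o, 'm) mor" where
  "colim_mor D A = \<lparr>mfun = (\<lambda>B. lan D (proj2 A B)),
     mstr = (\<lambda>w. mate D (idF A \<times>\<^sub>f w) (proj2 A (FSrc w)) (proj2 A (FTgt w)) w
                        (idN (proj2 A (FTgt w) \<odot> (idF A \<times>\<^sub>f w))))\<rparr>"

definition eval_mor :: "('u::universe, 'o, 'm) prederiv \<Rightarrow> 'u scat \<Rightarrow> 'u \<Rightarrow> ('u, 'o, 'm, 'o, 'm) mor" where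
  "eval_mor D A a = \<lparr>mfun = (\<lambda>B. pull D (section_at A a B)),
     mstr = (\<lambda>w. idN (pull D (section_at A a (FSrc w)) \<odot> pull D (idF A \<times>\<^sub>f w)))\<rparr>"

section \<open>Homotopy final functors and filtrations\<close>

text \<open>
  The canonical map \<open>colim\<^sub>A u\<^sup>* X \<rightarrow> colim\<^sub>B X\<close> for \<open>X\<close> in
  \<open>D\<^sup>B(C)\<close> is the mate of the identity of the projection \<open>A \<times> C \<rightarrow> C\<close>.
\<close>

definition final_map ::
  "('u::universe, 'o, 'm) prederiv \<Rightarrow> 'u sfunc \<Rightarrow> 'u scat \<Rightarrow> ('o, 'm, 'o, 'm) nat_trans" where
  "final_map D u C = mate D (u \<times>\<^sub>f idF C) (proj2 (FSrc u) C) (proj2 (FTgt u) C) (idF C)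
     (idN (proj2 (FTgt u) C \<odot> (u \<times>\<^sub>f idF C)))"

text \<open>
  A definition in HOL cannot quantify over types, so the types in which the derivators take
  values are parameters. A theorem asserting homotopy finality for type variables
  \<open>'o\<close> and \<open>'m\<close> asserts it for all derivators.
\<close>

definition homotopy_final :: "'o itself \<Rightarrow> 'm itself \<Rightarrow> 'u::universe sfunc \<Rightarrow> bool" where
  "homotopy_final (_ :: 'o itself) (_ :: 'm itself) u \<longleftrightarrow>
     (\<forall>D :: ('u, 'o, 'm) prederiv. derivator D \<longrightarrow>
       (\<forall>C. small_category C \<longrightarrow> (\<forall>X \<in> Ob (val (shift D (FTgt u)) C).
          isomorphism (val D C) (cmp (final_map D u C) X))))"

definition subcategory :: "('o, 'm) cat \<Rightarrow> ('o, 'm) cat \<Rightarrow> bool" where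
  "subcategory B A \<longleftrightarrow> category B \<and> Ob B \<subseteq> Ob A \<and> Ar B \<subseteq> Ar A \<and> B = A\<lparr>Ob := Ob B, Ar := Ar B\<rparr>"

definition full_subcategory :: "('o, 'm) cat \<Rightarrow> 'o set \<Rightarrow> ('o, 'm) cat" where
  "full_subcategory A X = A\<lparr>Ob := {x \<in> Ob A. x \<in> X}, Ar := {f \<in> Ar A. Dom A f \<in> X \<and> Cod A f \<in> X}\<rparr>"

definition inclusion :: "('o, 'm) cat \<Rightarrow> ('o, 'm) cat \<Rightarrow> ('o, 'm, 'o, 'm) func" where
  "inclusion B A = \<lparr>FSrc = B, FTgt = A, onOb = (\<lambda>x\<in>Ob B. x), onAr = (\<lambda>f\<in>Ar B. f)\<rparr>"

definition Sub :: "('o, 'm) cat \<Rightarrow> (('o, 'm) cat, ('o, 'm, 'o, 'm) func) cat" where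
  "Sub A = \<lparr>
     Ob = {B. subcategory B A},
     Ar = {F. is_functor F \<and> subcategory (FSrc F) A \<and> subcategory (FTgt F) A \<and>
              inclusion (FTgt F) A \<odot> F = inclusion (FSrc F) A},
     Dom = FSrc, Cod = FTgt, Id = idF, Comp = compF\<rparr>"

type_synonym 'u filtr = "('u, 'u, 'u scat, 'u sfunc) func"

definition filtration :: "'u::universe scat \<Rightarrow> 'u scat \<Rightarrow> 'u filtr \<Rightarrow> bool" where
  "filtration A C F \<longleftrightarrow> small_category C \<and> F \<in> Fun C (Sub A)"

definition groth :: "'u::universe scat \<Rightarrow> 'u filtr \<Rightarrow> 'u scat" where
  "groth C F = labelled_cat
     {\<lblot>c, x\<rblot> | c x. c \<in> Ob C \<and> x \<in> Ob (onOb F c)}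
     (\<lambda>z z'. {\<lblot>f, g\<rblot> | f g. f \<in> hom C (p1 z) (p1 z') \<and>
                g \<in> hom (onOb F (p1 z')) (onOb (onAr F f) (p2 z)) (p2 z')})
     (\<lambda>z. \<lblot>Id C (p1 z), Id (onOb F (p1 z)) (p2 z)\<rblot>)
     (\<lambda>l' l. \<lblot>p1 l' \<cdot>\<^bsub>C\<^esub> p1 l,
              p2 l' \<cdot>\<^bsub>onOb F (Cod C (p1 l'))\<^esub> onAr (onAr F (p1 l')) (p2 l)\<rblot>)"

definition groth_proj :: "'u::universe scat \<Rightarrow> 'u filtr \<Rightarrow> 'u sfunc" where
  "groth_proj C F = \<lparr>FSrc = groth C F, FTgt = C,
     onOb = (\<lambda>z\<in>Ob (groth C F). p1 z), onAr = (\<lambda>k\<in>Ar (groth C F). p1 (p1 (p2 k)))\<rparr>"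

text \<open>
  The functor \<open>u\<^sub>C\<^sub>,\<^sub>F\<close>. For an arrow \<open>(f, g)\<close> of the Grothendieck construction,
  \<open>F(f)(x) = x\<close> in \<open>A\<close>, so \<open>g\<close> is an arrow \<open>x \<rightarrow> x'\<close> of \<open>A\<close>.
\<close>

definition groth_to :: "'u::universe scat \<Rightarrow> 'u scat \<Rightarrow> 'u filtr \<Rightarrow> 'u sfunc" where
  "groth_to A C F = \<lparr>FSrc = groth C F, FTgt = A,
     onOb = (\<lambda>z\<in>Ob (groth C F). p2 z), onAr = (\<lambda>k\<in>Ar (groth C F). p2 (p1 (p2 k)))\<rparr>"

definition groth_fibre :: "'u::universe scat \<Rightarrow> 'u filtr \<Rightarrow> 'u \<Rightarrow> 'u sfunc" where
  "groth_fibre C F c = \<lparr>FSrc = onOb F c, FTgt = groth C F,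
     onOb = (\<lambda>x\<in>Ob (onOb F c). \<lblot>c, x\<rblot>),
     onAr = (\<lambda>g\<in>Ar (onOb F c).
       \<lblot>\<lblot>c, Dom (onOb F c) g\<rblot>, \<lblot>\<lblot>Id C c, g\<rblot>, \<lblot>c, Cod (onOb F c) g\<rblot>\<rblot>\<rblot>)\<rparr>"

definition left_filtration ::
  "'o itself \<Rightarrow> 'm itself \<Rightarrow> 'u::universe scat \<Rightarrow> 'u scat \<Rightarrow> 'u filtr \<Rightarrow> bool" where
  "left_filtration T T' A C F \<longleftrightarrow> filtration A C F \<and> homotopy_final T T' (groth_to A C F)"

section \<open>The decomposition morphism of a filtration\<close>

text \<open>
  With \<open>\<pi>\<close> the projection of the Grothendieck construction to \<open>C\<close> and
  \<open>u = u\<^sub>C\<^sub>,\<^sub>F\<close>, the decomposition morphism is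
  \<open>d = \<pi>\<^sub>! u\<^sup>*: D\<^sup>A \<rightarrow> D\<^sup>C\<close>.
\<close>

definition decomposition ::
  "('u::universe, 'o, 'm) prederiv \<Rightarrow> 'u scat \<Rightarrow> 'u scat \<Rightarrow> 'u filtr \<Rightarrow> ('u, 'o, 'm, 'o, 'm) mor" where
  "decomposition D A C F = lan_mor D (groth_proj C F) \<odot>\<^sub>m pull_mor D (groth_to A C F)"

text \<open>
  The canonical map \<open>colim\<^sub>C d X \<rightarrow> colim\<^sub>A X\<close>: the transpose of the canonical map from
  \<open>\<pi>\<^sub>! u\<^sup>* X\<close> to the constant diagram on \<open>colim\<^sub>A X\<close>, which in turn is
  the transpose of \<open>u\<^sup>*\<close> of the colimit cocone of \<open>X\<close>.
\<close>

definition decomposition_colim ::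
  "('u::universe, 'o, 'm) prederiv \<Rightarrow> 'u scat \<Rightarrow> 'u scat \<Rightarrow> 'u filtr
     \<Rightarrow> 'u scat \<Rightarrow> ('o, 'm, 'o, 'm) nat_trans" where
  "decomposition_colim D A C F B = \<lparr>
     NSrc = mfun (colim_mor D C \<odot>\<^sub>m decomposition D A C F) B,
     NTgt = mfun (colim_mor D A) B,
     cmp = (\<lambda>X\<in>Ob (val D (A \<times>\<^sub>c B)).
       cmp (lan_counit D (proj2 C B)) (onOb (mfun (colim_mor D A) B) X) \<cdot>\<^bsub>val D B\<^esub>
       onAr (lan D (proj2 C B))
         (cmp (mate D (groth_to A C F \<times>\<^sub>f idF B) (groth_proj C F \<times>\<^sub>f idF B) (proj2 A B) (proj2 C B)
                 (idN (proj2 A B \<odot> (groth_to A C F \<times>\<^sub>f idF B)))) X))\<rparr>"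

text \<open>
  The canonical map \<open>colim\<^sub>F\<^sub>(\<^sub>c\<^sub>) \<iota>\<^sup>* X \<rightarrow> (d X)\<^sub>c\<close>: with
  \<open>j: F(c) \<rightarrow> \<integral>F\<close> the inclusion of the fibre, \<open>\<iota>\<^sup>* X = j\<^sup>* u\<^sup>* X\<close>,
  and the map is the mate of the identity 2-cell \<open>\<pi> j = const\<^sub>c\<close> at \<open>u\<^sup>* X\<close>.
\<close>

definition decomposition_fibre ::
  "('u::universe, 'o, 'm) prederiv \<Rightarrow> 'u scat \<Rightarrow> 'u scat \<Rightarrow> 'u filtr \<Rightarrow> 'u
     \<Rightarrow> 'u scat \<Rightarrow> ('o, 'm, 'o, 'm) nat_trans" where
  "decomposition_fibre D A C F c B = \<lparr>
     NSrc = mfun (colim_mor D (onOb F c) \<odot>\<^sub>m pull_mor D (inclusion (onOb F c) A)) B,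
     NTgt = mfun (eval_mor D C c \<odot>\<^sub>m decomposition D A C F) B,
     cmp = (\<lambda>X\<in>Ob (val D (A \<times>\<^sub>c B)).
       cmp (mate D (groth_fibre C F c \<times>\<^sub>f idF B) (proj2 (onOb F c) B)
                   (groth_proj C F \<times>\<^sub>f idF B) (section_at C c B)
                   (idN ((groth_proj C F \<times>\<^sub>f idF B) \<odot> (groth_fibre C F c \<times>\<^sub>f idF B))))
           (onOb (pull D (groth_to A C F \<times>\<^sub>f idF B)) X))\<rparr>"

section \<open>The filtration of a category over a poset\<close>

text \<open>A poset is a set \<open>P\<close> with a relation \<open>r\<close>; \<open>(p, q) \<in> r\<close> means \<open>p \<le> q\<close>.\<close>

definition poset_cat :: "'u::universe set \<Rightarrow> 'u rel \<Rightarrow> 'u scat" where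
  "poset_cat P r = \<lparr>Ob = P, Ar = {\<lblot>p, q\<rblot> | p q. (p, q) \<in> r}, Dom = p1, Cod = p2,
     Id = (\<lambda>p. \<lblot>p, p\<rblot>), Comp = (\<lambda>l k. \<lblot>p1 k, p2 l\<rblot>)\<rparr>"

definition below :: "'u::universe rel \<Rightarrow> 'u sfunc \<Rightarrow> 'u \<Rightarrow> 'u scat" where
  "below r f p = full_subcategory (FSrc f) {x. (onOb f x, p) \<in> r}"

definition below_filtration :: "'u::universe set \<Rightarrow> 'u rel \<Rightarrow> 'u sfunc \<Rightarrow> 'u filtr" where
  "below_filtration P r f = \<lparr>FSrc = poset_cat P r, FTgt = Sub (FSrc f),
     onOb = (\<lambda>p\<in>P. below r f p),
     onAr = (\<lambda>k\<in>Ar (poset_cat P r). inclusion (below r f (p1 k)) (below r f (p2 k)))\<rparr>"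

end

theory Submission
  imports Defs
begin

text \<open>
  The functor \<open>u: \<integral>F \<rightarrow> A\<close>, \<open>(p, x) \<mapsto> x\<close>, has the left adjoint \<open>x \<mapsto> (f x, x)\<close>, hence it is
  homotopy final. Likewise the inclusion of \<open>A\<^bsub>\<le>p\<^esub>\<close> into the slice \<open>\<pi>/p\<close> of the
  projection \<open>\<pi>: \<integral>F \<rightarrow> P\<close> has the left adjoint \<open>((q, x), q \<le> p) \<mapsto> x\<close>, so by Der4 the
  value of \<open>d = \<pi>\<^sub>! u\<^sup>*\<close> at \<open>p\<close> is a colimit over \<open>A\<^bsub>\<le>p\<^esub>\<close>. With parameters, Der2 reduces the
  invertibility of all these canonical maps to objects, where both sides are colimits over one and the
  same category. The coherence conditions hold because both sides of each of
  them are mates of the same square.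
\<close>

section \<open>Categories, functors and transformations\<close>

text \<open>\<open>lan\<close> is an arbitrary choice, so the chosen adjoint of a composite functor
  is not the composite of the chosen adjoints, and canonical maps cannot be compared as formulas.
  What survives every choice is the property of being a universal arrow: such arrows compose, can be
  moved along isomorphisms, and detect equality of maps out of their target. So maps out of a Kan
  extension are compared after composition with the unit, and a map is shown to be invertible by
  recognising both of its ends as universal for one and the same functor.

  Finality comes from adjoints inside the derivator, without nerves: restriction reverses functors
  but keeps 2-cells, so a left adjoint \<open>L\<close> of \<open>K\<close> makes restriction along
  \<open>K\<close> left adjoint to restriction along \<open>L\<close>. As constant diagrams restrict
  to constant diagrams, a diagram and its restriction along \<open>K\<close> have the same maps to
  constant diagrams, hence the same colimit.

  The adjoints used for the filtration exist because each \<open>x\<close> has a least stage,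
  \<open>f x\<close>, and because the transition functors do not move \<open>x\<close>.\<close>

lemma hom_iff: "f \<in> hom C x y \<longleftrightarrow> f \<in> Ar C \<and> Dom C f = x \<and> Cod C f = y"
  by (simp add: hom_def)

lemma hom_Ar: "f \<in> hom C x y \<Longrightarrow> f \<in> Ar C"
  by (simp add: hom_def)

lemma Ar_hom: "f \<in> Ar C \<Longrightarrow> f \<in> hom C (Dom C f) (Cod C f)"
  by (simp add: hom_def)

lemma hom_Ob:
  assumes "category C" "f \<in> hom C x y" shows "x \<in> Ob C" "y \<in> Ob C"
  using assms by (auto simp: category_def hom_def)

lemma Id_hom: "category C \<Longrightarrow> x \<in> Ob C \<Longrightarrow> Id C x \<in> hom C x x"
  by (simp add: category_def)

lemma comp_hom: "category C \<Longrightarrow> f \<in> hom C x y \<Longrightarrow> g \<in> hom C y z \<Longrightarrow> g \<cdot>\<^bsub>C\<^esub> f \<in> hom C x z"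
  by (auto simp: category_def hom_def)

lemma comp_Id: "category C \<Longrightarrow> f \<in> hom C x y \<Longrightarrow> f \<cdot>\<^bsub>C\<^esub> Id C x = f"
  by (auto simp: category_def hom_def)

lemma Id_comp: "category C \<Longrightarrow> f \<in> hom C x y \<Longrightarrow> Id C y \<cdot>\<^bsub>C\<^esub> f = f"
  by (auto simp: category_def hom_def)

lemma comp_assoc:
  "category C \<Longrightarrow> f \<in> hom C w x \<Longrightarrow> g \<in> hom C x y \<Longrightarrow> h \<in> hom C y z \<Longrightarrow>
     h \<cdot>\<^bsub>C\<^esub> (g \<cdot>\<^bsub>C\<^esub> f) = (h \<cdot>\<^bsub>C\<^esub> g) \<cdot>\<^bsub>C\<^esub> f"
  by (auto simp: category_def hom_def)

lemma categoryI:
  assumes "\<And>f. f \<in> Ar C \<Longrightarrow> Dom C f \<in> Ob C" "\<And>f. f \<in> Ar C \<Longrightarrow> Cod C f \<in> Ob C"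
    and "\<And>x. x \<in> Ob C \<Longrightarrow> Id C x \<in> hom C x x"
    and "\<And>x y z f g. f \<in> hom C x y \<Longrightarrow> g \<in> hom C y z \<Longrightarrow> g \<cdot>\<^bsub>C\<^esub> f \<in> hom C x z"
    and "\<And>x y f. f \<in> hom C x y \<Longrightarrow> f \<cdot>\<^bsub>C\<^esub> Id C x = f"
    and "\<And>x y f. f \<in> hom C x y \<Longrightarrow> Id C y \<cdot>\<^bsub>C\<^esub> f = f"
    and "\<And>w x y z f g h. f \<in> hom C w x \<Longrightarrow> g \<in> hom C x y \<Longrightarrow> h \<in> hom C y z \<Longrightarrow>
      h \<cdot>\<^bsub>C\<^esub> (g \<cdot>\<^bsub>C\<^esub> f) = (h \<cdot>\<^bsub>C\<^esub> g) \<cdot>\<^bsub>C\<^esub> f"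
  shows "category C"
  unfolding category_def
proof (intro conjI ballI impI)
  fix f g h assume "f \<in> Ar C" "g \<in> Ar C" "h \<in> Ar C" "Dom C g = Cod C f \<and> Dom C h = Cod C g"
  then show "h \<cdot>\<^bsub>C\<^esub> (g \<cdot>\<^bsub>C\<^esub> f) = (h \<cdot>\<^bsub>C\<^esub> g) \<cdot>\<^bsub>C\<^esub> f"
    by (intro assms(7)[of f "Dom C f" "Cod C f" g "Cod C g" h "Cod C h"]) (auto simp: hom_def)
next
  fix f g assume "f \<in> Ar C" "g \<in> Ar C" "Dom C g = Cod C f"
  then show "g \<cdot>\<^bsub>C\<^esub> f \<in> hom C (Dom C f) (Cod C g)"
    by (intro assms(4)[of f "Dom C f" "Cod C f" g]) (auto simp: hom_def)
qed (auto intro: assms Ar_hom)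

lemma isomorphismI:
  "f \<in> hom C x y \<Longrightarrow> g \<in> hom C y x \<Longrightarrow> g \<cdot>\<^bsub>C\<^esub> f = Id C x \<Longrightarrow> f \<cdot>\<^bsub>C\<^esub> g = Id C y \<Longrightarrow> isomorphism C f"
  by (auto simp: isomorphism_def hom_def)

lemma isomorphismE:
  assumes "isomorphism C f" "f \<in> hom C x y"
  obtains g where "g \<in> hom C y x" "g \<cdot>\<^bsub>C\<^esub> f = Id C x" "f \<cdot>\<^bsub>C\<^esub> g = Id C y"
  using assms by (auto simp: isomorphism_def hom_def)

lemma isomorphism_Id: "category C \<Longrightarrow> x \<in> Ob C \<Longrightarrow> isomorphism C (Id C x)"
  by (rule isomorphismI[OF Id_hom Id_hom]) (auto intro: comp_Id Id_hom)

lemma isomorphism_comp: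
  assumes C: "category C" and f: "f \<in> hom C x y" "isomorphism C f" and g: "g \<in> hom C y z" "isomorphism C g"
  shows "isomorphism C (g \<cdot>\<^bsub>C\<^esub> f)"
proof -
  obtain f' where f': "f' \<in> hom C y x" "f' \<cdot>\<^bsub>C\<^esub> f = Id C x" "f \<cdot>\<^bsub>C\<^esub> f' = Id C y"
    by (rule isomorphismE[OF f(2,1)])
  obtain g' where g': "g' \<in> hom C z y" "g' \<cdot>\<^bsub>C\<^esub> g = Id C y" "g \<cdot>\<^bsub>C\<^esub> g' = Id C z"
    by (rule isomorphismE[OF g(2,1)])
  note gf = comp_hom[OF C f(1) g(1)] and fg = comp_hom[OF C g'(1) f'(1)]
  show ?thesis
  proof (rule isomorphismI[OF gf fg])
    show "(f' \<cdot>\<^bsub>C\<^esub> g') \<cdot>\<^bsub>C\<^esub> (g \<cdot>\<^bsub>C\<^esub> f) = Id C x"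
      using comp_assoc[OF C gf g'(1) f'(1)] comp_assoc[OF C f(1) g(1) g'(1)] g'(2) f'(2) Id_comp[OF C f(1)]
        by simp
    show "(g \<cdot>\<^bsub>C\<^esub> f) \<cdot>\<^bsub>C\<^esub> (f' \<cdot>\<^bsub>C\<^esub> g') = Id C z"
      using comp_assoc[OF C fg f(1) g(1)] comp_assoc[OF C g'(1) f'(1) f(1)] g'(3) f'(3) Id_comp[OF C g'(1)]
        by simp
  qed
qed

section \<open>Functors as extensional records\<close>

lemma FunD:
  assumes "F \<in> Fun C D"
  shows "is_functor F" "FSrc F = C" "FTgt F = D" "category C" "category D"
  using assms by (auto simp: Fun_def is_functor_def)

lemma Fun_Ob: "F \<in> Fun C D \<Longrightarrow> x \<in> Ob C \<Longrightarrow> onOb F x \<in> Ob D"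
  by (auto simp: Fun_def is_functor_def)

lemma Fun_hom: "F \<in> Fun C D \<Longrightarrow> f \<in> hom C x y \<Longrightarrow> onAr F f \<in> hom D (onOb F x) (onOb F y)"
  by (auto simp: Fun_def is_functor_def hom_def)

lemma Fun_Id: "F \<in> Fun C D \<Longrightarrow> x \<in> Ob C \<Longrightarrow> onAr F (Id C x) = Id D (onOb F x)"
  by (auto simp: Fun_def is_functor_def)

lemma Fun_comp:
  "F \<in> Fun C D \<Longrightarrow> f \<in> hom C x y \<Longrightarrow> g \<in> hom C y z \<Longrightarrow> onAr F (g \<cdot>\<^bsub>C\<^esub> f) = onAr F g \<cdot>\<^bsub>D\<^esub> onAr F f"
  by (auto simp: Fun_def is_functor_def hom_def)

lemma FunI:
  assumes "category C" "category D" "FSrc F = C" "FTgt F = D"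
    and "onOb F \<in> extensional (Ob C)" "onAr F \<in> extensional (Ar C)"
    and "\<And>x. x \<in> Ob C \<Longrightarrow> onOb F x \<in> Ob D"
    and "\<And>x y f. f \<in> hom C x y \<Longrightarrow> onAr F f \<in> hom D (onOb F x) (onOb F y)"
    and "\<And>x. x \<in> Ob C \<Longrightarrow> onAr F (Id C x) = Id D (onOb F x)"
    and "\<And>x y z f g. f \<in> hom C x y \<Longrightarrow> g \<in> hom C y z \<Longrightarrow> onAr F (g \<cdot>\<^bsub>C\<^esub> f) = onAr F g \<cdot>\<^bsub>D\<^esub> onAr F f"
  shows "F \<in> Fun C D"
proof -
  have "onAr F (g \<cdot>\<^bsub>C\<^esub> f) = onAr F g \<cdot>\<^bsub>D\<^esub> onAr F f"
    if "f \<in> Ar C" "g \<in> Ar C" "Dom C g = Cod C f" for f g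
    using that by (intro assms(10)[of f "Dom C f" "Cod C f" g "Cod C g"]) (auto simp: hom_def)
  moreover have "onAr F f \<in> hom D (onOb F (Dom C f)) (onOb F (Cod C f))" if "f \<in> Ar C" for f
    using assms(8)[OF Ar_hom[OF that]] .
  ultimately show ?thesis
    using assms(1-7,9) by (auto simp: Fun_def is_functor_def PiE_def)
qed

text \<open>Both maps of a functor are \<open>undefined\<close> off the carriers, so agreement on
  the carriers gives equality of records. The strict axioms of a prederivator are used by rewriting
  along such equations between functors.\<close>

lemma Fun_eqI:
  assumes "F \<in> Fun C D" "G \<in> Fun C D" "\<And>x. x \<in> Ob C \<Longrightarrow> onOb F x = onOb G x"
    and "\<And>x y f. f \<in> hom C x y \<Longrightarrow> onAr F f = onAr G f"
  shows "F = G"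
proof -
  have "onOb F = onOb G"
    using assms by (intro extensionalityI[of _ "Ob C"]) (auto simp: Fun_def is_functor_def PiE_def)
  moreover have "onAr F = onAr G"
    using assms(1-3) assms(4)[OF Ar_hom] by (intro extensionalityI[of _ "Ar C"]) (auto simp: Fun_def
      is_functor_def)
  ultimately show ?thesis
    using assms by (auto simp: Fun_def)
qed

lemma Fun_isomorphism:
  assumes F: "F \<in> Fun C D" and f: "isomorphism C f" shows "isomorphism D (onAr F f)"
proof -
  note h = Ar_hom[OF f[unfolded isomorphism_def, THEN conjunct1]]
  obtain g where g: "g \<in> hom C (Cod C f) (Dom C f)" "g \<cdot>\<^bsub>C\<^esub> f = Id C (Dom C f)" "f \<cdot>\<^bsub>C\<^esub> g = Id C (Cod C f)"
    by (rule isomorphismE[OF f h])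
  show ?thesis
    using Fun_comp[OF F h g(1)] Fun_comp[OF F g(1) h] g(2,3) Fun_Id[OF F] hom_Ob[OF FunD(4)[OF F] h]
    by (intro isomorphismI[OF Fun_hom[OF F h] Fun_hom[OF F g(1)]]) simp_all
qed

lemma idF_Fun: "category C \<Longrightarrow> idF C \<in> Fun C C"
  by (rule FunI) (auto simp: idF_def hom_def category_def)

lemma idF_simps [simp]:
  "FSrc (idF C) = C" "FTgt (idF C) = C" "x \<in> Ob C \<Longrightarrow> onOb (idF C) x = x"
  "f \<in> Ar C \<Longrightarrow> onAr (idF C) f = f"
  by (auto simp: idF_def)

lemma compF_simps [simp]:
  "FSrc (G \<odot> F) = FSrc F" "FTgt (G \<odot> F) = FTgt G"
  by (auto simp: compF_def)

lemma compF_Ob: "F \<in> Fun C D \<Longrightarrow> x \<in> Ob C \<Longrightarrow> onOb (G \<odot> F) x = onOb G (onOb F x)"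
  and compF_Ar: "F \<in> Fun C D \<Longrightarrow> f \<in> Ar C \<Longrightarrow> onAr (G \<odot> F) f = onAr G (onAr F f)"
  by (auto simp: compF_def Fun_def)

lemma compF_Fun:
  assumes F: "F \<in> Fun C D" and G: "G \<in> Fun D E"
  shows "G \<odot> F \<in> Fun C E"
proof (rule FunI)
  note C = FunD(4)[OF F]
  show "category C" "category E" by (fact FunD(4)[OF F] FunD(5)[OF G])+
  fix x y f assume f: "f \<in> hom C x y"
  then show "onAr (G \<odot> F) f \<in> hom E (onOb (G \<odot> F) x) (onOb (G \<odot> F) y)"
    using F G by (simp add: compF_Ob[OF F] compF_Ar[OF F] hom_Ar Fun_hom hom_Ob[OF C])
  fix z g assume g: "g \<in> hom C y z"
  show "onAr (G \<odot> F) (g \<cdot>\<^bsub>C\<^esub> f) = onAr (G \<odot> F) g \<cdot>\<^bsub>E\<^esub> onAr (G \<odot> F) f"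
    using hom_Ar[OF comp_hom[OF C f g]] f g
    by (simp add: compF_Ar[OF F] hom_Ar Fun_comp[OF F f g] Fun_comp[OF G Fun_hom[OF F f] Fun_hom[OF F g]])
next
  fix x assume x: "x \<in> Ob C"
  then show "onAr (G \<odot> F) (Id C x) = Id E (onOb (G \<odot> F) x)"
    using hom_Ar[OF Id_hom[OF FunD(4)[OF F] x]]
    by (simp add: compF_Ar[OF F] compF_Ob[OF F] Fun_Id[OF F] Fun_Id[OF G] Fun_Ob[OF F])
  show "onOb (G \<odot> F) x \<in> Ob E"
    using x F G by (simp add: compF_Ob[OF F] Fun_Ob)
qed (use F G in \<open>auto simp: compF_def Fun_def\<close>)

text \<open>Composites are restricted to the carriers of their source. By the typing hypotheses
  \<open>F\<close> lands in the carriers on which \<open>H \<odot> G\<close> is not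
  \<open>undefined\<close>, and there both bracketings unfold to the same value.\<close>

lemma compF_assoc:
  assumes "F \<in> Fun A B" "G \<in> Fun B C" "H \<in> Fun C D"
  shows "H \<odot> (G \<odot> F) = H \<odot> G \<odot> F"
proof (rule Fun_eqI)
  show "H \<odot> (G \<odot> F) \<in> Fun A D" "H \<odot> G \<odot> F \<in> Fun A D"
    using assms by (auto intro: compF_Fun)
next
  fix x assume "x \<in> Ob A"
  then show "onOb (H \<odot> (G \<odot> F)) x = onOb (H \<odot> G \<odot> F) x"
    using assms by (simp add: compF_Ob[OF compF_Fun[OF assms(1,2)]] compF_Ob[OF assms(1)] compF_Ob[OF
      assms(2)] Fun_Ob)
next
  fix x y f assume "f \<in> hom A x y"
  then show "onAr (H \<odot> (G \<odot> F)) f = onAr (H \<odot> G \<odot> F) f"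
    using hom_Ar[OF Fun_hom[OF assms(1) \<open>f \<in> hom A x y\<close>]] hom_Ar[OF \<open>f \<in> hom A x y\<close>]
    by (simp add: compF_Ar[OF compF_Fun[OF assms(1,2)]] compF_Ar[OF assms(1)] compF_Ar[OF assms(2)])
qed

lemma compF_idF [simp]:
  assumes "F \<in> Fun C D" shows "F \<odot> idF C = F" "idF D \<odot> F = F"
proof -
  note C = FunD(4)[OF assms] and D = FunD(5)[OF assms]
  show "F \<odot> idF C = F"
    by (rule Fun_eqI[OF compF_Fun[OF idF_Fun[OF C] assms] assms])
      (auto simp: compF_Ob[OF idF_Fun[OF C]] compF_Ar[OF idF_Fun[OF C]] hom_Ar)
  show "idF D \<odot> F = F"
    by (rule Fun_eqI[OF compF_Fun[OF assms idF_Fun[OF D]] assms])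
      (auto simp: compF_Ob[OF assms] compF_Ar[OF assms] hom_Ar Fun_Ob[OF assms] dest: hom_Ar[OF Fun_hom[OF
        assms]])
qed

section \<open>Natural transformations, their composites and inverses\<close>

lemma NatD:
  assumes "\<alpha> \<in> Nat F G" "F \<in> Fun C D"
  shows "G \<in> Fun C D" "NSrc \<alpha> = F" "NTgt \<alpha> = G"
  using assms by (auto simp: Nat_def Fun_def)

lemma Nat_hom:
  "\<alpha> \<in> Nat F G \<Longrightarrow> F \<in> Fun C D \<Longrightarrow> x \<in> Ob C \<Longrightarrow> cmp \<alpha> x \<in> hom D (onOb F x) (onOb G x)"
  by (auto simp: Nat_def Fun_def)

lemma Nat_natural:
  "\<alpha> \<in> Nat F G \<Longrightarrow> F \<in> Fun C D \<Longrightarrow> f \<in> hom C x y \<Longrightarrow> onAr G f \<cdot>\<^bsub>D\<^esub> cmp \<alpha> x = cmp \<alpha> y \<cdot>\<^bsub>D\<^esub> onAr F f"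
  by (auto simp: Nat_def Fun_def hom_def)

lemma NatI:
  assumes "F \<in> Fun C D" "G \<in> Fun C D" "NSrc \<alpha> = F" "NTgt \<alpha> = G" "cmp \<alpha> \<in> extensional (Ob C)"
    and "\<And>x. x \<in> Ob C \<Longrightarrow> cmp \<alpha> x \<in> hom D (onOb F x) (onOb G x)"
    and "\<And>x y f. f \<in> hom C x y \<Longrightarrow> onAr G f \<cdot>\<^bsub>D\<^esub> cmp \<alpha> x = cmp \<alpha> y \<cdot>\<^bsub>D\<^esub> onAr F f"
  shows "\<alpha> \<in> Nat F G"
  using assms(1-6) assms(7)[OF Ar_hom] by (auto simp: Nat_def Fun_def)

lemma Nat_eqI:
  assumes "\<alpha> \<in> Nat F G" "\<beta> \<in> Nat F G" "F \<in> Fun C D" "\<And>x. x \<in> Ob C \<Longrightarrow> cmp \<alpha> x = cmp \<beta> x"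
  shows "\<alpha> = \<beta>"
proof -
  have "cmp \<alpha> = cmp \<beta>"
    using assms by (intro extensionalityI[of _ "Ob C"]) (auto simp: Nat_def Fun_def)
  then show ?thesis
    using assms by (auto simp: Nat_def)
qed

lemma idN_simps [simp]:
  "NSrc (idN F) = F" "NTgt (idN F) = F" "x \<in> Ob (FSrc F) \<Longrightarrow> cmp (idN F) x = Id (FTgt F) (onOb F x)"
  by (auto simp: idN_def)

lemma idN_Nat:
  assumes "F \<in> Fun C D" shows "idN F \<in> Nat F F"
proof (rule NatI[OF assms assms])
  note FD = FunD[OF assms]
  fix x assume "x \<in> Ob C"
  then show "cmp (idN F) x \<in> hom D (onOb F x) (onOb F x)"
    using FD assms by (auto simp: Fun_Ob Id_hom)
next
  note FD = FunD[OF assms]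
  fix x y f assume f: "f \<in> hom C x y"
  then have "x \<in> Ob C" "y \<in> Ob C" using hom_Ob FD by auto
  then show "onAr F f \<cdot>\<^bsub>D\<^esub> cmp (idN F) x = cmp (idN F) y \<cdot>\<^bsub>D\<^esub> onAr F f"
    using FD Fun_hom[OF assms f] by (simp add: comp_Id Id_comp)
qed (use FunD[OF assms] in \<open>auto simp: idN_def\<close>)

lemma vcomp_Nat:
  assumes a: "\<alpha> \<in> Nat F G" and b: "\<beta> \<in> Nat G H" and F: "F \<in> Fun C D"
  shows "vcomp \<beta> \<alpha> \<in> Nat F H" "x \<in> Ob C \<Longrightarrow> cmp (vcomp \<beta> \<alpha>) x = cmp \<beta> x \<cdot>\<^bsub>D\<^esub> cmp \<alpha> x"
proof -
  note G = NatD(1)[OF a F]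
  note H = NatD(1)[OF b G] and FD = FunD[OF F]
  have c: "cmp (vcomp \<beta> \<alpha>) x = cmp \<beta> x \<cdot>\<^bsub>D\<^esub> cmp \<alpha> x" if "x \<in> Ob C" for x
    using that FD NatD[OF a F] by (simp add: vcomp_def)
  then show "x \<in> Ob C \<Longrightarrow> cmp (vcomp \<beta> \<alpha>) x = cmp \<beta> x \<cdot>\<^bsub>D\<^esub> cmp \<alpha> x" .
  show "vcomp \<beta> \<alpha> \<in> Nat F H"
  proof (rule NatI[OF F H])
    fix x assume "x \<in> Ob C"
    then show "cmp (vcomp \<beta> \<alpha>) x \<in> hom D (onOb F x) (onOb H x)"
      using comp_hom[OF FD(5) Nat_hom[OF a F] Nat_hom[OF b G]] by (simp add: c)
  next
    fix x y f assume f: "f \<in> hom C x y"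
    then have x: "x \<in> Ob C" "y \<in> Ob C" using hom_Ob FD by auto
    note h = Nat_hom[OF a F x(1)] Nat_hom[OF a F x(2)] Nat_hom[OF b G x(1)] Nat_hom[OF b G x(2)]
      Fun_hom[OF F f] Fun_hom[OF G f] Fun_hom[OF H f]
    show "onAr H f \<cdot>\<^bsub>D\<^esub> cmp (vcomp \<beta> \<alpha>) x = cmp (vcomp \<beta> \<alpha>) y \<cdot>\<^bsub>D\<^esub> onAr F f"
      unfolding c[OF x(1)] c[OF x(2)]
      using comp_assoc[OF FD(5) h(1) h(3) h(7)] comp_assoc[OF FD(5) h(1) h(6) h(4)]
        comp_assoc[OF FD(5) h(5) h(2) h(4)] Nat_natural[OF a F f] Nat_natural[OF b G f] by simp
  qed (use FD NatD[OF a F] NatD[OF b G] in \<open>auto simp: vcomp_def\<close>)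
qed

lemma hcomp_Nat:
  assumes a: "\<alpha> \<in> Nat F F'" and b: "\<beta> \<in> Nat G G'" and F: "F \<in> Fun A B" and G: "G \<in> Fun B C"
  shows "hcomp \<beta> \<alpha> \<in> Nat (G \<odot> F) (G' \<odot> F')"
    and "x \<in> Ob A \<Longrightarrow> cmp (hcomp \<beta> \<alpha>) x = cmp \<beta> (onOb F' x) \<cdot>\<^bsub>C\<^esub> onAr G (cmp \<alpha> x)"
proof -
  note F' = NatD(1)[OF a F] and G' = NatD(1)[OF b G]
  note FD = FunD[OF F] FunD[OF G]
  have c: "cmp (hcomp \<beta> \<alpha>) x = cmp \<beta> (onOb F' x) \<cdot>\<^bsub>C\<^esub> onAr G (cmp \<alpha> x)" if "x \<in> Ob A" for x
    using that FD NatD[OF a F] NatD[OF b G] by (simp add: hcomp_def)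
  then show "x \<in> Ob A \<Longrightarrow> cmp (hcomp \<beta> \<alpha>) x = cmp \<beta> (onOb F' x) \<cdot>\<^bsub>C\<^esub> onAr G (cmp \<alpha> x)" .
  show "hcomp \<beta> \<alpha> \<in> Nat (G \<odot> F) (G' \<odot> F')"
  proof (rule NatI[OF compF_Fun[OF F G] compF_Fun[OF F' G']])
    fix x assume x: "x \<in> Ob A"
    show "cmp (hcomp \<beta> \<alpha>) x \<in> hom C (onOb (G \<odot> F) x) (onOb (G' \<odot> F') x)"
      unfolding c[OF x] compF_Ob[OF F x] compF_Ob[OF F' x]
      using comp_hom[OF FD(10) Fun_hom[OF G Nat_hom[OF a F x]] Nat_hom[OF b G Fun_Ob[OF F' x]]] .
  next
    fix x y f assume f: "f \<in> hom A x y"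
    then have x: "x \<in> Ob A" "y \<in> Ob A" using hom_Ob FD by auto
    note Ff = Fun_hom[OF F f] Fun_hom[OF F' f]
    note ax = Nat_hom[OF a F x(1)] Nat_hom[OF a F x(2)]
    have 1: "onAr G (onAr F' f) \<cdot>\<^bsub>C\<^esub> onAr G (cmp \<alpha> x) = onAr G (cmp \<alpha> y) \<cdot>\<^bsub>C\<^esub> onAr G (onAr F f)"
      using Nat_natural[OF a F f] Fun_comp[OF G] Ff ax by metis
    have 2: "onAr G' (onAr F' f) \<cdot>\<^bsub>C\<^esub> cmp \<beta> (onOb F' x) = cmp \<beta> (onOb F' y) \<cdot>\<^bsub>C\<^esub> onAr G (onAr F' f)"
      using Nat_natural[OF b G Ff(2)] .
    note h = Fun_hom[OF G Ff(1)] Fun_hom[OF G Ff(2)] Fun_hom[OF G' Ff(2)] Fun_hom[OF G ax(1)] Fun_hom[OF G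
      ax(2)]
      Nat_hom[OF b G Fun_Ob[OF F' x(1)]] Nat_hom[OF b G Fun_Ob[OF F' x(2)]]
    show "onAr (G' \<odot> F') f \<cdot>\<^bsub>C\<^esub> cmp (hcomp \<beta> \<alpha>) x = cmp (hcomp \<beta> \<alpha>) y \<cdot>\<^bsub>C\<^esub> onAr (G \<odot> F) f"
      unfolding c[OF x(1)] c[OF x(2)] compF_Ar[OF F hom_Ar[OF f]] compF_Ar[OF F' hom_Ar[OF f]]
      using comp_assoc[OF FD(10) h(4) h(6) h(3)] comp_assoc[OF FD(10) h(4) h(2) h(7)]
        comp_assoc[OF FD(10) h(1) h(5) h(7)] 1 2 by simp
  qed (use FD NatD[OF a F] NatD[OF b G] in \<open>auto simp: hcomp_def\<close>)
qed

text \<open>Whiskering is expressed by \<open>hcomp\<close> with an identity transformation, because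
  the 2-functor axioms speak of \<open>hcomp\<close>; the identity factor then drops out of the
  components.\<close>

lemma whisker_right:
  assumes k: "k \<in> Fun J A" and u: "u \<in> Fun A B" and a: "\<alpha> \<in> Nat u u'"
  shows "hcomp \<alpha> (idN k) \<in> Nat (u \<odot> k) (u' \<odot> k)"
    and "x \<in> Ob J \<Longrightarrow> cmp (hcomp \<alpha> (idN k)) x = cmp \<alpha> (onOb k x)"
proof -
  show "hcomp \<alpha> (idN k) \<in> Nat (u \<odot> k) (u' \<odot> k)" by (rule hcomp_Nat(1)[OF idN_Nat[OF k] a k u])
  show "cmp (hcomp \<alpha> (idN k)) x = cmp \<alpha> (onOb k x)" if x: "x \<in> Ob J"
    using hcomp_Nat(2)[OF idN_Nat[OF k] a k u x] x FunD(2,3)[OF k] Fun_Id[OF u Fun_Ob[OF k x]]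
      comp_Id[OF FunD(5)[OF u] Nat_hom[OF a u Fun_Ob[OF k x]]] by simp
qed

lemma whisker_left:
  assumes u: "u \<in> Fun A B" and a: "\<alpha> \<in> Nat u u'" and v: "v \<in> Fun B C"
  shows "hcomp (idN v) \<alpha> \<in> Nat (v \<odot> u) (v \<odot> u')"
    and "x \<in> Ob A \<Longrightarrow> cmp (hcomp (idN v) \<alpha>) x = onAr v (cmp \<alpha> x)"
proof -
  show "hcomp (idN v) \<alpha> \<in> Nat (v \<odot> u) (v \<odot> u')" by (rule hcomp_Nat(1)[OF a idN_Nat[OF v] u v])
  show "cmp (hcomp (idN v) \<alpha>) x = onAr v (cmp \<alpha> x)" if x: "x \<in> Ob A"
    using hcomp_Nat(2)[OF a idN_Nat[OF v] u v x] FunD(2,3)[OF v] Fun_Ob[OF NatD(1)[OF a u] x]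
      Id_comp[OF FunD(5)[OF v] Fun_hom[OF v Nat_hom[OF a u x]]] by simp
qed

lemma natural_isoI:
  "\<alpha> \<in> Nat F G \<Longrightarrow> F \<in> Fun C D \<Longrightarrow> (\<And>x. x \<in> Ob C \<Longrightarrow> isomorphism D (cmp \<alpha> x)) \<Longrightarrow> natural_iso F G \<alpha>"
  by (simp add: natural_iso_def FunD)

lemma natural_isoD:
  assumes "natural_iso F G \<alpha>" "F \<in> Fun C D"
  shows "\<alpha> \<in> Nat F G" "x \<in> Ob C \<Longrightarrow> isomorphism D (cmp \<alpha> x)"
  using assms by (auto simp: natural_iso_def FunD)

text \<open>Pointwise inverses are automatically natural. The equations are returned both between
  transformations, as required of an invertible modification, and between components, as needed for
  cancellation.\<close>

lemma natural_iso_inverse: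
  assumes a: "natural_iso F G \<alpha>" and F: "F \<in> Fun C D"
  obtains \<beta> where "\<beta> \<in> Nat G F" "vcomp \<beta> \<alpha> = idN F" "vcomp \<alpha> \<beta> = idN G"
    "\<And>x. x \<in> Ob C \<Longrightarrow> cmp \<beta> x \<cdot>\<^bsub>D\<^esub> cmp \<alpha> x = Id D (onOb F x)"
    "\<And>x. x \<in> Ob C \<Longrightarrow> cmp \<alpha> x \<cdot>\<^bsub>D\<^esub> cmp \<beta> x = Id D (onOb G x)"
proof -
  note FD = FunD[OF F] and aN = natural_isoD(1)[OF a F]
  note G = NatD(1)[OF aN F] and ah = Nat_hom[OF aN F]
  have "\<forall>x \<in> Ob C. \<exists>g. g \<in> hom D (onOb G x) (onOb F x) \<and> g \<cdot>\<^bsub>D\<^esub> cmp \<alpha> x = Id D (onOb F x) \<and> cmp \<alpha> x \<cdot>\<^bsub>D\<^esub> g =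
    Id D (onOb G x)"
    using isomorphismE[OF natural_isoD(2)[OF a F] ah] by metis
  then obtain b where b: "\<And>x. x \<in> Ob C \<Longrightarrow> b x \<in> hom D (onOb G x) (onOb F x)"
      "\<And>x. x \<in> Ob C \<Longrightarrow> b x \<cdot>\<^bsub>D\<^esub> cmp \<alpha> x = Id D (onOb F x)" "\<And>x. x \<in> Ob C \<Longrightarrow> cmp \<alpha> x \<cdot>\<^bsub>D\<^esub> b x = Id D (onOb G x)"
    by metis
  define \<beta> where "\<beta> = \<lparr>NSrc = G, NTgt = F, cmp = (\<lambda>x\<in>Ob C. b x)\<rparr>"
  have c: "cmp \<beta> x = b x" if "x \<in> Ob C" for x using that by (simp add: \<beta>_def)
  have bN: "\<beta> \<in> Nat G F"
  proof (rule NatI[OF G F])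
    fix x y f assume f: "f \<in> hom C x y"
    note x = hom_Ob[OF FD(4) f]
    note h = b(1)[OF x(1)] b(1)[OF x(2)] ah[OF x(1)] ah[OF x(2)] Fun_hom[OF F f] Fun_hom[OF G f]
    \<comment> \<open>The naturality square of \<alpha> is conjugated by the inverses
      \<open>b x\<close> and \<open>b y\<close>.\<close>
    have "onAr F f \<cdot>\<^bsub>D\<^esub> b x = ((b y \<cdot>\<^bsub>D\<^esub> cmp \<alpha> y) \<cdot>\<^bsub>D\<^esub> onAr F f) \<cdot>\<^bsub>D\<^esub> b x"
      using b(2)[OF x(2)] Id_comp[OF FD(5) h(5)] by simp
    also have "\<dots> = (b y \<cdot>\<^bsub>D\<^esub> (onAr G f \<cdot>\<^bsub>D\<^esub> cmp \<alpha> x)) \<cdot>\<^bsub>D\<^esub> b x"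
      using comp_assoc[OF FD(5) h(5) h(4) h(2)] Nat_natural[OF aN F f] by simp
    also have "\<dots> = b y \<cdot>\<^bsub>D\<^esub> (onAr G f \<cdot>\<^bsub>D\<^esub> (cmp \<alpha> x \<cdot>\<^bsub>D\<^esub> b x))"
      using comp_assoc[OF FD(5) h(1) comp_hom[OF FD(5) h(3) h(6)] h(2)] comp_assoc[OF FD(5) h(1) h(3) h(6)]
        by simp
    also have "\<dots> = b y \<cdot>\<^bsub>D\<^esub> onAr G f"
      using b(3)[OF x(1)] comp_Id[OF FD(5) h(6)] by simp
    finally show "onAr F f \<cdot>\<^bsub>D\<^esub> cmp \<beta> x = cmp \<beta> y \<cdot>\<^bsub>D\<^esub> onAr G f" using x by (simp add: c)
  qed (use b(1) in \<open>auto simp: \<beta>_def\<close>)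
  have "vcomp \<beta> \<alpha> = idN F"
    by (rule Nat_eqI[OF vcomp_Nat(1)[OF aN bN F] idN_Nat[OF F] F])
      (simp add: vcomp_Nat(2)[OF aN bN F] c b(2) FD(2,3))
  moreover have "vcomp \<alpha> \<beta> = idN G"
    by (rule Nat_eqI[OF vcomp_Nat(1)[OF bN aN G] idN_Nat[OF G] G])
      (simp add: vcomp_Nat(2)[OF bN aN G] c b(3) FunD(2,3)[OF G])
  ultimately show thesis using that[OF bN] b c by simp
qed

section \<open>Universal arrows\<close>

text \<open>An initial object of the category of arrows from \<open>X\<close> to values of
  \<open>R\<close>. Equivalently, the value at \<open>X\<close> of a left adjoint of
  \<open>R\<close> together with its unit, determined up to a unique isomorphism and without any
  choice.\<close>

definition universal :: "('o, 'm, 'p, 'n) func \<Rightarrow> 'p \<Rightarrow> 'o \<Rightarrow> 'n \<Rightarrow> bool" where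
  "universal R X Z e \<longleftrightarrow> Z \<in> Ob (FSrc R) \<and> e \<in> hom (FTgt R) X (onOb R Z) \<and>
     (\<forall>Y \<in> Ob (FSrc R). \<forall>g \<in> hom (FTgt R) X (onOb R Y).
        \<exists>!h. h \<in> hom (FSrc R) Z Y \<and> onAr R h \<cdot>\<^bsub>FTgt R\<^esub> e = g)"

lemma universalD:
  assumes "universal R X Z e" "R \<in> Fun C D"
  shows "Z \<in> Ob C" "e \<in> hom D X (onOb R Z)"
  using assms by (auto simp: universal_def Fun_def)

lemma universal_ex:
  assumes u: "universal R X Z e" and R: "R \<in> Fun C D" and Y: "Y \<in> Ob C" "g \<in> hom D X (onOb R Y)"
  obtains h where "h \<in> hom C Z Y" "onAr R h \<cdot>\<^bsub>D\<^esub> e = g"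
  using u Y unfolding universal_def FunD(2,3)[OF R] by blast

lemma universal_eq:
  assumes u: "universal R X Z e" and R: "R \<in> Fun C D" and h: "h \<in> hom C Z Y" "h' \<in> hom C Z Y"
    and eq: "onAr R h \<cdot>\<^bsub>D\<^esub> e = onAr R h' \<cdot>\<^bsub>D\<^esub> e"
  shows "h = h'"
proof -
  have "Y \<in> Ob C" using hom_Ob FunD(4)[OF R] h by metis
  moreover have "onAr R h \<cdot>\<^bsub>D\<^esub> e \<in> hom D X (onOb R Y)"
    using comp_hom[OF FunD(5)[OF R] universalD(2)[OF u R] Fun_hom[OF R h(1)]] .
  ultimately show ?thesis
    using assms by (auto simp: universal_def Fun_def)
qed

lemma universalI:
  assumes R: "R \<in> Fun C D" and Z: "Z \<in> Ob C" and e: "e \<in> hom D X (onOb R Z)"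
    and ex: "\<And>Y g. Y \<in> Ob C \<Longrightarrow> g \<in> hom D X (onOb R Y) \<Longrightarrow> \<exists>h \<in> hom C Z Y. onAr R h \<cdot>\<^bsub>D\<^esub> e = g"
    and eq: "\<And>Y h h'. h \<in> hom C Z Y \<Longrightarrow> h' \<in> hom C Z Y \<Longrightarrow>
      onAr R h \<cdot>\<^bsub>D\<^esub> e = onAr R h' \<cdot>\<^bsub>D\<^esub> e \<Longrightarrow> h = h'"
  shows "universal R X Z e"
  unfolding universal_def FunD(2,3)[OF R]
proof (intro conjI ballI)
  fix Y g assume "Y \<in> Ob C" "g \<in> hom D X (onOb R Y)"
  then obtain h where "h \<in> hom C Z Y" "onAr R h \<cdot>\<^bsub>D\<^esub> e = g" using ex by blast
  then show "\<exists>!h. h \<in> hom C Z Y \<and> onAr R h \<cdot>\<^bsub>D\<^esub> e = g" using eq by metis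
qed (fact Z e)+

text \<open>Maps between initial objects are invertible: the map back exists by initiality, and both
  composites are identities by uniqueness. To invert a canonical map it is then enough to see that
  it carries one universal arrow to another.\<close>

lemma universal_iso:
  assumes u: "universal R X Z e" and u': "universal R X Z' e'" and R: "R \<in> Fun C D"
    and h: "h \<in> hom C Z Z'" "onAr R h \<cdot>\<^bsub>D\<^esub> e = e'"
  shows "isomorphism C h"
proof -
  note C = FunD(4)[OF R] and D = FunD(5)[OF R]
  note e = universalD[OF u R] and e' = universalD[OF u' R]
  obtain k where k: "k \<in> hom C Z' Z" "onAr R k \<cdot>\<^bsub>D\<^esub> e' = e"
    using universal_ex[OF u' R] e by blast
  have "onAr R (k \<cdot>\<^bsub>C\<^esub> h) \<cdot>\<^bsub>D\<^esub> e = onAr R (Id C Z) \<cdot>\<^bsub>D\<^esub> e"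
    using Fun_comp[OF R h(1) k(1)] comp_assoc[OF D e(2) Fun_hom[OF R h(1)] Fun_hom[OF R k(1)]] h(2) k(2)
      Fun_Id[OF R e(1)] Id_comp[OF D e(2)] by simp
  then have "k \<cdot>\<^bsub>C\<^esub> h = Id C Z"
    by (rule universal_eq[OF u R comp_hom[OF C h(1) k(1)] Id_hom[OF C e(1)]])
  moreover have "onAr R (h \<cdot>\<^bsub>C\<^esub> k) \<cdot>\<^bsub>D\<^esub> e' = onAr R (Id C Z') \<cdot>\<^bsub>D\<^esub> e'"
    using Fun_comp[OF R k(1) h(1)] comp_assoc[OF D e'(2) Fun_hom[OF R k(1)] Fun_hom[OF R h(1)]] h(2) k(2)
      Fun_Id[OF R e'(1)] Id_comp[OF D e'(2)] by simp
  then have "h \<cdot>\<^bsub>C\<^esub> k = Id C Z'"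
    by (rule universal_eq[OF u' R comp_hom[OF C k(1) h(1)] Id_hom[OF C e'(1)]])
  ultimately show ?thesis by (rule isomorphismI[OF h(1) k(1)])
qed

text \<open>Initiality is invariant under isomorphism. This is the passage from the chosen Kan
  extension to an arbitrary universal arrow, and from a Kan extension to the target of an invertible
  mate.\<close>

lemma universal_along_iso:
  assumes u: "universal R X Z e" and R: "R \<in> Fun C D" and h: "h \<in> hom C Z Z'" "isomorphism C h"
  shows "universal R X Z' (onAr R h \<cdot>\<^bsub>D\<^esub> e)"
proof -
  note C = FunD(4)[OF R] and D = FunD(5)[OF R] and e = universalD[OF u R]
  obtain k where k: "k \<in> hom C Z' Z" "k \<cdot>\<^bsub>C\<^esub> h = Id C Z" "h \<cdot>\<^bsub>C\<^esub> k = Id C Z'"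
    using isomorphismE h by metis
  show ?thesis
  proof (rule universalI[OF R])
    show "Z' \<in> Ob C" using hom_Ob[OF C h(1)] by simp
    show "onAr R h \<cdot>\<^bsub>D\<^esub> e \<in> hom D X (onOb R Z')"
      using comp_hom[OF D e(2) Fun_hom[OF R h(1)]] .
  next
    fix Y g assume "Y \<in> Ob C" "g \<in> hom D X (onOb R Y)"
    then obtain l where l: "l \<in> hom C Z Y" "onAr R l \<cdot>\<^bsub>D\<^esub> e = g" using universal_ex[OF u R] by blast
    have "onAr R (l \<cdot>\<^bsub>C\<^esub> k) \<cdot>\<^bsub>D\<^esub> (onAr R h \<cdot>\<^bsub>D\<^esub> e) = onAr R ((l \<cdot>\<^bsub>C\<^esub> k) \<cdot>\<^bsub>C\<^esub> h) \<cdot>\<^bsub>D\<^esub> e"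
      using Fun_comp[OF R h(1) comp_hom[OF C k(1) l(1)]]
        comp_assoc[OF D e(2) Fun_hom[OF R h(1)] Fun_hom[OF R comp_hom[OF C k(1) l(1)]]] by simp
    also have "(l \<cdot>\<^bsub>C\<^esub> k) \<cdot>\<^bsub>C\<^esub> h = l"
      using comp_assoc[OF C h(1) k(1) l(1)] comp_Id[OF C l(1)] k by simp
    finally show "\<exists>m \<in> hom C Z' Y. onAr R m \<cdot>\<^bsub>D\<^esub> (onAr R h \<cdot>\<^bsub>D\<^esub> e) = g"
      using l comp_hom[OF C k(1) l(1)] by auto
  next
    fix Y m m' assume m: "m \<in> hom C Z' Y" "m' \<in> hom C Z' Y"
      and "onAr R m \<cdot>\<^bsub>D\<^esub> (onAr R h \<cdot>\<^bsub>D\<^esub> e) = onAr R m' \<cdot>\<^bsub>D\<^esub> (onAr R h \<cdot>\<^bsub>D\<^esub> e)"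
    moreover have "onAr R (n \<cdot>\<^bsub>C\<^esub> h) \<cdot>\<^bsub>D\<^esub> e = onAr R n \<cdot>\<^bsub>D\<^esub> (onAr R h \<cdot>\<^bsub>D\<^esub> e)" if "n \<in> hom C Z' Y" for n
      using Fun_comp[OF R h(1) that] comp_assoc[OF D e(2) Fun_hom[OF R h(1)] Fun_hom[OF R that]] by simp
    ultimately have "m \<cdot>\<^bsub>C\<^esub> h = m' \<cdot>\<^bsub>C\<^esub> h"
      using universal_eq[OF u R comp_hom[OF C h(1) m(1)] comp_hom[OF C h(1) m(2)]] m by simp
    moreover have "n = (n \<cdot>\<^bsub>C\<^esub> h) \<cdot>\<^bsub>C\<^esub> k" if "n \<in> hom C Z' Y" for n
      using comp_assoc[OF C k(1) h(1) that] comp_Id[OF C that] k by simp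
    ultimately show "m = m'"
      using m by metis
  qed
qed

text \<open>Left adjoints compose, and the unit of the composite is \<open>e\<close> followed by the
  image of \<open>e'\<close>. At the level of universal arrows this avoids any comparison of chosen
  adjoints of a composite with composites of chosen adjoints.\<close>

lemma universal_compF:
  assumes R: "R \<in> Fun D E" and R': "R' \<in> Fun C D" and u: "universal R X Z e" and u': "universal R' Z W e'"
  shows "universal (R \<odot> R') X W (onAr R e' \<cdot>\<^bsub>E\<^esub> e)"
proof (rule universalI[OF compF_Fun[OF R' R]])
  note Z = universalD[OF u R] and W = universalD[OF u' R'] and Ec = FunD(5)[OF R] and Dc = FunD(5)[OF R']
  have Re: "onAr R e' \<in> hom E (onOb R Z) (onOb R (onOb R' W))" by (rule Fun_hom[OF R W(2)])
  have *: "onAr (R \<odot> R') h \<cdot>\<^bsub>E\<^esub> (onAr R e' \<cdot>\<^bsub>E\<^esub> e) = onAr R (onAr R' h \<cdot>\<^bsub>D\<^esub> e') \<cdot>\<^bsub>E\<^esub> e" if h: "h \<in> hom C W Y"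
    for h Y
    using comp_assoc[OF Ec Z(2) Re Fun_hom[OF R Fun_hom[OF R' h]]] Fun_comp[OF R W(2) Fun_hom[OF R' h]]
    by (simp add: compF_Ar[OF R' hom_Ar[OF h]])
  show "W \<in> Ob C" by (rule W(1))
  show "onAr R e' \<cdot>\<^bsub>E\<^esub> e \<in> hom E X (onOb (R \<odot> R') W)"
    using comp_hom[OF Ec Z(2) Re] by (simp add: compF_Ob[OF R' W(1)])
  { fix Y g assume Y: "Y \<in> Ob C" and g: "g \<in> hom E X (onOb (R \<odot> R') Y)"
    have "g \<in> hom E X (onOb R (onOb R' Y))" using g by (simp add: compF_Ob[OF R' Y])
    then obtain h where h: "h \<in> hom D Z (onOb R' Y)" "onAr R h \<cdot>\<^bsub>E\<^esub> e = g"
      using universal_ex[OF u R Fun_Ob[OF R' Y]] by blast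
    obtain h' where h': "h' \<in> hom C W Y" "onAr R' h' \<cdot>\<^bsub>D\<^esub> e' = h"
      by (rule universal_ex[OF u' R' Y h(1)])
    show "\<exists>h \<in> hom C W Y. onAr (R \<odot> R') h \<cdot>\<^bsub>E\<^esub> (onAr R e' \<cdot>\<^bsub>E\<^esub> e) = g"
      using h h' * by metis }
  fix Y h h' assume h: "h \<in> hom C W Y" "h' \<in> hom C W Y"
    and "onAr (R \<odot> R') h \<cdot>\<^bsub>E\<^esub> (onAr R e' \<cdot>\<^bsub>E\<^esub> e) = onAr (R \<odot> R') h' \<cdot>\<^bsub>E\<^esub> (onAr R e' \<cdot>\<^bsub>E\<^esub> e)"
  then have "onAr R (onAr R' h \<cdot>\<^bsub>D\<^esub> e') \<cdot>\<^bsub>E\<^esub> e = onAr R (onAr R' h' \<cdot>\<^bsub>D\<^esub> e') \<cdot>\<^bsub>E\<^esub> e" using * by simp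
  then have "onAr R' h \<cdot>\<^bsub>D\<^esub> e' = onAr R' h' \<cdot>\<^bsub>D\<^esub> e'"
    by (rule universal_eq[OF u R comp_hom[OF Dc W(2) Fun_hom[OF R' h(1)]] comp_hom[OF Dc W(2) Fun_hom[OF R'
      h(2)]]])
  then show "h = h'" by (rule universal_eq[OF u' R' h])
qed

lemma adjunction_universal:
  assumes adj: "adjunction L R \<eta> \<epsilon>" and X: "X \<in> Ob (FTgt R)"
  shows "universal R X (onOb L X) (cmp \<eta> X)"
proof -
  define C where "C = FSrc R"
  define D where "D = FTgt R"
  have L: "L \<in> Fun D C" and R: "R \<in> Fun C D"
  proof -
    show L: "L \<in> Fun D C"
      using adj by (simp add: adjunction_def C_def D_def)
    show "R \<in> Fun C D"
      using adj FunD(2,3)[OF L] by (simp add: adjunction_def)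
  qed
  have e: "\<eta> \<in> Nat (idF D) (R \<odot> L)" "\<epsilon> \<in> Nat (L \<odot> R) (idF C)"
    using adj FunD(2)[OF L] by (auto simp: adjunction_def C_def)
  have t: "\<And>x. x \<in> Ob D \<Longrightarrow> cmp \<epsilon> (onOb L x) \<cdot>\<^bsub>C\<^esub> onAr L (cmp \<eta> x) = Id C (onOb L x)"
    "\<And>y. y \<in> Ob C \<Longrightarrow> onAr R (cmp \<epsilon> y) \<cdot>\<^bsub>D\<^esub> cmp \<eta> (onOb R y) = Id D (onOb R y)"
    using adj FunD(2,3)[OF L] FunD(2,3)[OF R] by (auto simp: adjunction_def)
  note Cc = FunD(4)[OF R] and Dc = FunD(5)[OF R]
  have X: "X \<in> Ob D" using X by (simp add: D_def)
  have et: "cmp \<eta> x \<in> hom D x (onOb R (onOb L x))" if "x \<in> Ob D" for x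
    using Nat_hom[OF e(1) idF_Fun[OF Dc] that] that by (simp add: compF_Ob[OF L])
  have ep: "cmp \<epsilon> y \<in> hom C (onOb L (onOb R y)) y" if "y \<in> Ob C" for y
    using Nat_hom[OF e(2) compF_Fun[OF R L] that] that by (simp add: compF_Ob[OF R])
  have en: "onAr R (onAr L f) \<cdot>\<^bsub>D\<^esub> cmp \<eta> x = cmp \<eta> y \<cdot>\<^bsub>D\<^esub> f" if "f \<in> hom D x y" for f x y
    using Nat_natural[OF e(1) idF_Fun[OF Dc] that] that by (simp add: compF_Ar[OF L] hom_Ar)
  have pn: "f \<cdot>\<^bsub>C\<^esub> cmp \<epsilon> x = cmp \<epsilon> y \<cdot>\<^bsub>C\<^esub> onAr L (onAr R f)" if "f \<in> hom C x y" for f x y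
    using Nat_natural[OF e(2) compF_Fun[OF R L] that] that by (simp add: compF_Ar[OF R] hom_Ar)
  show ?thesis
  proof (rule universalI[OF R])
    show "onOb L X \<in> Ob C" "cmp \<eta> X \<in> hom D X (onOb R (onOb L X))"
      using X et Fun_Ob[OF L] by auto
  next
    fix Y g assume Y: "Y \<in> Ob C" and g: "g \<in> hom D X (onOb R Y)"
    \<comment> \<open>The transpose of \<open>g\<close>. That it factors \<open>g\<close> is
      naturality of the unit together with the triangle identity at \<open>Y\<close>.\<close>
    let ?h = "cmp \<epsilon> Y \<cdot>\<^bsub>C\<^esub> onAr L g"
    have Lg: "onAr L g \<in> hom C (onOb L X) (onOb L (onOb R Y))" using Fun_hom[OF L g] .
    have h: "?h \<in> hom C (onOb L X) Y" using comp_hom[OF Cc Lg ep[OF Y]] .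
    have "onAr R ?h \<cdot>\<^bsub>D\<^esub> cmp \<eta> X = onAr R (cmp \<epsilon> Y) \<cdot>\<^bsub>D\<^esub> (onAr R (onAr L g) \<cdot>\<^bsub>D\<^esub> cmp \<eta> X)"
      using Fun_comp[OF R Lg ep[OF Y]] comp_assoc[OF Dc et[OF X] Fun_hom[OF R Lg] Fun_hom[OF R ep[OF Y]]] by
        simp
    also have "\<dots> = g"
      using en[OF g] comp_assoc[OF Dc g et[OF Fun_Ob[OF R Y]] Fun_hom[OF R ep[OF Y]]] t(2)[OF Y] Id_comp[OF
        Dc g] by simp
    finally show "\<exists>h\<in>hom C (onOb L X) Y. onAr R h \<cdot>\<^bsub>D\<^esub> cmp \<eta> X = g" using h by blast
  next
    fix Y
    \<comment> \<open>Naturality of the counit and the other triangle identity recover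
      \<open>h\<close> from its transpose, which gives uniqueness.\<close>
    have *: "h = cmp \<epsilon> Y \<cdot>\<^bsub>C\<^esub> onAr L (onAr R h \<cdot>\<^bsub>D\<^esub> cmp \<eta> X)" if h: "h \<in> hom C (onOb L X) Y" for h
    proof -
      have Y: "Y \<in> Ob C" using hom_Ob[OF Cc h] by simp
      have "cmp \<epsilon> Y \<cdot>\<^bsub>C\<^esub> onAr L (onAr R h \<cdot>\<^bsub>D\<^esub> cmp \<eta> X) =
          (cmp \<epsilon> Y \<cdot>\<^bsub>C\<^esub> onAr L (onAr R h)) \<cdot>\<^bsub>C\<^esub> onAr L (cmp \<eta> X)"
        using Fun_comp[OF L et[OF X] Fun_hom[OF R h]]
          comp_assoc[OF Cc Fun_hom[OF L et[OF X]] Fun_hom[OF L Fun_hom[OF R h]] ep[OF Y]] by simp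
      also have "\<dots> = h"
        using pn[OF h] comp_assoc[OF Cc Fun_hom[OF L et[OF X]] ep[OF Fun_Ob[OF L X]] h] t(1)[OF X] comp_Id[OF
          Cc h] by simp
      finally show ?thesis ..
    qed
    show "h = h'" if "h \<in> hom C (onOb L X) Y" "h' \<in> hom C (onOb L X) Y"
      "onAr R h \<cdot>\<^bsub>D\<^esub> cmp \<eta> X = onAr R h' \<cdot>\<^bsub>D\<^esub> cmp \<eta> X" for h h'
      using *[OF that(1)] *[OF that(2)] that(3) by simp
  qed
qed

text \<open>Universal arrows are chosen at every object. The functor laws of \<open>L\<close>, the
  naturality of the counit and one triangle identity then hold because both sides agree after
  composition with a universal arrow. The lemma is applied to a functor into a slice category, whose
  left adjoint is thereby obtained without writing it down.\<close>

lemma adjunction_from_universal: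
  assumes R: "R \<in> Fun C D" and ex: "\<And>X. X \<in> Ob D \<Longrightarrow> \<exists>Z e. universal R X Z e"
  obtains L \<eta> \<epsilon> where "adjunction L R \<eta> \<epsilon>"
proof -
  note Cc = FunD(4)[OF R] and Dc = FunD(5)[OF R]
  obtain l e where u: "universal R X (l X) (e X)" if "X \<in> Ob D" for X
    using ex by metis
  note lO = universalD(1)[OF u R] and eh = universalD(2)[OF u R]
  have "\<exists>h. h \<in> hom C (l X) (l Y) \<and> onAr R h \<cdot>\<^bsub>D\<^esub> e X = e Y \<cdot>\<^bsub>D\<^esub> f" if f: "f \<in> hom D X Y" for f X Y
    using universal_ex[OF u R, of X "l Y" "e Y \<cdot>\<^bsub>D\<^esub> f"] comp_hom[OF Dc f eh] hom_Ob[OF Dc f] lO by metis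
  then have "\<forall>f \<in> Ar D. \<exists>h. h \<in> hom C (l (Dom D f)) (l (Cod D f)) \<and> onAr R h \<cdot>\<^bsub>D\<^esub> e (Dom D f) = e (Cod D f)
    \<cdot>\<^bsub>D\<^esub> f"
    using Ar_hom by fast
  then obtain m where "\<forall>f \<in> Ar D. m f \<in> hom C (l (Dom D f)) (l (Cod D f)) \<and> onAr R (m f) \<cdot>\<^bsub>D\<^esub> e (Dom D f) = e
    (Cod D f) \<cdot>\<^bsub>D\<^esub> f"
    by metis
  then have mh: "m f \<in> hom C (l X) (l Y)" and me: "onAr R (m f) \<cdot>\<^bsub>D\<^esub> e X = e Y \<cdot>\<^bsub>D\<^esub> f" if "f \<in> hom D X Y" for
    f X Y
    using that by (auto simp: hom_iff)
  define L where "L = \<lparr>FSrc = D, FTgt = C, onOb = (\<lambda>X\<in>Ob D. l X), onAr = (\<lambda>f\<in>Ar D. m f)\<rparr>"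
  have LO: "onOb L X = l X" if "X \<in> Ob D" for X using that by (simp add: L_def)
  have LA: "onAr L f = m f" if "f \<in> hom D X Y" for f X Y using that by (simp add: L_def hom_def)
  have L: "L \<in> Fun D C"
  proof (rule FunI[OF Dc Cc])
    fix X Y f assume f: "f \<in> hom D X Y"
    show "onAr L f \<in> hom C (onOb L X) (onOb L Y)"
      using mh[OF f] f hom_Ob[OF Dc f] by (simp add: LA LO)
    fix Z g assume g: "g \<in> hom D Y Z"
    have x: "X \<in> Ob D" "Y \<in> Ob D" "Z \<in> Ob D" using hom_Ob[OF Dc f] hom_Ob[OF Dc g] by auto
    have "onAr R (m (g \<cdot>\<^bsub>D\<^esub> f)) \<cdot>\<^bsub>D\<^esub> e X = onAr R (m g \<cdot>\<^bsub>C\<^esub> m f) \<cdot>\<^bsub>D\<^esub> e X"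
    proof -
      have "onAr R (m g \<cdot>\<^bsub>C\<^esub> m f) \<cdot>\<^bsub>D\<^esub> e X = onAr R (m g) \<cdot>\<^bsub>D\<^esub> (e Y \<cdot>\<^bsub>D\<^esub> f)"
        using Fun_comp[OF R mh[OF f] mh[OF g]] comp_assoc[OF Dc eh[OF x(1)] Fun_hom[OF R mh[OF f]] Fun_hom[OF
          R mh[OF g]]] me[OF f] by simp
      also have "\<dots> = (e Z \<cdot>\<^bsub>D\<^esub> g) \<cdot>\<^bsub>D\<^esub> f"
        using comp_assoc[OF Dc f eh[OF x(2)] Fun_hom[OF R mh[OF g]]] me[OF g] by simp
      also have "\<dots> = e Z \<cdot>\<^bsub>D\<^esub> (g \<cdot>\<^bsub>D\<^esub> f)"
        using comp_assoc[OF Dc f g eh[OF x(3)]] by simp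
      finally show ?thesis using me[OF comp_hom[OF Dc f g]] by simp
    qed
    then show "onAr L (g \<cdot>\<^bsub>D\<^esub> f) = onAr L g \<cdot>\<^bsub>C\<^esub> onAr L f"
      using universal_eq[OF u[OF x(1)] R mh[OF comp_hom[OF Dc f g]] comp_hom[OF Cc mh[OF f] mh[OF g]]]
        f g comp_hom[OF Dc f g] by (simp add: LA)
  next
    fix X assume X: "X \<in> Ob D"
    note i = Id_hom[OF Dc X]
    have "onAr R (m (Id D X)) \<cdot>\<^bsub>D\<^esub> e X = onAr R (Id C (l X)) \<cdot>\<^bsub>D\<^esub> e X"
      using me[OF i] comp_Id[OF Dc eh[OF X]] Id_comp[OF Dc eh[OF X]] Fun_Id[OF R lO[OF X]] by simp
    then show "onAr L (Id D X) = Id C (onOb L X)"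
      using universal_eq[OF u[OF X] R mh[OF i] Id_hom[OF Cc lO[OF X]]] X i by (simp add: LO LA)
    show "onOb L X \<in> Ob C" using X lO by (simp add: LO)
  qed (auto simp: L_def)
  define \<eta> where "\<eta> = \<lparr>NSrc = idF D, NTgt = R \<odot> L, cmp = (\<lambda>X\<in>Ob D. e X)\<rparr>"
  have \<eta>: "\<eta> \<in> Nat (idF D) (R \<odot> L)"
  proof (rule NatI[OF idF_Fun[OF Dc] compF_Fun[OF L R]])
    fix X Y f assume f: "f \<in> hom D X Y"
    then show "onAr (R \<odot> L) f \<cdot>\<^bsub>D\<^esub> cmp \<eta> X = cmp \<eta> Y \<cdot>\<^bsub>D\<^esub> onAr (idF D) f"
      using me[OF f] hom_Ob[OF Dc f] by (simp add: compF_Ar[OF L] hom_Ar \<eta>_def LA[OF f])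
  qed (use eh in \<open>auto simp: \<eta>_def compF_Ob[OF L] LO\<close>)
  \<comment> \<open>The counit at \<open>Y\<close> is the factorisation of the identity of
    \<open>onOb R Y\<close>, so that one triangle identity holds by construction.\<close>
  have "\<exists>h. h \<in> hom C (l (onOb R Y)) Y \<and> onAr R h \<cdot>\<^bsub>D\<^esub> e (onOb R Y) = Id D (onOb R Y)" if "Y \<in> Ob C" for Y
    using universal_ex[OF u R] that Fun_Ob[OF R that] Id_hom[OF Dc Fun_Ob[OF R that]] by metis
  then obtain k where kh: "k Y \<in> hom C (l (onOb R Y)) Y" and ke: "onAr R (k Y) \<cdot>\<^bsub>D\<^esub> e (onOb R Y) = Id D (onOb
    R Y)"
    if "Y \<in> Ob C" for Y by metis
  define \<epsilon> where "\<epsilon> = \<lparr>NSrc = L \<odot> R, NTgt = idF C, cmp = (\<lambda>Y\<in>Ob C. k Y)\<rparr>"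
  have \<epsilon>: "\<epsilon> \<in> Nat (L \<odot> R) (idF C)"
  proof (rule NatI[OF compF_Fun[OF R L] idF_Fun[OF Cc]])
    fix X Y f assume f: "f \<in> hom C X Y"
    have x: "X \<in> Ob C" "Y \<in> Ob C" using hom_Ob[OF Cc f] .
    note r = Fun_Ob[OF R x(1)] Fun_Ob[OF R x(2)] and Rf = Fun_hom[OF R f]
    have "onAr R (f \<cdot>\<^bsub>C\<^esub> k X) \<cdot>\<^bsub>D\<^esub> e (onOb R X) = onAr R f"
      using Fun_comp[OF R kh[OF x(1)] f] comp_assoc[OF Dc eh[OF r(1)] Fun_hom[OF R kh[OF x(1)]] Rf] ke[OF
        x(1)]
        comp_Id[OF Dc Rf] by simp
    moreover have "onAr R (k Y \<cdot>\<^bsub>C\<^esub> m (onAr R f)) \<cdot>\<^bsub>D\<^esub> e (onOb R X) = onAr R f"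
      using Fun_comp[OF R mh[OF Rf] kh[OF x(2)]] comp_assoc[OF Dc eh[OF r(1)] Fun_hom[OF R mh[OF Rf]]
        Fun_hom[OF R kh[OF x(2)]]]
        me[OF Rf] comp_assoc[OF Dc Rf eh[OF r(2)] Fun_hom[OF R kh[OF x(2)]]] ke[OF x(2)] Id_comp[OF Dc Rf] by
          simp
    ultimately have "f \<cdot>\<^bsub>C\<^esub> k X = k Y \<cdot>\<^bsub>C\<^esub> m (onAr R f)"
      using universal_eq[OF u[OF r(1)] R comp_hom[OF Cc kh[OF x(1)] f] comp_hom[OF Cc mh[OF Rf] kh[OF x(2)]]]
        by simp
    then show "onAr (idF C) f \<cdot>\<^bsub>C\<^esub> cmp \<epsilon> X = cmp \<epsilon> Y \<cdot>\<^bsub>C\<^esub> onAr (L \<odot> R) f"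
      using f x by (simp add: \<epsilon>_def compF_Ar[OF R] hom_Ar LA[OF Rf])
  qed (use kh in \<open>auto simp: \<epsilon>_def compF_Ob[OF R] LO Fun_Ob[OF R]\<close>)
  have "cmp \<epsilon> (onOb L X) \<cdot>\<^bsub>C\<^esub> onAr L (cmp \<eta> X) = Id C (onOb L X)" if X: "X \<in> Ob D" for X
  proof -
    note kl = kh[OF lO[OF X]] and Ex = eh[OF X] and RZ = Fun_Ob[OF R lO[OF X]]
    have "onAr R (k (l X) \<cdot>\<^bsub>C\<^esub> m (e X)) \<cdot>\<^bsub>D\<^esub> e X = onAr R (Id C (l X)) \<cdot>\<^bsub>D\<^esub> e X"
      using Fun_comp[OF R mh[OF Ex] kl] comp_assoc[OF Dc Ex Fun_hom[OF R mh[OF Ex]] Fun_hom[OF R kl]] me[OF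
        Ex]
        comp_assoc[OF Dc Ex eh[OF RZ] Fun_hom[OF R kl]] ke[OF lO[OF X]] Fun_Id[OF R lO[OF X]] by simp
    then show ?thesis
      using universal_eq[OF u[OF X] R comp_hom[OF Cc mh[OF Ex] kl] Id_hom[OF Cc lO[OF X]]] X lO[OF X] LA[OF
        Ex]
      by (simp add: \<epsilon>_def \<eta>_def LO)
  qed
  then have "adjunction L R \<eta> \<epsilon>"
    using L R \<eta> \<epsilon> ke FunD[OF L] FunD[OF R] Fun_Ob[OF R]
    unfolding adjunction_def by (simp add: \<eta>_def \<epsilon>_def)
  then show thesis by (rule that)
qed

section \<open>Constructions of small categories\<close>

lemma small_pairs:
  assumes "small X" "small Y"
  shows "small {\<lblot>x, y\<rblot> | x y. x \<in> X \<and> y \<in> Y}"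
proof -
  have "{\<lblot>x, y\<rblot> | x y. x \<in> X \<and> y \<in> Y} = (\<Union>x\<in>X. (\<lambda>y. \<lblot>x, y\<rblot>) ` Y)" by auto
  then show ?thesis using assms by (simp add: small_Union small_image)
qed

text \<open>An infinite small set is nonempty, and a constant map sends it onto the
  singleton.\<close>

lemma small_singleton: "small {x :: 'u::universe}"
proof -
  obtain X :: "'u set" where X: "small X" "infinite X" using small_infinity by blast
  then obtain y where "y \<in> X" using infinite_imp_nonempty by blast
  then have "(\<lambda>_. x) ` X = {x}" by auto
  then show ?thesis using small_image[OF X(1)] by metis
qed

lemma small_categoryD:
  assumes "small_category A" shows "category A" "small (Ob A)" "small (Ar A)"
  using assms by (auto simp: small_category_def)

lemma small_one_cat: "small_category one_cat"
  unfolding small_category_def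
proof (intro conjI)
  show "category one_cat" by (rule categoryI) (auto simp: one_cat_def hom_def)
qed (auto simp: one_cat_def small_singleton)

lemma one_cat_simps [simp]: "Ob one_cat = {undefined}" "Ar one_cat = {undefined}" "Id one_cat x = undefined"
  "f \<in> hom one_cat x y \<longleftrightarrow> f = undefined \<and> x = undefined \<and> y = undefined"
  "f \<cdot>\<^bsub>one_cat\<^esub> g = undefined"
  by (auto simp: one_cat_def hom_def)

lemma to_one_Fun: "category A \<Longrightarrow> to_one A \<in> Fun A one_cat"
  by (rule FunI)
    (use small_one_cat in \<open>auto simp: small_category_def to_one_def hom_Ar dest: hom_Ar[OF comp_hom]\<close>)

lemma to_one_unique: "F \<in> Fun A one_cat \<Longrightarrow> F = to_one A"
  using to_one_Fun[OF FunD(4), of F A one_cat] Fun_Ob[of F A one_cat] Fun_hom[of F A one_cat]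
    Fun_Ob[of "to_one A" A one_cat] Fun_hom[of "to_one A" A one_cat]
  by (intro Fun_eqI[of F A one_cat "to_one A"]) simp_all

text \<open>Terminality of \<open>one_cat\<close> in dimension two. Any 2-cell whiskered with the
  functor to \<open>one_cat\<close> becomes an identity; this is why units and counits act trivially
  on constant diagrams.\<close>

lemma Nat_one_unique:
  assumes "F \<in> Fun A one_cat" "\<alpha> \<in> Nat F G"
  shows "\<alpha> = idN (to_one A)"
proof -
  have eq: "F = to_one A" "G = to_one A" using assms to_one_unique NatD(1) by blast+
  have t: "to_one A \<in> Fun A one_cat" using assms eq by simp
  show ?thesis
    using assms Nat_hom[OF assms(2,1)] FunD[OF t] unfolding eq
    by (intro Nat_eqI[OF _ idN_Nat[OF t] t]) auto
qed

lemma point_simps [simp]: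
  "onOb (point A a) undefined = a" "onAr (point A a) undefined = Id A a"
  by (auto simp: point_def)

lemma point_Fun: "category A \<Longrightarrow> a \<in> Ob A \<Longrightarrow> point A a \<in> Fun one_cat A"
proof (rule FunI)
  assume A: "category A" "a \<in> Ob A"
  show "onAr (point A a) (g \<cdot>\<^bsub>one_cat\<^esub> f) = onAr (point A a) g \<cdot>\<^bsub>A\<^esub> onAr (point A a) f"
    if "f \<in> hom one_cat x y" "g \<in> hom one_cat y z" for f g x y z
    using that comp_Id[OF A(1) Id_hom[OF A]] by simp
qed (use small_one_cat in \<open>auto simp: point_def small_category_def intro: Id_hom\<close>)

lemma compF_point: "u \<in> Fun A B \<Longrightarrow> a \<in> Ob A \<Longrightarrow> u \<odot> point A a = point B (onOb u a)"
  by (rule Fun_eqI[OF compF_Fun[OF point_Fun] point_Fun])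
    (auto simp: FunD Fun_Ob compF_Ob[OF point_Fun] compF_Ar[OF point_Fun] Fun_Id dest: FunD(4,5))

text \<open>Constant functors are kept factored through \<open>one_cat\<close>, because this
  composite is the target of the slice cell of Der4.\<close>

abbreviation const :: "'u::universe scat \<Rightarrow> 'u scat \<Rightarrow> 'u \<Rightarrow> 'u sfunc" where
  "const J A a \<equiv> point A a \<odot> to_one J"

lemma const_Fun: "category J \<Longrightarrow> category A \<Longrightarrow> a \<in> Ob A \<Longrightarrow> const J A a \<in> Fun J A"
  by (rule compF_Fun[OF to_one_Fun point_Fun])

lemma const_Ob [simp]: "x \<in> Ob J \<Longrightarrow> onOb (const J A a) x = a"
  and const_Ar [simp]: "f \<in> Ar J \<Longrightarrow> onAr (const J A a) f = Id A a"
  by (simp_all add: compF_def to_one_def)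

lemma compF_const:
  "category J \<Longrightarrow> u \<in> Fun A B \<Longrightarrow> a \<in> Ob A \<Longrightarrow> u \<odot> const J A a = const J B (onOb u a)"
  using compF_assoc[OF to_one_Fun point_Fun] compF_point by (metis FunD(4))

section \<open>Products of small categories: projections, sections and pairings\<close>

lemma prod_cat_simps [simp]:
  "x \<in> Ob (A \<times>\<^sub>c B) \<longleftrightarrow> (\<exists>a\<in>Ob A. \<exists>b\<in>Ob B. x = \<lblot>a, b\<rblot>)"
  "k \<in> Ar (A \<times>\<^sub>c B) \<longleftrightarrow> (\<exists>f\<in>Ar A. \<exists>g\<in>Ar B. k = \<lblot>f, g\<rblot>)"
  "Id (A \<times>\<^sub>c B) \<lblot>a, b\<rblot> = \<lblot>Id A a, Id B b\<rblot>"
  "\<lblot>f', g'\<rblot> \<cdot>\<^bsub>A \<times>\<^sub>c B\<^esub> \<lblot>f, g\<rblot> = \<lblot>f' \<cdot>\<^bsub>A\<^esub> f, g' \<cdot>\<^bsub>B\<^esub> g\<rblot>"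
  by (auto simp: prod_cat_def)

lemma hom_prod_cat:
  "k \<in> hom (A \<times>\<^sub>c B) x y \<longleftrightarrow>
     (\<exists>a a' b b' f g. f \<in> hom A a a' \<and> g \<in> hom B b b' \<and> k = \<lblot>f, g\<rblot> \<and> x = \<lblot>a, b\<rblot> \<and> y = \<lblot>a', b'\<rblot>)"
  by (auto simp: prod_cat_def hom_def)

lemma hom_prod_catE:
  assumes "category A" "category B" "k \<in> hom (A \<times>\<^sub>c B) x y"
  obtains f g a b a' b' where "k = \<lblot>f, g\<rblot>" "x = \<lblot>a, b\<rblot>" "y = \<lblot>a', b'\<rblot>"
    "f \<in> hom A a a'" "g \<in> hom B b b'" "a \<in> Ob A" "b \<in> Ob B" "a' \<in> Ob A" "b' \<in> Ob B"
  using assms hom_Ob[OF assms(1)] hom_Ob[OF assms(2)] unfolding hom_prod_cat by metis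

lemma hom_prod_cat_pr [simp]:
  "\<lblot>f, g\<rblot> \<in> hom (A \<times>\<^sub>c B) \<lblot>a, b\<rblot> \<lblot>a', b'\<rblot> \<longleftrightarrow> f \<in> hom A a a' \<and> g \<in> hom B b b'"
  by (auto simp: hom_prod_cat)

lemma category_prod_cat: "category A \<Longrightarrow> category B \<Longrightarrow> category (A \<times>\<^sub>c B)"
proof (rule categoryI)
  assume A: "category A" and B: "category B"
  fix w x y z f g h
  assume "f \<in> hom (A \<times>\<^sub>c B) w x" "g \<in> hom (A \<times>\<^sub>c B) x y" "h \<in> hom (A \<times>\<^sub>c B) y z"
  then show "h \<cdot>\<^bsub>A \<times>\<^sub>c B\<^esub> (g \<cdot>\<^bsub>A \<times>\<^sub>c B\<^esub> f) = (h \<cdot>\<^bsub>A \<times>\<^sub>c B\<^esub> g) \<cdot>\<^bsub>A \<times>\<^sub>c B\<^esub> f"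
    by (auto simp: hom_prod_cat comp_assoc[OF A] comp_assoc[OF B])
qed (auto simp: prod_cat_def Id_hom comp_Id Id_comp intro: comp_hom dest: hom_Ob[OF _ Ar_hom] simp:
  hom_prod_cat[unfolded prod_cat_def])

lemma small_prod_cat [intro, simp]: "small_category A \<Longrightarrow> small_category B \<Longrightarrow> small_category (A \<times>\<^sub>c B)"
  unfolding small_category_def
  using category_prod_cat small_pairs[of "Ob A" "Ob B"] small_pairs[of "Ar A" "Ar B"]
  by (auto simp: prod_cat_def)

lemma prodF_simps [simp]:
  "FSrc (u \<times>\<^sub>f v) = FSrc u \<times>\<^sub>c FSrc v" "FTgt (u \<times>\<^sub>f v) = FTgt u \<times>\<^sub>c FTgt v"
  "a \<in> Ob (FSrc u) \<Longrightarrow> b \<in> Ob (FSrc v) \<Longrightarrow> onOb (u \<times>\<^sub>f v) \<lblot>a, b\<rblot> = \<lblot>onOb u a, onOb v b\<rblot>"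
  "f \<in> Ar (FSrc u) \<Longrightarrow> g \<in> Ar (FSrc v) \<Longrightarrow> onAr (u \<times>\<^sub>f v) \<lblot>f, g\<rblot> = \<lblot>onAr u f, onAr v g\<rblot>"
  by (auto simp: prodF_def)

lemma prodF_Fun:
  assumes u: "u \<in> Fun A A'" and v: "v \<in> Fun B B'"
  shows "u \<times>\<^sub>f v \<in> Fun (A \<times>\<^sub>c B) (A' \<times>\<^sub>c B')"
proof (rule FunI)
  note FD = FunD[OF u] FunD[OF v]
  show "category (A \<times>\<^sub>c B)" "category (A' \<times>\<^sub>c B')" using FD by (auto intro: category_prod_cat)
  fix x y k assume k: "k \<in> hom (A \<times>\<^sub>c B) x y"
  then show "onAr (u \<times>\<^sub>f v) k \<in> hom (A' \<times>\<^sub>c B') (onOb (u \<times>\<^sub>f v) x) (onOb (u \<times>\<^sub>f v) y)"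
    by (rule hom_prod_catE[OF FD(4,9)]) (simp add: FD hom_Ar Fun_hom[OF u] Fun_hom[OF v])
  fix z l assume "l \<in> hom (A \<times>\<^sub>c B) y z"
  with k show "onAr (u \<times>\<^sub>f v) (l \<cdot>\<^bsub>A \<times>\<^sub>c B\<^esub> k) = onAr (u \<times>\<^sub>f v) l \<cdot>\<^bsub>A' \<times>\<^sub>c B'\<^esub> onAr (u \<times>\<^sub>f v) k"
    by (auto simp: FD hom_prod_cat[of k] hom_prod_cat[of l] hom_Ar hom_Ar[OF comp_hom[OF FD(4)]]
        hom_Ar[OF comp_hom[OF FD(9)]] Fun_comp[OF u] Fun_comp[OF v])
next
  note FD = FunD[OF u] FunD[OF v]
  fix x assume "x \<in> Ob (A \<times>\<^sub>c B)"
  then show "onOb (u \<times>\<^sub>f v) x \<in> Ob (A' \<times>\<^sub>c B')" "onAr (u \<times>\<^sub>f v) (Id (A \<times>\<^sub>c B) x) = Id (A' \<times>\<^sub>c B') (onOb (u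
    \<times>\<^sub>f v) x)"
    by (auto simp: FD Fun_Ob[OF u] Fun_Ob[OF v] Fun_Id[OF u] Fun_Id[OF v] hom_Ar[OF Id_hom])
qed (use FunD[OF u] FunD[OF v] in \<open>auto simp: prodF_def\<close>)

lemma prodF_compF:
  assumes "u \<in> Fun A A'" "u' \<in> Fun A' A''" "v \<in> Fun B B'" "v' \<in> Fun B' B''"
  shows "(u' \<times>\<^sub>f v') \<odot> (u \<times>\<^sub>f v) = (u' \<odot> u) \<times>\<^sub>f (v' \<odot> v)"
proof (rule Fun_eqI)
  note FD = FunD[OF assms(1)] FunD[OF assms(2)] FunD[OF assms(3)] FunD[OF assms(4)]
  note p = prodF_Fun[OF assms(1,3)]
  show "(u' \<times>\<^sub>f v') \<odot> (u \<times>\<^sub>f v) \<in> Fun (A \<times>\<^sub>c B) (A'' \<times>\<^sub>c B'')" "(u' \<odot> u) \<times>\<^sub>f (v' \<odot> v) \<in> Fun (A \<times>\<^sub>c B) (A''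
    \<times>\<^sub>c B'')"
    using assms by (auto intro!: compF_Fun prodF_Fun)
  show "onOb ((u' \<times>\<^sub>f v') \<odot> (u \<times>\<^sub>f v)) x = onOb ((u' \<odot> u) \<times>\<^sub>f (v' \<odot> v)) x" if "x \<in> Ob (A \<times>\<^sub>c B)" for x
    using that
    by (auto simp: FD compF_Ob[OF p] compF_Ob[OF assms(1)] compF_Ob[OF assms(3)] Fun_Ob[OF assms(1)]
      Fun_Ob[OF assms(3)])
  show "onAr ((u' \<times>\<^sub>f v') \<odot> (u \<times>\<^sub>f v)) k = onAr ((u' \<odot> u) \<times>\<^sub>f (v' \<odot> v)) k" if "k \<in> hom (A \<times>\<^sub>c B) x y" for x y
    k
    using that
    by (auto simp: FD hom_prod_cat compF_Ar[OF p] compF_Ar[OF assms(1)] compF_Ar[OF assms(3)] hom_Ar[OF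
      Fun_hom[OF assms(1)]] hom_Ar[OF Fun_hom[OF assms(3)]] hom_Ar)
qed

lemma prodF_idF: "category A \<Longrightarrow> category B \<Longrightarrow> idF A \<times>\<^sub>f idF B = idF (A \<times>\<^sub>c B)"
  by (rule Fun_eqI[OF prodF_Fun[OF idF_Fun idF_Fun] idF_Fun[OF category_prod_cat]])
    (auto simp: hom_prod_cat hom_Ar)

lemma prodF_idF_comp:
  "category A \<Longrightarrow> v \<in> Fun B B' \<Longrightarrow> w \<in> Fun B' C \<Longrightarrow> idF A \<times>\<^sub>f (w \<odot> v) = (idF A \<times>\<^sub>f w) \<odot> (idF A \<times>\<^sub>f v)"
  using prodF_compF[OF idF_Fun idF_Fun, of A v B B' w C] compF_idF(1)[OF idF_Fun, of A] by simp

lemma proj2_simps [simp]: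
  "FSrc (proj2 A B) = A \<times>\<^sub>c B" "FTgt (proj2 A B) = B"
  "a \<in> Ob A \<Longrightarrow> b \<in> Ob B \<Longrightarrow> onOb (proj2 A B) \<lblot>a, b\<rblot> = b"
  "f \<in> Ar A \<Longrightarrow> g \<in> Ar B \<Longrightarrow> onAr (proj2 A B) \<lblot>f, g\<rblot> = g"
  by (auto simp: proj2_def)

lemma proj2_Fun: "category A \<Longrightarrow> category B \<Longrightarrow> proj2 A B \<in> Fun (A \<times>\<^sub>c B) B"
proof (rule FunI)
  assume A: "category A" and B: "category B"
  fix x y k assume k: "k \<in> hom (A \<times>\<^sub>c B) x y"
  then show "onAr (proj2 A B) k \<in> hom B (onOb (proj2 A B) x) (onOb (proj2 A B) y)"
    by (rule hom_prod_catE[OF A B]) (simp add: hom_Ar)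
  fix z l assume "l \<in> hom (A \<times>\<^sub>c B) y z"
  with k show "onAr (proj2 A B) (l \<cdot>\<^bsub>A \<times>\<^sub>c B\<^esub> k) = onAr (proj2 A B) l \<cdot>\<^bsub>B\<^esub> onAr (proj2 A B) k"
    using A B by (auto simp: hom_prod_cat[of k] hom_prod_cat[of l] hom_Ar hom_Ar[OF comp_hom])
qed (auto simp: category_prod_cat hom_Ar[OF Id_hom], auto simp: proj2_def)

lemma proj2_prodF:
  assumes "u \<in> Fun A A'" "v \<in> Fun B B'"
  shows "proj2 A' B' \<odot> (u \<times>\<^sub>f v) = v \<odot> proj2 A B"
proof (rule Fun_eqI)
  note FD = FunD[OF assms(1)] FunD[OF assms(2)]
  note p = prodF_Fun[OF assms] proj2_Fun[OF FD(4) FD(9)] proj2_Fun[OF FD(5) FD(10)]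
  show "proj2 A' B' \<odot> (u \<times>\<^sub>f v) \<in> Fun (A \<times>\<^sub>c B) B'" "v \<odot> proj2 A B \<in> Fun (A \<times>\<^sub>c B) B'"
    using compF_Fun p assms by blast+
  show "onOb (proj2 A' B' \<odot> (u \<times>\<^sub>f v)) x = onOb (v \<odot> proj2 A B) x" if "x \<in> Ob (A \<times>\<^sub>c B)" for x
    using that
    by (auto simp: FD compF_Ob[OF p(1)] compF_Ob[OF p(2)] Fun_Ob[OF assms(1)] Fun_Ob[OF assms(2)])
  show "onAr (proj2 A' B' \<odot> (u \<times>\<^sub>f v)) k = onAr (v \<odot> proj2 A B) k" if "k \<in> hom (A \<times>\<^sub>c B) x y" for x y k
    using that
    by (auto simp: FD hom_prod_cat compF_Ar[OF p(1)] compF_Ar[OF p(2)] hom_Ar[OF Fun_hom[OF assms(1)]]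
      hom_Ar[OF Fun_hom[OF assms(2)]] hom_Ar)
qed

lemma prodN_id_Nat:
  assumes A: "category A" and v: "v \<in> Fun B C" and a: "\<alpha> \<in> Nat v w"
  shows "idN (idF A) \<times>\<^sub>n \<alpha> \<in> Nat (idF A \<times>\<^sub>f v) (idF A \<times>\<^sub>f w)"
    and "x \<in> Ob A \<Longrightarrow> b \<in> Ob B \<Longrightarrow> cmp (idN (idF A) \<times>\<^sub>n \<alpha>) \<lblot>x, b\<rblot> = \<lblot>Id A x, cmp \<alpha> b\<rblot>"
proof -
  note i = idF_Fun[OF A] and w = NatD(1)[OF a v] and sv = FunD(2,3)[OF v] and sw = FunD(2,3)[OF NatD(1)[OF a
    v]]
  have c: "cmp (idN (idF A) \<times>\<^sub>n \<alpha>) \<lblot>x, b\<rblot> = \<lblot>Id A x, cmp \<alpha> b\<rblot>" if "x \<in> Ob A" "b \<in> Ob B" for x b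
    using that NatD(2)[OF a v] sv by (simp add: prodN_def)
  then show "x \<in> Ob A \<Longrightarrow> b \<in> Ob B \<Longrightarrow> cmp (idN (idF A) \<times>\<^sub>n \<alpha>) \<lblot>x, b\<rblot> = \<lblot>Id A x, cmp \<alpha> b\<rblot>" .
  show "idN (idF A) \<times>\<^sub>n \<alpha> \<in> Nat (idF A \<times>\<^sub>f v) (idF A \<times>\<^sub>f w)"
  proof (rule NatI[OF prodF_Fun[OF i v] prodF_Fun[OF i w]])
    show "cmp (idN (idF A) \<times>\<^sub>n \<alpha>) x \<in> hom (A \<times>\<^sub>c C) (onOb (idF A \<times>\<^sub>f v) x) (onOb (idF A \<times>\<^sub>f w) x)"
      if "x \<in> Ob (A \<times>\<^sub>c B)" for x
      using that Nat_hom[OF a v] by (auto simp: c sv sw Id_hom[OF A])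
    fix x y k assume k: "k \<in> hom (A \<times>\<^sub>c B) x y"
    show "onAr (idF A \<times>\<^sub>f w) k \<cdot>\<^bsub>A \<times>\<^sub>c C\<^esub> cmp (idN (idF A) \<times>\<^sub>n \<alpha>) x =
        cmp (idN (idF A) \<times>\<^sub>n \<alpha>) y \<cdot>\<^bsub>A \<times>\<^sub>c C\<^esub> onAr (idF A \<times>\<^sub>f v) k"
      by (rule hom_prod_catE[OF A FunD(4)[OF v] k])
        (simp add: c sv sw hom_Ar comp_Id[OF A] Id_comp[OF A] Nat_natural[OF a v])
  qed (use NatD[OF a v] in \<open>auto simp: prodN_def sv\<close>)
qed

text \<open>The interchange law: \<open>u\<close> acts on the first factor of the product and
  \<alpha> on the second, so they commute. It gives the compatibility with 2-cells of the morphisms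
  \<open>pull_mor D u\<close> and \<open>lan_mor D u\<close>.\<close>

lemma prodN_whisker:
  assumes u: "u \<in> Fun A A'" and v: "v \<in> Fun B C" and a: "\<alpha> \<in> Nat v w"
  shows "hcomp (idN (u \<times>\<^sub>f idF C)) (idN (idF A) \<times>\<^sub>n \<alpha>) = hcomp (idN (idF A') \<times>\<^sub>n \<alpha>) (idN (u \<times>\<^sub>f idF B))"
proof -
  note FD = FunD[OF u] FunD[OF v]
  note n = prodN_id_Nat[OF FD(4) v a] and n' = prodN_id_Nat[OF FD(5) v a]
  note i = idF_Fun[OF FD(4)] idF_Fun[OF FD(5)]
  note uB = prodF_Fun[OF u idF_Fun[OF FD(9)]] and uC = prodF_Fun[OF u idF_Fun[OF FD(10)]]
  note L = whisker_left[OF prodF_Fun[OF i(1) v] n(1) uC] and R = whisker_right[OF uB prodF_Fun[OF i(2) v]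
    n'(1)]
  have sw: "(u \<times>\<^sub>f idF C) \<odot> (idF A \<times>\<^sub>f x) = (idF A' \<times>\<^sub>f x) \<odot> (u \<times>\<^sub>f idF B)" if "x \<in> Fun B C" for x
    using prodF_compF[OF i(1) u that idF_Fun[OF FD(10)]] prodF_compF[OF u i(2) idF_Fun[OF FD(9)] that]
      u that by simp
  show ?thesis
  proof (rule Nat_eqI[OF _ R(1) compF_Fun[OF uB prodF_Fun[OF i(2) v]]])
    show "hcomp (idN (u \<times>\<^sub>f idF C)) (idN (idF A) \<times>\<^sub>n \<alpha>) \<in> Nat ((idF A' \<times>\<^sub>f v) \<odot> (u \<times>\<^sub>f idF B)) ((idF A' \<times>\<^sub>f
      w) \<odot> (u \<times>\<^sub>f idF B))"
      using L(1) sw[OF v] sw[OF NatD(1)[OF a v]] by simp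
    fix x assume "x \<in> Ob (A \<times>\<^sub>c B)"
    then obtain y b where x: "x = \<lblot>y, b\<rblot>" "y \<in> Ob A" "b \<in> Ob B" by auto
    then have "x \<in> Ob (A \<times>\<^sub>c B)" by simp
    then show "cmp (hcomp (idN (u \<times>\<^sub>f idF C)) (idN (idF A) \<times>\<^sub>n \<alpha>)) x = cmp (hcomp (idN (idF A') \<times>\<^sub>n \<alpha>) (idN
      (u \<times>\<^sub>f idF B))) x"
      using x hom_Ar[OF Id_hom[OF FD(4) x(2)]] hom_Ar[OF Nat_hom[OF a v x(3)]] Fun_Ob[OF u x(2)] FD(2,3)
      by (simp add: L(2) R(2) n(2) n'(2) Fun_Id[OF u x(2)])
  qed
qed

lemma section_at_Fun:
  assumes A: "category A" and B: "category B" and a: "a \<in> Ob A"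
  shows "section_at A a B \<in> Fun B (A \<times>\<^sub>c B)"
proof (rule FunI)
  note i = Id_hom[OF A a]
  show "category B" "category (A \<times>\<^sub>c B)" using A B by (auto intro: category_prod_cat)
  fix x y g assume g: "g \<in> hom B x y"
  then show "onAr (section_at A a B) g \<in> hom (A \<times>\<^sub>c B) (onOb (section_at A a B) x) (onOb (section_at A a B)
    y)"
    using i by (simp add: section_at_def hom_Ar hom_Ob[OF B g])
  fix z h assume h: "h \<in> hom B y z"
  show "onAr (section_at A a B) (h \<cdot>\<^bsub>B\<^esub> g) = onAr (section_at A a B) h \<cdot>\<^bsub>A \<times>\<^sub>c B\<^esub> onAr (section_at A a B) g"
    using g h hom_Ar[OF comp_hom[OF B g h]] by (simp add: section_at_def hom_Ar comp_Id[OF A i])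
qed (use a in \<open>auto simp: section_at_def hom_Ar[OF Id_hom[OF B]]\<close>)

lemma section_at_prodF:
  assumes A: "category A" and a: "a \<in> Ob A" and w: "w \<in> Fun B C"
  shows "(idF A \<times>\<^sub>f w) \<odot> section_at A a B = section_at A a C \<odot> w"
proof (rule Fun_eqI)
  note C = FunD(5)[OF w] and s = section_at_Fun[OF A FunD(4)[OF w] a]
  note ss = FunD(2,3)[OF w]
  show "(idF A \<times>\<^sub>f w) \<odot> section_at A a B \<in> Fun B (A \<times>\<^sub>c C)" "section_at A a C \<odot> w \<in> Fun B (A \<times>\<^sub>c C)"
    using compF_Fun[OF s prodF_Fun[OF idF_Fun[OF A] w]] compF_Fun[OF w section_at_Fun[OF A C a]] by auto
  show "onOb ((idF A \<times>\<^sub>f w) \<odot> section_at A a B) x = onOb (section_at A a C \<odot> w) x" if "x \<in> Ob B" for x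
    using that a ss Fun_Ob[OF w that] by (simp add: compF_Ob[OF s] compF_Ob[OF w]) (simp add: section_at_def)
  show "onAr ((idF A \<times>\<^sub>f w) \<odot> section_at A a B) f = onAr (section_at A a C \<odot> w) f" if "f \<in> hom B x y" for x y
    f
    using hom_Ar[OF that] ss hom_Ar[OF Fun_hom[OF w that]] hom_Ar[OF Id_hom[OF A a]]
    by (simp add: compF_Ar[OF s] compF_Ar[OF w]) (simp add: section_at_def)
qed

text \<open>The functor into a product with components \<open>u\<close> and \<open>v\<close>. With a
  constant second component it places a diagram in the first factor at a single value of the
  parameter, which is how index categories for the pointwise computations are formed.\<close>

definition pairF :: "'u::universe sfunc \<Rightarrow> 'u sfunc \<Rightarrow> 'u sfunc" where
  "pairF u v = \<lparr>FSrc = FSrc u, FTgt = FTgt u \<times>\<^sub>c FTgt v,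
     onOb = (\<lambda>x\<in>Ob (FSrc u). \<lblot>onOb u x, onOb v x\<rblot>),
     onAr = (\<lambda>f\<in>Ar (FSrc u). \<lblot>onAr u f, onAr v f\<rblot>)\<rparr>"

lemma pairF_simps [simp]:
  "FSrc (pairF u v) = FSrc u" "FTgt (pairF u v) = FTgt u \<times>\<^sub>c FTgt v"
  "x \<in> Ob (FSrc u) \<Longrightarrow> onOb (pairF u v) x = \<lblot>onOb u x, onOb v x\<rblot>"
  "f \<in> Ar (FSrc u) \<Longrightarrow> onAr (pairF u v) f = \<lblot>onAr u f, onAr v f\<rblot>"
  by (auto simp: pairF_def)

lemma pairF_Fun:
  assumes u: "u \<in> Fun J A" and v: "v \<in> Fun J B"
  shows "pairF u v \<in> Fun J (A \<times>\<^sub>c B)"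
proof (rule FunI)
  note FD = FunD[OF u] FunD[OF v]
  show "category J" "category (A \<times>\<^sub>c B)" using FD by (auto intro: category_prod_cat)
  fix x y f assume f: "f \<in> hom J x y"
  then show "onAr (pairF u v) f \<in> hom (A \<times>\<^sub>c B) (onOb (pairF u v) x) (onOb (pairF u v) y)"
    using FD hom_Ob[OF FD(4) f] Fun_hom[OF u f] Fun_hom[OF v f] by (simp add: hom_Ar)
  fix z g assume g: "g \<in> hom J y z"
  show "onAr (pairF u v) (g \<cdot>\<^bsub>J\<^esub> f) = onAr (pairF u v) g \<cdot>\<^bsub>A \<times>\<^sub>c B\<^esub> onAr (pairF u v) f"
    using f g FD hom_Ar[OF comp_hom[OF FD(4) f g]] by (simp add: hom_Ar Fun_comp[OF u f g] Fun_comp[OF v f g])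
next
  note FD = FunD[OF u] FunD[OF v]
  fix x assume x: "x \<in> Ob J"
  then show "onOb (pairF u v) x \<in> Ob (A \<times>\<^sub>c B)" "onAr (pairF u v) (Id J x) = Id (A \<times>\<^sub>c B) (onOb (pairF u v)
    x)"
    by (auto simp: FD Fun_Ob[OF u] Fun_Ob[OF v] Fun_Id[OF u] Fun_Id[OF v] hom_Ar[OF Id_hom])
qed (use FunD[OF u] FunD[OF v] in \<open>auto simp: pairF_def\<close>)

lemma proj2_pairF:
  assumes u: "u \<in> Fun J A" and v: "v \<in> Fun J B"
  shows "proj2 A B \<odot> pairF u v = v"
proof (rule Fun_eqI[OF compF_Fun[OF pairF_Fun[OF u v] proj2_Fun] v])
  note FD = FunD[OF u] FunD[OF v]
  show "category A" "category B" using FD by auto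
  show "onOb (proj2 A B \<odot> pairF u v) x = onOb v x" if "x \<in> Ob J" for x
    using that FD by (simp add: compF_Ob[OF pairF_Fun[OF u v]] Fun_Ob[OF u] Fun_Ob[OF v])
  show "onAr (proj2 A B \<odot> pairF u v) f = onAr v f" if f: "f \<in> hom J x y" for f x y
    using hom_Ar[OF f] FD hom_Ar[OF Fun_hom[OF u f]] hom_Ar[OF Fun_hom[OF v f]]
    by (simp add: compF_Ar[OF pairF_Fun[OF u v]])
qed

lemma prodF_pairF:
  assumes u: "u \<in> Fun J A" and v: "v \<in> Fun J B" and u': "u' \<in> Fun A A'" and v': "v' \<in> Fun B B'"
  shows "(u' \<times>\<^sub>f v') \<odot> pairF u v = pairF (u' \<odot> u) (v' \<odot> v)"
proof (rule Fun_eqI[OF compF_Fun[OF pairF_Fun[OF u v] prodF_Fun[OF u' v']] pairF_Fun[OF compF_Fun[OF u u']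
  compF_Fun[OF v v']]])
  note FD = FunD[OF u] FunD[OF v] FunD[OF u'] FunD[OF v']
  show "onOb ((u' \<times>\<^sub>f v') \<odot> pairF u v) x = onOb (pairF (u' \<odot> u) (v' \<odot> v)) x" if "x \<in> Ob J" for x
    using that FD by (simp add: compF_Ob[OF pairF_Fun[OF u v]] Fun_Ob[OF u] Fun_Ob[OF v] compF_Ob[OF u]
      compF_Ob[OF v])
  show "onAr ((u' \<times>\<^sub>f v') \<odot> pairF u v) f = onAr (pairF (u' \<odot> u) (v' \<odot> v)) f" if f: "f \<in> hom J x y" for f x y
    using hom_Ar[OF f] FD hom_Ar[OF Fun_hom[OF u f]] hom_Ar[OF Fun_hom[OF v f]]
    by (simp add: compF_Ar[OF pairF_Fun[OF u v]] compF_Ar[OF u] compF_Ar[OF v])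
qed

section \<open>Categories with labelled arrows; slices\<close>

lemma labelled_cat_simps [simp]:
  "Ob (labelled_cat X H i c) = X" "Id (labelled_cat X H i c) x = \<lblot>x, \<lblot>i x, x\<rblot>\<rblot>"
  "\<lblot>y', \<lblot>l', z\<rblot>\<rblot> \<cdot>\<^bsub>labelled_cat X H i c\<^esub> \<lblot>x, \<lblot>l, y\<rblot>\<rblot> = \<lblot>x, \<lblot>c l' l, z\<rblot>\<rblot>"
  by (auto simp: labelled_cat_def)

lemma hom_labelled_cat:
  "k \<in> hom (labelled_cat X H i c) x y \<longleftrightarrow> x \<in> X \<and> y \<in> X \<and> (\<exists>l \<in> H x y. k = \<lblot>x, \<lblot>l, y\<rblot>\<rblot>)"
  by (auto simp: labelled_cat_def hom_def)

text \<open>Every arrow stores its source and target, so the category axioms reduce to conditions on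
  the labels alone.\<close>

lemma category_labelled_cat:
  assumes "\<And>x. x \<in> X \<Longrightarrow> i x \<in> H x x"
    and "\<And>x y z l l'. x \<in> X \<Longrightarrow> y \<in> X \<Longrightarrow> z \<in> X \<Longrightarrow> l \<in> H x y \<Longrightarrow> l' \<in> H y z \<Longrightarrow> c l' l \<in> H x z"
    and "\<And>x y l. x \<in> X \<Longrightarrow> y \<in> X \<Longrightarrow> l \<in> H x y \<Longrightarrow> c l (i x) = l"
    and "\<And>x y l. x \<in> X \<Longrightarrow> y \<in> X \<Longrightarrow> l \<in> H x y \<Longrightarrow> c (i y) l = l"
    and "\<And>w x y z l l' l''. w \<in> X \<Longrightarrow> x \<in> X \<Longrightarrow> y \<in> X \<Longrightarrow> z \<in> X \<Longrightarrow> l \<in> H w x \<Longrightarrow> l' \<in> H x y \<Longrightarrow> l'' \<in> H y z \<Longrightarrow>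
      c l'' (c l' l) = c (c l'' l') l"
  shows "category (labelled_cat X H i c)"
proof (rule categoryI)
  fix f assume "f \<in> Ar (labelled_cat X H i c)"
  then show "Dom (labelled_cat X H i c) f \<in> Ob (labelled_cat X H i c)" "Cod (labelled_cat X H i c) f \<in> Ob
    (labelled_cat X H i c)"
    by (auto simp: labelled_cat_def)
next
  fix w x y z f g h
  assume "f \<in> hom (labelled_cat X H i c) w x" "g \<in> hom (labelled_cat X H i c) x y" "h \<in> hom (labelled_cat X H
    i c) y z"
  then show "h \<cdot>\<^bsub>labelled_cat X H i c\<^esub> (g \<cdot>\<^bsub>labelled_cat X H i c\<^esub> f) =
      (h \<cdot>\<^bsub>labelled_cat X H i c\<^esub> g) \<cdot>\<^bsub>labelled_cat X H i c\<^esub> f"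
    using assms(5) by (auto simp: hom_labelled_cat)
qed (use assms(1-4) in \<open>auto simp: hom_labelled_cat\<close>)

lemma small_labelled_cat:
  assumes "category (labelled_cat X H i c)" "small X" "\<And>x y. x \<in> X \<Longrightarrow> y \<in> X \<Longrightarrow> small (H x y)"
  shows "small_category (labelled_cat X H i c)"
proof -
  have "Ar (labelled_cat X H i c) = (\<Union>x\<in>X. \<Union>y\<in>X. (\<lambda>l. \<lblot>x, \<lblot>l, y\<rblot>\<rblot>) ` H x y)"
    by (auto simp: labelled_cat_def)
  then show ?thesis
    using assms by (simp add: small_category_def small_Union small_image)
qed

lemma small_hom: "small_category A \<Longrightarrow> small (hom A x y)"
  by (rule small_subset[of "Ar A"]) (auto simp: small_category_def hom_def)

lemma small_slice_over:
  assumes A: "small_category A" and B: "small_category B" and u: "u \<in> Fun A B"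
  shows "small_category (slice_over u b)"
  unfolding slice_over_def FunD(2,3)[OF u]
proof (rule small_labelled_cat[OF category_labelled_cat])
  note Ac = small_categoryD(1)[OF A] and Bc = small_categoryD(1)[OF B]
  let ?X = "{\<lblot>a, h\<rblot> | a h. a \<in> Ob A \<and> h \<in> hom B (onOb u a) b}"
  show "small ?X"
    by (rule small_subset[OF small_pairs[OF small_categoryD(2)[OF A] small_categoryD(3)[OF B]]]) (auto simp:
      hom_def)
  show "small {g \<in> hom A (p1 x) (p1 y). p2 y \<cdot>\<^bsub>B\<^esub> onAr u g = p2 x}" for x y
    by (rule small_subset[OF small_hom[OF A]]) auto
  show "Id A (p1 x) \<in> {g \<in> hom A (p1 x) (p1 x). p2 x \<cdot>\<^bsub>B\<^esub> onAr u g = p2 x}" if "x \<in> ?X" for x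
    using that by (auto simp: Id_hom[OF Ac] Fun_Id[OF u] comp_Id[OF Bc])
  fix x y z l l'
  assume "x \<in> ?X" "y \<in> ?X" "z \<in> ?X" and l: "l \<in> {g \<in> hom A (p1 x) (p1 y). p2 y \<cdot>\<^bsub>B\<^esub> onAr u g = p2 x}"
    and l': "l' \<in> {g \<in> hom A (p1 y) (p1 z). p2 z \<cdot>\<^bsub>B\<^esub> onAr u g = p2 y}"
  then obtain a h where z: "z = \<lblot>a, h\<rblot>" "h \<in> hom B (onOb u a) b" by auto
  have "h \<cdot>\<^bsub>B\<^esub> onAr u (l' \<cdot>\<^bsub>A\<^esub> l) = p2 x"
    using l l' z Fun_comp[OF u, of l "p1 x" "p1 y" l' a]
      comp_assoc[OF Bc Fun_hom[OF u] Fun_hom[OF u] z(2), of l "p1 x" "p1 y" l'] by simp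
  then show "l' \<cdot>\<^bsub>A\<^esub> l \<in> {g \<in> hom A (p1 x) (p1 z). p2 z \<cdot>\<^bsub>B\<^esub> onAr u g = p2 x}"
    using l l' z comp_hom[OF Ac] by auto
qed (use comp_assoc[OF small_categoryD(1)[OF A]] comp_Id[OF small_categoryD(1)[OF A]] Id_comp[OF
  small_categoryD(1)[OF A]] in auto)

lemma Ob_slice_over:
  "u \<in> Fun A B \<Longrightarrow> x \<in> Ob (slice_over u b) \<longleftrightarrow> (\<exists>a\<in>Ob A. \<exists>h\<in>hom B (onOb u a) b. x = \<lblot>a, h\<rblot>)"
  by (auto simp: slice_over_def FunD)

lemma hom_slice_over:
  "u \<in> Fun A B \<Longrightarrow> k \<in> hom (slice_over u b) \<lblot>a, h\<rblot> \<lblot>a', h'\<rblot> \<longleftrightarrow>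
     h \<in> hom B (onOb u a) b \<and> h' \<in> hom B (onOb u a') b \<and>
     (\<exists>g\<in>hom A a a'. h' \<cdot>\<^bsub>B\<^esub> onAr u g = h \<and> k = \<lblot>\<lblot>a, h\<rblot>, \<lblot>g, \<lblot>a', h'\<rblot>\<rblot>\<rblot>)"
  by (auto simp: slice_over_def FunD hom_labelled_cat dest: hom_Ob[OF FunD(4)])

lemma comp_slice_over:
  "u \<in> Fun A B \<Longrightarrow> \<lblot>y', \<lblot>l', z\<rblot>\<rblot> \<cdot>\<^bsub>slice_over u b\<^esub> \<lblot>x, \<lblot>l, y\<rblot>\<rblot> = \<lblot>x, \<lblot>l' \<cdot>\<^bsub>A\<^esub> l, z\<rblot>\<rblot>"
  by (simp add: slice_over_def FunD)

lemma slice_over_proj_Fun: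
  assumes A: "small_category A" and B: "small_category B" and u: "u \<in> Fun A B"
  shows "slice_over_proj u b \<in> Fun (slice_over u b) A"
proof (rule FunI)
  note S = small_categoryD(1)[OF small_slice_over[OF assms]]
  show "category (slice_over u b)" "category A" using S small_categoryD[OF A] by auto
  fix x y k assume k: "k \<in> hom (slice_over u b) x y"
  note h = hom_Ob[OF S k] hom_Ar[OF k]
  from h k show "onAr (slice_over_proj u b) k \<in> hom A (onOb (slice_over_proj u b) x) (onOb (slice_over_proj u
    b) y)"
    unfolding Ob_slice_over[OF u] by (auto simp: slice_over_proj_def hom_slice_over[OF u] Ob_slice_over[OF u])
  fix z l assume l: "l \<in> hom (slice_over u b) y z"
  have "onAr (slice_over_proj u b) (l \<cdot>\<^bsub>slice_over u b\<^esub> k) = p1 (p2 (l \<cdot>\<^bsub>slice_over u b\<^esub> k))"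
    using hom_Ar[OF comp_hom[OF S k l]] by (simp add: slice_over_proj_def)
  also have "\<dots> = p1 (p2 l) \<cdot>\<^bsub>A\<^esub> p1 (p2 k)"
    using h hom_Ob[OF S l] k l unfolding Ob_slice_over[OF u]
    by (auto simp: hom_slice_over[OF u] comp_slice_over[OF u])
  finally show "onAr (slice_over_proj u b) (l \<cdot>\<^bsub>slice_over u b\<^esub> k) =
      onAr (slice_over_proj u b) l \<cdot>\<^bsub>A\<^esub> onAr (slice_over_proj u b) k"
    using h(3) hom_Ar[OF l] by (simp add: slice_over_proj_def)
next
  note S = small_categoryD(1)[OF small_slice_over[OF assms]]
  fix x assume x: "x \<in> Ob (slice_over u b)"
  then have "onAr (slice_over_proj u b) (Id (slice_over u b) x) = p1 (p2 (Id (slice_over u b) x))"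
    using hom_Ar[OF Id_hom[OF S x]] by (simp add: slice_over_proj_def)
  then show "onAr (slice_over_proj u b) (Id (slice_over u b) x) = Id A (onOb (slice_over_proj u b) x)"
    using x FunD[OF u] by (simp add: slice_over_proj_def) (simp add: slice_over_def)
  show "onOb (slice_over_proj u b) x \<in> Ob A"
    using x by (auto simp: slice_over_proj_def Ob_slice_over[OF u])
qed (use FunD[OF u] in \<open>auto simp: slice_over_proj_def\<close>)

lemma slice_over_cell_Nat:
  assumes A: "small_category A" and B: "small_category B" and u: "u \<in> Fun A B" and b: "b \<in> Ob B"
  shows "slice_over_cell u b \<in> Nat (u \<odot> slice_over_proj u b) (const (slice_over u b) B b)"
proof (rule NatI)
  note S = small_categoryD(1)[OF small_slice_over[OF A B u]] and Bc = small_categoryD(1)[OF B]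
  note p = slice_over_proj_Fun[OF A B u]
  show "u \<odot> slice_over_proj u b \<in> Fun (slice_over u b) B" "const (slice_over u b) B b \<in> Fun (slice_over u b)
    B"
    using compF_Fun[OF p u] const_Fun[OF S Bc b] .
  show "cmp (slice_over_cell u b) x \<in> hom B (onOb (u \<odot> slice_over_proj u b) x) (onOb (const (slice_over u b)
    B b) x)"
    if "x \<in> Ob (slice_over u b)" for x
    using that by (simp add: compF_Ob[OF p]) (auto simp: slice_over_proj_def slice_over_cell_def
      Ob_slice_over[OF u])
  fix x y k assume k: "k \<in> hom (slice_over u b) x y"
  note h = hom_Ob[OF S k] hom_Ar[OF k]
  \<comment> \<open>The triangle that defines an arrow of the slice is exactly the naturality square
    of the cell.\<close>
  from h k have "p2 y \<cdot>\<^bsub>B\<^esub> onAr u (p1 (p2 k)) = p2 x" "p2 x \<in> hom B (onOb u (p1 x)) b"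
    unfolding Ob_slice_over[OF u] by (auto simp: hom_slice_over[OF u])
  then show "onAr (const (slice_over u b) B b) k \<cdot>\<^bsub>B\<^esub> cmp (slice_over_cell u b) x =
    cmp (slice_over_cell u b) y \<cdot>\<^bsub>B\<^esub> onAr (u \<odot> slice_over_proj u b) k"
    using h Id_comp[OF Bc] by (simp add: compF_Ar[OF p]) (simp add: slice_over_proj_def slice_over_cell_def)
qed (use FunD[OF u] in \<open>auto simp: slice_over_cell_def\<close>)

section \<open>Prederivators\<close>

text \<open>Typing and smallness in one predicate, since every axiom of a prederivator is
  conditional on the smallness of the categories involved.\<close>

definition SFun :: "'u::universe scat \<Rightarrow> 'u scat \<Rightarrow> 'u sfunc set" where
  "SFun A B = {u \<in> Fun A B. small_category A \<and> small_category B}"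

lemma SFunI: "small_category A \<Longrightarrow> small_category B \<Longrightarrow> u \<in> Fun A B \<Longrightarrow> u \<in> SFun A B"
  by (simp add: SFun_def)

lemma SFunD:
  assumes "u \<in> SFun A B"
  shows "u \<in> Fun A B" "small_category A" "small_category B" "category A" "category B"
  using assms by (auto simp: SFun_def small_category_def)

lemma SFun_comp: "u \<in> SFun A B \<Longrightarrow> v \<in> SFun B C \<Longrightarrow> v \<odot> u \<in> SFun A C"
  by (auto simp: SFun_def intro: compF_Fun)

lemma SFun_idF: "small_category A \<Longrightarrow> idF A \<in> SFun A A"
  by (simp add: SFun_def idF_Fun small_category_def)

lemma SFun_prodF: "u \<in> SFun A A' \<Longrightarrow> v \<in> SFun B B' \<Longrightarrow> u \<times>\<^sub>f v \<in> SFun (A \<times>\<^sub>c B) (A' \<times>\<^sub>c B')"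
  by (auto simp: SFun_def intro: prodF_Fun)

lemma SFun_proj2: "small_category A \<Longrightarrow> small_category B \<Longrightarrow> proj2 A B \<in> SFun (A \<times>\<^sub>c B) B"
  by (auto simp: SFun_def small_category_def[of A] small_category_def[of B] intro!: proj2_Fun)

lemma SFun_to_one: "small_category A \<Longrightarrow> to_one A \<in> SFun A one_cat"
  by (simp add: SFun_def small_one_cat to_one_Fun small_categoryD)

lemma SFun_point: "small_category A \<Longrightarrow> a \<in> Ob A \<Longrightarrow> point A a \<in> SFun one_cat A"
  by (simp add: SFun_def small_one_cat point_Fun small_categoryD)

lemma SFun_section_at:
  "small_category A \<Longrightarrow> small_category B \<Longrightarrow> a \<in> Ob A \<Longrightarrow> section_at A a B \<in> SFun B (A \<times>\<^sub>c B)"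
  by (auto simp: SFun_def small_category_def[of A] small_category_def[of B] intro!: section_at_Fun)

lemma SFun_pairF: "u \<in> SFun J A \<Longrightarrow> v \<in> SFun J B \<Longrightarrow> pairF u v \<in> SFun J (A \<times>\<^sub>c B)"
  by (auto simp: SFun_def intro: pairF_Fun)

lemma SFun_const: "small_category J \<Longrightarrow> small_category A \<Longrightarrow> a \<in> Ob A \<Longrightarrow> const J A a \<in> SFun J A"
  by (rule SFun_comp[OF SFun_to_one SFun_point])

locale prederivator_on =
  fixes D :: "('u::universe, 'o, 'm) prederiv"
  assumes prederivator: "prederivator D"
begin

abbreviation V :: "'u scat \<Rightarrow> ('o, 'm) cat" where "V \<equiv> val D"
abbreviation pull_Ob :: "'u sfunc \<Rightarrow> 'o \<Rightarrow> 'o" (infixr "\<star>" 90) where "u \<star> X \<equiv> onOb (pull D u) X"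
abbreviation pull_Ar :: "'u sfunc \<Rightarrow> 'm \<Rightarrow> 'm" (infixr "\<bullet>" 90) where "u \<bullet> f \<equiv> onAr (pull D u) f"

lemma V_category: "small_category A \<Longrightarrow> category (V A)"
  using prederivator by (simp add: prederivator_def)

lemma pull_Fun: "u \<in> SFun A B \<Longrightarrow> pull D u \<in> Fun (V B) (V A)"
  using prederivator by (auto simp: prederivator_def SFun_def)

lemma pull_idF: "small_category A \<Longrightarrow> pull D (idF A) = idF (V A)"
  using prederivator by (simp add: prederivator_def)

lemma pull_compF: "u \<in> SFun A B \<Longrightarrow> v \<in> SFun B C \<Longrightarrow> pull D (v \<odot> u) = pull D u \<odot> pull D v"
  using prederivator by (auto simp: prederivator_def SFun_def)

lemma star_Ob: "u \<in> SFun A B \<Longrightarrow> X \<in> Ob (V B) \<Longrightarrow> u \<star> X \<in> Ob (V A)"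
  by (rule Fun_Ob[OF pull_Fun])

lemma bullet_hom: "u \<in> SFun A B \<Longrightarrow> f \<in> hom (V B) X Y \<Longrightarrow> u \<bullet> f \<in> hom (V A) (u \<star> X) (u \<star> Y)"
  by (rule Fun_hom[OF pull_Fun])

lemma bullet_comp:
  "u \<in> SFun A B \<Longrightarrow> f \<in> hom (V B) X Y \<Longrightarrow> g \<in> hom (V B) Y Z \<Longrightarrow>
     u \<bullet> (g \<cdot>\<^bsub>V B\<^esub> f) = u \<bullet> g \<cdot>\<^bsub>V A\<^esub> u \<bullet> f"
  by (rule Fun_comp[OF pull_Fun])

lemma bullet_Id: "u \<in> SFun A B \<Longrightarrow> X \<in> Ob (V B) \<Longrightarrow> u \<bullet> Id (V B) X = Id (V A) (u \<star> X)"
  by (rule Fun_Id[OF pull_Fun])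

lemma star_compF: "u \<in> SFun A B \<Longrightarrow> v \<in> SFun B C \<Longrightarrow> X \<in> Ob (V C) \<Longrightarrow> (v \<odot> u) \<star> X = u \<star> v \<star> X"
  using pull_compF compF_Ob[OF pull_Fun] by metis

lemma bullet_compF: "u \<in> SFun A B \<Longrightarrow> v \<in> SFun B C \<Longrightarrow> f \<in> hom (V C) X Y \<Longrightarrow> (v \<odot> u) \<bullet> f = u \<bullet> v \<bullet> f"
  using pull_compF compF_Ar[OF pull_Fun] hom_Ar by metis

lemma star_idF: "small_category A \<Longrightarrow> X \<in> Ob (V A) \<Longrightarrow> idF A \<star> X = X"
  by (simp add: pull_idF)

lemma bullet_idF: "small_category A \<Longrightarrow> f \<in> hom (V A) X Y \<Longrightarrow> idF A \<bullet> f = f"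
  by (simp add: pull_idF hom_Ar)

lemma pull2_Nat:
  assumes u: "u \<in> SFun A B" and a: "\<alpha> \<in> Nat u v" shows "pull2 D \<alpha> \<in> Nat (pull D u) (pull D v)"
proof -
  have "v \<in> Fun A B" using NatD(1)[OF a SFunD(1)[OF u]] .
  then show ?thesis
    using assms prederivator by (auto simp: prederivator_def SFun_def)
qed

lemma pull2_hom:
  "u \<in> SFun A B \<Longrightarrow> \<alpha> \<in> Nat u v \<Longrightarrow> X \<in> Ob (V B) \<Longrightarrow> cmp (pull2 D \<alpha>) X \<in> hom (V A) (u \<star> X) (v \<star> X)"
  by (rule Nat_hom[OF pull2_Nat pull_Fun])

lemma pull2_natural:
  "u \<in> SFun A B \<Longrightarrow> \<alpha> \<in> Nat u v \<Longrightarrow> f \<in> hom (V B) X Y \<Longrightarrow>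
     v \<bullet> f \<cdot>\<^bsub>V A\<^esub> cmp (pull2 D \<alpha>) X = cmp (pull2 D \<alpha>) Y \<cdot>\<^bsub>V A\<^esub> u \<bullet> f"
  by (rule Nat_natural[OF pull2_Nat pull_Fun])

lemma pull2_idN_eq: "u \<in> SFun A B \<Longrightarrow> pull2 D (idN u) = idN (pull D u)"
  by (rule prederivator[unfolded prederivator_def, THEN conjunct2, THEN conjunct2, THEN conjunct2, THEN
    conjunct2, THEN conjunct2, THEN conjunct1, rule_format, of A B])
    (simp add: SFun_def)

lemma pull2_idN: "u \<in> SFun A B \<Longrightarrow> X \<in> Ob (V B) \<Longrightarrow> cmp (pull2 D (idN u)) X = Id (V A) (u \<star> X)"
  using pull2_idN_eq FunD(2,3)[OF pull_Fun[of u A B]] by simp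

lemma pull2_vcomp:
  assumes u: "u \<in> SFun A B" and a: "\<alpha> \<in> Nat u v" and b: "\<beta> \<in> Nat v w" and X: "X \<in> Ob (V B)"
  shows "cmp (pull2 D (vcomp \<beta> \<alpha>)) X = cmp (pull2 D \<beta>) X \<cdot>\<^bsub>V A\<^esub> cmp (pull2 D \<alpha>) X"
proof -
  have v: "v \<in> SFun A B" using NatD(1)[OF a SFunD(1)[OF u]] u by (simp add: SFun_def)
  have w: "w \<in> SFun A B" using NatD(1)[OF b SFunD(1)[OF v]] u by (simp add: SFun_def)
  have "pull2 D (vcomp \<beta> \<alpha>) = vcomp (pull2 D \<beta>) (pull2 D \<alpha>)"
    by (rule prederivator[unfolded prederivator_def, THEN conjunct2, THEN conjunct2, THEN conjunct2, THEN
      conjunct2, THEN conjunct2, THEN conjunct2, THEN conjunct1, rule_format, of A B u v w])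
      (use assms v w in \<open>simp add: SFun_def\<close>)
  then show ?thesis
    using vcomp_Nat(2)[OF pull2_Nat[OF u a] pull2_Nat[OF v b] pull_Fun[OF u] X] by simp
qed

lemma pull2_hcomp:
  assumes "u \<in> SFun A B" "\<alpha> \<in> Nat u u'" "v \<in> SFun B C" "\<beta> \<in> Nat v v'"
  shows "pull2 D (hcomp \<beta> \<alpha>) = hcomp (pull2 D \<alpha>) (pull2 D \<beta>)"
proof -
  have "u' \<in> SFun A B" "v' \<in> SFun B C"
    using NatD(1)[OF assms(2) SFunD(1)[OF assms(1)]] NatD(1)[OF assms(4) SFunD(1)[OF assms(3)]] assms
    by (simp_all add: SFun_def)
  then show ?thesis
    by (intro prederivator[unfolded prederivator_def, THEN conjunct2, THEN conjunct2, THEN conjunct2, THEN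
      conjunct2, THEN conjunct2, THEN conjunct2, THEN conjunct2, rule_format, of A B C u u' v v'])
      (use assms in \<open>simp add: SFun_def\<close>)
qed

text \<open>Since 1-cells are reversed, \<open>pull2\<close> exchanges the factors of
  \<open>hcomp\<close>: precomposition with \<open>k\<close> turns into an application of the
  functor \<open>pull D k\<close> to components.\<close>

lemma pull2_whisker_right:
  assumes k: "k \<in> SFun J A" and u: "u \<in> SFun A B" and a: "\<alpha> \<in> Nat u u'" and X: "X \<in> Ob (V B)"
  shows "cmp (pull2 D (hcomp \<alpha> (idN k))) X = k \<bullet> cmp (pull2 D \<alpha>) X"
proof -
  have u': "u' \<in> SFun A B" using NatD(1)[OF a SFunD(1)[OF u]] u by (simp add: SFun_def)
  have "cmp (pull2 D (hcomp \<alpha> (idN k))) X = Id (V J) (k \<star> u' \<star> X) \<cdot>\<^bsub>V J\<^esub> k \<bullet> cmp (pull2 D \<alpha>) X"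
    unfolding pull2_hcomp[OF k idN_Nat[OF SFunD(1)[OF k]] u a] pull2_idN_eq[OF k]
      hcomp_Nat(2)[OF pull2_Nat[OF u a] idN_Nat[OF pull_Fun[OF k]] pull_Fun[OF u] pull_Fun[OF k] X]
    using FunD[OF pull_Fun[OF k]] star_Ob[OF u' X] by simp
  then show ?thesis
    using Id_comp[OF V_category bullet_hom[OF k pull2_hom[OF u a X]]] SFunD[OF k] by simp
qed

text \<open>The other half of the exchange: postcomposition with \<open>v\<close> leaves the pulled
  2-cell alone and evaluates it at a restricted object.\<close>

lemma pull2_whisker_left:
  assumes u: "u \<in> SFun A B" and a: "\<alpha> \<in> Nat u u'" and v: "v \<in> SFun B C" and X: "X \<in> Ob (V C)"
  shows "cmp (pull2 D (hcomp (idN v) \<alpha>)) X = cmp (pull2 D \<alpha>) (v \<star> X)"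
proof -
  note vX = star_Ob[OF v X]
  have "cmp (pull2 D (hcomp (idN v) \<alpha>)) X = cmp (pull2 D \<alpha>) (v \<star> X) \<cdot>\<^bsub>V A\<^esub> u \<bullet> Id (V B) (v \<star> X)"
    unfolding pull2_hcomp[OF u a v idN_Nat[OF SFunD(1)[OF v]]] pull2_idN_eq[OF v]
      hcomp_Nat(2)[OF idN_Nat[OF pull_Fun[OF v]] pull2_Nat[OF u a] pull_Fun[OF v] pull_Fun[OF u] X]
    using FunD[OF pull_Fun[OF v]] X by simp
  then show ?thesis
    using comp_Id[OF V_category pull2_hom[OF u a vX]] SFunD[OF u] bullet_Id[OF u vX] by simp
qed

section \<open>Exact squares\<close>

text \<open>
  Provided that left Kan extensions exist, this says that the mate of the square is invertible. Universal
  arrows instead of chosen left adjoints make the pasting of squares immediate.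
\<close>

definition exact :: "'u sfunc \<Rightarrow> 'u sfunc \<Rightarrow> 'u sfunc \<Rightarrow> 'u sfunc \<Rightarrow> 'u snat \<Rightarrow> bool" where
  "exact p q u v \<alpha> \<longleftrightarrow> (\<forall>X \<in> Ob (V (FSrc u)). \<forall>Z e. universal (pull D u) X Z e \<longrightarrow>
     universal (pull D q) (p \<star> X) (v \<star> Z) (cmp (pull2 D \<alpha>) Z \<cdot>\<^bsub>V (FSrc p)\<^esub> p \<bullet> e))"

lemma exactD:
  assumes "exact p q u v \<alpha>" "p \<in> SFun S A" "u \<in> SFun A B" "X \<in> Ob (V A)" "universal (pull D u) X Z e"
  shows "universal (pull D q) (p \<star> X) (v \<star> Z) (cmp (pull2 D \<alpha>) Z \<cdot>\<^bsub>V S\<^esub> p \<bullet> e)"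
  using assms FunD(2)[OF SFunD(1)[OF assms(2)]] FunD(2)[OF SFunD(1)[OF assms(3)]]
  by (simp add: exact_def)

text \<open>A universal arrow for \<open>u\<close> is carried by the first square to one for
  \<open>q\<close>, and by the second to one for \<open>q'\<close>. The hypothesis on \<gamma> only
  asks that it pull back to the pasted 2-cell componentwise, so \<gamma> may be presented in any
  convenient form.\<close>

lemma exact_paste:
  assumes 1: "exact p q u v \<alpha>" and 2: "exact p' q' q v' \<alpha>'"
    and p: "p \<in> SFun S A" and q: "q \<in> SFun S T" and u: "u \<in> SFun A B" and v: "v \<in> SFun T B"
    and a: "\<alpha> \<in> Nat (u \<odot> p) (v \<odot> q)"
    and p': "p' \<in> SFun S' S" and q': "q' \<in> SFun S' T'" and v': "v' \<in> SFun T' T"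
    and a': "\<alpha>' \<in> Nat (q \<odot> p') (v' \<odot> q')"
    and g: "\<And>Z. Z \<in> Ob (V B) \<Longrightarrow>
      cmp (pull2 D \<gamma>) Z = cmp (pull2 D \<alpha>') (v \<star> Z) \<cdot>\<^bsub>V S'\<^esub> p' \<bullet> cmp (pull2 D \<alpha>) Z"
  shows "exact (p \<odot> p') q' u (v \<odot> v') \<gamma>"
  unfolding exact_def
proof (intro ballI allI impI)
  fix X Z e assume X: "X \<in> Ob (V (FSrc u))" and un: "universal (pull D u) X Z e"
  have X: "X \<in> Ob (V A)" using X FunD(2)[OF SFunD(1)[OF u]] by simp
  note Z = universalD[OF un pull_Fun[OF u]]
  note C = V_category[OF SFunD(2)[OF p']]
  note vZ = star_Ob[OF v Z(1)]
  note aZ = pull2_hom[OF SFun_comp[OF p u] a Z(1), unfolded star_compF[OF p u Z(1)] star_compF[OF q v Z(1)]]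
  note aZ' = pull2_hom[OF SFun_comp[OF p' q] a' vZ, unfolded star_compF[OF p' q vZ] star_compF[OF q' v' vZ]]
  note pe = bullet_hom[OF p Z(2)]
  have "universal (pull D q') (p' \<star> p \<star> X) (v' \<star> v \<star> Z)
      (cmp (pull2 D \<alpha>') (v \<star> Z) \<cdot>\<^bsub>V S'\<^esub> p' \<bullet> (cmp (pull2 D \<alpha>) Z \<cdot>\<^bsub>V S\<^esub> p \<bullet> e))"
    by (rule exactD[OF 2 p' q star_Ob[OF p X] exactD[OF 1 p u X un]])
  moreover have "cmp (pull2 D \<alpha>') (v \<star> Z) \<cdot>\<^bsub>V S'\<^esub> p' \<bullet> (cmp (pull2 D \<alpha>) Z \<cdot>\<^bsub>V S\<^esub> p \<bullet> e) =
      cmp (pull2 D \<gamma>) Z \<cdot>\<^bsub>V S'\<^esub> (p \<odot> p') \<bullet> e"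
    using bullet_comp[OF p' pe aZ] comp_assoc[OF C bullet_hom[OF p' pe] bullet_hom[OF p' aZ] aZ']
      bullet_compF[OF p' p Z(2)] g[OF Z(1)] by simp
  ultimately show "universal (pull D q') ((p \<odot> p') \<star> X) ((v \<odot> v') \<star> Z)
      (cmp (pull2 D \<gamma>) Z \<cdot>\<^bsub>V (FSrc (p \<odot> p'))\<^esub> (p \<odot> p') \<bullet> e)"
    using star_compF[OF p' p X] star_compF[OF v' v Z(1)] FunD(2)[OF SFunD(1)[OF p']] by simp
qed

text \<open>Right adjoints are homotopy final. A map from \<open>K \<star> X\<close> to a constant
  diagram corresponds, under the adjunction between the two restriction functors, to a map from
  \<open>X\<close> to the restriction along \<open>L\<close> of that constant diagram, which is
  again constant. So a universal map from \<open>X\<close> to a constant diagram restricts along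
  \<open>K\<close> to a universal one.\<close>

lemma right_adjoint_exact:
  assumes K: "K \<in> SFun J S" and adj: "adjunction L K \<eta> \<epsilon>"
  shows "exact K (to_one J) (to_one S) (idF one_cat) (idN (to_one J))"
  unfolding exact_def
proof (intro ballI allI impI)
  note J = SFunD(2)[OF K] and S = SFunD(3)[OF K]
  note VJ = V_category[OF J] and VS = V_category[OF S] and V1 = V_category[OF small_one_cat]
  note tJ = SFun_to_one[OF J] and tS = SFun_to_one[OF S]
  note fK = FunD(2,3)[OF SFunD(1)[OF K]]
  have L: "L \<in> SFun S J"
    using adj SFunI[OF S J] by (simp add: adjunction_def fK)
  have \<eta>: "\<eta> \<in> Nat (idF S) (K \<odot> L)" and \<epsilon>: "\<epsilon> \<in> Nat (L \<odot> K) (idF J)"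
    using adj FunD(2)[OF SFunD(1)[OF L]] by (auto simp: adjunction_def fK)
  have tri: "onAr K (cmp \<epsilon> y) \<cdot>\<^bsub>S\<^esub> cmp \<eta> (onOb K y) = Id S (onOb K y)" if "y \<in> Ob J" for y
    using adj that FunD(3)[OF SFunD(1)[OF L]] by (simp add: adjunction_def fK)
  have KL: "K \<odot> L \<in> SFun S S" and LK: "L \<odot> K \<in> SFun J J" using SFun_comp K L by blast+
  \<comment> \<open>By terminality these are equalities, so constant diagrams restrict to constant
    diagrams on the nose.\<close>
  have tK: "to_one S \<odot> K = to_one J" and tL: "to_one J \<odot> L = to_one S"
    using to_one_unique[OF SFunD(1)[OF SFun_comp[OF K tS]]] to_one_unique[OF SFunD(1)[OF SFun_comp[OF L tJ]]]
      by auto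
  fix X Z e assume "X \<in> Ob (V (FSrc (to_one S)))" and un: "universal (pull D (to_one S)) X Z e"
  then have X: "X \<in> Ob (V S)" by (simp add: to_one_def)
  note Z = universalD[OF un pull_Fun[OF tS]]
  note KX = star_Ob[OF K X]
  have e: "e \<in> hom (V S) X (to_one S \<star> Z)" using Z by simp
  have KtS: "K \<star> to_one S \<star> Y = to_one J \<star> Y" if "Y \<in> Ob (V one_cat)" for Y
    using star_compF[OF K tS that] tK by simp
  have LtJ: "L \<star> to_one J \<star> Y = to_one S \<star> Y" if "Y \<in> Ob (V one_cat)" for Y
    using star_compF[OF L tJ that] tL by simp
  have KtSA: "K \<bullet> to_one S \<bullet> h = to_one J \<bullet> h" if "h \<in> hom (V one_cat) Y Y'" for Y Y' h
    using bullet_compF[OF K tS that] tK by simp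
  have idS: "idF S \<in> SFun S S" and idJ: "idF J \<in> SFun J J" using SFun_idF S J by auto
  let ?e = "\<lambda>X. cmp (pull2 D \<eta>) X" and ?c = "\<lambda>X. cmp (pull2 D \<epsilon>) X"
  have eh: "?e W \<in> hom (V S) W (L \<star> K \<star> W)" if "W \<in> Ob (V S)" for W
    using pull2_hom[OF idS \<eta> that] star_idF[OF S that] star_compF[OF L K that] by simp
  have ch: "?c W \<in> hom (V J) (K \<star> L \<star> W) W" if "W \<in> Ob (V J)" for W
    using pull2_hom[OF LK \<epsilon> that] star_idF[OF J that] star_compF[OF K L that] by simp
  have en: "L \<bullet> K \<bullet> f \<cdot>\<^bsub>V S\<^esub> ?e W = ?e W' \<cdot>\<^bsub>V S\<^esub> f" if "f \<in> hom (V S) W W'" for f W W'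
    using pull2_natural[OF idS \<eta> that] bullet_idF[OF S that] bullet_compF[OF L K that] by simp
  have cn: "f \<cdot>\<^bsub>V J\<^esub> ?c W = ?c W' \<cdot>\<^bsub>V J\<^esub> K \<bullet> L \<bullet> f" if "f \<in> hom (V J) W W'" for f W W'
    using pull2_natural[OF LK \<epsilon> that] bullet_idF[OF J that] bullet_compF[OF K L that] by simp
  \<comment> \<open>On a constant diagram the pulled back unit is the pull of a 2-cell into
    \<open>one_cat\<close>, hence an identity. The same holds for the counit.\<close>
  have et: "?e (to_one S \<star> Y) = Id (V S) (to_one S \<star> Y)" if Y: "Y \<in> Ob (V one_cat)" for Y
  proof -
    have "hcomp (idN (to_one S)) \<eta> \<in> Nat (to_one S \<odot> idF S) (to_one S \<odot> (K \<odot> L))"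
      by (rule hcomp_Nat(1)[OF \<eta> idN_Nat[OF SFunD(1)[OF tS]] SFunD(1)[OF idS] SFunD(1)[OF tS]])
    then have "hcomp (idN (to_one S)) \<eta> = idN (to_one S)"
      by (rule Nat_one_unique[OF SFunD(1)[OF SFun_comp[OF idS tS]]])
    then show ?thesis
      using pull2_whisker_left[OF idS \<eta> tS Y] pull2_idN[OF tS Y] by simp
  qed
  have ct: "?c (to_one J \<star> Y) = Id (V J) (to_one J \<star> Y)" if Y: "Y \<in> Ob (V one_cat)" for Y
  proof -
    have "hcomp (idN (to_one J)) \<epsilon> \<in> Nat (to_one J \<odot> (L \<odot> K)) (to_one J \<odot> idF J)"
      by (rule hcomp_Nat(1)[OF \<epsilon> idN_Nat[OF SFunD(1)[OF tJ]] SFunD(1)[OF LK] SFunD(1)[OF tJ]])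
    then have "hcomp (idN (to_one J)) \<epsilon> = idN (to_one J)"
      by (rule Nat_one_unique[OF SFunD(1)[OF SFun_comp[OF LK tJ]]])
    then show ?thesis
      using pull2_whisker_left[OF LK \<epsilon> tJ Y] pull2_idN[OF tJ Y] by simp
  qed
  \<comment> \<open>The triangle identity of the adjunction at \<open>K\<close> is first stated as
    an equation of 2-cells and then sent through \<open>pull2\<close>.\<close>
  have triX: "?c (K \<star> X) \<cdot>\<^bsub>V J\<^esub> K \<bullet> ?e X = Id (V J) (K \<star> X)"
  proof -
    have a: "hcomp \<eta> (idN K) \<in> Nat (idF S \<odot> K) ((K \<odot> L) \<odot> K)"
      by (rule hcomp_Nat(1)[OF idN_Nat[OF SFunD(1)[OF K]] \<eta> SFunD(1)[OF K] SFunD(1)[OF idS]])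
    have b: "hcomp (idN K) \<epsilon> \<in> Nat (K \<odot> (L \<odot> K)) (K \<odot> idF J)"
      by (rule hcomp_Nat(1)[OF \<epsilon> idN_Nat[OF SFunD(1)[OF K]] SFunD(1)[OF LK] SFunD(1)[OF K]])
    have as: "K \<odot> (L \<odot> K) = (K \<odot> L) \<odot> K"
      using compF_assoc SFunD(1) K L by blast
    have i: "idF S \<odot> K = K" "K \<odot> idF J = K" using SFunD(1)[OF K] by simp_all
    note a = a[unfolded i] and b = b[unfolded i as]
    have "vcomp (hcomp (idN K) \<epsilon>) (hcomp \<eta> (idN K)) = idN K"
    proof (rule Nat_eqI[OF vcomp_Nat(1)[OF a b SFunD(1)[OF K]] idN_Nat[OF SFunD(1)[OF K]] SFunD(1)[OF K]])
      fix x assume x: "x \<in> Ob J"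
      show "cmp (vcomp (hcomp (idN K) \<epsilon>) (hcomp \<eta> (idN K))) x = cmp (idN K) x"
        using vcomp_Nat(2)[OF a b SFunD(1)[OF K] x] tri[OF x] fK x whisker_left(2)[OF SFunD(1)[OF LK] \<epsilon>
          SFunD(1)[OF K] x]
          whisker_right(2)[OF SFunD(1)[OF K] SFunD(1)[OF idS] \<eta> x] by simp
    qed
    then show ?thesis
      using pull2_vcomp[OF K a b X] pull2_idN[OF K X]
        pull2_whisker_right[OF K idS \<eta> X] pull2_whisker_left[OF LK \<epsilon> K X] by simp
  qed
  have "universal (pull D (to_one J)) (K \<star> X) Z (K \<bullet> e)"
  proof (rule universalI[OF pull_Fun[OF tJ] Z(1)])
    show "K \<bullet> e \<in> hom (V J) (K \<star> X) (to_one J \<star> Z)"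
      using bullet_hom[OF K e] KtS[OF Z(1)] by simp
  next
    fix Y g assume Y: "Y \<in> Ob (V one_cat)" and g: "g \<in> hom (V J) (K \<star> X) (to_one J \<star> Y)"
    \<comment> \<open>To factor \<open>g\<close>, it is transposed to a map out of \<open>X\<close>
      by restriction along \<open>L\<close> and the unit; the universal arrow \<open>e\<close> then
      provides \<open>h\<close>.\<close>
    have Lg: "L \<bullet> g \<in> hom (V S) (L \<star> K \<star> X) (to_one S \<star> Y)" using bullet_hom[OF L g] LtJ[OF Y] by simp
    obtain h where h: "h \<in> hom (V one_cat) Z Y" "to_one S \<bullet> h \<cdot>\<^bsub>V S\<^esub> e = L \<bullet> g \<cdot>\<^bsub>V S\<^esub> ?e X"
      using universal_ex[OF un pull_Fun[OF tS] Y comp_hom[OF VS eh[OF X] Lg]] by blast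
    have KLg: "K \<bullet> L \<bullet> g = g \<cdot>\<^bsub>V J\<^esub> ?c (K \<star> X)"
      using cn[OF g] ct[OF Y] Id_comp[OF VJ, of "K \<bullet> L \<bullet> g"] bullet_hom[OF K Lg] KtS[OF Y] by simp
    have Ke: "K \<bullet> ?e X \<in> hom (V J) (K \<star> X) (K \<star> L \<star> K \<star> X)" using bullet_hom[OF K eh[OF X]] .
    have "to_one J \<bullet> h \<cdot>\<^bsub>V J\<^esub> K \<bullet> e = K \<bullet> (to_one S \<bullet> h \<cdot>\<^bsub>V S\<^esub> e)"
      using bullet_comp[OF K e bullet_hom[OF tS h(1)]] KtSA[OF h(1)] by simp
    also have "\<dots> = (g \<cdot>\<^bsub>V J\<^esub> ?c (K \<star> X)) \<cdot>\<^bsub>V J\<^esub> K \<bullet> ?e X"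
      using h(2) bullet_comp[OF K eh[OF X] Lg] KLg by simp
    also have "\<dots> = g"
      using comp_assoc[OF VJ Ke ch[OF KX] g] triX comp_Id[OF VJ g] by simp
    finally show "\<exists>h\<in>hom (V one_cat) Z Y. to_one J \<bullet> h \<cdot>\<^bsub>V J\<^esub> K \<bullet> e = g" using h(1) by blast
  next
    fix Y h h' assume h: "h \<in> hom (V one_cat) Z Y" "h' \<in> hom (V one_cat) Z Y"
      and eq: "to_one J \<bullet> h \<cdot>\<^bsub>V J\<^esub> K \<bullet> e = to_one J \<bullet> h' \<cdot>\<^bsub>V J\<^esub> K \<bullet> e"
    have Y: "Y \<in> Ob (V one_cat)" using hom_Ob[OF V1 h(1)] by simp
    \<comment> \<open>A map from \<open>X\<close> to a constant diagram is determined by its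
      restriction along \<open>K\<close>, because the unit is an identity on the constant
      diagram.\<close>
    have recover: "f = L \<bullet> K \<bullet> f \<cdot>\<^bsub>V S\<^esub> ?e X" if "f \<in> hom (V S) X (to_one S \<star> Y)" for f
      using en[OF that] et[OF Y] Id_comp[OF VS that] by simp
    have th: "to_one S \<bullet> k \<cdot>\<^bsub>V S\<^esub> e \<in> hom (V S) X (to_one S \<star> Y)" if "k \<in> hom (V one_cat) Z Y" for k
      using comp_hom[OF VS e bullet_hom[OF tS that]] .
    have "K \<bullet> (to_one S \<bullet> h \<cdot>\<^bsub>V S\<^esub> e) = K \<bullet> (to_one S \<bullet> h' \<cdot>\<^bsub>V S\<^esub> e)"
      using bullet_comp[OF K e bullet_hom[OF tS h(1)]] bullet_comp[OF K e bullet_hom[OF tS h(2)]]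
        KtSA[OF h(1)] KtSA[OF h(2)] eq by simp
    then have "to_one S \<bullet> h \<cdot>\<^bsub>V S\<^esub> e = to_one S \<bullet> h' \<cdot>\<^bsub>V S\<^esub> e"
      using recover[OF th[OF h(1)]] recover[OF th[OF h(2)]] by simp
    then show "h = h'" by (rule universal_eq[OF un pull_Fun[OF tS] h])
  qed
  moreover have "cmp (pull2 D (idN (to_one J))) Z \<cdot>\<^bsub>V J\<^esub> K \<bullet> e = K \<bullet> e"
    using pull2_idN[OF tJ Z(1)] Id_comp[OF VJ, of "K \<bullet> e"] bullet_hom[OF K e] KtS[OF Z(1)] by simp
  ultimately show "universal (pull D (to_one J)) (K \<star> X) (idF one_cat \<star> Z)
      (cmp (pull2 D (idN (to_one J))) Z \<cdot>\<^bsub>V (FSrc K)\<^esub> K \<bullet> e)"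
    using star_idF[OF small_one_cat Z(1)] fK by simp
qed

end

section \<open>Derivators and mates\<close>

locale derivator_on = prederivator_on D for D :: "('u::universe, 'o, 'm) prederiv" +
  assumes derivator: "derivator D"
begin

lemma Der2: "Der2 D" and Der3: "Der3 D" and Der4: "Der4 D"
  using derivator by (auto simp: derivator_def)

text \<open>Der3 says that the predicate under \<open>SOME\<close> in \<open>lan_data\<close> is
  satisfiable, so the arbitrary choice is an adjunction.\<close>

lemma lan_adjunction:
  assumes "u \<in> SFun A B"
  shows "adjunction (lan D u) (pull D u) (lan_unit D u) (lan_counit D u)"
proof -
  have "\<exists>L \<eta> \<epsilon>. adjunction L (pull D u) \<eta> \<epsilon>"
    using Der3 assms unfolding Der3_def SFun_def by blast
  then have "\<exists>t. case t of (L, \<eta>, \<epsilon>) \<Rightarrow> adjunction L (pull D u) \<eta> \<epsilon>" by auto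
  then have "case lan_data D u of (L, \<eta>, \<epsilon>) \<Rightarrow> adjunction L (pull D u) \<eta> \<epsilon>"
    unfolding lan_data_def by (rule someI_ex)
  then show ?thesis by (simp add: lan_def lan_unit_def lan_counit_def case_prod_beta)
qed

abbreviation lan_Ob :: "'u sfunc \<Rightarrow> 'o \<Rightarrow> 'o" where "lan_Ob u X \<equiv> onOb (lan D u) X"
abbreviation lan_Ar :: "'u sfunc \<Rightarrow> 'm \<Rightarrow> 'm" where "lan_Ar u f \<equiv> onAr (lan D u) f"
abbreviation unit :: "'u sfunc \<Rightarrow> 'o \<Rightarrow> 'm" where "unit u X \<equiv> cmp (lan_unit D u) X"
abbreviation counit :: "'u sfunc \<Rightarrow> 'o \<Rightarrow> 'm" where "counit u Y \<equiv> cmp (lan_counit D u) Y"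

lemma lan_Fun: "u \<in> SFun A B \<Longrightarrow> lan D u \<in> Fun (V A) (V B)"
  using lan_adjunction[of u A B] FunD(2,3)[OF pull_Fun[of u A B]] by (simp add: adjunction_def)

lemma lan_Ob: "u \<in> SFun A B \<Longrightarrow> X \<in> Ob (V A) \<Longrightarrow> lan_Ob u X \<in> Ob (V B)"
  by (rule Fun_Ob[OF lan_Fun])

lemma lan_hom: "u \<in> SFun A B \<Longrightarrow> f \<in> hom (V A) X Y \<Longrightarrow> lan_Ar u f \<in> hom (V B) (lan_Ob u X) (lan_Ob u Y)"
  by (rule Fun_hom[OF lan_Fun])

lemma unit_Nat: "u \<in> SFun A B \<Longrightarrow> lan_unit D u \<in> Nat (idF (V A)) (pull D u \<odot> lan D u)"
  using lan_adjunction[of u A B] FunD(2,3)[OF lan_Fun[of u A B]] by (simp add: adjunction_def)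

lemma counit_Nat: "u \<in> SFun A B \<Longrightarrow> lan_counit D u \<in> Nat (lan D u \<odot> pull D u) (idF (V B))"
  using lan_adjunction[of u A B] FunD(2,3)[OF pull_Fun[of u A B]] by (simp add: adjunction_def)

lemma unit_hom:
  assumes u: "u \<in> SFun A B" and X: "X \<in> Ob (V A)"
  shows "unit u X \<in> hom (V A) X (u \<star> lan_Ob u X)"
  using Nat_hom[OF unit_Nat[OF u] idF_Fun[OF V_category[OF SFunD(2)[OF u]]] X] X
  by (simp add: compF_Ob[OF lan_Fun[OF u]])

lemma unit_natural:
  assumes u: "u \<in> SFun A B" and f: "f \<in> hom (V A) X Y"
  shows "u \<bullet> lan_Ar u f \<cdot>\<^bsub>V A\<^esub> unit u X = unit u Y \<cdot>\<^bsub>V A\<^esub> f"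
  using Nat_natural[OF unit_Nat[OF u] idF_Fun[OF V_category[OF SFunD(2)[OF u]]] f] f
  by (simp add: compF_Ar[OF lan_Fun[OF u]] hom_Ar)

lemma counit_hom:
  assumes u: "u \<in> SFun A B" and Y: "Y \<in> Ob (V B)"
  shows "counit u Y \<in> hom (V B) (lan_Ob u (u \<star> Y)) Y"
  using Nat_hom[OF counit_Nat[OF u] compF_Fun[OF pull_Fun[OF u] lan_Fun[OF u]] Y] Y
  by (simp add: compF_Ob[OF pull_Fun[OF u]])

lemma counit_unit:
  assumes u: "u \<in> SFun A B" and Y: "Y \<in> Ob (V B)"
  shows "u \<bullet> counit u Y \<cdot>\<^bsub>V A\<^esub> unit u (u \<star> Y) = Id (V A) (u \<star> Y)"
  using lan_adjunction[OF u] FunD(2,3)[OF pull_Fun[OF u]] Y by (simp add: adjunction_def)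

lemma lan_universal: "u \<in> SFun A B \<Longrightarrow> X \<in> Ob (V A) \<Longrightarrow> universal (pull D u) X (lan_Ob u X) (unit u X)"
  by (rule adjunction_universal[OF lan_adjunction]) (simp_all add: FunD(3)[OF pull_Fun[of u A B]])

text \<open>Uniqueness in the universal property of the unit. The coherence identities for mates and
  transposed mates are reduced by it to equations between restrictions, where units and 2-cells can
  be moved freely.\<close>

lemma lan_ext:
  assumes u: "u \<in> SFun A B" and X: "X \<in> Ob (V A)"
    and h: "h \<in> hom (V B) (lan_Ob u X) Y" "h' \<in> hom (V B) (lan_Ob u X) Y"
    and "u \<bullet> h \<cdot>\<^bsub>V A\<^esub> unit u X = u \<bullet> h' \<cdot>\<^bsub>V A\<^esub> unit u X"
  shows "h = h'"
  by (rule universal_eq[OF lan_universal[OF u X] pull_Fun[OF u] h]) fact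

text \<open>Naturality of the unit moves it past \<open>g\<close>, where it meets the counit and
  cancels by the triangle identity.\<close>

lemma transpose:
  assumes u: "u \<in> SFun A B" and Y: "Y \<in> Ob (V B)" and g: "g \<in> hom (V A) X (u \<star> Y)"
  shows "counit u Y \<cdot>\<^bsub>V B\<^esub> lan_Ar u g \<in> hom (V B) (lan_Ob u X) Y"
    and "u \<bullet> (counit u Y \<cdot>\<^bsub>V B\<^esub> lan_Ar u g) \<cdot>\<^bsub>V A\<^esub> unit u X = g"
proof -
  note VA = V_category[OF SFunD(2)[OF u]] and VB = V_category[OF SFunD(3)[OF u]]
  have X: "X \<in> Ob (V A)" using hom_Ob[OF VA g] by simp
  note c = counit_hom[OF u Y] and l = lan_hom[OF u g]
  show "counit u Y \<cdot>\<^bsub>V B\<^esub> lan_Ar u g \<in> hom (V B) (lan_Ob u X) Y" by (rule comp_hom[OF VB l c])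
  show "u \<bullet> (counit u Y \<cdot>\<^bsub>V B\<^esub> lan_Ar u g) \<cdot>\<^bsub>V A\<^esub> unit u X = g"
    using bullet_comp[OF u l c] comp_assoc[OF VA unit_hom[OF u X] bullet_hom[OF u l] bullet_hom[OF u c]]
      unit_natural[OF u g] comp_assoc[OF VA g unit_hom[OF u star_Ob[OF u Y]] bullet_hom[OF u c]]
      counit_unit[OF u Y] Id_comp[OF VA g] by simp
qed

section \<open>Mates, and exactness as invertibility of the mate\<close>

lemma mate_cmp:
  assumes "p \<in> SFun S A" "q \<in> SFun S T" "u \<in> SFun A B" "X \<in> Ob (V A)"
  shows "cmp (mate D p q u v \<alpha>) X = counit q (v \<star> lan_Ob u X) \<cdot>\<^bsub>V T\<^esub>
    lan_Ar q (cmp (pull2 D \<alpha>) (lan_Ob u X) \<cdot>\<^bsub>V S\<^esub> p \<bullet> unit u X)"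
  using assms FunD(2,3)[OF SFunD(1)[OF assms(2)]] FunD(2)[OF SFunD(1)[OF assms(3)]] by (simp add: mate_def)

text \<open>The defining formula of a mate is a transpose in the sense of \<open>transpose\<close>.
  Mates are handled through the resulting equation with the unit instead of the formula with the
  counit.\<close>

lemma mate_transpose:
  assumes p: "p \<in> SFun S A" and q: "q \<in> SFun S T" and u: "u \<in> SFun A B" and v: "v \<in> SFun T B"
    and a: "\<alpha> \<in> Nat (u \<odot> p) (v \<odot> q)" and X: "X \<in> Ob (V A)"
  shows mate_hom: "cmp (mate D p q u v \<alpha>) X \<in> hom (V T) (lan_Ob q (p \<star> X)) (v \<star> lan_Ob u X)"
    and mate_unit: "q \<bullet> cmp (mate D p q u v \<alpha>) X \<cdot>\<^bsub>V S\<^esub> unit q (p \<star> X) =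
      cmp (pull2 D \<alpha>) (lan_Ob u X) \<cdot>\<^bsub>V S\<^esub> p \<bullet> unit u X"
proof -
  note l = lan_Ob[OF u X]
  note h = comp_hom[OF V_category[OF SFunD(2)[OF p]] bullet_hom[OF p unit_hom[OF u X]]
      pull2_hom[OF SFun_comp[OF p u] a l, unfolded star_compF[OF p u l] star_compF[OF q v l]]]
  show "cmp (mate D p q u v \<alpha>) X \<in> hom (V T) (lan_Ob q (p \<star> X)) (v \<star> lan_Ob u X)"
    "q \<bullet> cmp (mate D p q u v \<alpha>) X \<cdot>\<^bsub>V S\<^esub> unit q (p \<star> X) = cmp (pull2 D \<alpha>) (lan_Ob u X) \<cdot>\<^bsub>V S\<^esub> p \<bullet> unit u X"
    unfolding mate_cmp[OF p q u X] using transpose[OF q star_Ob[OF v l] h] .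
qed

text \<open>The mate is the comparison map between the universal arrow obtained from the chosen Kan
  extension along \<open>u\<close> and the chosen one along \<open>q\<close>. Testing the chosen
  arrow suffices, since any other differs from it by an isomorphism.\<close>

lemma exact_iff_mate:
  assumes p: "p \<in> SFun S A" and q: "q \<in> SFun S T" and u: "u \<in> SFun A B" and v: "v \<in> SFun T B"
    and a: "\<alpha> \<in> Nat (u \<odot> p) (v \<odot> q)"
  shows "exact p q u v \<alpha> \<longleftrightarrow> (\<forall>X \<in> Ob (V A). isomorphism (V T) (cmp (mate D p q u v \<alpha>) X))"
proof
  assume e: "exact p q u v \<alpha>"
  show "\<forall>X \<in> Ob (V A). isomorphism (V T) (cmp (mate D p q u v \<alpha>) X)"
  proof
    fix X assume X: "X \<in> Ob (V A)"
    show "isomorphism (V T) (cmp (mate D p q u v \<alpha>) X)"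
      by (rule universal_iso[OF lan_universal[OF q star_Ob[OF p X]] exactD[OF e p u X lan_universal[OF u X]]
        pull_Fun[OF q] mate_transpose[OF p q u v a X]])
  qed
next
  assume iso: "\<forall>X \<in> Ob (V A). isomorphism (V T) (cmp (mate D p q u v \<alpha>) X)"
  show "exact p q u v \<alpha>"
    unfolding exact_def FunD(2)[OF SFunD(1)[OF p]] FunD(2)[OF SFunD(1)[OF u]]
  proof (intro ballI allI impI)
    fix X Z e assume X: "X \<in> Ob (V A)" and un: "universal (pull D u) X Z e"
    note VS = V_category[OF SFunD(2)[OF p]]
    note Z = universalD[OF un pull_Fun[OF u]] and l = lan_Ob[OF u X]
    \<comment> \<open>The comparison of the chosen Kan extension with the given universal object. It
      is invertible, hence so is its restriction along \<open>v\<close>, and universality is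
      transported along the latter.\<close>
    obtain k where k: "k \<in> hom (V B) (lan_Ob u X) Z" "u \<bullet> k \<cdot>\<^bsub>V A\<^esub> unit u X = e"
      using universal_ex[OF lan_universal[OF u X] pull_Fun[OF u] Z] .
    have ki: "isomorphism (V B) k"
      by (rule universal_iso[OF lan_universal[OF u X] un pull_Fun[OF u] k])
    obtain k' where k': "k' \<in> hom (V B) Z (lan_Ob u X)" "k' \<cdot>\<^bsub>V B\<^esub> k = Id (V B) (lan_Ob u X)" "k \<cdot>\<^bsub>V B\<^esub> k' =
      Id (V B) Z"
      using isomorphismE[OF ki k(1)] .
    have vk: "isomorphism (V T) (v \<bullet> k)"
      using bullet_comp[OF v k(1) k'(1)] bullet_comp[OF v k'(1) k(1)] k' bullet_Id[OF v l] bullet_Id[OF v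
        Z(1)]
      by (intro isomorphismI[OF bullet_hom[OF v k(1)] bullet_hom[OF v k'(1)]]) simp_all
    let ?m = "cmp (mate D p q u v \<alpha>) X"
    note m = mate_transpose[OF p q u v a X]
    have "universal (pull D q) (p \<star> X) (v \<star> lan_Ob u X) (q \<bullet> ?m \<cdot>\<^bsub>V S\<^esub> unit q (p \<star> X))"
      using iso X by (intro universal_along_iso[OF lan_universal[OF q star_Ob[OF p X]] pull_Fun[OF q] m(1)])
        blast
    from universal_along_iso[OF this[unfolded m(2)] pull_Fun[OF q] bullet_hom[OF v k(1)] vk]
    have "universal (pull D q) (p \<star> X) (v \<star> Z)
      (q \<bullet> v \<bullet> k \<cdot>\<^bsub>V S\<^esub> (cmp (pull2 D \<alpha>) (lan_Ob u X) \<cdot>\<^bsub>V S\<^esub> p \<bullet> unit u X))" .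
    moreover have "q \<bullet> v \<bullet> k \<cdot>\<^bsub>V S\<^esub> (cmp (pull2 D \<alpha>) (lan_Ob u X) \<cdot>\<^bsub>V S\<^esub> p \<bullet> unit u X) =
        cmp (pull2 D \<alpha>) Z \<cdot>\<^bsub>V S\<^esub> p \<bullet> e"
    proof -
      note up = SFun_comp[OF p u]
      note al = pull2_hom[OF up a l, unfolded star_compF[OF p u l] star_compF[OF q v l]]
      note aZ = pull2_hom[OF up a Z(1), unfolded star_compF[OF p u Z(1)] star_compF[OF q v Z(1)]]
      note pun = bullet_hom[OF p unit_hom[OF u X]]
      note pk = bullet_hom[OF p bullet_hom[OF u k(1)]]
      have "q \<bullet> v \<bullet> k \<cdot>\<^bsub>V S\<^esub> (cmp (pull2 D \<alpha>) (lan_Ob u X) \<cdot>\<^bsub>V S\<^esub> p \<bullet> unit u X) =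
          (cmp (pull2 D \<alpha>) Z \<cdot>\<^bsub>V S\<^esub> p \<bullet> u \<bullet> k) \<cdot>\<^bsub>V S\<^esub> p \<bullet> unit u X"
        using comp_assoc[OF VS pun al bullet_hom[OF q bullet_hom[OF v k(1)]]] pull2_natural[OF up a k(1)]
          bullet_compF[OF p u k(1)] bullet_compF[OF q v k(1)] by simp
      also have "\<dots> = cmp (pull2 D \<alpha>) Z \<cdot>\<^bsub>V S\<^esub> p \<bullet> e"
        using comp_assoc[OF VS pun pk aZ] bullet_comp[OF p unit_hom[OF u X] bullet_hom[OF u k(1)]] k(2) by
          simp
      finally show ?thesis .
    qed
    ultimately show "universal (pull D q) (p \<star> X) (v \<star> Z) (cmp (pull2 D \<alpha>) Z \<cdot>\<^bsub>V S\<^esub> p \<bullet> e)" by simp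
  qed
qed

end

text \<open>
  This amounts to saying that the functor \<open>J \<rightarrow> u/b\<close> induced by \<open>\<kappa>: u k \<Rightarrow> b\<close> has a left adjoint,
  so that \<open>\<kappa>\<close> computes the value of \<open>u\<^sub>!\<close> at \<open>b\<close> as a colimit over \<open>J\<close>.
\<close>

definition final_at :: "'u::universe sfunc \<Rightarrow> 'u \<Rightarrow> 'u sfunc \<Rightarrow> ('u \<Rightarrow> 'u) \<Rightarrow> bool" where
  "final_at u b k \<kappa> \<longleftrightarrow> (\<forall>a \<in> Ob (FSrc u). \<forall>h \<in> hom (FTgt u) (onOb u a) b.
     \<exists>j \<in> Ob (FSrc k). \<exists>g \<in> hom (FSrc u) a (onOb k j). \<kappa> j \<cdot>\<^bsub>FTgt u\<^esub> onAr u g = h \<and>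
       (\<forall>j' \<in> Ob (FSrc k). \<forall>g' \<in> hom (FSrc u) a (onOb k j'). \<kappa> j' \<cdot>\<^bsub>FTgt u\<^esub> onAr u g' = h \<longrightarrow>
          (\<exists>!t. t \<in> hom (FSrc k) j j' \<and> onAr k t \<cdot>\<^bsub>FSrc u\<^esub> g = g')))"

lemma final_atI:
  assumes u: "u \<in> Fun A B" and k: "k \<in> Fun J A"
    and "\<And>a h. a \<in> Ob A \<Longrightarrow> h \<in> hom B (onOb u a) b \<Longrightarrow>
      \<exists>j \<in> Ob J. \<exists>g \<in> hom A a (onOb k j). \<kappa> j \<cdot>\<^bsub>B\<^esub> onAr u g = h \<and>
       (\<forall>j' \<in> Ob J. \<forall>g' \<in> hom A a (onOb k j'). \<kappa> j' \<cdot>\<^bsub>B\<^esub> onAr u g' = h \<longrightarrow>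
          (\<exists>!t. t \<in> hom J j j' \<and> onAr k t \<cdot>\<^bsub>A\<^esub> g = g'))"
  shows "final_at u b k \<kappa>"
  using assms(3) FunD[OF u] FunD[OF k] by (simp add: final_at_def)

lemma final_atE:
  assumes "final_at u b k \<kappa>" "u \<in> Fun A B" "k \<in> Fun J A" "a \<in> Ob A" "h \<in> hom B (onOb u a) b"
  obtains j g where "j \<in> Ob J" "g \<in> hom A a (onOb k j)" "\<kappa> j \<cdot>\<^bsub>B\<^esub> onAr u g = h"
    "\<And>j' g'. j' \<in> Ob J \<Longrightarrow> g' \<in> hom A a (onOb k j') \<Longrightarrow> \<kappa> j' \<cdot>\<^bsub>B\<^esub> onAr u g' = h \<Longrightarrow>
      \<exists>!t. t \<in> hom J j j' \<and> onAr k t \<cdot>\<^bsub>A\<^esub> g = g'"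
proof -
  have "\<exists>j \<in> Ob J. \<exists>g \<in> hom A a (onOb k j). \<kappa> j \<cdot>\<^bsub>B\<^esub> onAr u g = h \<and>
       (\<forall>j' \<in> Ob J. \<forall>g' \<in> hom A a (onOb k j'). \<kappa> j' \<cdot>\<^bsub>B\<^esub> onAr u g' = h \<longrightarrow>
          (\<exists>!t. t \<in> hom J j j' \<and> onAr k t \<cdot>\<^bsub>A\<^esub> g = g'))"
    using assms FunD(2,3)[OF assms(2)] FunD(2)[OF assms(3)] unfolding final_at_def by simp
  then show thesis using that by auto
qed

lemma final_at_cong:
  assumes "\<And>j. j \<in> Ob (FSrc k) \<Longrightarrow> \<kappa> j = \<kappa>' j"
  shows "final_at u b k \<kappa> \<longleftrightarrow> final_at u b k \<kappa>'"
  using assms by (simp add: final_at_def cong: ball_cong bex_cong)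

text \<open>\<open>K\<close> sends \<open>j\<close> to the object \<open>(k j, \<kappa> j)\<close>
  of the slice. What \<open>final_at\<close> provides for \<open>(a, h)\<close> is a universal arrow
  from this object to \<open>K\<close>, so the left adjoint exists by
  \<open>adjunction_from_universal\<close>; the slice projection and the slice cell recover
  \<open>k\<close> and \<kappa>.\<close>

lemma final_at_right_adjoint:
  assumes u: "u \<in> SFun A B" and b: "b \<in> Ob B" and k: "k \<in> SFun J A"
    and \<kappa>: "\<kappa> \<in> Nat (u \<odot> k) (const J B b)" and fin: "final_at u b k (cmp \<kappa>)"
  obtains K L \<eta> \<epsilon> where "K \<in> SFun J (slice_over u b)" "adjunction L K \<eta> \<epsilon>"
    "slice_over_proj u b \<odot> K = k" "hcomp (slice_over_cell u b) (idN K) = \<kappa>"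
proof -
  define S where "S = slice_over u b"
  note uF = SFunD(1)[OF u] and kF = SFunD(1)[OF k]
  note Ac = SFunD(4)[OF u] and Bc = SFunD(5)[OF u] and Jc = SFunD(4)[OF k]
  have Ss: "small_category S" using small_slice_over[OF SFunD(2,3,1)[OF u]] by (simp add: S_def)
  note Sc = small_categoryD(1)[OF Ss]
  note SO = Ob_slice_over[OF uF, of _ b, folded S_def] and Sh = hom_slice_over[OF uF, of _ b, folded S_def]
    and Scomp = comp_slice_over[OF uF, of b, folded S_def]
  have \<kappa>h: "cmp \<kappa> j \<in> hom B (onOb u (onOb k j)) b" if "j \<in> Ob J" for j
    using Nat_hom[OF \<kappa> compF_Fun[OF kF uF] that] that by (simp add: compF_Ob[OF kF])
  \<comment> \<open>Naturality into a constant functor: \<kappa> is a cocone with vertex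
    \<open>b\<close>, so arrows of \<open>J\<close> give commuting triangles over
    \<open>b\<close>.\<close>
  have \<kappa>n: "cmp \<kappa> j' \<cdot>\<^bsub>B\<^esub> onAr u (onAr k t) = cmp \<kappa> j" if t: "t \<in> hom J j j'" for t j j'
    using Nat_natural[OF \<kappa> compF_Fun[OF kF uF] t] hom_Ar[OF t] hom_Ob[OF Jc t] Id_comp[OF Bc \<kappa>h]
    by (simp add: compF_Ar[OF kF])
  define K where "K = \<lparr>FSrc = J, FTgt = S, onOb = (\<lambda>j\<in>Ob J. \<lblot>onOb k j, cmp \<kappa> j\<rblot>),
    onAr = (\<lambda>t\<in>Ar J. \<lblot>\<lblot>onOb k (Dom J t), cmp \<kappa> (Dom J t)\<rblot>, \<lblot>onAr k t, \<lblot>onOb k (Cod J t), cmp \<kappa> (Cod J t)\<rblot>\<rblot>\<rblot>)\<rparr>"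
  have KO: "onOb K j = \<lblot>onOb k j, cmp \<kappa> j\<rblot>" if "j \<in> Ob J" for j using that by (simp add: K_def)
  have KA: "onAr K t = \<lblot>\<lblot>onOb k j, cmp \<kappa> j\<rblot>, \<lblot>onAr k t, \<lblot>onOb k j', cmp \<kappa> j'\<rblot>\<rblot>\<rblot>" if "t \<in> hom J j j'" for t j
    j'
    using that by (simp add: K_def hom_def)
  have KF: "K \<in> Fun J S"
  proof (rule FunI[OF Jc Sc])
    fix x y t assume t: "t \<in> hom J x y"
    note x = hom_Ob[OF Jc t]
    show "onAr K t \<in> hom S (onOb K x) (onOb K y)"
      using x \<kappa>h \<kappa>n[OF t] Fun_hom[OF kF t] by (simp add: KO KA[OF t] Sh)
    fix z s assume s: "s \<in> hom J y z"
    show "onAr K (s \<cdot>\<^bsub>J\<^esub> t) = onAr K s \<cdot>\<^bsub>S\<^esub> onAr K t"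
      by (simp add: KA[OF t] KA[OF s] KA[OF comp_hom[OF Jc t s]] Scomp Fun_comp[OF kF t s])
  next
    fix x assume x: "x \<in> Ob J"
    show "onOb K x \<in> Ob S"
      using \<kappa>h[OF x] Fun_Ob[OF kF x] by (auto simp: KO[OF x] SO)
    show "onAr K (Id J x) = Id S (onOb K x)"
      using FunD(2)[OF uF] by (simp add: KA[OF Id_hom[OF Jc x]] KO[OF x] Fun_Id[OF kF x]) (simp add: S_def
        slice_over_def)
  qed (auto simp: K_def)
  have "\<exists>Z e. universal K s Z e" if s: "s \<in> Ob S" for s
  proof -
    obtain a h where s: "s = \<lblot>a, h\<rblot>" "a \<in> Ob A" "h \<in> hom B (onOb u a) b" using s SO by auto
    obtain j g where j: "j \<in> Ob J" and g: "g \<in> hom A a (onOb k j)" "cmp \<kappa> j \<cdot>\<^bsub>B\<^esub> onAr u g = h"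
      and un: "\<And>j' g'. j' \<in> Ob J \<Longrightarrow> g' \<in> hom A a (onOb k j') \<Longrightarrow> cmp \<kappa> j' \<cdot>\<^bsub>B\<^esub> onAr u g' = h \<Longrightarrow>
        \<exists>!t. t \<in> hom J j j' \<and> onAr k t \<cdot>\<^bsub>A\<^esub> g = g'"
      by (rule final_atE[OF fin uF kF s(2,3)]) blast
    \<comment> \<open>The arrow \<open>g\<close> supplied by \<open>final_at\<close>, read as an
      arrow of the slice from \<open>(a, h)\<close> to the image of \<open>j\<close>.\<close>
    let ?e = "\<lblot>\<lblot>a, h\<rblot>, \<lblot>g, \<lblot>onOb k j, cmp \<kappa> j\<rblot>\<rblot>\<rblot>"
    have "universal K s j ?e"
    proof (rule universalI[OF KF j])
      show "?e \<in> hom S s (onOb K j)" using g s \<kappa>h[OF j] by (simp add: KO[OF j] Sh)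
    next
      fix j' w assume j': "j' \<in> Ob J" and "w \<in> hom S s (onOb K j')"
      then obtain g' where g': "g' \<in> hom A a (onOb k j')" "cmp \<kappa> j' \<cdot>\<^bsub>B\<^esub> onAr u g' = h"
        and w: "w = \<lblot>\<lblot>a, h\<rblot>, \<lblot>g', \<lblot>onOb k j', cmp \<kappa> j'\<rblot>\<rblot>\<rblot>" using s by (auto simp: KO Sh)
      obtain t where t: "t \<in> hom J j j'" "onAr k t \<cdot>\<^bsub>A\<^esub> g = g'" using un[OF j' g'] by auto
      have "onAr K t \<cdot>\<^bsub>S\<^esub> ?e = w" using t w by (simp add: KA[OF t(1)] Scomp)
      then show "\<exists>t \<in> hom J j j'. onAr K t \<cdot>\<^bsub>S\<^esub> ?e = w" using t by blast
    next
      fix j' t t' assume t: "t \<in> hom J j j'" and t': "t' \<in> hom J j j'" and eq: "onAr K t \<cdot>\<^bsub>S\<^esub> ?e = onAr K t'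
        \<cdot>\<^bsub>S\<^esub> ?e"
      note j' = hom_Ob(2)[OF Jc t] and kt = Fun_hom[OF kF t]
      have "onAr k t \<cdot>\<^bsub>A\<^esub> g = onAr k t' \<cdot>\<^bsub>A\<^esub> g" using eq by (simp add: KA[OF t] KA[OF t'] Scomp)
      \<comment> \<open>As \<kappa> is a cocone, the composite is again a factorisation of
        \<open>h\<close>, so the uniqueness clause of \<open>final_at\<close> applies to it.\<close>
      moreover have "cmp \<kappa> j' \<cdot>\<^bsub>B\<^esub> onAr u (onAr k t \<cdot>\<^bsub>A\<^esub> g) = h"
        using Fun_comp[OF uF g(1) kt] comp_assoc[OF Bc Fun_hom[OF uF g(1)] Fun_hom[OF uF kt] \<kappa>h[OF j']] \<kappa>n[OF
          t] g(2) by simp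
      ultimately show "t = t'" using un[OF j' comp_hom[OF Ac g(1) kt]] t t' by metis
    qed
    then show ?thesis by blast
  qed
  then obtain L \<eta> \<epsilon> where adj: "adjunction L K \<eta> \<epsilon>"
    by (rule adjunction_from_universal[OF KF])
  have pF: "slice_over_proj u b \<in> Fun S A" using slice_over_proj_Fun[OF SFunD(2,3,1)[OF u]] by (simp add:
    S_def)
  have pK: "slice_over_proj u b \<odot> K = k"
  proof (rule Fun_eqI[OF compF_Fun[OF KF pF] kF])
    show "onOb (slice_over_proj u b \<odot> K) j = onOb k j" if "j \<in> Ob J" for j
      using Fun_Ob[OF KF that] by (simp add: compF_Ob[OF KF that] slice_over_proj_def S_def[symmetric] KO[OF
        that])
    show "onAr (slice_over_proj u b \<odot> K) t = onAr k t" if t: "t \<in> hom J x y" for t x y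
      using hom_Ar[OF Fun_hom[OF KF t]]
      by (simp add: compF_Ar[OF KF hom_Ar[OF t]] slice_over_proj_def S_def[symmetric] KA[OF t])
  qed
  have "hcomp (slice_over_cell u b) (idN K) = \<kappa>"
  proof (rule Nat_eqI[OF _ \<kappa> compF_Fun[OF kF uF]])
    note cN = slice_over_cell_Nat[OF SFunD(2,3,1)[OF u] b, folded S_def]
    note upF = compF_Fun[OF pF uF]
    have "const S B b \<odot> K = const J B b"
      using compF_assoc[OF KF to_one_Fun[OF Sc] point_Fun[OF Bc b]] to_one_unique[OF compF_Fun[OF KF
        to_one_Fun[OF Sc]]]
      by simp
    moreover have "u \<odot> slice_over_proj u b \<odot> K = u \<odot> k" using compF_assoc[OF KF pF uF] pK by simp
    ultimately show "hcomp (slice_over_cell u b) (idN K) \<in> Nat (u \<odot> k) (const J B b)"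
      using hcomp_Nat(1)[OF idN_Nat[OF KF] cN KF upF] by simp
    fix j assume j: "j \<in> Ob J"
    have Kj: "onOb K j \<in> Ob S" "onOb K j \<in> Ob (slice_over u b)" using Fun_Ob[OF KF j] by (simp_all add: S_def)
    show "cmp (hcomp (slice_over_cell u b) (idN K)) j = cmp \<kappa> j"
      using Kj by (simp add: whisker_right(2)[OF KF upF cN j]) (simp add: slice_over_cell_def KO[OF j])
  qed
  then show thesis
    using that[of K L \<eta> \<epsilon>] adj pK SFunI[OF SFunD(2)[OF k] Ss KF] by (simp add: S_def)
qed

context derivator_on
begin

text \<open>The square of Der4 for the slice is pasted with the square of the right adjoint
  \<open>K\<close> from \<open>J\<close> to the slice. Since \<kappa> is the slice cell whiskered
  with \<open>K\<close>, the pasted square is the one of \<kappa>.\<close>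

lemma final_at_exact:
  assumes u: "u \<in> SFun A B" and b: "b \<in> Ob B" and k: "k \<in> SFun J A"
    and \<kappa>: "\<kappa> \<in> Nat (u \<odot> k) (const J B b)" and fin: "final_at u b k (cmp \<kappa>)"
  shows "exact k (to_one J) u (point B b) \<kappa>"
proof -
  note A = SFunD(2)[OF u] and B = SFunD(3)[OF u] and uF = SFunD(1)[OF u]
  let ?S = "slice_over u b"
  note Ss = small_slice_over[OF A B uF]
  obtain K L \<eta> \<epsilon> where K: "K \<in> SFun J ?S" and adj: "adjunction L K \<eta> \<epsilon>"
    and pK: "slice_over_proj u b \<odot> K = k" and cK: "hcomp (slice_over_cell u b) (idN K) = \<kappa>"
    using final_at_right_adjoint[OF assms] .
  have p: "slice_over_proj u b \<in> SFun ?S A" using SFunI[OF Ss A slice_over_proj_Fun[OF A B uF]] .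
  note c = slice_over_cell_Nat[OF A B uF b]
  note tS = SFun_to_one[OF Ss] and tJ = SFun_to_one[OF SFunD(2)[OF k]]
  have tK: "to_one ?S \<odot> K = to_one J" using to_one_unique[OF SFunD(1)[OF SFun_comp[OF K tS]]] .
  \<comment> \<open>Der4 for left Kan extensions, read as exactness.\<close>
  have 1: "exact (slice_over_proj u b) (to_one ?S) u (point B b) (slice_over_cell u b)"
    unfolding exact_iff_mate[OF p tS u SFun_point[OF B b] c]
    using Der4 A B uF b unfolding Der4_def by blast
  have idt: "idN (to_one J) \<in> Nat (to_one ?S \<odot> K) (idF one_cat \<odot> to_one J)"
    using idN_Nat[OF SFunD(1)[OF tJ]] SFunD(1)[OF tJ] tK by simp
  have "exact (slice_over_proj u b \<odot> K) (to_one J) u (point B b \<odot> idF one_cat) \<kappa>"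
  proof (rule exact_paste[OF 1 right_adjoint_exact[OF K adj] p tS u SFun_point[OF B b] c K tJ SFun_idF[OF
    small_one_cat] idt])
    fix Z assume Z: "Z \<in> Ob (V B)"
    note pb = SFun_point[OF B b]
    have cz: "K \<bullet> cmp (pull2 D (slice_over_cell u b)) Z \<in> hom (V J) (K \<star> (u \<odot> slice_over_proj u b) \<star> Z) (K \<star>
      const ?S B b \<star> Z)"
      using bullet_hom[OF K pull2_hom[OF SFun_comp[OF p u] c Z]] .
    have "K \<star> const ?S B b \<star> Z = to_one J \<star> point B b \<star> Z"
      using star_compF[OF tS pb Z] star_compF[OF K tS star_Ob[OF pb Z]] tK by simp
    then show "cmp (pull2 D \<kappa>) Z = cmp (pull2 D (idN (to_one J))) (point B b \<star> Z) \<cdot>\<^bsub>V J\<^esub>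
        K \<bullet> cmp (pull2 D (slice_over_cell u b)) Z"
      using pull2_whisker_right[OF K SFun_comp[OF p u] c Z] cK pull2_idN[OF tJ star_Ob[OF pb Z]]
        Id_comp[OF V_category[OF SFunD(2)[OF k]] cz] by simp
  qed
  then show ?thesis using pK SFunD(1)[OF SFun_point[OF B b]] by simp
qed

section \<open>The calculus of mates of strictly commuting squares\<close>

abbreviation smate :: "'u sfunc \<Rightarrow> 'u sfunc \<Rightarrow> 'u sfunc \<Rightarrow> 'u sfunc \<Rightarrow> ('o, 'm, 'o, 'm) nat_trans" where
  "smate p q u v \<equiv> mate D p q u v (idN (u \<odot> p))"

text \<open>\<open>S\<close> is the initial and \<open>B\<close> the final corner: \<open>p\<close>
  and \<open>q\<close> leave \<open>S\<close>, while \<open>u\<close> and \<open>v\<close> end in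
  \<open>B\<close>. The 2-cell is an identity, so \<open>v\<close> and \<open>q\<close> take the
  part of base and pulled back Kan extension in a base change. The canonical maps of the theorem are
  built from mates of such squares.\<close>

definition square :: "'u scat \<Rightarrow> 'u scat \<Rightarrow> 'u scat \<Rightarrow> 'u scat \<Rightarrow> 'u sfunc \<Rightarrow> 'u sfunc \<Rightarrow> 'u sfunc \<Rightarrow> 'u sfunc \<Rightarrow>
  bool" where
  "square S A T B p q u v \<longleftrightarrow> p \<in> SFun S A \<and> q \<in> SFun S T \<and> u \<in> SFun A B \<and> v \<in> SFun T B \<and> u \<odot> p = v \<odot> q"

lemma squareD:
  assumes "square S A T B p q u v"
  shows "p \<in> SFun S A" "q \<in> SFun S T" "u \<in> SFun A B" "v \<in> SFun T B" "u \<odot> p = v \<odot> q"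
    and "idN (u \<odot> p) \<in> Nat (u \<odot> p) (v \<odot> q)"
proof -
  show s: "p \<in> SFun S A" "q \<in> SFun S T" "u \<in> SFun A B" "v \<in> SFun T B" "u \<odot> p = v \<odot> q"
    using assms by (auto simp: square_def)
  show "idN (u \<odot> p) \<in> Nat (u \<odot> p) (v \<odot> q)"
    unfolding s(5) by (rule idN_Nat[OF SFunD(1)[OF SFun_comp[OF s(2,4)]]])
qed

lemma square_star: "square S A T B p q u v \<Longrightarrow> Z \<in> Ob (V B) \<Longrightarrow> p \<star> u \<star> Z = q \<star> v \<star> Z"
  using star_compF[of p S A u B Z] star_compF[of q S T v B Z] squareD(1-5)[of S A T B p q u v] by simp

lemma square_bullet: "square S A T B p q u v \<Longrightarrow> f \<in> hom (V B) Z Z' \<Longrightarrow> p \<bullet> u \<bullet> f = q \<bullet> v \<bullet> f"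
  using bullet_compF[of p S A u B f] bullet_compF[of q S T v B f] squareD(1-5)[of S A T B p q u v] by metis

lemma smate_hom:
  assumes "square S A T B p q u v" "X \<in> Ob (V A)"
  shows "cmp (smate p q u v) X \<in> hom (V T) (lan_Ob q (p \<star> X)) (v \<star> lan_Ob u X)"
  by (rule mate_hom[OF squareD(1-4,6)[OF assms(1)] assms(2)])

lemma smate_unit:
  assumes sq: "square S A T B p q u v" and X: "X \<in> Ob (V A)"
  shows "q \<bullet> cmp (smate p q u v) X \<cdot>\<^bsub>V S\<^esub> unit q (p \<star> X) = p \<bullet> unit u X"
  using mate_unit[OF squareD(1-4,6)[OF sq] X] pull2_idN[OF SFun_comp[OF squareD(1,3)[OF sq]] lan_Ob[OF
    squareD(3)[OF sq] X]]
    star_compF[OF squareD(1,3)[OF sq] lan_Ob[OF squareD(3)[OF sq] X]]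
    Id_comp[OF V_category[OF SFunD(2)[OF squareD(1)[OF sq]]] bullet_hom[OF squareD(1)[OF sq] unit_hom[OF
      squareD(3)[OF sq] X]]]
  by simp

text \<open>Mates are recognised by their effect on the unit. This turns identities between
  composites of mates into identities between restrictions of one unit.\<close>

lemma smate_unique:
  assumes sq: "square S A T B p q u v" and X: "X \<in> Ob (V A)"
    and m: "m \<in> hom (V T) (lan_Ob q (p \<star> X)) (v \<star> lan_Ob u X)"
    and eq: "q \<bullet> m \<cdot>\<^bsub>V S\<^esub> unit q (p \<star> X) = p \<bullet> unit u X"
  shows "m = cmp (smate p q u v) X"
  by (rule lan_ext[OF squareD(2)[OF sq] star_Ob[OF squareD(1)[OF sq] X] m smate_hom[OF sq X]])
    (simp add: eq smate_unit[OF sq X])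

text \<open>After composition with the unit of \<open>q\<close>, both sides become the restriction
  along \<open>p\<close> of \<open>unit u Y\<close> after \<open>f\<close>.\<close>

lemma smate_natural:
  assumes sq: "square S A T B p q u v" and f: "f \<in> hom (V A) X Y"
  shows "v \<bullet> lan_Ar u f \<cdot>\<^bsub>V T\<^esub> cmp (smate p q u v) X = cmp (smate p q u v) Y \<cdot>\<^bsub>V T\<^esub> lan_Ar q (p \<bullet> f)"
proof -
  note s = squareD[OF sq]
  note VS = V_category[OF SFunD(2)[OF s(1)]] and VT = V_category[OF SFunD(3)[OF s(2)]]
    and VA = V_category[OF SFunD(2)[OF s(3)]]
  note X = hom_Ob[OF VA f]
  note m = smate_hom[OF sq X(1)] smate_hom[OF sq X(2)]
  note pf = bullet_hom[OF s(1) f] and lf = lan_hom[OF s(3) f]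
  note vl = bullet_hom[OF s(4) lf] and lpf = lan_hom[OF s(2) pf]
  note un = unit_hom[OF s(2) star_Ob[OF s(1) X(1)]] unit_hom[OF s(2) star_Ob[OF s(1) X(2)]]
  note uu = unit_hom[OF s(3) X(1)] unit_hom[OF s(3) X(2)]
  show ?thesis
  proof (rule lan_ext[OF s(2) star_Ob[OF s(1) X(1)] comp_hom[OF VT m(1) vl] comp_hom[OF VT lpf m(2)]])
    have "q \<bullet> (v \<bullet> lan_Ar u f \<cdot>\<^bsub>V T\<^esub> cmp (smate p q u v) X) \<cdot>\<^bsub>V S\<^esub> unit q (p \<star> X) = p \<bullet> u \<bullet> lan_Ar u f \<cdot>\<^bsub>V S\<^esub>
      p \<bullet> unit u X"
      using bullet_comp[OF s(2) m(1) vl] comp_assoc[OF VS un(1) bullet_hom[OF s(2) m(1)] bullet_hom[OF s(2)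
        vl]]
        smate_unit[OF sq X(1)] square_bullet[OF sq lf] by simp
    also have "\<dots> = p \<bullet> (unit u Y \<cdot>\<^bsub>V A\<^esub> f)"
      using bullet_comp[OF s(1) uu(1) bullet_hom[OF s(3) lf]] unit_natural[OF s(3) f] by simp
    also have "\<dots> = q \<bullet> cmp (smate p q u v) Y \<cdot>\<^bsub>V S\<^esub> unit q (p \<star> Y) \<cdot>\<^bsub>V S\<^esub> p \<bullet> f"
      using bullet_comp[OF s(1) f uu(2)] smate_unit[OF sq X(2)] by simp
    also have "\<dots> = q \<bullet> (cmp (smate p q u v) Y \<cdot>\<^bsub>V T\<^esub> lan_Ar q (p \<bullet> f)) \<cdot>\<^bsub>V S\<^esub> unit q (p \<star> X)"
      using bullet_comp[OF s(2) lpf m(2)] comp_assoc[OF VS un(1) bullet_hom[OF s(2) lpf] bullet_hom[OF s(2)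
        m(2)]]
        comp_assoc[OF VS pf un(2) bullet_hom[OF s(2) m(2)]] unit_natural[OF s(2) pf] by simp
    finally show "q \<bullet> (v \<bullet> lan_Ar u f \<cdot>\<^bsub>V T\<^esub> cmp (smate p q u v) X) \<cdot>\<^bsub>V S\<^esub> unit q (p \<star> X) =
      q \<bullet> (cmp (smate p q u v) Y \<cdot>\<^bsub>V T\<^esub> lan_Ar q (p \<bullet> f)) \<cdot>\<^bsub>V S\<^esub> unit q (p \<star> X)" .
  qed
qed

lemma smate_Nat:
  assumes sq: "square S A T B p q u v"
  shows "smate p q u v \<in> Nat (lan D q \<odot> pull D p) (pull D v \<odot> lan D u)"
proof -
  note s = squareD[OF sq]
  note l = lan_Fun[OF s(3)] and pp = pull_Fun[OF s(1)]
  show ?thesis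
  proof (rule NatI[OF compF_Fun[OF pp lan_Fun[OF s(2)]] compF_Fun[OF l pull_Fun[OF s(4)]]])
    show "NSrc (smate p q u v) = lan D q \<odot> pull D p" "NTgt (smate p q u v) = pull D v \<odot> lan D u"
      "cmp (smate p q u v) \<in> extensional (Ob (V A))"
      using FunD(2)[OF SFunD(1)[OF s(3)]] by (auto simp: mate_def)
    show "cmp (smate p q u v) X \<in> hom (V T) (onOb (lan D q \<odot> pull D p) X) (onOb (pull D v \<odot> lan D u) X)"
      if "X \<in> Ob (V A)" for X
      using smate_hom[OF sq that] by (simp add: compF_Ob[OF pp that] compF_Ob[OF l that])
    show "onAr (pull D v \<odot> lan D u) f \<cdot>\<^bsub>V T\<^esub> cmp (smate p q u v) X =
        cmp (smate p q u v) Y \<cdot>\<^bsub>V T\<^esub> onAr (lan D q \<odot> pull D p) f" if "f \<in> hom (V A) X Y" for f X Y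
      using smate_natural[OF sq that] by (simp add: compF_Ar[OF pp hom_Ar[OF that]] compF_Ar[OF l hom_Ar[OF
        that]])
  qed
qed

lemma square_paste:
  assumes "square S A T B p q u v" "square S' S T' T p' q' q v'"
  shows "square S' A T' B (p \<odot> p') q' u (v \<odot> v')"
proof -
  note s = squareD[OF assms(1)] and s' = squareD[OF assms(2)]
  have "u \<odot> (p \<odot> p') = v \<odot> v' \<odot> q'"
    using compF_assoc[OF s'(1)[THEN SFunD(1)] s(1)[THEN SFunD(1)] s(3)[THEN SFunD(1)]]
      compF_assoc[OF s'(1)[THEN SFunD(1)] s(2)[THEN SFunD(1)] s(4)[THEN SFunD(1)]]
      compF_assoc[OF s'(2)[THEN SFunD(1)] s'(4)[THEN SFunD(1)] s(4)[THEN SFunD(1)]] s(5) s'(5) by simp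
  then show ?thesis
    using s s' SFun_comp unfolding square_def by blast
qed

text \<open>Both sides restrict along the unit of \<open>q'\<close> to the restriction of
  \<open>unit u X\<close> along \<open>p \<odot> p'\<close>. The functoriality of the structure maps
  of \<open>lan_mor\<close> and \<open>colim_mor\<close> is an instance, and so is the coherence of
  the canonical maps with respect to parameters.\<close>

lemma smate_paste:
  assumes sq: "square S A T B p q u v" and sq': "square S' S T' T p' q' q v'" and X: "X \<in> Ob (V A)"
  shows "v' \<bullet> cmp (smate p q u v) X \<cdot>\<^bsub>V T'\<^esub> cmp (smate p' q' q v') (p \<star> X) = cmp (smate (p \<odot> p') q' u (v \<odot>
    v')) X"
proof (rule smate_unique[OF square_paste[OF sq sq'] X])
  note s = squareD[OF sq] and s' = squareD[OF sq']
  note VS' = V_category[OF SFunD(2)[OF s'(1)]] and VT' = V_category[OF SFunD(3)[OF s'(2)]]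
  note pX = star_Ob[OF s(1) X] and l = lan_Ob[OF s(3) X]
  note m = smate_hom[OF sq X] and m' = smate_hom[OF sq' pX]
  note vm = bullet_hom[OF s'(4) m]
  have e: "(p \<odot> p') \<star> X = p' \<star> p \<star> X" "(v \<odot> v') \<star> lan_Ob u X = v' \<star> v \<star> lan_Ob u X"
    using star_compF[OF s'(1) s(1) X] star_compF[OF s'(4) s(4) l] by auto
  show "v' \<bullet> cmp (smate p q u v) X \<cdot>\<^bsub>V T'\<^esub> cmp (smate p' q' q v') (p \<star> X)
      \<in> hom (V T') (lan_Ob q' ((p \<odot> p') \<star> X)) ((v \<odot> v') \<star> lan_Ob u X)"
    unfolding e by (rule comp_hom[OF VT' m' vm])
  have "q' \<bullet> (v' \<bullet> cmp (smate p q u v) X \<cdot>\<^bsub>V T'\<^esub> cmp (smate p' q' q v') (p \<star> X)) \<cdot>\<^bsub>V S'\<^esub> unit q' (p' \<star> p \<star> X)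
    =
      p' \<bullet> q \<bullet> cmp (smate p q u v) X \<cdot>\<^bsub>V S'\<^esub> p' \<bullet> unit q (p \<star> X)"
    using bullet_comp[OF s'(2) m' vm]
      comp_assoc[OF VS' unit_hom[OF s'(2) star_Ob[OF s'(1) pX]] bullet_hom[OF s'(2) m'] bullet_hom[OF s'(2)
        vm]]
      smate_unit[OF sq' pX] square_bullet[OF sq' m] by simp
  also have "\<dots> = p' \<bullet> p \<bullet> unit u X"
    using bullet_comp[OF s'(1) unit_hom[OF s(2) pX] bullet_hom[OF s(2) m]] smate_unit[OF sq X] by simp
  finally show "q' \<bullet> (v' \<bullet> cmp (smate p q u v) X \<cdot>\<^bsub>V T'\<^esub> cmp (smate p' q' q v') (p \<star> X)) \<cdot>\<^bsub>V S'\<^esub> unit q' ((p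
    \<odot> p') \<star> X) =
      (p \<odot> p') \<bullet> unit u X"
    using bullet_compF[OF s'(1) s(1) unit_hom[OF s(3) X]] e by simp
qed

lemma square_id: "u \<in> SFun A B \<Longrightarrow> square A A B B (idF A) u u (idF B)"
  unfolding square_def using SFunD[of u A B] SFun_idF[of A] SFun_idF[of B] by simp

lemma smate_id:
  assumes u: "u \<in> SFun A B" and X: "X \<in> Ob (V A)"
  shows "cmp (smate (idF A) u u (idF B)) X = Id (V B) (lan_Ob u X)"
proof (rule smate_unique[OF square_id[OF u] X, symmetric])
  note VA = V_category[OF SFunD(2)[OF u]] and VB = V_category[OF SFunD(3)[OF u]]
  note l = lan_Ob[OF u X]
  show "Id (V B) (lan_Ob u X) \<in> hom (V B) (lan_Ob u (idF A \<star> X)) (idF B \<star> lan_Ob u X)"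
    using star_idF[OF SFunD(2)[OF u] X] star_idF[OF SFunD(3)[OF u] l] Id_hom[OF VB l] by simp
  show "u \<bullet> Id (V B) (lan_Ob u X) \<cdot>\<^bsub>V A\<^esub> unit u (idF A \<star> X) = idF A \<bullet> unit u X"
    using star_idF[OF SFunD(2)[OF u] X] bullet_idF[OF SFunD(2)[OF u] unit_hom[OF u X]] bullet_Id[OF u l]
      Id_comp[OF VA unit_hom[OF u X]] by simp
qed

text \<open>The two squares share \<open>q\<close> and \<open>u\<close>, and the 2-cells between
  their other sides become equal in \<open>B\<close>. This is the shape of the compatibility of a
  morphism of derivators with 2-cells between parameter functors.\<close>

lemma smate_2cell:
  assumes sq: "square S A T B p q u v" and sq': "square S A T B p' q u v'"
    and b: "\<beta> \<in> Nat p p'" and g: "\<gamma> \<in> Nat v v'" and bg: "hcomp (idN u) \<beta> = hcomp \<gamma> (idN q)"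
    and X: "X \<in> Ob (V A)"
  shows "cmp (pull2 D \<gamma>) (lan_Ob u X) \<cdot>\<^bsub>V T\<^esub> cmp (smate p q u v) X =
    cmp (smate p' q u v') X \<cdot>\<^bsub>V T\<^esub> lan_Ar q (cmp (pull2 D \<beta>) X)"
proof -
  note s = squareD[OF sq] and s' = squareD[OF sq']
  note VS = V_category[OF SFunD(2)[OF s(1)]] and VT = V_category[OF SFunD(3)[OF s(2)]]
  note l = lan_Ob[OF s(3) X]
  note m = smate_hom[OF sq X] smate_hom[OF sq' X]
  note gl = pull2_hom[OF s(4) g l] and bX = pull2_hom[OF s(1) b X]
  note lb = lan_hom[OF s(2) bX] and uX = unit_hom[OF s(3) X]
  note un = unit_hom[OF s(2) star_Ob[OF s(1) X]] unit_hom[OF s(2) star_Ob[OF s'(1) X]]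
  \<comment> \<open>The equation between the two whiskered 2-cells, sent through
    \<open>pull2\<close>: one side becomes a restriction along \<open>q\<close>, the other the pull
    of \<beta> at a restricted object.\<close>
  have qg: "q \<bullet> cmp (pull2 D \<gamma>) (lan_Ob u X) = cmp (pull2 D \<beta>) (u \<star> lan_Ob u X)"
    using pull2_whisker_left[OF s(1) b s(3) l] pull2_whisker_right[OF s(2) s(4) g l] bg by simp
  show ?thesis
  proof (rule lan_ext[OF s(2) star_Ob[OF s(1) X] comp_hom[OF VT m(1) gl] comp_hom[OF VT lb m(2)]])
    have "q \<bullet> (cmp (pull2 D \<gamma>) (lan_Ob u X) \<cdot>\<^bsub>V T\<^esub> cmp (smate p q u v) X) \<cdot>\<^bsub>V S\<^esub> unit q (p \<star> X) =
        cmp (pull2 D \<beta>) (u \<star> lan_Ob u X) \<cdot>\<^bsub>V S\<^esub> p \<bullet> unit u X"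
      using bullet_comp[OF s(2) m(1) gl] comp_assoc[OF VS un(1) bullet_hom[OF s(2) m(1)] bullet_hom[OF s(2)
        gl]]
        smate_unit[OF sq X] qg by simp
    also have "\<dots> = p' \<bullet> unit u X \<cdot>\<^bsub>V S\<^esub> cmp (pull2 D \<beta>) X"
      using pull2_natural[OF s(1) b uX] by simp
    also have "\<dots> = q \<bullet> (cmp (smate p' q u v') X \<cdot>\<^bsub>V T\<^esub> lan_Ar q (cmp (pull2 D \<beta>) X)) \<cdot>\<^bsub>V S\<^esub> unit q (p \<star> X)"
      using bullet_comp[OF s(2) lb m(2)] comp_assoc[OF VS un(1) bullet_hom[OF s(2) lb] bullet_hom[OF s(2)
        m(2)]]
        comp_assoc[OF VS bX un(2) bullet_hom[OF s(2) m(2)]] unit_natural[OF s(2) bX] smate_unit[OF sq' X] by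
          simp
    finally show "q \<bullet> (cmp (pull2 D \<gamma>) (lan_Ob u X) \<cdot>\<^bsub>V T\<^esub> cmp (smate p q u v) X) \<cdot>\<^bsub>V S\<^esub> unit q (p \<star> X) =
      q \<bullet> (cmp (smate p' q u v') X \<cdot>\<^bsub>V T\<^esub> lan_Ar q (cmp (pull2 D \<beta>) X)) \<cdot>\<^bsub>V S\<^esub> unit q (p \<star> X)" .
  qed
qed

text \<open>
  By Der2 the mate is tested at each object \<open>t\<close>, where both left Kan extensions are colimits over
  the same category \<open>J\<close>.
\<close>

lemma smate_iso_pointwise:
  assumes sq: "square S A T B p q u v" and X: "X \<in> Ob (V A)"
    and pt: "\<And>t. t \<in> Ob T \<Longrightarrow> \<exists>J j \<kappa>. j \<in> SFun J S \<and> \<kappa> \<in> Nat (q \<odot> j) (const J T t) \<and>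
      final_at q t j (cmp \<kappa>) \<and> final_at u (onOb v t) (p \<odot> j) (\<lambda>x. onAr v (cmp \<kappa> x))"
  shows "isomorphism (V T) (cmp (smate p q u v) X)"
proof -
  note s = squareD[OF sq]
  note T = SFunD(3)[OF s(2)]
  let ?m = "cmp (smate p q u v) X"
  note m = smate_hom[OF sq X] and mu = smate_unit[OF sq X]
  note pX = star_Ob[OF s(1) X] and l = lan_Ob[OF s(3) X]
  have "isomorphism (V one_cat) (point T t \<bullet> ?m)" if t: "t \<in> Ob T" for t
  proof -
    obtain J j \<kappa> where j: "j \<in> SFun J S" and \<kappa>: "\<kappa> \<in> Nat (q \<odot> j) (const J T t)"
      and f1: "final_at q t j (cmp \<kappa>)" and f2: "final_at u (onOb v t) (p \<odot> j) (\<lambda>x. onAr v (cmp \<kappa> x))"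
      using pt[OF t] by blast
    note qj = SFun_comp[OF j s(2)] and pj = SFun_comp[OF j s(1)]
    note J = SFunD(2)[OF j] and VJ = V_category[OF SFunD(2)[OF j]]
    note tJ = SFun_to_one[OF J] and ptt = SFun_point[OF T t]
    note vF = SFunD(1)[OF s(4)] and vt = Fun_Ob[OF SFunD(1)[OF s(4)] t]
    let ?\<kappa> = "hcomp (idN v) \<kappa>"
    note k = whisker_left(2)[OF SFunD(1)[OF qj] \<kappa> vF]
    have "?\<kappa> \<in> Nat (v \<odot> (q \<odot> j)) (v \<odot> const J T t)"
      by (rule hcomp_Nat(1)[OF \<kappa> idN_Nat[OF vF] SFunD(1)[OF qj] vF])
    moreover have "v \<odot> (q \<odot> j) = u \<odot> (p \<odot> j)"
      using compF_assoc[OF SFunD(1)[OF j] SFunD(1)[OF s(2)] vF] compF_assoc[OF SFunD(1)[OF j] SFunD(1)[OF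
        s(1)] SFunD(1)[OF s(3)]]
        s(5) by simp
    ultimately have \<kappa>': "?\<kappa> \<in> Nat (u \<odot> (p \<odot> j)) (const J B (onOb v t))"
      using compF_const[OF SFunD(4)[OF j] vF t] by simp
    have ex1: "exact j (to_one J) q (point T t) \<kappa>" by (rule final_at_exact[OF s(2) t j \<kappa> f1])
    have "final_at u (onOb v t) (p \<odot> j) (cmp ?\<kappa>)"
      using f2 k FunD(2)[OF SFunD(1)[OF pj]] final_at_cong[of "p \<odot> j" "cmp ?\<kappa>" "\<lambda>x. onAr v (cmp \<kappa> x)"] by simp
    then have ex2: "exact (p \<odot> j) (to_one J) u (point B (onOb v t)) ?\<kappa>"
      by (rule final_at_exact[OF s(3) vt pj \<kappa>'])
    \<comment> \<open>By finality for \<open>q\<close> at \<open>t\<close>, the source of the mate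
      has as value at \<open>t\<close> a colimit of \<open>j \<star> p \<star> X\<close>.\<close>
    have u1: "universal (pull D (to_one J)) (j \<star> p \<star> X) (point T t \<star> lan_Ob q (p \<star> X))
        (cmp (pull2 D \<kappa>) (lan_Ob q (p \<star> X)) \<cdot>\<^bsub>V J\<^esub> j \<bullet> unit q (p \<star> X))"
      by (rule exactD[OF ex1 j s(2) pX lan_universal[OF s(2) pX]])
    have "universal (pull D (to_one J)) ((p \<odot> j) \<star> X) (point B (onOb v t) \<star> lan_Ob u X)
        (cmp (pull2 D ?\<kappa>) (lan_Ob u X) \<cdot>\<^bsub>V J\<^esub> (p \<odot> j) \<bullet> unit u X)"
      by (rule exactD[OF ex2 pj s(3) X lan_universal[OF s(3) X]])
    \<comment> \<open>By finality for \<open>u\<close> at the image of \<open>t\<close>, the target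
      has as value at \<open>t\<close> a colimit of the same diagram.\<close>
    then have u2: "universal (pull D (to_one J)) (j \<star> p \<star> X) (point T t \<star> v \<star> lan_Ob u X)
        (cmp (pull2 D \<kappa>) (v \<star> lan_Ob u X) \<cdot>\<^bsub>V J\<^esub> j \<bullet> p \<bullet> unit u X)"
      using star_compF[OF j s(1) X] star_compF[OF ptt s(4) l] compF_point[OF vF t]
        bullet_compF[OF j s(1) unit_hom[OF s(3) X]] pull2_whisker_left[OF qj \<kappa> s(4) l] by simp
    note tm = bullet_hom[OF ptt m]
    have tjm: "to_one J \<bullet> point T t \<bullet> ?m = const J T t \<bullet> ?m"
      using bullet_compF[OF tJ ptt m] by simp
    note c1 = pull2_hom[OF qj \<kappa> lan_Ob[OF s(2) pX]] and c2 = pull2_hom[OF qj \<kappa> star_Ob[OF s(4) l]]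
    have ju: "j \<bullet> unit q (p \<star> X) \<in> hom (V J) (j \<star> p \<star> X) ((q \<odot> j) \<star> lan_Ob q (p \<star> X))"
      using bullet_hom[OF j unit_hom[OF s(2) pX]] star_compF[OF j s(2) lan_Ob[OF s(2) pX]] by simp
    have cm: "const J T t \<bullet> ?m \<in> hom (V J) (const J T t \<star> lan_Ob q (p \<star> X)) (const J T t \<star> v \<star> lan_Ob u X)"
      by (rule bullet_hom[OF SFun_comp[OF tJ ptt] m])
    \<comment> \<open>Naturality of the pulled 2-cell moves the mate past \<kappa>; there it meets
      the unit of \<open>q\<close> and is absorbed by \<open>smate_unit\<close>.\<close>
    have "to_one J \<bullet> point T t \<bullet> ?m \<cdot>\<^bsub>V J\<^esub> (cmp (pull2 D \<kappa>) (lan_Ob q (p \<star> X)) \<cdot>\<^bsub>V J\<^esub> j \<bullet> unit q (p \<star> X)) =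
        (cmp (pull2 D \<kappa>) (v \<star> lan_Ob u X) \<cdot>\<^bsub>V J\<^esub> (q \<odot> j) \<bullet> ?m) \<cdot>\<^bsub>V J\<^esub> j \<bullet> unit q (p \<star> X)"
      unfolding tjm using comp_assoc[OF VJ ju c1 cm] pull2_natural[OF qj \<kappa> m] by simp
    also have "\<dots> = cmp (pull2 D \<kappa>) (v \<star> lan_Ob u X) \<cdot>\<^bsub>V J\<^esub> j \<bullet> (q \<bullet> ?m \<cdot>\<^bsub>V S\<^esub> unit q (p \<star> X))"
      using comp_assoc[OF VJ ju bullet_hom[OF qj m] c2] bullet_compF[OF j s(2) m]
        bullet_comp[OF j unit_hom[OF s(2) pX] bullet_hom[OF s(2) m]] by simp
    finally have "to_one J \<bullet> point T t \<bullet> ?m \<cdot>\<^bsub>V J\<^esub> (cmp (pull2 D \<kappa>) (lan_Ob q (p \<star> X)) \<cdot>\<^bsub>V J\<^esub> j \<bullet> unit q (p \<star>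
      X)) =
        cmp (pull2 D \<kappa>) (v \<star> lan_Ob u X) \<cdot>\<^bsub>V J\<^esub> j \<bullet> p \<bullet> unit u X" using mu by simp
    then show ?thesis by (rule universal_iso[OF u1 u2 pull_Fun[OF tJ] tm])
  qed
  then show ?thesis using Der2 T hom_Ar[OF m] unfolding Der2_def by blast
qed

end

section \<open>Pointwise computations of left Kan extensions\<close>

text \<open>The induced functor to the slice is the identity, so \<open>(a, h)\<close> is its own
  witness, reached by the identity of \<open>a\<close>.\<close>

lemma final_at_slice:
  assumes A: "small_category A" and B: "small_category B" and u: "u \<in> Fun A B"
  shows "final_at u b (slice_over_proj u b) (cmp (slice_over_cell u b))"
proof (rule final_atI[OF u slice_over_proj_Fun[OF A B u]])
  note Ac = small_categoryD(1)[OF A] and Bc = small_categoryD(1)[OF B]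
  let ?S = "slice_over u b"
  have pO: "onOb (slice_over_proj u b) x = p1 x" "cmp (slice_over_cell u b) x = p2 x" if "x \<in> Ob ?S" for x
    using that by (simp_all add: slice_over_proj_def slice_over_cell_def)
  fix a h assume a: "a \<in> Ob A" and h: "h \<in> hom B (onOb u a) b"
  let ?j = "\<lblot>a, h\<rblot>"
  have j: "?j \<in> Ob ?S" using a h by (simp add: Ob_slice_over[OF u])
  have "\<exists>!t. t \<in> hom ?S ?j j' \<and> onAr (slice_over_proj u b) t \<cdot>\<^bsub>A\<^esub> Id A a = g'"
    if j': "j' \<in> Ob ?S" and g': "g' \<in> hom A a (onOb (slice_over_proj u b) j')"
      and e: "cmp (slice_over_cell u b) j' \<cdot>\<^bsub>B\<^esub> onAr u g' = h" for j' g'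
  proof -
    obtain a' h' where x: "j' = \<lblot>a', h'\<rblot>" "h' \<in> hom B (onOb u a') b" using j' by (auto simp: Ob_slice_over[OF
      u])
    have pA: "onAr (slice_over_proj u b) t \<cdot>\<^bsub>A\<^esub> Id A a = p1 (p2 t)" if "t \<in> hom ?S ?j j'" for t
    proof -
      have "onAr (slice_over_proj u b) t = p1 (p2 t)" using hom_Ar[OF that] by (simp add: slice_over_proj_def)
      moreover have "p1 (p2 t) \<in> hom A a a'" using that x by (auto simp: hom_slice_over[OF u])
      ultimately show ?thesis using comp_Id[OF Ac] by metis
    qed
    have g: "g' \<in> hom A a a'" "h' \<cdot>\<^bsub>B\<^esub> onAr u g' = h" using g' e j' x by (simp_all add: pO)
    show ?thesis
    proof (rule ex1I[of _ "\<lblot>?j, \<lblot>g', j'\<rblot>\<rblot>"])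
      have *: "\<lblot>?j, \<lblot>g', j'\<rblot>\<rblot> \<in> hom ?S ?j j'" using g h x by (simp add: hom_slice_over[OF u])
      then show "\<lblot>?j, \<lblot>g', j'\<rblot>\<rblot> \<in> hom ?S ?j j' \<and> onAr (slice_over_proj u b) \<lblot>?j, \<lblot>g', j'\<rblot>\<rblot> \<cdot>\<^bsub>A\<^esub> Id A a = g'"
        using pA[OF *] by simp
      fix t assume "t \<in> hom ?S ?j j' \<and> onAr (slice_over_proj u b) t \<cdot>\<^bsub>A\<^esub> Id A a = g'"
      then show "t = \<lblot>?j, \<lblot>g', j'\<rblot>\<rblot>" using pA x by (auto simp: hom_slice_over[OF u])
    qed
  qed
  then show "\<exists>j\<in>Ob ?S. \<exists>g\<in>hom A a (onOb (slice_over_proj u b) j). cmp (slice_over_cell u b) j \<cdot>\<^bsub>B\<^esub> onAr u g =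
    h \<and>
       (\<forall>j' \<in> Ob ?S. \<forall>g' \<in> hom A a (onOb (slice_over_proj u b) j'). cmp (slice_over_cell u b) j' \<cdot>\<^bsub>B\<^esub> onAr u
         g' = h \<longrightarrow>
          (\<exists>!t. t \<in> hom ?S j j' \<and> onAr (slice_over_proj u b) t \<cdot>\<^bsub>A\<^esub> g = g'))"
    using j Id_hom[OF Ac a] Fun_Id[OF u a] comp_Id[OF Bc h]
    by (intro bexI[of _ ?j] bexI[of _ "Id A a"]) (simp_all add: pO)
qed

text \<open>An object of the slice over \<open>c\<close> is given by \<open>a\<close>,
  \<open>c'\<close> and an arrow \<open>h\<close> from \<open>c'\<close> to \<open>c\<close>. The
  parameter is carried to \<open>c\<close> by \<open>h\<close> itself, and \<open>a\<close> is
  carried to the diagram \<open>k\<close> by its universal arrow; together they form the witness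
  \<open>(e, h)\<close>. Hence a colimit with parameters has at \<open>c\<close> the expected value
  over \<open>J\<close>.\<close>

lemma final_at_proj2:
  assumes C: "category C" and k: "k \<in> Fun J A" and c: "c \<in> Ob C"
    and un: "\<And>a. a \<in> Ob A \<Longrightarrow> \<exists>Z e. universal k a Z e"
  shows "final_at (proj2 A C) c (pairF k (const J C c)) (\<lambda>_. Id C c)"
proof -
  note FD = FunD[OF k]
  note cF = const_Fun[OF FD(4) C c]
  note pk = pairF_Fun[OF k cF]
  show ?thesis
  proof (rule final_atI[OF proj2_Fun[OF FD(5) C] pk])
    fix x h assume "x \<in> Ob (A \<times>\<^sub>c C)" and h: "h \<in> hom C (onOb (proj2 A C) x) c"
    then obtain a c' where x: "x = \<lblot>a, c'\<rblot>" "a \<in> Ob A" "c' \<in> Ob C" by auto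
    have h: "h \<in> hom C c' c" using h x by simp
    obtain Z e where u: "universal k a Z e" using un[OF x(2)] by blast
    note Z = universalD[OF u k]
    have kO: "onOb (pairF k (const J C c)) j = \<lblot>onOb k j, c\<rblot>" if "j \<in> Ob J" for j
      using that FD(2) by simp
    have kA: "onAr (pairF k (const J C c)) t \<cdot>\<^bsub>A \<times>\<^sub>c C\<^esub> \<lblot>e, h\<rblot> = \<lblot>onAr k t \<cdot>\<^bsub>A\<^esub> e, h\<rblot>" if "t \<in> hom J Z j" for
      t j
      using hom_Ar[OF that] FD(2) Id_comp[OF C h] by simp
    have "\<exists>!t. t \<in> hom J Z j' \<and> onAr (pairF k (const J C c)) t \<cdot>\<^bsub>A \<times>\<^sub>c C\<^esub> \<lblot>e, h\<rblot> = g'"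
      if j': "j' \<in> Ob J" and g': "g' \<in> hom (A \<times>\<^sub>c C) x (onOb (pairF k (const J C c)) j')"
        and eq: "Id C c \<cdot>\<^bsub>C\<^esub> onAr (proj2 A C) g' = h" for j' g'
    proof -
      obtain g1 g2 where g: "g' = \<lblot>g1, g2\<rblot>" "g1 \<in> hom A a (onOb k j')" "g2 \<in> hom C c' c"
        using g' x by (auto simp: kO[OF j'] hom_prod_cat)
      then have "g2 = h" using eq Id_comp[OF C g(3)] by (simp add: hom_Ar)
      then have "t \<in> hom J Z j' \<and> onAr (pairF k (const J C c)) t \<cdot>\<^bsub>A \<times>\<^sub>c C\<^esub> \<lblot>e, h\<rblot> = g' \<longleftrightarrow>
          t \<in> hom J Z j' \<and> onAr k t \<cdot>\<^bsub>A\<^esub> e = g1" for t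
        using kA[of t j'] g(1) by (cases "t \<in> hom J Z j'") simp_all
      moreover have "\<exists>!t. t \<in> hom J Z j' \<and> onAr k t \<cdot>\<^bsub>A\<^esub> e = g1"
        using u j' g(2) unfolding universal_def FD(2,3) by blast
      ultimately show ?thesis by (simp only:)
    qed
    moreover have "\<lblot>e, h\<rblot> \<in> hom (A \<times>\<^sub>c C) x (onOb (pairF k (const J C c)) Z)"
      using Z h by (simp add: kO x)
    moreover have "Id C c \<cdot>\<^bsub>C\<^esub> onAr (proj2 A C) \<lblot>e, h\<rblot> = h"
      using hom_Ar[OF Z(2)] hom_Ar[OF h] Id_comp[OF C h] by simp
    ultimately show "\<exists>j\<in>Ob J. \<exists>g\<in>hom (A \<times>\<^sub>c C) x (onOb (pairF k (const J C c)) j). Id C c \<cdot>\<^bsub>C\<^esub> onAr (proj2 A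
      C) g = h \<and>
       (\<forall>j' \<in> Ob J. \<forall>g' \<in> hom (A \<times>\<^sub>c C) x (onOb (pairF k (const J C c)) j'). Id C c \<cdot>\<^bsub>C\<^esub> onAr (proj2 A C) g'
         = h \<longrightarrow>
          (\<exists>!t. t \<in> hom J j j' \<and> onAr (pairF k (const J C c)) t \<cdot>\<^bsub>A \<times>\<^sub>c C\<^esub> g = g'))"
      using Z(1) by blast
  qed
qed

lemma universal_idF:
  assumes "category A" "a \<in> Ob A" shows "universal (idF A) a a (Id A a)"
  by (rule universalI[OF idF_Fun[OF assms(1)]]) (use assms in \<open>auto simp: Id_hom comp_Id hom_Ar\<close>)

text \<open>The slice of a product functor is the product of the slices, and the slice of
  \<open>idF C\<close> over \<open>c\<close> has the terminal object \<open>(c, Id C c)\<close>. So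
  the parameter adds nothing to the index category.\<close>

lemma final_at_prodF:
  assumes fin: "final_at u t k \<kappa>" and u: "u \<in> Fun S T" and k: "k \<in> Fun J S" and C: "category C" and c: "c \<in>
    Ob C"
  shows "final_at (u \<times>\<^sub>f idF C) \<lblot>t, c\<rblot> (pairF k (const J C c)) (\<lambda>j. \<lblot>\<kappa> j, Id C c\<rblot>)"
proof -
  note FD = FunD[OF k] and FU = FunD[OF u]
  note cF = const_Fun[OF FD(4) C c]
  let ?k = "pairF k (const J C c)" and ?u = "u \<times>\<^sub>f idF C"
  note pk = pairF_Fun[OF k cF]
  have kO: "onOb ?k j = \<lblot>onOb k j, c\<rblot>" if "j \<in> Ob J" for j
    using that FD(2) by simp
  have uA: "onAr ?u \<lblot>g, l\<rblot> = \<lblot>onAr u g, l\<rblot>" if "g \<in> hom S a b" "l \<in> hom C a' b'" for g l a b a' b'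
    using that FU(2) by (simp add: hom_Ar)
  show ?thesis
  proof (rule final_atI[OF prodF_Fun[OF u idF_Fun[OF C]] pk])
    fix x m assume "x \<in> Ob (S \<times>\<^sub>c C)" and m: "m \<in> hom (T \<times>\<^sub>c C) (onOb ?u x) \<lblot>t, c\<rblot>"
    then obtain s c' where x: "x = \<lblot>s, c'\<rblot>" "s \<in> Ob S" "c' \<in> Ob C" by auto
    then obtain h l where m: "m = \<lblot>h, l\<rblot>" and h: "h \<in> hom T (onOb u s) t" and l: "l \<in> hom C c' c"
      using m FU(2) by (auto simp: hom_prod_cat)
    obtain j g where j: "j \<in> Ob J" and g: "g \<in> hom S s (onOb k j)" "\<kappa> j \<cdot>\<^bsub>T\<^esub> onAr u g = h"
      and un: "\<And>j' g'. j' \<in> Ob J \<Longrightarrow> g' \<in> hom S s (onOb k j') \<Longrightarrow> \<kappa> j' \<cdot>\<^bsub>T\<^esub> onAr u g' = h \<Longrightarrow>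
        \<exists>!t. t \<in> hom J j j' \<and> onAr k t \<cdot>\<^bsub>S\<^esub> g = g'"
      by (rule final_atE[OF fin u k x(2) h]) blast
    have kA: "onAr ?k t \<cdot>\<^bsub>S \<times>\<^sub>c C\<^esub> \<lblot>g, l\<rblot> = \<lblot>onAr k t \<cdot>\<^bsub>S\<^esub> g, l\<rblot>" if "t \<in> hom J j j'" for t j'
      using hom_Ar[OF that] FD(2) Id_comp[OF C l] by simp
    have "\<exists>!t. t \<in> hom J j j' \<and> onAr ?k t \<cdot>\<^bsub>S \<times>\<^sub>c C\<^esub> \<lblot>g, l\<rblot> = g'"
      if j': "j' \<in> Ob J" and g': "g' \<in> hom (S \<times>\<^sub>c C) x (onOb ?k j')"
        and eq: "\<lblot>\<kappa> j', Id C c\<rblot> \<cdot>\<^bsub>T \<times>\<^sub>c C\<^esub> onAr ?u g' = m" for j' g'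
    proof -
      obtain g1 g2 where g12: "g' = \<lblot>g1, g2\<rblot>" "g1 \<in> hom S s (onOb k j')" "g2 \<in> hom C c' c"
        using g' x by (auto simp: kO[OF j'] hom_prod_cat)
      then have "g2 = l" "\<kappa> j' \<cdot>\<^bsub>T\<^esub> onAr u g1 = h" using eq Id_comp[OF C g12(3)] m by (simp_all add: uA[OF
        g12(2,3)])
      then have "t \<in> hom J j j' \<and> onAr ?k t \<cdot>\<^bsub>S \<times>\<^sub>c C\<^esub> \<lblot>g, l\<rblot> = g' \<longleftrightarrow>
          t \<in> hom J j j' \<and> onAr k t \<cdot>\<^bsub>S\<^esub> g = g1" for t
        using kA[of t j'] g12(1) by (cases "t \<in> hom J j j'") simp_all
      then show ?thesis using un[OF j' g12(2) \<open>\<kappa> j' \<cdot>\<^bsub>T\<^esub> onAr u g1 = h\<close>] by (simp only:)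
    qed
    moreover have "\<lblot>g, l\<rblot> \<in> hom (S \<times>\<^sub>c C) x (onOb ?k j)"
      using g l by (simp add: kO[OF j] x)
    moreover have "\<lblot>\<kappa> j, Id C c\<rblot> \<cdot>\<^bsub>T \<times>\<^sub>c C\<^esub> onAr ?u \<lblot>g, l\<rblot> = m"
      using uA[OF g(1) l] g(2) Id_comp[OF C l] m by simp
    ultimately show "\<exists>j\<in>Ob J. \<exists>g\<in>hom (S \<times>\<^sub>c C) x (onOb ?k j). \<lblot>\<kappa> j, Id C c\<rblot> \<cdot>\<^bsub>T \<times>\<^sub>c C\<^esub> onAr ?u g = m \<and>
       (\<forall>j' \<in> Ob J. \<forall>g' \<in> hom (S \<times>\<^sub>c C) x (onOb ?k j'). \<lblot>\<kappa> j', Id C c\<rblot> \<cdot>\<^bsub>T \<times>\<^sub>c C\<^esub> onAr ?u g' = m \<longrightarrow>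
          (\<exists>!t. t \<in> hom J j j' \<and> onAr ?k t \<cdot>\<^bsub>S \<times>\<^sub>c C\<^esub> g = g'))"
      using j by blast
  qed
qed

lemma pair_cell_Nat:
  assumes \<kappa>: "\<kappa> \<in> Nat u (const J T t)" and u: "u \<in> Fun J T" and t: "t \<in> Ob T" and C: "category C" and c: "c \<in>
    Ob C"
  shows "\<lparr>NSrc = pairF u (const J C c), NTgt = const J (T \<times>\<^sub>c C) \<lblot>t, c\<rblot>, cmp = (\<lambda>j\<in>Ob J. \<lblot>cmp \<kappa> j, Id C c\<rblot>)\<rparr>
    \<in> Nat (pairF u (const J C c)) (const J (T \<times>\<^sub>c C) \<lblot>t, c\<rblot>)"
proof -
  note FD = FunD[OF u]
  note cF = const_Fun[OF FD(4) C c]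
  have tc: "\<lblot>t, c\<rblot> \<in> Ob (T \<times>\<^sub>c C)" using t c by simp
  show ?thesis
  proof (rule NatI[OF pairF_Fun[OF u cF] const_Fun[OF FD(4) category_prod_cat[OF FD(5) C] tc]], goal_cases)
    case (4 x)
    then show ?case using Nat_hom[OF \<kappa> u 4] FD(2) Id_hom[OF C c] by simp
  next
    case (5 x y f)
    then show ?case
      using Nat_natural[OF \<kappa> u 5] hom_Ob[OF FD(4) 5] hom_Ar[OF 5] FD(2) by simp
  qed auto
qed

context derivator_on
begin

section \<open>Three families of squares with invertible mates\<close>

lemma square_proj2:
  assumes u: "u \<in> SFun S A" and w: "w \<in> SFun B C"
  shows "square (S \<times>\<^sub>c B) (A \<times>\<^sub>c C) B C (u \<times>\<^sub>f w) (proj2 S B) (proj2 A C) w"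
  unfolding square_def
  using SFun_prodF[OF u w] SFun_proj2[OF SFunD(2)[OF u] SFunD(2)[OF w]] SFun_proj2[OF SFunD(3)[OF u]
    SFunD(3)[OF w]] w
    proj2_prodF[OF SFunD(1)[OF u] SFunD(1)[OF w]] by simp

text \<open>At a parameter \<open>t\<close> take \<open>J\<close> to be \<open>S\<close>, placed
  over \<open>t\<close>. For the source the identity of \<open>S\<close> is used in
  \<open>final_at_proj2\<close>, for the target the functor \<open>u\<close> with its universal
  arrows. With \<open>w\<close> an identity this is homotopy finality of \<open>u\<close>; with
  \<open>u\<close> an identity it is the compatibility of colimits with change of
  parameters.\<close>

lemma smate_proj2_iso:
  assumes u: "u \<in> SFun S A" and w: "w \<in> SFun B C" and X: "X \<in> Ob (V (A \<times>\<^sub>c C))"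
    and un: "\<And>a. a \<in> Ob A \<Longrightarrow> \<exists>Z e. universal u a Z e"
  shows "isomorphism (V B) (cmp (smate (u \<times>\<^sub>f w) (proj2 S B) (proj2 A C) w) X)"
proof -
  note S = SFunD(2)[OF u] and A = SFunD(3)[OF u] and B = SFunD(2)[OF w] and C = SFunD(3)[OF w]
  note sq = square_proj2[OF u w]
  note Sc = small_categoryD(1)[OF S] and Bc = small_categoryD(1)[OF B] and Cc = small_categoryD(1)[OF C]
  note iS = idF_Fun[OF Sc] and wF = SFunD(1)[OF w] and uF = SFunD(1)[OF u]
  show "isomorphism (V B) (cmp (smate (u \<times>\<^sub>f w) (proj2 S B) (proj2 A C) w) X)"
  proof (rule smate_iso_pointwise[OF sq X])
    fix t assume t: "t \<in> Ob B"
    note wt = Fun_Ob[OF wF t]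
    note cB = const_Fun[OF Sc Bc t]
    let ?j = "pairF (idF S) (const S B t)"
    have j: "?j \<in> SFun S (S \<times>\<^sub>c B)" by (rule SFun_pairF[OF SFun_idF[OF S] SFun_const[OF S B t]])
    have pj: "proj2 S B \<odot> ?j = const S B t" by (rule proj2_pairF[OF iS cB])
    have uj: "(u \<times>\<^sub>f w) \<odot> ?j = pairF u (const S C (onOb w t))"
      using prodF_pairF[OF iS cB uF wF] compF_const[OF Sc wF t] uF by simp
    let ?\<kappa> = "idN (const S B t)"
    have k: "cmp ?\<kappa> x = Id B t" if "x \<in> Ob S" for x using that FunD(2,3)[OF cB] by simp
    have "final_at (proj2 S B) t ?j (\<lambda>_. Id B t)"
      by (rule final_at_proj2[OF Bc iS t]) (use universal_idF[OF Sc] in blast)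
    then have "final_at (proj2 S B) t ?j (cmp ?\<kappa>)"
      using final_at_cong[of ?j "cmp ?\<kappa>" "\<lambda>_. Id B t"] k by simp
    moreover have "final_at (proj2 A C) (onOb w t) (pairF u (const S C (onOb w t))) (\<lambda>_. Id C (onOb w t))"
      by (rule final_at_proj2[OF Cc uF wt un])
    then have "final_at (proj2 A C) (onOb w t) ((u \<times>\<^sub>f w) \<odot> ?j) (\<lambda>x. onAr w (cmp ?\<kappa> x))"
      unfolding uj using final_at_cong[of "pairF u (const S C (onOb w t))" "\<lambda>x. onAr w (cmp ?\<kappa> x)" "\<lambda>_. Id C
        (onOb w t)"]
        k Fun_Id[OF wF t] FunD(2)[OF uF] by simp
    moreover have "?\<kappa> \<in> Nat (proj2 S B \<odot> ?j) (const S B t)" unfolding pj by (rule idN_Nat[OF cB])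
    ultimately show "\<exists>J j \<kappa>. j \<in> SFun J (S \<times>\<^sub>c B) \<and> \<kappa> \<in> Nat (proj2 S B \<odot> j) (const J B t) \<and>
        final_at (proj2 S B) t j (cmp \<kappa>) \<and> final_at (proj2 A C) (onOb w t) ((u \<times>\<^sub>f w) \<odot> j) (\<lambda>x. onAr w (cmp \<kappa>
          x))"
      using j by blast
  qed
qed

lemma square_lan:
  assumes u: "u \<in> SFun S T" and w: "w \<in> SFun B C"
  shows "square (S \<times>\<^sub>c B) (S \<times>\<^sub>c C) (T \<times>\<^sub>c B) (T \<times>\<^sub>c C) (idF S \<times>\<^sub>f w) (u \<times>\<^sub>f idF B) (u \<times>\<^sub>f idF C) (idF T \<times>\<^sub>f
    w)"
proof -
  note wF = SFunD(1)[OF w] and uF = SFunD(1)[OF u]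
  note i = idF_Fun[OF SFunD(4)[OF u]] idF_Fun[OF SFunD(5)[OF u]] idF_Fun[OF SFunD(4)[OF w]] idF_Fun[OF
    SFunD(5)[OF w]]
  show ?thesis
    unfolding square_def
    using SFun_prodF[OF SFun_idF[OF SFunD(2)[OF u]] w] SFun_prodF[OF u SFun_idF[OF SFunD(2)[OF w]]]
      SFun_prodF[OF u SFun_idF[OF SFunD(3)[OF w]]] SFun_prodF[OF SFun_idF[OF SFunD(3)[OF u]] w]
      prodF_compF[OF i(1) uF wF i(4)] prodF_compF[OF uF i(2) i(3) wF] uF wF by simp
qed

text \<open>At \<open>(t, b)\<close> both sides are colimits over the slice of \<open>u\<close> over
  \<open>t\<close>, with the parameter frozen at \<open>b\<close> in the source and at its image
  under \<open>w\<close> in the target. This makes the structure maps of \<open>lan_mor\<close>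
  invertible.\<close>

lemma smate_lan_iso:
  assumes u: "u \<in> SFun S T" and w: "w \<in> SFun B C" and X: "X \<in> Ob (V (S \<times>\<^sub>c C))"
  shows "isomorphism (V (T \<times>\<^sub>c B)) (cmp (smate (idF S \<times>\<^sub>f w) (u \<times>\<^sub>f idF B) (u \<times>\<^sub>f idF C) (idF T \<times>\<^sub>f w)) X)"
proof -
  note S = SFunD(2)[OF u] and T = SFunD(3)[OF u] and B = SFunD(2)[OF w] and C = SFunD(3)[OF w]
  note Sc = small_categoryD(1)[OF S] and Tc = small_categoryD(1)[OF T]
    and Bc = small_categoryD(1)[OF B] and Cc = small_categoryD(1)[OF C]
  note wF = SFunD(1)[OF w] and uF = SFunD(1)[OF u]
  note iS = idF_Fun[OF Sc] and iT = idF_Fun[OF Tc] and iB = idF_Fun[OF Bc] and iC = idF_Fun[OF Cc]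
  note sq = square_lan[OF u w]
  show "isomorphism (V (T \<times>\<^sub>c B)) (cmp (smate (idF S \<times>\<^sub>f w) (u \<times>\<^sub>f idF B) (u \<times>\<^sub>f idF C) (idF T \<times>\<^sub>f w)) X)"
  proof (rule smate_iso_pointwise[OF sq X])
    fix x assume "x \<in> Ob (T \<times>\<^sub>c B)"
    then obtain t b where x: "x = \<lblot>t, b\<rblot>" and t: "t \<in> Ob T" and b: "b \<in> Ob B" by auto
    note wb = Fun_Ob[OF wF b]
    let ?J = "slice_over u t" and ?k = "slice_over_proj u t" and ?c = "slice_over_cell u t"
    note J = small_slice_over[OF S T uF, of t] and kF = slice_over_proj_Fun[OF S T uF, of t]
    note Jc = small_categoryD(1)[OF J]
    note cN = slice_over_cell_Nat[OF S T uF t]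
    note cB = const_Fun[OF Jc Bc b]
    note fin = final_at_slice[OF S T uF, of t]
    let ?j = "pairF ?k (const ?J B b)"
    have j: "?j \<in> SFun ?J (S \<times>\<^sub>c B)" by (rule SFun_pairF[OF SFunI[OF J S kF] SFun_const[OF J B b]])
    have uj: "(u \<times>\<^sub>f idF B) \<odot> ?j = pairF (u \<odot> ?k) (const ?J B b)"
      using prodF_pairF[OF kF cB uF iB] cB by simp
    have pj: "(idF S \<times>\<^sub>f w) \<odot> ?j = pairF ?k (const ?J C (onOb w b))"
      using prodF_pairF[OF kF cB iS wF] compF_const[OF Jc wF b] kF by simp
    let ?\<kappa> = "\<lparr>NSrc = pairF (u \<odot> ?k) (const ?J B b), NTgt = const ?J (T \<times>\<^sub>c B) \<lblot>t, b\<rblot>,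
      cmp = (\<lambda>j\<in>Ob ?J. \<lblot>cmp ?c j, Id B b\<rblot>)\<rparr>"
    have kN: "?\<kappa> \<in> Nat ((u \<times>\<^sub>f idF B) \<odot> ?j) (const ?J (T \<times>\<^sub>c B) x)"
      unfolding uj x by (rule pair_cell_Nat[OF cN compF_Fun[OF kF uF] t Bc b])
    have s: "FSrc (pairF ?k z) = ?J" for z :: "'u sfunc" using FunD(2)[OF kF] by simp
    have cA: "cmp ?c i \<in> Ar T" if "i \<in> Ob ?J" for i
      using hom_Ar[OF Nat_hom[OF cN compF_Fun[OF kF uF] that]] .
    have "final_at (u \<times>\<^sub>f idF B) x ?j (\<lambda>i. \<lblot>cmp ?c i, Id B b\<rblot>)"
      unfolding x by (rule final_at_prodF[OF fin uF kF Bc b])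
    then have "final_at (u \<times>\<^sub>f idF B) x ?j (cmp ?\<kappa>)"
      using final_at_cong[of ?j "cmp ?\<kappa>" "\<lambda>i. \<lblot>cmp ?c i, Id B b\<rblot>"] s by simp
    moreover have "final_at (u \<times>\<^sub>f idF C) \<lblot>t, onOb w b\<rblot> (pairF ?k (const ?J C (onOb w b))) (\<lambda>i. \<lblot>cmp ?c i, Id
      C (onOb w b)\<rblot>)"
      by (rule final_at_prodF[OF fin uF kF Cc wb])
    then have "final_at (u \<times>\<^sub>f idF C) (onOb (idF T \<times>\<^sub>f w) x) ((idF S \<times>\<^sub>f w) \<odot> ?j) (\<lambda>i. onAr (idF T \<times>\<^sub>f w)
      (cmp ?\<kappa> i))"
      unfolding pj x
      using final_at_cong[of "pairF ?k (const ?J C (onOb w b))" "\<lambda>i. onAr (idF T \<times>\<^sub>f w) (cmp ?\<kappa> i)" "\<lambda>i. \<lblot>cmp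
        ?c i, Id C (onOb w b)\<rblot>"]
        s cA hom_Ar[OF Id_hom[OF Bc b]] Fun_Id[OF wF b] FunD(2)[OF wF] t b by simp
    ultimately show "\<exists>J j \<kappa>. j \<in> SFun J (S \<times>\<^sub>c B) \<and> \<kappa> \<in> Nat ((u \<times>\<^sub>f idF B) \<odot> j) (const J (T \<times>\<^sub>c B) x) \<and>
        final_at (u \<times>\<^sub>f idF B) x j (cmp \<kappa>) \<and>
        final_at (u \<times>\<^sub>f idF C) (onOb (idF T \<times>\<^sub>f w) x) ((idF S \<times>\<^sub>f w) \<odot> j) (\<lambda>i. onAr (idF T \<times>\<^sub>f w) (cmp \<kappa> i))"
      using j kN by blast
  qed
qed

lemma square_fibre:
  assumes u: "u \<in> SFun S T" and j: "j \<in> SFun J S" and t: "t \<in> Ob T" and uj: "u \<odot> j = const J T t"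
    and B: "small_category B"
  shows "square (J \<times>\<^sub>c B) (S \<times>\<^sub>c B) B (T \<times>\<^sub>c B) (j \<times>\<^sub>f idF B) (proj2 J B) (u \<times>\<^sub>f idF B) (section_at T t B)"
proof -
  note S = SFunD(2)[OF u] and T = SFunD(3)[OF u] and J = SFunD(2)[OF j]
  note Tc = small_categoryD(1)[OF T]
    and Bc = small_categoryD(1)[OF B] and Jc = small_categoryD(1)[OF J]
  note uF = SFunD(1)[OF u] and jF = SFunD(1)[OF j]
  note iB = idF_Fun[OF Bc]
  note sec = section_at_Fun[OF Tc Bc t] and prj = proj2_Fun[OF Jc Bc]
  have "(u \<times>\<^sub>f idF B) \<odot> (j \<times>\<^sub>f idF B) = const J T t \<times>\<^sub>f idF B"
    using prodF_compF[OF jF uF iB iB] uj iB by simp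
  \<comment> \<open>Both functors send \<open>(x, b)\<close> to \<open>(t, b)\<close>.\<close>
  also have "\<dots> = section_at T t B \<odot> proj2 J B"
  proof (rule Fun_eqI[OF prodF_Fun[OF const_Fun[OF Jc Tc t] iB] compF_Fun[OF prj sec]])
    note cs = FunD(2)[OF const_Fun[OF Jc Tc t]]
    show "onOb (const J T t \<times>\<^sub>f idF B) x = onOb (section_at T t B \<odot> proj2 J B) x" if "x \<in> Ob (J \<times>\<^sub>c B)" for x
      using that cs by (auto simp: compF_Ob[OF prj that] section_at_def)
    show "onAr (const J T t \<times>\<^sub>f idF B) g = onAr (section_at T t B \<odot> proj2 J B) g" if "g \<in> hom (J \<times>\<^sub>c B) x y"
      for x y g
      using hom_Ar[OF that] cs by (auto simp: compF_Ar[OF prj hom_Ar[OF that]] section_at_def)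
  qed
  finally show "square (J \<times>\<^sub>c B) (S \<times>\<^sub>c B) B (T \<times>\<^sub>c B) (j \<times>\<^sub>f idF B) (proj2 J B) (u \<times>\<^sub>f idF B) (section_at T
    t B)"
    unfolding square_def
    using SFun_prodF[OF j SFun_idF[OF B]] SFun_prodF[OF u SFun_idF[OF B]] SFun_proj2[OF J B]
      SFun_section_at[OF T B t] by simp
qed

text \<open>As \<open>j\<close> maps into the strict fibre over \<open>t\<close>, the cocone has
  identity components, and \<open>fin\<close> says that this fibre is final in the slice. Over each
  parameter the two sides are then colimits over \<open>J\<close>.\<close>

lemma smate_fibre_iso:
  assumes u: "u \<in> SFun S T" and j: "j \<in> SFun J S" and t: "t \<in> Ob T" and uj: "u \<odot> j = const J T t"
    and fin: "final_at u t j (\<lambda>_. Id T t)" and B: "small_category B" and X: "X \<in> Ob (V (S \<times>\<^sub>c B))"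
  shows "isomorphism (V B) (cmp (smate (j \<times>\<^sub>f idF B) (proj2 J B) (u \<times>\<^sub>f idF B) (section_at T t B)) X)"
proof -
  note S = SFunD(2)[OF u] and T = SFunD(3)[OF u] and J = SFunD(2)[OF j]
  note Bc = small_categoryD(1)[OF B] and Jc = small_categoryD(1)[OF J]
  note uF = SFunD(1)[OF u] and jF = SFunD(1)[OF j]
  note iB = idF_Fun[OF Bc] and iJ = idF_Fun[OF Jc]
  note sq = square_fibre[OF u j t uj B]
  show "isomorphism (V B) (cmp (smate (j \<times>\<^sub>f idF B) (proj2 J B) (u \<times>\<^sub>f idF B) (section_at T t B)) X)"
  proof (rule smate_iso_pointwise[OF sq X])
    fix b assume b: "b \<in> Ob B"
    note cB = const_Fun[OF Jc Bc b]
    let ?j = "pairF (idF J) (const J B b)" and ?\<kappa> = "idN (const J B b)"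
    have jj: "?j \<in> SFun J (J \<times>\<^sub>c B)" by (rule SFun_pairF[OF SFun_idF[OF J] SFun_const[OF J B b]])
    have pj: "proj2 J B \<odot> ?j = const J B b" by (rule proj2_pairF[OF iJ cB])
    have jk: "(j \<times>\<^sub>f idF B) \<odot> ?j = pairF j (const J B b)"
      using prodF_pairF[OF iJ cB jF iB] jF cB by simp
    have k: "cmp ?\<kappa> x = Id B b" if "x \<in> Ob J" for x using that FunD(2,3)[OF cB] by simp
    have "final_at (proj2 J B) b ?j (\<lambda>_. Id B b)"
      by (rule final_at_proj2[OF Bc iJ b]) (use universal_idF[OF Jc] in blast)
    then have "final_at (proj2 J B) b ?j (cmp ?\<kappa>)"
      using final_at_cong[of ?j "cmp ?\<kappa>" "\<lambda>_. Id B b"] k by simp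
    moreover have "final_at (u \<times>\<^sub>f idF B) \<lblot>t, b\<rblot> (pairF j (const J B b)) (\<lambda>_. \<lblot>Id T t, Id B b\<rblot>)"
      by (rule final_at_prodF[OF fin uF jF Bc b])
    then have "final_at (u \<times>\<^sub>f idF B) (onOb (section_at T t B) b) ((j \<times>\<^sub>f idF B) \<odot> ?j) (\<lambda>x. onAr (section_at
      T t B) (cmp ?\<kappa> x))"
      unfolding jk using final_at_cong[of "pairF j (const J B b)" "\<lambda>x. onAr (section_at T t B) (cmp ?\<kappa> x)"
        "\<lambda>_. \<lblot>Id T t, Id B b\<rblot>"]
        k b FunD(2)[OF jF] hom_Ar[OF Id_hom[OF Bc b]] by (simp add: section_at_def)
    moreover have "?\<kappa> \<in> Nat (proj2 J B \<odot> ?j) (const J B b)" unfolding pj by (rule idN_Nat[OF cB])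
    ultimately show "\<exists>K k \<kappa>. k \<in> SFun K (J \<times>\<^sub>c B) \<and> \<kappa> \<in> Nat (proj2 J B \<odot> k) (const K B b) \<and>
        final_at (proj2 J B) b k (cmp \<kappa>) \<and>
        final_at (u \<times>\<^sub>f idF B) (onOb (section_at T t B) b) ((j \<times>\<^sub>f idF B) \<odot> k) (\<lambda>x. onAr (section_at T t B)
          (cmp \<kappa> x))"
      using jj by blast
  qed
qed

end

section \<open>Morphisms and modifications\<close>

text \<open>The part of the prederivator structure on which the composition of morphisms and the
  inversion of modifications rely. It is singled out because it passes directly from
  \<open>D\<close> to \<open>shift D A\<close>.\<close>

definition pull_functorial :: "('u::universe, 'o, 'm) prederiv \<Rightarrow> bool" where
  "pull_functorial D \<longleftrightarrow> (\<forall>A B u. u \<in> SFun A B \<longrightarrow> pull D u \<in> Fun (val D B) (val D A)) \<and>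
     (\<forall>A B u v \<alpha>. u \<in> SFun A B \<and> \<alpha> \<in> Nat u v \<longrightarrow> pull2 D \<alpha> \<in> Nat (pull D u) (pull D v))"

lemma pull_functorialD:
  assumes "pull_functorial D"
  shows "u \<in> SFun A B \<Longrightarrow> pull D u \<in> Fun (val D B) (val D A)"
    and "u \<in> SFun A B \<Longrightarrow> \<alpha> \<in> Nat u v \<Longrightarrow> pull2 D \<alpha> \<in> Nat (pull D u) (pull D v)"
  using assms unfolding pull_functorial_def by blast+

lemma (in prederivator_on) pull_functorial: "pull_functorial D"
  unfolding pull_functorial_def using pull_Fun pull2_Nat by blast

lemma (in prederivator_on) pull_functorial_shift:
  assumes A: "small_category A" shows "pull_functorial (shift D A)"
  unfolding pull_functorial_def
proof (intro conjI allI impI)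
  fix B C :: "'u scat" and u assume u: "u \<in> SFun B C"
  then show "pull (shift D A) u \<in> Fun (val (shift D A) C) (val (shift D A) B)"
    using pull_Fun[OF SFun_prodF[OF SFun_idF[OF A] u]] by (simp add: shift_def)
next
  fix B C :: "'u scat" and u v \<alpha> assume "u \<in> SFun B C \<and> \<alpha> \<in> Nat u v"
  then show "pull2 (shift D A) \<alpha> \<in> Nat (pull (shift D A) u) (pull (shift D A) v)"
    using pull2_Nat[OF SFun_prodF[OF SFun_idF[OF A]] prodN_id_Nat(1)[OF small_categoryD(1)[OF A] SFunD(1)]]
    by (auto simp: shift_def)
qed

lemma derivator_morphismD:
  assumes "derivator_morphism D E F"
  shows mor_Fun: "small_category B \<Longrightarrow> mfun F B \<in> Fun (val D B) (val E B)"
    and mor_iso: "w \<in> SFun B C \<Longrightarrow> natural_iso (mfun F B \<odot> pull D w) (pull E w \<odot> mfun F C) (mstr F w)"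
    and mor_idF: "small_category B \<Longrightarrow> mstr F (idF B) = idN (mfun F B)"
    and mor_comp: "v \<in> SFun A B \<Longrightarrow> w \<in> SFun B C \<Longrightarrow> X \<in> Ob (val D C) \<Longrightarrow>
      cmp (mstr F (w \<odot> v)) X = onAr (pull E v) (cmp (mstr F w) X) \<cdot>\<^bsub>val E A\<^esub> cmp (mstr F v) (onOb (pull D w)
        X)"
    and mor_2cell: "v \<in> SFun B C \<Longrightarrow> \<alpha> \<in> Nat v w \<Longrightarrow> X \<in> Ob (val D C) \<Longrightarrow>
      cmp (pull2 E \<alpha>) (onOb (mfun F C) X) \<cdot>\<^bsub>val E B\<^esub> cmp (mstr F v) X =
        cmp (mstr F w) X \<cdot>\<^bsub>val E B\<^esub> onAr (mfun F B) (cmp (pull2 D \<alpha>) X)"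
proof -
  note m = assms[unfolded derivator_morphism_def]
  show "small_category B \<Longrightarrow> mfun F B \<in> Fun (val D B) (val E B)"
    using m[THEN conjunct1] by blast
  show "w \<in> SFun B C \<Longrightarrow> natural_iso (mfun F B \<odot> pull D w) (pull E w \<odot> mfun F C) (mstr F w)"
    by (rule m[THEN conjunct2, THEN conjunct1, rule_format]) (simp add: SFun_def)
  show "small_category B \<Longrightarrow> mstr F (idF B) = idN (mfun F B)"
    using m[THEN conjunct2, THEN conjunct2, THEN conjunct1] by blast
  show "v \<in> SFun A B \<Longrightarrow> w \<in> SFun B C \<Longrightarrow> X \<in> Ob (val D C) \<Longrightarrow>
      cmp (mstr F (w \<odot> v)) X = onAr (pull E v) (cmp (mstr F w) X) \<cdot>\<^bsub>val E A\<^esub> cmp (mstr F v) (onOb (pull D w)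
        X)"
    by (rule m[THEN conjunct2, THEN conjunct2, THEN conjunct2, THEN conjunct1, rule_format, of A B C])
      (simp_all add: SFun_def)
  show "v \<in> SFun B C \<Longrightarrow> \<alpha> \<in> Nat v w \<Longrightarrow> X \<in> Ob (val D C) \<Longrightarrow>
      cmp (pull2 E \<alpha>) (onOb (mfun F C) X) \<cdot>\<^bsub>val E B\<^esub> cmp (mstr F v) X =
        cmp (mstr F w) X \<cdot>\<^bsub>val E B\<^esub> onAr (mfun F B) (cmp (pull2 D \<alpha>) X)"
    by (rule m[THEN conjunct2, THEN conjunct2, THEN conjunct2, THEN conjunct2, rule_format, of B C v w])
      (auto simp: SFun_def dest: NatD(1))
qed

lemma derivator_morphismI:
  assumes "\<And>B. small_category B \<Longrightarrow> mfun F B \<in> Fun (val D B) (val E B)"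
    and "\<And>B C w. w \<in> SFun B C \<Longrightarrow> natural_iso (mfun F B \<odot> pull D w) (pull E w \<odot> mfun F C) (mstr F w)"
    and "\<And>B. small_category B \<Longrightarrow> mstr F (idF B) = idN (mfun F B)"
    and "\<And>A B C v w X. v \<in> SFun A B \<Longrightarrow> w \<in> SFun B C \<Longrightarrow> X \<in> Ob (val D C) \<Longrightarrow>
      cmp (mstr F (w \<odot> v)) X = onAr (pull E v) (cmp (mstr F w) X) \<cdot>\<^bsub>val E A\<^esub> cmp (mstr F v) (onOb (pull D w)
        X)"
    and "\<And>B C v w \<alpha> X. v \<in> SFun B C \<Longrightarrow> w \<in> SFun B C \<Longrightarrow> \<alpha> \<in> Nat v w \<Longrightarrow> X \<in> Ob (val D C) \<Longrightarrow>
      cmp (pull2 E \<alpha>) (onOb (mfun F C) X) \<cdot>\<^bsub>val E B\<^esub> cmp (mstr F v) X =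
        cmp (mstr F w) X \<cdot>\<^bsub>val E B\<^esub> onAr (mfun F B) (cmp (pull2 D \<alpha>) X)"
  shows "derivator_morphism D E F"
  unfolding derivator_morphism_def
proof (intro conjI allI impI ballI; (elim conjE)?)
qed (auto intro: assms(1,3) assms(2)[OF SFunI] assms(4)[OF SFunI SFunI] assms(5)[OF SFunI SFunI])

lemma mor_str_hom:
  assumes F: "derivator_morphism D E F" and D: "pull_functorial D" and w: "w \<in> SFun B C" and X: "X \<in> Ob (val
    D C)"
  shows "cmp (mstr F w) X \<in> hom (val E B) (onOb (mfun F B) (onOb (pull D w) X)) (onOb (pull E w) (onOb (mfun
    F C) X))"
proof -
  note p = pull_functorialD(1)[OF D w]
  have "mstr F w \<in> Nat (mfun F B \<odot> pull D w) (pull E w \<odot> mfun F C)"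
    using mor_iso[OF F w] by (simp add: natural_iso_def)
  from Nat_hom[OF this compF_Fun[OF p mor_Fun[OF F SFunD(2)[OF w]]] X]
  show ?thesis using X by (simp add: compF_Ob[OF p] compF_Ob[OF mor_Fun[OF F SFunD(3)[OF w]]])
qed

lemma mor_str_natural:
  assumes F: "derivator_morphism D E F" and D: "pull_functorial D" and w: "w \<in> SFun B C" and f: "f \<in> hom (val
    D C) X Y"
  shows "onAr (pull E w) (onAr (mfun F C) f) \<cdot>\<^bsub>val E B\<^esub> cmp (mstr F w) X =
    cmp (mstr F w) Y \<cdot>\<^bsub>val E B\<^esub> onAr (mfun F B) (onAr (pull D w) f)"
proof -
  note p = pull_functorialD(1)[OF D w]
  have "mstr F w \<in> Nat (mfun F B \<odot> pull D w) (pull E w \<odot> mfun F C)"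
    using mor_iso[OF F w] by (simp add: natural_iso_def)
  from Nat_natural[OF this compF_Fun[OF p mor_Fun[OF F SFunD(2)[OF w]]] f]
  show ?thesis by (simp add: compF_Ar[OF p hom_Ar[OF f]] compF_Ar[OF mor_Fun[OF F SFunD(3)[OF w]] hom_Ar[OF
    f]])
qed

text \<open>Pointwise inverses are chosen for all \<open>B\<close>; their compatibility with the
  structure maps follows by cancellation from that of \<mu>, so it has to be checked for \<mu>
  only.\<close>

lemma invertible_modificationI:
  fixes D :: "('u::universe, 'o, 'm) prederiv" and E :: "('u, 'p, 'n) prederiv"
  assumes D: "pull_functorial D" and E: "pull_functorial E"
    and F: "derivator_morphism D E F" and G: "derivator_morphism D E G"
    and iso: "\<And>B. small_category B \<Longrightarrow> natural_iso (mfun F B) (mfun G B) (\<mu> B)"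
    and str: "\<And>B C w X. w \<in> SFun B C \<Longrightarrow> X \<in> Ob (val D C) \<Longrightarrow>
      onAr (pull E w) (cmp (\<mu> C) X) \<cdot>\<^bsub>val E B\<^esub> cmp (mstr F w) X =
        cmp (mstr G w) X \<cdot>\<^bsub>val E B\<^esub> cmp (\<mu> B) (onOb (pull D w) X)"
  shows "invertible_modification D E F G \<mu>"
proof -
  let ?inv = "\<lambda>B \<beta>. \<beta> \<in> Nat (mfun G B) (mfun F B) \<and> vcomp \<beta> (\<mu> B) = idN (mfun F B) \<and>
    vcomp (\<mu> B) \<beta> = idN (mfun G B) \<and>
    (\<forall>x \<in> Ob (val D B). cmp \<beta> x \<cdot>\<^bsub>val E B\<^esub> cmp (\<mu> B) x = Id (val E B) (onOb (mfun F B) x)) \<and>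
    (\<forall>x \<in> Ob (val D B). cmp (\<mu> B) x \<cdot>\<^bsub>val E B\<^esub> cmp \<beta> x = Id (val E B) (onOb (mfun G B) x))"
  have "\<exists>\<beta>. ?inv B \<beta>" if B: "small_category B" for B
    by (rule natural_iso_inverse[OF iso[OF B] mor_Fun[OF F B]]) blast
  then have "\<forall>B. \<exists>\<beta>. small_category B \<longrightarrow> ?inv B \<beta>" by blast
  from choice[OF this] obtain \<nu> where "\<forall>B. small_category B \<longrightarrow> ?inv B (\<nu> B)" by blast
  then have \<nu>: "\<And>B. small_category B \<Longrightarrow> \<nu> B \<in> Nat (mfun G B) (mfun F B)"
    and inv: "\<And>B. small_category B \<Longrightarrow> vcomp (\<nu> B) (\<mu> B) = idN (mfun F B)" "\<And>B. small_category B \<Longrightarrow> vcomp (\<mu> B)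
      (\<nu> B) = idN (mfun G B)"
    and c1: "\<And>B x. small_category B \<Longrightarrow> x \<in> Ob (val D B) \<Longrightarrow> cmp (\<nu> B) x \<cdot>\<^bsub>val E B\<^esub> cmp (\<mu> B) x = Id (val E B)
      (onOb (mfun F B) x)"
    and c2: "\<And>B x. small_category B \<Longrightarrow> x \<in> Ob (val D B) \<Longrightarrow> cmp (\<mu> B) x \<cdot>\<^bsub>val E B\<^esub> cmp (\<nu> B) x = Id (val E B)
      (onOb (mfun G B) x)"
    by blast+
  have \<mu>: "\<mu> B \<in> Nat (mfun F B) (mfun G B)" if "small_category B" for B
    using natural_isoD(1)[OF iso[OF that] mor_Fun[OF F that]] .
  have "modification D E F G \<mu>"
    unfolding modification_def using \<mu> str[OF SFunI] by blast
  moreover have "modification D E G F \<nu>"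
    unfolding modification_def
  proof (intro conjI allI impI ballI)
    fix B C :: "'u scat" and w X assume w: "small_category B \<and> small_category C \<and> w \<in> Fun B C" and X: "X \<in> Ob
      (val D C)"
    then have B: "small_category B" and C: "small_category C" and w: "w \<in> SFun B C" by (auto simp: SFun_def)
    note p = pull_functorialD(1)[OF D w] and q = pull_functorialD(1)[OF E w]
    note wX = Fun_Ob[OF p X] and EB = FunD(5)[OF mor_Fun[OF F B]]
    note FC = mor_Fun[OF F C] and GC = mor_Fun[OF G C]
    note m = Nat_hom[OF \<mu>[OF C] FC X] and n = Nat_hom[OF \<nu>[OF C] GC X]
    note m' = Nat_hom[OF \<mu>[OF B] mor_Fun[OF F B] wX] and n' = Nat_hom[OF \<nu>[OF B] mor_Fun[OF G B] wX]
    note sF = mor_str_hom[OF F D w X] and sG = mor_str_hom[OF G D w X]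
    note wm = Fun_hom[OF q m] and wn = Fun_hom[OF q n]
    let ?wn = "onAr (pull E w) (cmp (\<nu> C) X)" and ?wm = "onAr (pull E w) (cmp (\<mu> C) X)"
    let ?m = "cmp (\<mu> B) (onOb (pull D w) X)" and ?n = "cmp (\<nu> B) (onOb (pull D w) X)"
    have 1: "?wn \<cdot>\<^bsub>val E B\<^esub> ?wm = Id (val E B) (onOb (pull E w) (onOb (mfun F C) X))"
      using Fun_comp[OF q m n] c1[OF C X] Fun_Id[OF q Fun_Ob[OF FC X]] by simp
    \<comment> \<open>The identity \<open>?m\<close> after \<open>?n\<close> is inserted,
      \<open>?m\<close> is traded for \<open>?wm\<close> by compatibility of \<mu>, and
      \<open>?wm\<close> cancels against \<open>?wn\<close>.\<close>
    have "?wn \<cdot>\<^bsub>val E B\<^esub> cmp (mstr G w) X = ?wn \<cdot>\<^bsub>val E B\<^esub> (cmp (mstr G w) X \<cdot>\<^bsub>val E B\<^esub> (?m \<cdot>\<^bsub>val E B\<^esub> ?n))"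
      using c2[OF B wX] comp_Id[OF EB sG] by simp
    also have "\<dots> = ?wn \<cdot>\<^bsub>val E B\<^esub> (?wm \<cdot>\<^bsub>val E B\<^esub> (cmp (mstr F w) X \<cdot>\<^bsub>val E B\<^esub> ?n))"
      using comp_assoc[OF EB n' m' sG] str[OF w X] comp_assoc[OF EB n' sF wm] by simp
    also have "\<dots> = cmp (mstr F w) X \<cdot>\<^bsub>val E B\<^esub> ?n"
      using comp_assoc[OF EB comp_hom[OF EB n' sF] wm wn] 1 Id_comp[OF EB comp_hom[OF EB n' sF]] by simp
    finally show "?wn \<cdot>\<^bsub>val E B\<^esub> cmp (mstr G w) X = cmp (mstr F w) X \<cdot>\<^bsub>val E B\<^esub> ?n" .
  qed (rule \<nu>)
  ultimately show ?thesis unfolding invertible_modification_def using inv by blast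
qed

section \<open>Composition of morphisms of derivators\<close>

lemma comp_mor_simps:
  assumes F: "derivator_morphism D E F" and G: "derivator_morphism E H G" and D: "pull_functorial D" and E:
    "pull_functorial E"
  shows "mfun (G \<odot>\<^sub>m F) B = mfun G B \<odot> mfun F B"
    and "w \<in> SFun B C \<Longrightarrow> mstr (G \<odot>\<^sub>m F) w \<in> Nat (mfun (G \<odot>\<^sub>m F) B \<odot> pull D w) (pull H w \<odot> mfun (G \<odot>\<^sub>m F) C)"
    and "w \<in> SFun B C \<Longrightarrow> X \<in> Ob (val D C) \<Longrightarrow> cmp (mstr (G \<odot>\<^sub>m F) w) X =
      cmp (mstr G w) (onOb (mfun F C) X) \<cdot>\<^bsub>val H B\<^esub> onAr (mfun G B) (cmp (mstr F w) X)"
proof -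
  show "mfun (G \<odot>\<^sub>m F) B = mfun G B \<odot> mfun F B" for B by (simp add: comp_mor_def)
  note mf = this
  { assume w: "w \<in> SFun B C"
    note s = FunD(2,3)[OF SFunD(1)[OF w]]
    note FB = mor_Fun[OF F SFunD(2)[OF w]] and FC = mor_Fun[OF F SFunD(3)[OF w]]
      and GB = mor_Fun[OF G SFunD(2)[OF w]] and GC = mor_Fun[OF G SFunD(3)[OF w]]
    note pD = pull_functorialD(1)[OF D w] and pE = pull_functorialD(1)[OF E w]
    have Fw: "mstr F w \<in> Nat (mfun F B \<odot> pull D w) (pull E w \<odot> mfun F C)"
      and Gw: "mstr G w \<in> Nat (mfun G B \<odot> pull E w) (pull H w \<odot> mfun G C)"
      using mor_iso[OF F w] mor_iso[OF G w] by (simp_all add: natural_iso_def)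
    note L = whisker_left[OF compF_Fun[OF pD FB] Fw GB] and R = whisker_right[OF FC compF_Fun[OF pE GB] Gw]
    note as = compF_assoc[OF pD FB GB] compF_assoc[OF FC pE GB]
    \<comment> \<open>Nothing is assumed about \<open>pull H w\<close>, so this bracketing is
      checked directly on the records instead of by \<open>compF_assoc\<close>.\<close>
    have as': "pull H w \<odot> mfun G C \<odot> mfun F C = pull H w \<odot> (mfun G C \<odot> mfun F C)"
      using FunD(2)[OF FC] FunD(2)[OF GC] Fun_Ob[OF FC] hom_Ar[OF Fun_hom[OF FC Ar_hom]]
      by (auto simp: compF_def fun_eq_iff)
    note V = vcomp_Nat[OF L(1)[unfolded as] R(1) compF_Fun[OF pD compF_Fun[OF FB GB], unfolded as]]
    have ms: "mstr (G \<odot>\<^sub>m F) w = vcomp (hcomp (mstr G w) (idN (mfun F C))) (hcomp (idN (mfun G B)) (mstr F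
      w))"
      by (simp add: comp_mor_def s)
    show "mstr (G \<odot>\<^sub>m F) w \<in> Nat (mfun (G \<odot>\<^sub>m F) B \<odot> pull D w) (pull H w \<odot> mfun (G \<odot>\<^sub>m F) C)"
      unfolding ms mf using V(1) as as' by simp
    show "cmp (mstr (G \<odot>\<^sub>m F) w) X = cmp (mstr G w) (onOb (mfun F C) X) \<cdot>\<^bsub>val H B\<^esub> onAr (mfun G B) (cmp (mstr
      F w) X)"
      if X: "X \<in> Ob (val D C)"
      unfolding ms using V(2)[OF X] L(2)[OF X] R(2)[OF X] by simp }
qed

lemma derivator_morphism_comp_mor:
  assumes F: "derivator_morphism D E F" and G: "derivator_morphism E H G"
    and D: "pull_functorial D" and E: "pull_functorial E" and H: "pull_functorial H"
  shows "derivator_morphism D H (G \<odot>\<^sub>m F)"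
proof (rule derivator_morphismI)
  note cs = comp_mor_simps[OF F G D E]
  show Fn: "mfun (G \<odot>\<^sub>m F) B \<in> Fun (val D B) (val H B)" if "small_category B" for B
    unfolding cs(1) by (rule compF_Fun[OF mor_Fun[OF F that] mor_Fun[OF G that]])
  show "natural_iso (mfun (G \<odot>\<^sub>m F) B \<odot> pull D w) (pull H w \<odot> mfun (G \<odot>\<^sub>m F) C) (mstr (G \<odot>\<^sub>m F) w)" if w: "w
    \<in> SFun B C" for B C w
  proof (rule natural_isoI[OF cs(2)[OF w] compF_Fun[OF pull_functorialD(1)[OF D w] Fn[OF SFunD(2)[OF w]]]])
    fix X assume X: "X \<in> Ob (val D C)"
    note FC = mor_Fun[OF F SFunD(3)[OF w]] and GB = mor_Fun[OF G SFunD(2)[OF w]]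
    note HB = FunD(5)[OF GB]
    have iF: "isomorphism (val E B) (cmp (mstr F w) X)"
      using natural_isoD(2)[OF mor_iso[OF F w] compF_Fun[OF pull_functorialD(1)[OF D w] mor_Fun[OF F
        SFunD(2)[OF w]]] X] .
    have iG: "isomorphism (val H B) (cmp (mstr G w) (onOb (mfun F C) X))"
      using natural_isoD(2)[OF mor_iso[OF G w] compF_Fun[OF pull_functorialD(1)[OF E w] GB] Fun_Ob[OF FC X]] .
    show "isomorphism (val H B) (cmp (mstr (G \<odot>\<^sub>m F) w) X)"
      unfolding cs(3)[OF w X]
      by (rule isomorphism_comp[OF HB Fun_hom[OF GB mor_str_hom[OF F D w X]] Fun_isomorphism[OF GB iF]
        mor_str_hom[OF G E w Fun_Ob[OF FC X]] iG])
  qed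
  show "mstr (G \<odot>\<^sub>m F) (idF B) = idN (mfun (G \<odot>\<^sub>m F) B)" if B: "small_category B" for B
  proof -
    note FB = mor_Fun[OF F B] and GB = mor_Fun[OF G B]
    have "mstr (G \<odot>\<^sub>m F) (idF B) = vcomp (hcomp (idN (mfun G B)) (idN (mfun F B))) (hcomp (idN (mfun G B))
      (idN (mfun F B)))"
      using mor_idF[OF F B] mor_idF[OF G B] by (simp add: comp_mor_def)
    also have "\<dots> = idN (mfun G B \<odot> mfun F B)"
    proof (rule Nat_eqI)
      note n = whisker_left[OF FB idN_Nat[OF FB] GB]
      show "vcomp (hcomp (idN (mfun G B)) (idN (mfun F B))) (hcomp (idN (mfun G B)) (idN (mfun F B)))
          \<in> Nat (mfun G B \<odot> mfun F B) (mfun G B \<odot> mfun F B)"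
        by (rule vcomp_Nat(1)[OF n(1) n(1) compF_Fun[OF FB GB]])
      show "idN (mfun G B \<odot> mfun F B) \<in> Nat (mfun G B \<odot> mfun F B) (mfun G B \<odot> mfun F B)"
        by (rule idN_Nat[OF compF_Fun[OF FB GB]])
      fix x assume x: "x \<in> Ob (val D B)"
      show "cmp (vcomp (hcomp (idN (mfun G B)) (idN (mfun F B))) (hcomp (idN (mfun G B)) (idN (mfun F B)))) x
        =
          cmp (idN (mfun G B \<odot> mfun F B)) x"
        using x FunD(2,3)[OF FB] FunD(2,3)[OF GB] Fun_Id[OF GB Fun_Ob[OF FB x]] Fun_Ob[OF GB Fun_Ob[OF FB x]]
          Id_comp[OF FunD(5)[OF GB] Id_hom[OF FunD(5)[OF GB]]]
        by (simp add: vcomp_Nat(2)[OF n(1) n(1) compF_Fun[OF FB GB] x] n(2) compF_Ob[OF FB])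
    qed (rule compF_Fun[OF FB GB])
    finally show ?thesis by (simp add: cs(1))
  qed
  show "cmp (mstr (G \<odot>\<^sub>m F) (w \<odot> v)) X =
      onAr (pull H v) (cmp (mstr (G \<odot>\<^sub>m F) w) X) \<cdot>\<^bsub>val H A\<^esub> cmp (mstr (G \<odot>\<^sub>m F) v) (onOb (pull D w) X)"
    if v: "v \<in> SFun A B" and w: "w \<in> SFun B C" and X: "X \<in> Ob (val D C)" for A B C v w X
  proof -
    note wv = SFun_comp[OF v w]
    note FC = mor_Fun[OF F SFunD(3)[OF w]] and GA = mor_Fun[OF G SFunD(2)[OF v]] and GB = mor_Fun[OF G
      SFunD(2)[OF w]]
    note HA = FunD(5)[OF GA]
    note pE = pull_functorialD(1)[OF E v] and pH = pull_functorialD(1)[OF H v]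
    note wX = Fun_Ob[OF pull_functorialD(1)[OF D w] X] and FX = Fun_Ob[OF FC X]
    note Fw = mor_str_hom[OF F D w X] and Fv = mor_str_hom[OF F D v wX]
    note Gw = mor_str_hom[OF G E w FX] and Gv = mor_str_hom[OF G E v Fun_Ob[OF pull_functorialD(1)[OF E w]
      FX]]
      and Gv' = mor_str_hom[OF G E v Fun_Ob[OF mor_Fun[OF F SFunD(2)[OF w]] wX]]
    note vFw = Fun_hom[OF pE Fw]
    note h = Fun_hom[OF GA Fv] Fun_hom[OF GA vFw] Gv Gv' Fun_hom[OF pH Gw] Fun_hom[OF pH Fun_hom[OF GB Fw]]
    have "cmp (mstr (G \<odot>\<^sub>m F) (w \<odot> v)) X = (onAr (pull H v) (cmp (mstr G w) (onOb (mfun F C) X)) \<cdot>\<^bsub>val H A\<^esub>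
        cmp (mstr G v) (onOb (pull E w) (onOb (mfun F C) X))) \<cdot>\<^bsub>val H A\<^esub>
        (onAr (mfun G A) (onAr (pull E v) (cmp (mstr F w) X)) \<cdot>\<^bsub>val H A\<^esub> onAr (mfun G A) (cmp (mstr F v)
          (onOb (pull D w) X)))"
      using cs(3)[OF wv X] mor_comp[OF F v w X] mor_comp[OF G v w FX] Fun_comp[OF GA Fv vFw] by simp
    \<comment> \<open>The two middle factors are exchanged by naturality of the structure map of
      \<open>G\<close> at \<open>v\<close>, applied to the structure map of \<open>F\<close> at
      \<open>w\<close>.\<close>
    also have "\<dots> = (onAr (pull H v) (cmp (mstr G w) (onOb (mfun F C) X)) \<cdot>\<^bsub>val H A\<^esub> onAr (pull H v) (onAr
      (mfun G B) (cmp (mstr F w) X))) \<cdot>\<^bsub>val H A\<^esub>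
        (cmp (mstr G v) (onOb (mfun F B) (onOb (pull D w) X)) \<cdot>\<^bsub>val H A\<^esub> onAr (mfun G A) (cmp (mstr F v)
          (onOb (pull D w) X)))"
      using mor_str_natural[OF G E v Fw]
        comp_assoc[OF HA h(1,2) comp_hom[OF HA h(3,5)]] comp_assoc[OF HA h(2,3,5)]
        comp_assoc[OF HA h(1,4) comp_hom[OF HA h(6,5)]] comp_assoc[OF HA h(4,6,5)] by simp
    also have "\<dots> = onAr (pull H v) (cmp (mstr (G \<odot>\<^sub>m F) w) X) \<cdot>\<^bsub>val H A\<^esub> cmp (mstr (G \<odot>\<^sub>m F) v) (onOb (pull D
      w) X)"
      using cs(3)[OF w X] cs(3)[OF v wX] Fun_comp[OF pH Fun_hom[OF GB Fw] Gw] by simp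
    finally show ?thesis .
  qed
  show "cmp (pull2 H \<alpha>) (onOb (mfun (G \<odot>\<^sub>m F) C) X) \<cdot>\<^bsub>val H B\<^esub> cmp (mstr (G \<odot>\<^sub>m F) v) X =
      cmp (mstr (G \<odot>\<^sub>m F) w) X \<cdot>\<^bsub>val H B\<^esub> onAr (mfun (G \<odot>\<^sub>m F) B) (cmp (pull2 D \<alpha>) X)"
    if v: "v \<in> SFun B C" and w: "w \<in> SFun B C" and a: "\<alpha> \<in> Nat v w" and X: "X \<in> Ob (val D C)" for B C v w \<alpha> X
  proof -
    note FC = mor_Fun[OF F SFunD(3)[OF v]] and FB = mor_Fun[OF F SFunD(2)[OF v]] and GB = mor_Fun[OF G
      SFunD(2)[OF v]]
      and GC = mor_Fun[OF G SFunD(3)[OF v]]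
    note HB = FunD(5)[OF GB]
    note FX = Fun_Ob[OF FC X]
    note aD = Nat_hom[OF pull_functorialD(2)[OF D v a] pull_functorialD(1)[OF D v] X]
      and aE = Nat_hom[OF pull_functorialD(2)[OF E v a] pull_functorialD(1)[OF E v] FX]
      and aH = Nat_hom[OF pull_functorialD(2)[OF H v a] pull_functorialD(1)[OF H v] Fun_Ob[OF GC FX]]
    note Fv = mor_str_hom[OF F D v X] and Fw = mor_str_hom[OF F D w X]
      and Gv = mor_str_hom[OF G E v FX] and Gw = mor_str_hom[OF G E w FX]
    have "cmp (pull2 H \<alpha>) (onOb (mfun G C) (onOb (mfun F C) X)) \<cdot>\<^bsub>val H B\<^esub>
        (cmp (mstr G v) (onOb (mfun F C) X) \<cdot>\<^bsub>val H B\<^esub> onAr (mfun G B) (cmp (mstr F v) X)) =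
      cmp (mstr G w) (onOb (mfun F C) X) \<cdot>\<^bsub>val H B\<^esub> onAr (mfun G B) (cmp (pull2 E \<alpha>) (onOb (mfun F C) X)
        \<cdot>\<^bsub>val E B\<^esub> cmp (mstr F v) X)"
      using comp_assoc[OF HB Fun_hom[OF GB Fv] Gv aH] mor_2cell[OF G v a FX]
        comp_assoc[OF HB Fun_hom[OF GB Fv] Fun_hom[OF GB aE] Gw] Fun_comp[OF GB Fv aE] by simp
    also have "\<dots> = (cmp (mstr G w) (onOb (mfun F C) X) \<cdot>\<^bsub>val H B\<^esub> onAr (mfun G B) (cmp (mstr F w) X)) \<cdot>\<^bsub>val H
      B\<^esub>
        onAr (mfun G B) (onAr (mfun F B) (cmp (pull2 D \<alpha>) X))"
      using mor_2cell[OF F v a X] Fun_comp[OF GB Fun_hom[OF FB aD] Fw]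
        comp_assoc[OF HB Fun_hom[OF GB Fun_hom[OF FB aD]] Fun_hom[OF GB Fw] Gw] by simp
    finally show ?thesis
      using cs(3)[OF v X] cs(3)[OF w X] by (simp add: cs(1) compF_Ob[OF FC X] compF_Ar[OF FB hom_Ar[OF aD]])
  qed
qed

section \<open>Restriction, evaluation, Kan extension and colimit as morphisms of derivators\<close>

context derivator_on
begin

text \<open>The common form of \<open>pull_mor\<close> and \<open>eval_mor\<close>: restriction
  along functors \<open>k C\<close> that commute strictly with the parameter functors. The structure
  maps are identities, so coherence amounts to equations in Cat. The families \<open>a\<close> and
  \<open>b\<close> describe source and target derivator on a parameter category.\<close>

lemma strict_morphism:
  assumes k: "\<And>C. small_category C \<Longrightarrow> k C \<in> SFun (b C) (a C)"
    and p: "\<And>B C w. w \<in> SFun B C \<Longrightarrow> p w \<in> SFun (a B) (a C)"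
    and v: "\<And>B C w. w \<in> SFun B C \<Longrightarrow> v w \<in> SFun (b B) (b C)"
    and comm: "\<And>B C w. w \<in> SFun B C \<Longrightarrow> k C \<odot> v w = p w \<odot> k B"
    and pid: "\<And>B. small_category B \<Longrightarrow> p (idF B) = idF (a B)"
    and pcomp: "\<And>A B C w' w. w' \<in> SFun A B \<Longrightarrow> w \<in> SFun B C \<Longrightarrow> p (w \<odot> w') = p w \<odot> p w'"
    and cell: "\<And>B C w w' \<alpha>. w \<in> SFun B C \<Longrightarrow> \<alpha> \<in> Nat w w' \<Longrightarrow>
      pp \<alpha> \<in> Nat (p w) (p w') \<and> vv \<alpha> \<in> Nat (v w) (v w') \<and> hcomp (pp \<alpha>) (idN (k B)) = hcomp (idN (k C)) (vv \<alpha>)"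
    and D1: "val D1 = (\<lambda>C. V (a C))" "pull D1 = (\<lambda>w. pull D (p w))" "pull2 D1 = (\<lambda>\<alpha>. pull2 D (pp \<alpha>))"
    and D2: "val D2 = (\<lambda>C. V (b C))" "pull D2 = (\<lambda>w. pull D (v w))" "pull2 D2 = (\<lambda>\<alpha>. pull2 D (vv \<alpha>))"
    and F: "mfun F = (\<lambda>C. pull D (k C))"
      "\<And>B C w. w \<in> SFun B C \<Longrightarrow> mstr F w = idN (pull D (k B) \<odot> pull D (p w))"
  shows "derivator_morphism D1 D2 F"
proof -
  have eq: "pull D (k B) \<odot> pull D (p w) = pull D (v w) \<odot> pull D (k C)" if w: "w \<in> SFun B C" for B C w
    using pull_compF[OF k[OF SFunD(2)[OF w]] p[OF w]] pull_compF[OF v[OF w] k[OF SFunD(3)[OF w]]] comm[OF w]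
      by simp
  have Fn: "pull D (k B) \<odot> pull D (p w) \<in> Fun (V (a C)) (V (b B))" if w: "w \<in> SFun B C" for B C w
    by (rule compF_Fun[OF pull_Fun[OF p[OF w]] pull_Fun[OF k[OF SFunD(2)[OF w]]]])
  have c: "cmp (mstr F w) X = Id (V (b B)) (k B \<star> p w \<star> X)" if w: "w \<in> SFun B C" and X: "X \<in> Ob (V (a C))"
    for B C w X
    using X FunD(2,3)[OF Fn[OF w]] unfolding F(2)[OF w] by (simp add: compF_Ob[OF pull_Fun[OF p[OF w]] X])
  have kX: "k B \<star> p w \<star> X = v w \<star> k C \<star> X" if w: "w \<in> SFun B C" and X: "X \<in> Ob (V (a C))" for B C w X
    using eq[OF w] compF_Ob[OF pull_Fun[OF p[OF w]] X] compF_Ob[OF pull_Fun[OF k[OF SFunD(3)[OF w]]] X] by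
      metis
  show ?thesis
  proof (rule derivator_morphismI; (unfold D1 D2 F(1))?)
    show "pull D (k B) \<in> Fun (V (a B)) (V (b B))" if "small_category B" for B by (rule pull_Fun[OF k[OF
      that]])
    show "natural_iso (pull D (k B) \<odot> pull D (p w)) (pull D (v w) \<odot> pull D (k C)) (mstr F w)" if w: "w \<in> SFun
      B C" for B C w
    proof (rule natural_isoI[OF _ Fn[OF w]])
      show "mstr F w \<in> Nat (pull D (k B) \<odot> pull D (p w)) (pull D (v w) \<odot> pull D (k C))"
        using idN_Nat[OF Fn[OF w]] eq[OF w] F(2)[OF w] by simp
      show "isomorphism (V (b B)) (cmp (mstr F w) X)" if X: "X \<in> Ob (V (a C))" for X
        unfolding c[OF w X]
        using isomorphism_Id[OF V_category[OF SFunD(2)[OF v[OF w]]]] star_Ob[OF k[OF SFunD(2)[OF w]]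
          star_Ob[OF p[OF w] X]] .
    qed
    show "mstr F (idF B) = idN (pull D (k B))" if B: "small_category B" for B
      using F(2)[OF SFun_idF[OF B]] pid[OF B] pull_idF[OF SFunD(3)[OF k[OF B]]] pull_Fun[OF k[OF B]] by simp
  next
    fix A B C w' w X assume w': "w' \<in> SFun A B" and w: "w \<in> SFun B C" and X: "X \<in> Ob (V (a C))"
    note wX = star_Ob[OF p[OF w] X]
    note kwX = star_Ob[OF k[OF SFunD(2)[OF w]] wX]
    note h = Id_hom[OF V_category[OF SFunD(2)[OF v[OF w']]] star_Ob[OF k[OF SFunD(2)[OF w']] star_Ob[OF p[OF
      w'] wX]]]
    show "cmp (mstr F (w \<odot> w')) X = v w' \<bullet> cmp (mstr F w) X \<cdot>\<^bsub>V (b A)\<^esub> cmp (mstr F w') (p w \<star> X)"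
      unfolding c[OF SFun_comp[OF w' w] X] c[OF w X] c[OF w' wX] pcomp[OF w' w] star_compF[OF p[OF w'] p[OF
        w] X]
        bullet_Id[OF v[OF w'] kwX]
      using kX[OF w' wX] Id_comp[OF V_category[OF SFunD(2)[OF v[OF w']]] h] by simp
  next
    fix B C w w' \<alpha> X assume w: "w \<in> SFun B C" and w': "w' \<in> SFun B C" and a: "\<alpha> \<in> Nat w w'" and X: "X \<in> Ob (V
      (a C))"
    note kB = k[OF SFunD(2)[OF w]] and kC = k[OF SFunD(3)[OF w]]
    note pa = cell[OF w a, THEN conjunct1] and va = cell[OF w a, THEN conjunct2, THEN conjunct1]
    have "cmp (pull2 D (vv \<alpha>)) (k C \<star> X) = k B \<bullet> cmp (pull2 D (pp \<alpha>)) X"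
      using pull2_whisker_left[OF v[OF w] va kC X] pull2_whisker_right[OF kB p[OF w] pa X] cell[OF w a] by
        simp
    moreover have "k B \<bullet> cmp (pull2 D (pp \<alpha>)) X \<in> hom (V (b B)) (k B \<star> p w \<star> X) (k B \<star> p w' \<star> X)"
      by (rule bullet_hom[OF kB pull2_hom[OF p[OF w] pa X]])
    ultimately show "cmp (pull2 D (vv \<alpha>)) (k C \<star> X) \<cdot>\<^bsub>V (b B)\<^esub> cmp (mstr F w) X =
        cmp (mstr F w') X \<cdot>\<^bsub>V (b B)\<^esub> k B \<bullet> cmp (pull2 D (pp \<alpha>)) X"
      unfolding c[OF w X] c[OF w' X]
      using comp_Id Id_comp V_category[OF SFunD(2)[OF kB]] by metis
  qed
qed

text \<open>The common form of \<open>lan_mor\<close> and \<open>colim_mor\<close>: Kan extensions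
  along a family \<open>q\<close>, with mates as structure maps. Normalisation, composition and
  compatibility with 2-cells are \<open>smate_id\<close>, \<open>smate_paste\<close> and
  \<open>smate_2cell\<close>; invertibility of the mates is supplied by the pointwise
  computations.\<close>

lemma smate_morphism:
  assumes sq: "\<And>B C w. w \<in> SFun B C \<Longrightarrow> square (a B) (a C) (b B) (b C) (p w) (q B) (q C) (v w)"
    and iso: "\<And>B C w X. w \<in> SFun B C \<Longrightarrow> X \<in> Ob (V (a C)) \<Longrightarrow> isomorphism (V (b B)) (cmp (smate (p w) (q B) (q C)
      (v w)) X)"
    and pid: "\<And>B. small_category B \<Longrightarrow> p (idF B) = idF (a B)" "\<And>B. small_category B \<Longrightarrow> v (idF B) = idF (b B)"
    and pcomp: "\<And>A B C w' w. w' \<in> SFun A B \<Longrightarrow> w \<in> SFun B C \<Longrightarrow> p (w \<odot> w') = p w \<odot> p w'"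
      "\<And>A B C w' w. w' \<in> SFun A B \<Longrightarrow> w \<in> SFun B C \<Longrightarrow> v (w \<odot> w') = v w \<odot> v w'"
    and cell: "\<And>B C w w' \<alpha>. w \<in> SFun B C \<Longrightarrow> \<alpha> \<in> Nat w w' \<Longrightarrow>
      pp \<alpha> \<in> Nat (p w) (p w') \<and> vv \<alpha> \<in> Nat (v w) (v w') \<and> hcomp (idN (q C)) (pp \<alpha>) = hcomp (vv \<alpha>) (idN (q B))"
    and D1: "val D1 = (\<lambda>C. V (a C))" "pull D1 = (\<lambda>w. pull D (p w))" "pull2 D1 = (\<lambda>\<alpha>. pull2 D (pp \<alpha>))"
    and D2: "val D2 = (\<lambda>C. V (b C))" "pull D2 = (\<lambda>w. pull D (v w))" "pull2 D2 = (\<lambda>\<alpha>. pull2 D (vv \<alpha>))"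
    and F: "mfun F = (\<lambda>C. lan D (q C))"
      "\<And>B C w. w \<in> SFun B C \<Longrightarrow> mstr F w = smate (p w) (q B) (q C) (v w)"
  shows "derivator_morphism D1 D2 F"
proof -
  have q: "q B \<in> SFun (a B) (b B)" if "small_category B" for B
    using squareD(2)[OF sq[OF SFun_idF[OF that]]] .
  show ?thesis
  proof (rule derivator_morphismI; (unfold D1 D2 F(1))?)
    show "lan D (q B) \<in> Fun (V (a B)) (V (b B))" if "small_category B" for B by (rule lan_Fun[OF q[OF that]])
    show "natural_iso (lan D (q B) \<odot> pull D (p w)) (pull D (v w) \<odot> lan D (q C)) (mstr F w)" if w: "w \<in> SFun B
      C" for B C w
      unfolding F(2)[OF w]
      by (rule natural_isoI[OF smate_Nat[OF sq[OF w]] compF_Fun[OF pull_Fun[OF squareD(1)[OF sq[OF w]]]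
        lan_Fun[OF q[OF SFunD(2)[OF w]]]] iso[OF w]])
    show "mstr F (idF B) = idN (lan D (q B))" if B: "small_category B" for B
    proof -
      note qB = q[OF B] and lF = lan_Fun[OF q[OF B]]
      have "smate (idF (a B)) (q B) (q B) (idF (b B)) = idN (lan D (q B))"
      proof (rule Nat_eqI[OF _ idN_Nat[OF lF] lF])
        show "smate (idF (a B)) (q B) (q B) (idF (b B)) \<in> Nat (lan D (q B)) (lan D (q B))"
          using smate_Nat[OF square_id[OF qB]] lF by (simp add: pull_idF[OF SFunD(2)[OF qB]] pull_idF[OF
            SFunD(3)[OF qB]])
        show "cmp (smate (idF (a B)) (q B) (q B) (idF (b B))) X = cmp (idN (lan D (q B))) X" if "X \<in> Ob (V (a
          B))" for X
          using smate_id[OF qB that] that FunD(2,3)[OF lF] by simp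
      qed
      then show ?thesis using F(2)[OF SFun_idF[OF B]] pid[OF B] by simp
    qed
    show "cmp (mstr F (w \<odot> w')) X = v w' \<bullet> cmp (mstr F w) X \<cdot>\<^bsub>V (b A)\<^esub> cmp (mstr F w') (p w \<star> X)"
      if w': "w' \<in> SFun A B" and w: "w \<in> SFun B C" and X: "X \<in> Ob (V (a C))" for A B C w' w X
      using smate_paste[OF sq[OF w] sq[OF w'] X] pcomp[OF w' w] F(2)[OF w] F(2)[OF w'] F(2)[OF SFun_comp[OF
        w' w]] by simp
    show "cmp (pull2 D (vv \<alpha>)) (lan_Ob (q C) X) \<cdot>\<^bsub>V (b B)\<^esub> cmp (mstr F w) X =
        cmp (mstr F w') X \<cdot>\<^bsub>V (b B)\<^esub> lan_Ar (q B) (cmp (pull2 D (pp \<alpha>)) X)"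
      if w: "w \<in> SFun B C" and w': "w' \<in> SFun B C" and al: "\<alpha> \<in> Nat w w'" and X: "X \<in> Ob (V (a C))" for B C w
        w' \<alpha> X
      unfolding F(2)[OF w] F(2)[OF w'] using cell[OF w al] by (intro smate_2cell[OF sq[OF w] sq[OF w'] _ _ _
        X]) auto
  qed
qed

lemma pull_mor_morphism:
  assumes u: "u \<in> SFun S A"
  shows "derivator_morphism (shift D A) (shift D S) (pull_mor D u)"
proof (rule strict_morphism[where k = "\<lambda>C. u \<times>\<^sub>f idF C" and a = "\<lambda>C. A \<times>\<^sub>c C" and b = "\<lambda>C. S \<times>\<^sub>c C"
      and p = "\<lambda>w. idF A \<times>\<^sub>f w" and v = "\<lambda>w. idF S \<times>\<^sub>f w"
      and pp = "\<lambda>\<alpha>. idN (idF A) \<times>\<^sub>n \<alpha>" and vv = "\<lambda>\<alpha>. idN (idF S) \<times>\<^sub>n \<alpha>"], goal_cases)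
  case (1 C) then show ?case by (rule SFun_prodF[OF u SFun_idF])
next
  case (2 B C w) then show ?case by (rule SFun_prodF[OF SFun_idF[OF SFunD(3)[OF u]]])
next
  case (3 B C w) then show ?case by (rule SFun_prodF[OF SFun_idF[OF SFunD(2)[OF u]]])
next
  case (4 B C w)
  note w = SFunD(1)[OF 4] and uF = SFunD(1)[OF u]
  note i = idF_Fun[OF FunD(4)[OF w]] idF_Fun[OF FunD(5)[OF w]] idF_Fun[OF FunD(4)[OF uF]] idF_Fun[OF
    FunD(5)[OF uF]]
  show ?case using prodF_compF[OF i(3) uF w i(2)] prodF_compF[OF uF i(4) i(1) w] w uF by simp
next
  case (5 B) then show ?case using prodF_idF[OF SFunD(5)[OF u]] by (simp add: small_categoryD)
next
  case (6 A' B C w' w) then show ?case using prodF_idF_comp[OF SFunD(5)[OF u]] SFunD(1) by blast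
next
  case (7 B C w w' \<alpha>)
  note w = SFunD(1)[OF 7(1)]
  show ?case
    using prodN_id_Nat(1)[OF SFunD(5)[OF u] w 7(2)] prodN_id_Nat(1)[OF SFunD(4)[OF u] w 7(2)]
      prodN_whisker[OF SFunD(1)[OF u] w 7(2)] by simp
qed (auto simp: shift_def pull_mor_def FunD(3)[OF SFunD(1)[OF u]] dest: FunD(2)[OF SFunD(1)])

lemma eval_mor_morphism:
  assumes A: "small_category A" and x: "x \<in> Ob A"
  shows "derivator_morphism (shift D A) D (eval_mor D A x)"
proof (rule strict_morphism[where k = "section_at A x" and a = "\<lambda>C. A \<times>\<^sub>c C" and b = "\<lambda>C. C"
      and p = "\<lambda>w. idF A \<times>\<^sub>f w" and v = "\<lambda>w. w"
      and pp = "\<lambda>\<alpha>. idN (idF A) \<times>\<^sub>n \<alpha>" and vv = "\<lambda>\<alpha>. \<alpha>"], goal_cases)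
  note Ac = small_categoryD(1)[OF A]
  case (1 C) then show ?case by (rule SFun_section_at[OF A _ x])
next
  case (2 B C w) then show ?case by (rule SFun_prodF[OF SFun_idF[OF A]])
next
  case (4 B C w)
  show ?case using section_at_prodF[OF small_categoryD(1)[OF A] x SFunD(1)[OF 4]] by simp
next
  case (5 B) then show ?case using prodF_idF[OF small_categoryD(1)[OF A]] by (simp add: small_categoryD)
next
  case (6 A' B C w' w) then show ?case using prodF_idF_comp[OF small_categoryD(1)[OF A]] SFunD(1) by blast
next
  case (7 B C w w' \<alpha>)
  note w = SFunD(1)[OF 7(1)] and Ac = small_categoryD(1)[OF A]
  note w' = NatD(1)[OF 7(2) w]
  note Bc = FunD(4)[OF w] and Cc = FunD(5)[OF w]
  note sB = section_at_Fun[OF Ac Bc x] and sC = section_at_Fun[OF Ac Cc x]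
  note n = prodN_id_Nat[OF Ac w 7(2)]
  note L = whisker_left[OF w 7(2) sC] and R = whisker_right[OF sB prodF_Fun[OF idF_Fun[OF Ac] w] n(1)]
  \<comment> \<open>Both whiskerings have at \<open>y\<close> the component formed by the identity
    of \<open>x\<close> and the component of \<alpha> at \<open>y\<close>.\<close>
  have "hcomp (idN (idF A) \<times>\<^sub>n \<alpha>) (idN (section_at A x B)) = hcomp (idN (section_at A x C)) \<alpha>"
  proof (rule Nat_eqI[OF _ L(1) compF_Fun[OF w sC]])
    show "hcomp (idN (idF A) \<times>\<^sub>n \<alpha>) (idN (section_at A x B)) \<in> Nat (section_at A x C \<odot> w) (section_at A x C \<odot>
      w')"
      using R(1) section_at_prodF[OF Ac x w] section_at_prodF[OF Ac x w'] by simp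
    fix y assume y: "y \<in> Ob B"
    show "cmp (hcomp (idN (idF A) \<times>\<^sub>n \<alpha>) (idN (section_at A x B))) y = cmp (hcomp (idN (section_at A x C)) \<alpha>)
      y"
      unfolding L(2)[OF y] R(2)[OF y] using y hom_Ar[OF Nat_hom[OF 7(2) w y]] n(2)[OF x y] by (simp add:
        section_at_def)
  qed
  then show ?case using n(1) 7 by simp
qed (auto simp: shift_def eval_mor_def dest: FunD(2)[OF SFunD(1)])

lemma lan_mor_morphism:
  assumes u: "u \<in> SFun S T"
  shows "derivator_morphism (shift D S) (shift D T) (lan_mor D u)"
proof (rule smate_morphism[where q = "\<lambda>C. u \<times>\<^sub>f idF C" and a = "\<lambda>C. S \<times>\<^sub>c C" and b = "\<lambda>C. T \<times>\<^sub>c C"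
      and p = "\<lambda>w. idF S \<times>\<^sub>f w" and v = "\<lambda>w. idF T \<times>\<^sub>f w"
      and pp = "\<lambda>\<alpha>. idN (idF S) \<times>\<^sub>n \<alpha>" and vv = "\<lambda>\<alpha>. idN (idF T) \<times>\<^sub>n \<alpha>"], goal_cases)
  case (1 B C w) show ?case by (rule square_lan[OF u 1])
next
  case (2 B C w X) then show ?case by (rule smate_lan_iso[OF u])
next
  case (3 B) then show ?case using prodF_idF[OF SFunD(4)[OF u]] by (simp add: small_categoryD)
next
  case (4 B) then show ?case using prodF_idF[OF SFunD(5)[OF u]] by (simp add: small_categoryD)
next
  case (5 A' B C w' w) then show ?case using prodF_idF_comp[OF SFunD(4)[OF u]] SFunD(1) by blast
next
  case (6 A' B C w' w) then show ?case using prodF_idF_comp[OF SFunD(5)[OF u]] SFunD(1) by blast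
next
  case (7 B C w w' \<alpha>)
  note w = SFunD(1)[OF 7(1)]
  show ?case
    using prodN_id_Nat(1)[OF SFunD(5)[OF u] w 7(2)] prodN_id_Nat(1)[OF SFunD(4)[OF u] w 7(2)]
      prodN_whisker[OF SFunD(1)[OF u] w 7(2)] by simp
qed (auto simp: shift_def lan_mor_def FunD(2,3)[OF SFunD(1)[OF u]] dest: FunD(2,3)[OF SFunD(1)])

lemma colim_mor_morphism:
  assumes A: "small_category A"
  shows "derivator_morphism (shift D A) D (colim_mor D A)"
proof (rule smate_morphism[where q = "\<lambda>C. proj2 A C" and a = "\<lambda>C. A \<times>\<^sub>c C" and b = "\<lambda>C. C"
      and p = "\<lambda>w. idF A \<times>\<^sub>f w" and v = "\<lambda>w. w"
      and pp = "\<lambda>\<alpha>. idN (idF A) \<times>\<^sub>n \<alpha>" and vv = "\<lambda>\<alpha>. \<alpha>"], goal_cases)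
  case (1 B C w) show ?case by (rule square_proj2[OF SFun_idF[OF A] 1])
next
  case (2 B C w X)
  show ?case by (rule smate_proj2_iso[OF SFun_idF[OF A] 2]) (use universal_idF[OF small_categoryD(1)[OF A]]
    in blast)
next
  case (3 B) then show ?case using prodF_idF[OF small_categoryD(1)[OF A]] by (simp add: small_categoryD)
next
  case (5 A' B C w' w) then show ?case using prodF_idF_comp[OF small_categoryD(1)[OF A]] SFunD(1) by blast
next
  case (7 B C w w' \<alpha>)
  note w = SFunD(1)[OF 7(1)] and Ac = small_categoryD(1)[OF A]
  note w' = NatD(1)[OF 7(2) w]
  note Bc = FunD(4)[OF w] and Cc = FunD(5)[OF w]
  note iw = prodF_Fun[OF idF_Fun[OF Ac] w]
  note n = prodN_id_Nat[OF Ac w 7(2)]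
  note L = whisker_left[OF iw n(1) proj2_Fun[OF Ac Cc]] and R = whisker_right[OF proj2_Fun[OF Ac Bc] w 7(2)]
  have "hcomp (idN (proj2 A C)) (idN (idF A) \<times>\<^sub>n \<alpha>) = hcomp \<alpha> (idN (proj2 A B))"
  proof (rule Nat_eqI[OF _ R(1) compF_Fun[OF proj2_Fun[OF Ac Bc] w]])
    show "hcomp (idN (proj2 A C)) (idN (idF A) \<times>\<^sub>n \<alpha>) \<in> Nat (w \<odot> proj2 A B) (w' \<odot> proj2 A B)"
      using L(1) proj2_prodF[OF idF_Fun[OF Ac] w] proj2_prodF[OF idF_Fun[OF Ac] w'] by simp
    fix y assume y: "y \<in> Ob (A \<times>\<^sub>c B)"
    then obtain x b where "y = \<lblot>x, b\<rblot>" "x \<in> Ob A" "b \<in> Ob B" by auto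
    then show "cmp (hcomp (idN (proj2 A C)) (idN (idF A) \<times>\<^sub>n \<alpha>)) y = cmp (hcomp \<alpha> (idN (proj2 A B))) y"
      unfolding L(2)[OF y] R(2)[OF y] using hom_Ar[OF Nat_hom[OF 7(2) w]] hom_Ar[OF Id_hom[OF Ac]] by (simp
        add: n(2))
  qed
  then show ?case using n(1) 7 by simp
qed (auto simp: shift_def colim_mor_def dest: FunD(2,3)[OF SFunD(1)])

section \<open>Transposed mates\<close>

text \<open>The canonical map from the Kan extension along \<open>q\<close> and then
  \<open>v\<close> to the one along \<open>u\<close>. It keeps the literal shape of
  \<open>decomposition_colim\<close>, where \<open>v\<close> is the projection to the
  parameters.\<close>

definition tmate :: "'u sfunc \<Rightarrow> 'u sfunc \<Rightarrow> 'u sfunc \<Rightarrow> 'u sfunc \<Rightarrow> 'o \<Rightarrow> 'm" where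
  "tmate p q u v X = counit v (lan_Ob u X) \<cdot>\<^bsub>V (FTgt v)\<^esub> lan_Ar v (cmp (smate p q u v) X)"

lemma tmate_transpose:
  assumes sq: "square S A T B p q u v" and X: "X \<in> Ob (V A)"
  shows tmate_hom: "tmate p q u v X \<in> hom (V B) (lan_Ob v (lan_Ob q (p \<star> X))) (lan_Ob u X)"
    and tmate_unit: "v \<bullet> tmate p q u v X \<cdot>\<^bsub>V T\<^esub> unit v (lan_Ob q (p \<star> X)) = cmp (smate p q u v) X"
  using transpose[OF squareD(4)[OF sq] lan_Ob[OF squareD(3)[OF sq] X] smate_hom[OF sq X]]
    FunD(3)[OF SFunD(1)[OF squareD(4)[OF sq]]] by (simp_all add: tmate_def)

lemma tmate_natural:
  assumes sq: "square S A T B p q u v" and f: "f \<in> hom (V A) X Y"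
  shows "lan_Ar u f \<cdot>\<^bsub>V B\<^esub> tmate p q u v X = tmate p q u v Y \<cdot>\<^bsub>V B\<^esub> lan_Ar v (lan_Ar q (p \<bullet> f))"
proof -
  note s = squareD[OF sq]
  note VA = V_category[OF SFunD(2)[OF s(3)]] and VT = V_category[OF SFunD(3)[OF s(2)]] and VB = V_category[OF
    SFunD(3)[OF s(3)]]
  note X = hom_Ob[OF VA f]
  note t = tmate_hom[OF sq X(1)] tmate_hom[OF sq X(2)]
  note l = lan_hom[OF s(3) f] and ql = lan_hom[OF s(2) bullet_hom[OF s(1) f]]
  note vql = lan_hom[OF s(4) ql]
  note Q = lan_Ob[OF s(2) star_Ob[OF s(1) X(1)]] lan_Ob[OF s(2) star_Ob[OF s(1) X(2)]]
  note un = unit_hom[OF s(4) Q(1)] unit_hom[OF s(4) Q(2)]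
  show ?thesis
  proof (rule lan_ext[OF s(4) Q(1) comp_hom[OF VB t(1) l] comp_hom[OF VB vql t(2)]])
    have "v \<bullet> (lan_Ar u f \<cdot>\<^bsub>V B\<^esub> tmate p q u v X) \<cdot>\<^bsub>V T\<^esub> unit v (lan_Ob q (p \<star> X)) = v \<bullet> lan_Ar u f \<cdot>\<^bsub>V T\<^esub>
      cmp (smate p q u v) X"
      using bullet_comp[OF s(4) t(1) l] comp_assoc[OF VT un(1) bullet_hom[OF s(4) t(1)] bullet_hom[OF s(4)
        l]] tmate_unit[OF sq X(1)] by simp
    also have "\<dots> = v \<bullet> tmate p q u v Y \<cdot>\<^bsub>V T\<^esub> (unit v (lan_Ob q (p \<star> Y)) \<cdot>\<^bsub>V T\<^esub> lan_Ar q (p \<bullet> f))"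
      using smate_natural[OF sq f] comp_assoc[OF VT ql un(2) bullet_hom[OF s(4) t(2)]] tmate_unit[OF sq X(2)]
        by simp
    also have "\<dots> = v \<bullet> (tmate p q u v Y \<cdot>\<^bsub>V B\<^esub> lan_Ar v (lan_Ar q (p \<bullet> f))) \<cdot>\<^bsub>V T\<^esub> unit v (lan_Ob q (p \<star> X))"
      using unit_natural[OF s(4) ql] bullet_comp[OF s(4) vql t(2)]
        comp_assoc[OF VT un(1) bullet_hom[OF s(4) vql] bullet_hom[OF s(4) t(2)]] by simp
    finally show "v \<bullet> (lan_Ar u f \<cdot>\<^bsub>V B\<^esub> tmate p q u v X) \<cdot>\<^bsub>V T\<^esub> unit v (lan_Ob q (p \<star> X)) =
      v \<bullet> (tmate p q u v Y \<cdot>\<^bsub>V B\<^esub> lan_Ar v (lan_Ar q (p \<bullet> f))) \<cdot>\<^bsub>V T\<^esub> unit v (lan_Ob q (p \<star> X))" .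
  qed
qed

text \<open>The two units compose to a universal arrow for \<open>v \<odot> q\<close>. If the outer
  square, with \<open>v \<odot> q\<close> in place of \<open>q\<close> and an identity in place of
  \<open>v\<close>, has invertible mates, then \<open>lan_Ob u X\<close> is universal for the same
  functor, and the transposed mate is the comparison. In the application the outer square is the one
  expressing homotopy finality of \<open>groth_to\<close>.\<close>

lemma tmate_iso:
  assumes sq: "square S A T B p q u v" and X: "X \<in> Ob (V A)"
    and sq': "square S A B B p (v \<odot> q) u (idF B)"
    and iso: "\<And>X. X \<in> Ob (V A) \<Longrightarrow> isomorphism (V B) (cmp (smate p (v \<odot> q) u (idF B)) X)"
  shows "isomorphism (V B) (tmate p q u v X)"
proof -
  note s = squareD[OF sq] and s' = squareD[OF sq']
  note VS = V_category[OF SFunD(2)[OF s(1)]]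
  note pX = star_Ob[OF s(1) X] and l = lan_Ob[OF s(3) X]
  note Q = lan_Ob[OF s(2) pX] and t = tmate_hom[OF sq X]
  note un = unit_hom[OF s(2) pX] unit_hom[OF s(4) Q]
  have "exact p (v \<odot> q) u (idF B) (idN (u \<odot> p))"
    unfolding exact_iff_mate[OF s'(1-4,6)] using iso by blast
  from exactD[OF this s(1,3) X lan_universal[OF s(3) X]]
  have u2: "universal (pull D (v \<odot> q)) (p \<star> X) (lan_Ob u X) (p \<bullet> unit u X)"
    using star_idF[OF SFunD(3)[OF s(3)] l] pull2_idN[OF SFun_comp[OF s(1,3)] l] star_compF[OF s(1,3) l]
      Id_comp[OF VS bullet_hom[OF s(1) unit_hom[OF s(3) X]]] by simp
  have u1: "universal (pull D (v \<odot> q)) (p \<star> X) (lan_Ob v (lan_Ob q (p \<star> X)))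
      (q \<bullet> unit v (lan_Ob q (p \<star> X)) \<cdot>\<^bsub>V S\<^esub> unit q (p \<star> X))"
    unfolding pull_compF[OF s(2,4)]
    by (rule universal_compF[OF pull_Fun[OF s(2)] pull_Fun[OF s(4)] lan_universal[OF s(2) pX]
      lan_universal[OF s(4) Q]])
  have "(v \<odot> q) \<bullet> tmate p q u v X \<cdot>\<^bsub>V S\<^esub> (q \<bullet> unit v (lan_Ob q (p \<star> X)) \<cdot>\<^bsub>V S\<^esub> unit q (p \<star> X)) = p \<bullet> unit u X"
    using bullet_compF[OF s(2,4) t] comp_assoc[OF VS un(1) bullet_hom[OF s(2) un(2)] bullet_hom[OF s(2)
      bullet_hom[OF s(4) t]]]
      bullet_comp[OF s(2) un(2) bullet_hom[OF s(4) t]] tmate_unit[OF sq X] smate_unit[OF sq X] by simp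
  then show ?thesis by (rule universal_iso[OF u1 u2 pull_Fun[OF SFun_comp[OF s(2,4)]] t])
qed

text \<open>A cube: \<open>sq0\<close> and \<open>sq\<close> are opposite faces, joined by
  \<open>x\<close>, \<open>y\<close>, \<open>z\<close>, \<open>w\<close>. After composition with the
  unit of \<open>v0\<close> both sides become the mate of one pasted square. This is the
  compatibility of \<open>decomposition_colim\<close> with change of parameters.\<close>

lemma tmate_paste:
  assumes sq: "square S A T B p q u v" and sq0: "square S0 A0 T0 B0 p0 q0 u0 v0"
    and s1: "square S0 S T0 T x q0 q y" and s2: "square T0 T B0 B y v0 v w" and s3: "square A0 A B0 B z u0 u
      w"
    and comm: "p \<odot> x = z \<odot> p0" and X: "X \<in> Ob (V A)"
  shows "w \<bullet> tmate p q u v X \<cdot>\<^bsub>V B0\<^esub>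
      (cmp (smate y v0 v w) (lan_Ob q (p \<star> X)) \<cdot>\<^bsub>V B0\<^esub> lan_Ar v0 (cmp (smate x q0 q y) (p \<star> X))) =
    cmp (smate z u0 u w) X \<cdot>\<^bsub>V B0\<^esub> tmate p0 q0 u0 v0 (z \<star> X)"
proof -
  note d = squareD[OF sq] and d0 = squareD[OF sq0] and d1 = squareD[OF s1] and d2 = squareD[OF s2] and d3 =
    squareD[OF s3]
  note VB0 = V_category[OF SFunD(3)[OF d0(3)]] and VT0 = V_category[OF SFunD(3)[OF d0(2)]]
  note pX = star_Ob[OF d(1) X] and zX = star_Ob[OF d3(1) X]
  have px: "x \<star> p \<star> X = p0 \<star> z \<star> X"
    using star_compF[OF d1(1) d(1) X] star_compF[OF d0(1) d3(1) X] comm by simp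
  note Q = lan_Ob[OF d(2) pX] and Q0 = lan_Ob[OF d0(2) star_Ob[OF d1(1) pX]]
  note m = tmate_hom[OF sq X] and m0 = tmate_hom[OF sq0 zX, folded px]
  note sg = smate_hom[OF s1 pX] and ta = smate_hom[OF s2 Q] and ro = smate_hom[OF s3 X]
  note lsg = lan_hom[OF d0(4) sg] and wm = bullet_hom[OF d3(4) m]
  note un = unit_hom[OF d0(4) Q0] unit_hom[OF d(4) Q] unit_hom[OF d0(4) star_Ob[OF d2(1) Q]]
  note b = bullet_hom[OF d0(4)]
  let ?L = "w \<bullet> tmate p q u v X \<cdot>\<^bsub>V B0\<^esub>
      (cmp (smate y v0 v w) (lan_Ob q (p \<star> X)) \<cdot>\<^bsub>V B0\<^esub> lan_Ar v0 (cmp (smate x q0 q y) (p \<star> X)))"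
  let ?R = "cmp (smate z u0 u w) X \<cdot>\<^bsub>V B0\<^esub> tmate p0 q0 u0 v0 (z \<star> X)"
  show ?thesis
  proof (rule lan_ext[OF d0(4) Q0 comp_hom[OF VB0 comp_hom[OF VB0 lsg ta] wm] comp_hom[OF VB0 m0 ro]])
    have "v0 \<bullet> ?L \<cdot>\<^bsub>V T0\<^esub> unit v0 (lan_Ob q0 (x \<star> p \<star> X)) =
        v0 \<bullet> w \<bullet> tmate p q u v X \<cdot>\<^bsub>V T0\<^esub> (v0 \<bullet> cmp (smate y v0 v w) (lan_Ob q (p \<star> X)) \<cdot>\<^bsub>V T0\<^esub>
          (unit v0 (y \<star> lan_Ob q (p \<star> X)) \<cdot>\<^bsub>V T0\<^esub> cmp (smate x q0 q y) (p \<star> X)))"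
      using bullet_comp[OF d0(4) comp_hom[OF VB0 lsg ta] wm] bullet_comp[OF d0(4) lsg ta]
        comp_assoc[OF VT0 un(1) comp_hom[OF VT0 b[OF lsg] b[OF ta]] b[OF wm]] comp_assoc[OF VT0 un(1) b[OF
          lsg] b[OF ta]]
        unit_natural[OF d0(4) sg] by simp
    also have "\<dots> = y \<bullet> v \<bullet> tmate p q u v X \<cdot>\<^bsub>V T0\<^esub> (y \<bullet> unit v (lan_Ob q (p \<star> X)) \<cdot>\<^bsub>V T0\<^esub> cmp (smate x q0 q
      y) (p \<star> X))"
      using comp_assoc[OF VT0 sg un(3) b[OF ta]] smate_unit[OF s2 Q] square_bullet[OF s2 m] by simp
    also have "\<dots> = y \<bullet> cmp (smate p q u v) X \<cdot>\<^bsub>V T0\<^esub> cmp (smate x q0 q y) (p \<star> X)"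
      using comp_assoc[OF VT0 sg bullet_hom[OF d2(1) un(2)] bullet_hom[OF d2(1) bullet_hom[OF d(4) m]]]
        bullet_comp[OF d2(1) un(2) bullet_hom[OF d(4) m]] tmate_unit[OF sq X] by simp
    \<comment> \<open>The pasted square shared by both routes: \<open>comm\<close> and the
      commutation of \<open>s2\<close> identify its sides.\<close>
    also have "\<dots> = cmp (smate (z \<odot> p0) q0 u (w \<odot> v0)) X"
      using smate_paste[OF sq s1 X] comm d2(5) by simp
    also have "\<dots> = v0 \<bullet> cmp (smate z u0 u w) X \<cdot>\<^bsub>V T0\<^esub> cmp (smate p0 q0 u0 v0) (z \<star> X)"
      using smate_paste[OF s3 sq0 X] by simp
    also have "\<dots> = v0 \<bullet> ?R \<cdot>\<^bsub>V T0\<^esub> unit v0 (lan_Ob q0 (x \<star> p \<star> X))"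
      using bullet_comp[OF d0(4) m0 ro] comp_assoc[OF VT0 un(1) b[OF m0] b[OF ro]] tmate_unit[OF sq0 zX] px
        by simp
    finally show "v0 \<bullet> ?L \<cdot>\<^bsub>V T0\<^esub> unit v0 (lan_Ob q0 (x \<star> p \<star> X)) = v0 \<bullet> ?R \<cdot>\<^bsub>V T0\<^esub> unit v0 (lan_Ob q0 (x \<star> p
      \<star> X))" .
  qed
qed

section \<open>The decomposition morphism\<close>

text \<open>\<open>pull_mor\<close> is strict, so its structure maps are identities and drop out of
  the composite with \<open>G\<close>.\<close>

lemma precomp_pull:
  assumes u: "u \<in> SFun S A" and G: "derivator_morphism (shift D S) H G"
  shows "small_category B \<Longrightarrow> X \<in> Ob (V (A \<times>\<^sub>c B)) \<Longrightarrow>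
      onOb (mfun (G \<odot>\<^sub>m pull_mor D u) B) X = onOb (mfun G B) ((u \<times>\<^sub>f idF B) \<star> X)"
    and "small_category B \<Longrightarrow> f \<in> Ar (V (A \<times>\<^sub>c B)) \<Longrightarrow>
      onAr (mfun (G \<odot>\<^sub>m pull_mor D u) B) f = onAr (mfun G B) ((u \<times>\<^sub>f idF B) \<bullet> f)"
    and "w \<in> SFun B C \<Longrightarrow> X \<in> Ob (V (A \<times>\<^sub>c C)) \<Longrightarrow>
      cmp (mstr (G \<odot>\<^sub>m pull_mor D u) w) X = cmp (mstr G w) ((u \<times>\<^sub>f idF C) \<star> X)"
proof -
  note A = SFunD(3)[OF u] and S = SFunD(2)[OF u]
  note F = pull_mor_morphism[OF u]
  note fA = pull_functorial_shift[OF A] and fS = pull_functorial_shift[OF S]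
  note cs = comp_mor_simps[OF F G fA fS]
  have pF: "pull D (u \<times>\<^sub>f idF B) \<in> Fun (V (A \<times>\<^sub>c B)) (V (S \<times>\<^sub>c B))" if "small_category B" for B
    by (rule pull_Fun[OF SFun_prodF[OF u SFun_idF[OF that]]])
  show "onOb (mfun (G \<odot>\<^sub>m pull_mor D u) B) X = onOb (mfun G B) ((u \<times>\<^sub>f idF B) \<star> X)"
    if "small_category B" "X \<in> Ob (V (A \<times>\<^sub>c B))"
    unfolding cs(1) by (simp add: pull_mor_def compF_Ob[OF pF[OF that(1)] that(2)])
  show "onAr (mfun (G \<odot>\<^sub>m pull_mor D u) B) f = onAr (mfun G B) ((u \<times>\<^sub>f idF B) \<bullet> f)"
    if "small_category B" "f \<in> Ar (V (A \<times>\<^sub>c B))"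
    unfolding cs(1) by (simp add: pull_mor_def compF_Ar[OF pF[OF that(1)] that(2)])
  show "cmp (mstr (G \<odot>\<^sub>m pull_mor D u) w) X = cmp (mstr G w) ((u \<times>\<^sub>f idF C) \<star> X)"
    if w: "w \<in> SFun B C" and X: "X \<in> Ob (V (A \<times>\<^sub>c C))"
  proof -
    note B = SFunD(2)[OF w] and C = SFunD(3)[OF w]
    note iw = SFun_prodF[OF SFun_idF[OF A] w] and Sw = SFun_prodF[OF SFun_idF[OF S] w]
      and uB = SFun_prodF[OF u SFun_idF[OF B]] and uC = SFun_prodF[OF u SFun_idF[OF C]]
    note uX = star_Ob[OF uC X]
    have "cmp (mstr (pull_mor D u) w) X = Id (V (S \<times>\<^sub>c B)) ((u \<times>\<^sub>f idF B) \<star> (idF A \<times>\<^sub>f w) \<star> X)"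
      using X FunD(2,3)[OF SFunD(1)[OF w]] FunD(3)[OF SFunD(1)[OF u]]
        FunD(2)[OF pull_Fun[OF iw]] FunD(3)[OF pull_Fun[OF uB]]
      by (simp add: pull_mor_def compF_Ob[OF pull_Fun[OF iw] X])
    also have "(u \<times>\<^sub>f idF B) \<star> (idF A \<times>\<^sub>f w) \<star> X = (idF S \<times>\<^sub>f w) \<star> (u \<times>\<^sub>f idF C) \<star> X"
      using star_compF[OF uB iw X] star_compF[OF Sw uC X] squareD(5)[OF square_lan[OF u w]] by simp
    finally have c: "cmp (mstr (pull_mor D u) w) X = Id (V (S \<times>\<^sub>c B)) ((idF S \<times>\<^sub>f w) \<star> (u \<times>\<^sub>f idF C) \<star> X)" .
    have GB: "mfun G B \<in> Fun (V (S \<times>\<^sub>c B)) (val H B)" using mor_Fun[OF G B] by (simp add: shift_def)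
    have h: "cmp (mstr G w) ((u \<times>\<^sub>f idF C) \<star> X) \<in> hom (val H B) (onOb (mfun G B) ((idF S \<times>\<^sub>f w) \<star> (u \<times>\<^sub>f idF
      C) \<star> X))
        (onOb (pull H w) (onOb (mfun G C) ((u \<times>\<^sub>f idF C) \<star> X)))"
      using mor_str_hom[OF G fS w] uX by (simp add: shift_def)
    have "cmp (mstr (G \<odot>\<^sub>m pull_mor D u) w) X =
        cmp (mstr G w) ((u \<times>\<^sub>f idF C) \<star> X) \<cdot>\<^bsub>val H B\<^esub> onAr (mfun G B) (cmp (mstr (pull_mor D u) w) X)"
      using cs(3)[OF w] X by (simp add: pull_mor_def shift_def)
    then show ?thesis
      unfolding c using Fun_Id[OF GB star_Ob[OF Sw uX]] comp_Id[OF FunD(5)[OF GB] h] by simp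
  qed
qed

lemma decomposition_morphism:
  assumes "groth_to A C F \<in> SFun S A" "groth_proj C F \<in> SFun S C"
  shows "derivator_morphism (shift D A) (shift D C) (decomposition D A C F)"
  unfolding decomposition_def
  by (rule derivator_morphism_comp_mor[OF pull_mor_morphism[OF assms(1)] lan_mor_morphism[OF assms(2)]
    pull_functorial_shift[OF SFunD(3)[OF assms(1)]] pull_functorial_shift[OF SFunD(2)[OF assms(1)]]
    pull_functorial_shift[OF SFunD(3)[OF assms(2)]]])

lemma decomposition_simps:
  assumes gt: "groth_to A C F \<in> SFun S A" and gp: "groth_proj C F \<in> SFun S C"
  shows "small_category B \<Longrightarrow> X \<in> Ob (V (A \<times>\<^sub>c B)) \<Longrightarrow>
      onOb (mfun (decomposition D A C F) B) X = lan_Ob (groth_proj C F \<times>\<^sub>f idF B) ((groth_to A C F \<times>\<^sub>f idF B)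
        \<star> X)"
    and "small_category B \<Longrightarrow> f \<in> Ar (V (A \<times>\<^sub>c B)) \<Longrightarrow>
      onAr (mfun (decomposition D A C F) B) f = lan_Ar (groth_proj C F \<times>\<^sub>f idF B) ((groth_to A C F \<times>\<^sub>f idF B)
        \<bullet> f)"
    and "w \<in> SFun B B' \<Longrightarrow> X \<in> Ob (V (A \<times>\<^sub>c B')) \<Longrightarrow> cmp (mstr (decomposition D A C F) w) X =
      cmp (smate (idF S \<times>\<^sub>f w) (groth_proj C F \<times>\<^sub>f idF B) (groth_proj C F \<times>\<^sub>f idF B') (idF C \<times>\<^sub>f w))
        ((groth_to A C F \<times>\<^sub>f idF B') \<star> X)"
  unfolding decomposition_def
  using precomp_pull[OF gt lan_mor_morphism[OF gp]] FunD(2,3)[OF SFunD(1)[OF gp]]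
  by (simp_all add: lan_mor_def FunD(2,3)[OF SFunD(1)])

text \<open>The component at \<open>X\<close> is a transposed mate. Its outer square has an
  invertible mate because the hypothesis on universal arrows makes \<open>groth_to\<close> final.
  Changing parameters gives the cube of \<open>tmate_paste\<close>.\<close>

lemma decomposition_colim_invertible:
  assumes gt: "groth_to A C F \<in> SFun S A" and gp: "groth_proj C F \<in> SFun S C"
    and un: "\<And>a. a \<in> Ob A \<Longrightarrow> \<exists>Z e. universal (groth_to A C F) a Z e"
  shows "invertible_modification (shift D A) D (colim_mor D C \<odot>\<^sub>m decomposition D A C F) (colim_mor D A)
    (decomposition_colim D A C F)"
proof -
  note A = SFunD(3)[OF gt] and C = SFunD(3)[OF gp]
  note fA = pull_functorial_shift[OF A] and fC = pull_functorial_shift[OF C]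
  note d = decomposition_morphism[OF gt gp] and cC = colim_mor_morphism[OF C] and cA = colim_mor_morphism[OF
    A]
  note cd = derivator_morphism_comp_mor[OF d cC fA fC pull_functorial] and cs = comp_mor_simps[OF d cC fA fC]
  note ds = decomposition_simps[OF gt gp]
  let ?u = "\<lambda>B. groth_to A C F \<times>\<^sub>f idF B" and ?p = "\<lambda>B. groth_proj C F \<times>\<^sub>f idF B"
  let ?t = "\<lambda>B. tmate (?u B) (?p B) (proj2 A B) (proj2 C B)"
  have pu: "proj2 A B \<odot> ?u B = proj2 S B" and pp: "proj2 C B \<odot> ?p B = proj2 S B" if B: "small_category B" for
    B
    using proj2_prodF[OF SFunD(1)[OF gt] idF_Fun[OF small_categoryD(1)[OF B]]]
      proj2_prodF[OF SFunD(1)[OF gp] idF_Fun[OF small_categoryD(1)[OF B]]] proj2_Fun[OF SFunD(4)[OF gt]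
        small_categoryD(1)[OF B]]
    by simp_all
  have sq: "square (S \<times>\<^sub>c B) (A \<times>\<^sub>c B) (C \<times>\<^sub>c B) B (?u B) (?p B) (proj2 A B) (proj2 C B)" if B:
    "small_category B" for B
    unfolding square_def pu[OF B] pp[OF B]
    using SFun_prodF[OF gt SFun_idF[OF B]] SFun_prodF[OF gp SFun_idF[OF B]] SFun_proj2[OF A B] SFun_proj2[OF
      C B] by simp
  have dF: "mfun (decomposition D A C F) B \<in> Fun (V (A \<times>\<^sub>c B)) (V (C \<times>\<^sub>c B))" if "small_category B" for B
    using mor_Fun[OF d that] by (simp add: shift_def)
  have mO: "onOb (mfun (colim_mor D C \<odot>\<^sub>m decomposition D A C F) B) X = lan_Ob (proj2 C B) (lan_Ob (?p B) (?u
    B \<star> X))"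
    if B: "small_category B" and X: "X \<in> Ob (V (A \<times>\<^sub>c B))" for B X
    unfolding cs(1) using ds(1)[OF B X] by (simp add: compF_Ob[OF dF[OF B] X] colim_mor_def)
  have mA: "onAr (mfun (colim_mor D C \<odot>\<^sub>m decomposition D A C F) B) f = lan_Ar (proj2 C B) (lan_Ar (?p B) (?u
    B \<bullet> f))"
    if B: "small_category B" and f: "f \<in> Ar (V (A \<times>\<^sub>c B))" for B f
    unfolding cs(1) using ds(2)[OF B f] by (simp add: compF_Ar[OF dF[OF B] f] colim_mor_def)
  have dc: "cmp (decomposition_colim D A C F B) X = ?t B X" if "X \<in> Ob (V (A \<times>\<^sub>c B))" for B X
    using that by (simp add: decomposition_colim_def tmate_def colim_mor_def)
  show ?thesis
  proof (rule invertible_modificationI[OF fA pull_functorial cd cA])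
    fix B :: "'u scat" assume B: "small_category B"
    have F1: "mfun (colim_mor D C \<odot>\<^sub>m decomposition D A C F) B \<in> Fun (V (A \<times>\<^sub>c B)) (V B)"
      using mor_Fun[OF cd B] by (simp add: shift_def)
    have F2: "mfun (colim_mor D A) B \<in> Fun (V (A \<times>\<^sub>c B)) (V B)"
      using mor_Fun[OF cA B] by (simp add: shift_def)
    show "natural_iso (mfun (colim_mor D C \<odot>\<^sub>m decomposition D A C F) B) (mfun (colim_mor D A) B)
      (decomposition_colim D A C F B)"
    proof (rule natural_isoI[OF NatI[OF F1 F2] F1])
      show "cmp (decomposition_colim D A C F B) X \<in> hom (V B) (onOb (mfun (colim_mor D C \<odot>\<^sub>m decomposition D
        A C F) B) X)
          (onOb (mfun (colim_mor D A) B) X)" if X: "X \<in> Ob (V (A \<times>\<^sub>c B))" for X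
        using tmate_hom[OF sq[OF B] X] by (simp add: dc[OF X] mO[OF B X]) (simp add: colim_mor_def)
      show "onAr (mfun (colim_mor D A) B) f \<cdot>\<^bsub>V B\<^esub> cmp (decomposition_colim D A C F B) X =
          cmp (decomposition_colim D A C F B) Y \<cdot>\<^bsub>V B\<^esub> onAr (mfun (colim_mor D C \<odot>\<^sub>m decomposition D A C F)
            B) f"
        if f: "f \<in> hom (V (A \<times>\<^sub>c B)) X Y" for X Y f
      proof -
        have x: "X \<in> Ob (V (A \<times>\<^sub>c B))" "Y \<in> Ob (V (A \<times>\<^sub>c B))" using hom_Ob[OF FunD(4)[OF F1] f] .
        show ?thesis
          unfolding dc[OF x(1)] dc[OF x(2)] mA[OF B hom_Ar[OF f]]
          using tmate_natural[OF sq[OF B] f] by (simp add: colim_mor_def)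
      qed
      show "isomorphism (V B) (cmp (decomposition_colim D A C F B) X)" if X: "X \<in> Ob (V (A \<times>\<^sub>c B))" for X
        unfolding dc[OF X]
      \<comment> \<open>By \<open>pp\<close> the composite \<open>v \<odot> q\<close> is the
        projection from \<open>S \<times>\<^sub>c B\<close>, so the outer square is of the kind
        treated in \<open>smate_proj2_iso\<close>.\<close>
      proof (rule tmate_iso[OF sq[OF B] X], unfold pp[OF B])
        show "square (S \<times>\<^sub>c B) (A \<times>\<^sub>c B) B B (?u B) (proj2 S B) (proj2 A B) (idF B)"
          by (rule square_proj2[OF gt SFun_idF[OF B]])
        show "isomorphism (V B) (cmp (smate (?u B) (proj2 S B) (proj2 A B) (idF B)) X)" if "X \<in> Ob (V (A \<times>\<^sub>c
          B))" for X
          by (rule smate_proj2_iso[OF gt SFun_idF[OF B] that un])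
      qed
    qed (auto simp: decomposition_colim_def)
  next
    fix B B' :: "'u scat" and w X assume w: "w \<in> SFun B B'" and "X \<in> Ob (val (shift D A) B')"
    then have X: "X \<in> Ob (V (A \<times>\<^sub>c B'))" by (simp add: shift_def)
    note B = SFunD(2)[OF w] and B' = SFunD(3)[OF w] and sw = FunD(2,3)[OF SFunD(1)[OF w]]
    have wX: "(idF A \<times>\<^sub>f w) \<star> X \<in> Ob (V (A \<times>\<^sub>c B))" by (rule star_Ob[OF SFun_prodF[OF SFun_idF[OF A] w] X])
    \<comment> \<open>The structure map of the composite splits into the mate for the colimit over
      \<open>C\<close> and the image of the mate for the Kan extension along the projection.\<close>
    have "cmp (mstr (colim_mor D C \<odot>\<^sub>m decomposition D A C F) w) X =
      cmp (smate (idF C \<times>\<^sub>f w) (proj2 C B) (proj2 C B') w) (lan_Ob (?p B') (?u B' \<star> X)) \<cdot>\<^bsub>V B\<^esub>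
      lan_Ar (proj2 C B) (cmp (smate (idF S \<times>\<^sub>f w) (?p B) (?p B') (idF C \<times>\<^sub>f w)) (?u B' \<star> X))"
      using cs(3)[OF w] X ds(1)[OF B' X] ds(3)[OF w X] sw by (simp add: colim_mor_def shift_def)
    then show "onAr (pull D w) (cmp (decomposition_colim D A C F B') X) \<cdot>\<^bsub>V B\<^esub>
        cmp (mstr (colim_mor D C \<odot>\<^sub>m decomposition D A C F) w) X =
      cmp (mstr (colim_mor D A) w) X \<cdot>\<^bsub>V B\<^esub> cmp (decomposition_colim D A C F B) (onOb (pull (shift D A) w) X)"
      using tmate_paste[OF sq[OF B'] sq[OF B] square_lan[OF gp w] square_proj2[OF SFun_idF[OF C] w]
          square_proj2[OF SFun_idF[OF A] w] squareD(5)[OF square_lan[OF gt w]] X] dc[OF X] dc[OF wX] sw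
      by (simp add: shift_def colim_mor_def)
  qed
qed

text \<open>Restricting \<open>X\<close> along the inclusion is, by \<open>tj\<close>, the same as
  restricting it to the Grothendieck construction and then to the fibre. Thus the map is a mate at
  the restricted diagram, invertible by \<open>fin\<close>. Change of parameters leads to two
  pastings of squares with the same outer sides.\<close>

lemma decomposition_fibre_invertible:
  assumes gt: "groth_to A C F \<in> SFun S A" and gp: "groth_proj C F \<in> SFun S C"
    and j: "groth_fibre C F c \<in> SFun (onOb F c) S" and c: "c \<in> Ob C"
    and pj: "groth_proj C F \<odot> groth_fibre C F c = const (onOb F c) C c"
    and tj: "groth_to A C F \<odot> groth_fibre C F c = inclusion (onOb F c) A"
    and fin: "final_at (groth_proj C F) c (groth_fibre C F c) (\<lambda>_. Id C c)"
  shows "invertible_modification (shift D A) D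
    (colim_mor D (onOb F c) \<odot>\<^sub>m pull_mor D (inclusion (onOb F c) A)) (eval_mor D C c \<odot>\<^sub>m decomposition D A C
      F)
    (decomposition_fibre D A C F c)"
proof -
  note S = SFunD(2)[OF gt] and A = SFunD(3)[OF gt] and C = SFunD(3)[OF gp] and J = SFunD(2)[OF j]
  let ?J = "onOb F c"
  have i: "inclusion ?J A \<in> SFun ?J A" using SFun_comp[OF j gt] tj by simp
  note fA = pull_functorial_shift[OF A] and fC = pull_functorial_shift[OF C] and fJ =
    pull_functorial_shift[OF J]
  note d = decomposition_morphism[OF gt gp] and cJ = colim_mor_morphism[OF J] and ev = eval_mor_morphism[OF C
    c]
  note M1 = derivator_morphism_comp_mor[OF pull_mor_morphism[OF i] cJ fA fJ pull_functorial]
    and M2 = derivator_morphism_comp_mor[OF d ev fA fC pull_functorial]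
  note ps = precomp_pull[OF i cJ] and es = comp_mor_simps[OF d ev fA fC] and ds = decomposition_simps[OF gt
    gp]
  let ?u = "\<lambda>B. groth_to A C F \<times>\<^sub>f idF B" and ?p = "\<lambda>B. groth_proj C F \<times>\<^sub>f idF B" and ?j = "\<lambda>B. groth_fibre C
    F c \<times>\<^sub>f idF B"
    and ?i = "\<lambda>B. inclusion ?J A \<times>\<^sub>f idF B"
  let ?s = "\<lambda>B. section_at C c B"
  let ?m = "\<lambda>B. smate (?j B) (proj2 ?J B) (?p B) (?s B)"
  have ij: "?u B \<odot> ?j B = ?i B" if B: "small_category B" for B
    using prodF_compF[OF SFunD(1)[OF j] SFunD(1)[OF gt] idF_Fun idF_Fun, of B] small_categoryD(1)[OF B] tj
      compF_idF(1)[OF idF_Fun[OF small_categoryD(1)[OF B]]] by simp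
  note sq = square_fibre[OF gp j c pj]
  have uS: "?u B \<in> SFun (S \<times>\<^sub>c B) (A \<times>\<^sub>c B)" and jS: "?j B \<in> SFun (?J \<times>\<^sub>c B) (S \<times>\<^sub>c B)" if B: "small_category
    B" for B
    using SFun_prodF[OF gt SFun_idF[OF B]] SFun_prodF[OF j SFun_idF[OF B]] .
  have iX: "?i B \<star> X = ?j B \<star> ?u B \<star> X" if B: "small_category B" and X: "X \<in> Ob (V (A \<times>\<^sub>c B))" for B X
    using star_compF[OF jS[OF B] uS[OF B] X] ij[OF B] by simp
  have df: "cmp (decomposition_fibre D A C F c B) X = cmp (?m B) (?u B \<star> X)" if "X \<in> Ob (V (A \<times>\<^sub>c B))" for B X
    using that by (simp add: decomposition_fibre_def)
  have sO: "onOb (mfun (colim_mor D ?J \<odot>\<^sub>m pull_mor D (inclusion ?J A)) B) X = lan_Ob (proj2 ?J B) (?j B \<star> ?u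
    B \<star> X)"
    if B: "small_category B" and X: "X \<in> Ob (V (A \<times>\<^sub>c B))" for B X
    using ps(1)[OF B X] iX[OF B X] by (simp add: colim_mor_def)
  have sA: "onAr (mfun (colim_mor D ?J \<odot>\<^sub>m pull_mor D (inclusion ?J A)) B) f = lan_Ar (proj2 ?J B) (?j B \<bullet> ?u
    B \<bullet> f)"
    if B: "small_category B" and f: "f \<in> hom (V (A \<times>\<^sub>c B)) X Y" for B f X Y
    using ps(2)[OF B hom_Ar[OF f]] bullet_compF[OF jS[OF B] uS[OF B] f] ij[OF B] by (simp add: colim_mor_def)
  have dF: "mfun (decomposition D A C F) B \<in> Fun (V (A \<times>\<^sub>c B)) (V (C \<times>\<^sub>c B))" if "small_category B" for B
    using mor_Fun[OF d that] by (simp add: shift_def)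
  have eO: "onOb (mfun (eval_mor D C c \<odot>\<^sub>m decomposition D A C F) B) X = ?s B \<star> lan_Ob (?p B) (?u B \<star> X)"
    if B: "small_category B" and X: "X \<in> Ob (V (A \<times>\<^sub>c B))" for B X
    unfolding es(1) using ds(1)[OF B X] by (simp add: compF_Ob[OF dF[OF B] X] eval_mor_def)
  have eA: "onAr (mfun (eval_mor D C c \<odot>\<^sub>m decomposition D A C F) B) f = ?s B \<bullet> lan_Ar (?p B) (?u B \<bullet> f)"
    if B: "small_category B" and f: "f \<in> Ar (V (A \<times>\<^sub>c B))" for B f
    unfolding es(1) using ds(2)[OF B f] by (simp add: compF_Ar[OF dF[OF B] f] eval_mor_def)
  show ?thesis
  proof (rule invertible_modificationI[OF fA pull_functorial M1 M2])
    fix B :: "'u scat" assume B: "small_category B"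
    let ?F = "mfun (colim_mor D ?J \<odot>\<^sub>m pull_mor D (inclusion ?J A)) B" and ?G = "mfun (eval_mor D C c \<odot>\<^sub>m
      decomposition D A C F) B"
    have F1: "?F \<in> Fun (V (A \<times>\<^sub>c B)) (V B)" using mor_Fun[OF M1 B] by (simp add: shift_def)
    have F2: "?G \<in> Fun (V (A \<times>\<^sub>c B)) (V B)" using mor_Fun[OF M2 B] by (simp add: shift_def)
    show "natural_iso ?F ?G (decomposition_fibre D A C F c B)"
    proof (rule natural_isoI[OF NatI[OF F1 F2] F1])
      show "cmp (decomposition_fibre D A C F c B) X \<in> hom (V B) (onOb ?F X) (onOb ?G X)" if X: "X \<in> Ob (V (A
        \<times>\<^sub>c B))" for X
        using smate_hom[OF sq[OF B] star_Ob[OF uS[OF B] X]] by (simp add: df[OF X] sO[OF B X] eO[OF B X])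
      show "onAr ?G f \<cdot>\<^bsub>V B\<^esub> cmp (decomposition_fibre D A C F c B) X = cmp (decomposition_fibre D A C F c B)
        Y \<cdot>\<^bsub>V B\<^esub> onAr ?F f"
        if f: "f \<in> hom (V (A \<times>\<^sub>c B)) X Y" for X Y f
      proof -
        have x: "X \<in> Ob (V (A \<times>\<^sub>c B))" "Y \<in> Ob (V (A \<times>\<^sub>c B))" using hom_Ob[OF FunD(4)[OF F1] f] .
        show ?thesis
          unfolding df[OF x(1)] df[OF x(2)] sA[OF B f] eA[OF B hom_Ar[OF f]]
          by (rule smate_natural[OF sq[OF B] bullet_hom[OF uS[OF B] f]])
      qed
      show "isomorphism (V B) (cmp (decomposition_fibre D A C F c B) X)" if X: "X \<in> Ob (V (A \<times>\<^sub>c B))" for X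
        unfolding df[OF X] by (rule smate_fibre_iso[OF gp j c pj fin B star_Ob[OF uS[OF B] X]])
    qed (auto simp: decomposition_fibre_def)
  next
    fix B B' :: "'u scat" and w X assume w: "w \<in> SFun B B'" and "X \<in> Ob (val (shift D A) B')"
    then have X: "X \<in> Ob (V (A \<times>\<^sub>c B'))" by (simp add: shift_def)
    note B = SFunD(2)[OF w] and B' = SFunD(3)[OF w] and sw = FunD(2,3)[OF SFunD(1)[OF w]] and wF =
      SFunD(1)[OF w]
    note Aw = SFun_prodF[OF SFun_idF[OF A] w] and Sw = SFun_prodF[OF SFun_idF[OF S] w] and Cw = SFun_prodF[OF
      SFun_idF[OF C] w]
    have wX: "(idF A \<times>\<^sub>f w) \<star> X \<in> Ob (V (A \<times>\<^sub>c B))" by (rule star_Ob[OF Aw X])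
    note uX = star_Ob[OF uS[OF B'] X]
    have uw: "?u B \<star> (idF A \<times>\<^sub>f w) \<star> X = (idF S \<times>\<^sub>f w) \<star> ?u B' \<star> X"
      using star_compF[OF uS[OF B] Aw X] star_compF[OF Sw uS[OF B'] X] squareD(5)[OF square_lan[OF gt w]] by
        simp
    let ?sg = "smate (idF S \<times>\<^sub>f w) (?p B) (?p B') (idF C \<times>\<^sub>f w)"
    note sl = square_lan[OF gp w]
    have "cmp (mstr (colim_mor D ?J \<odot>\<^sub>m pull_mor D (inclusion ?J A)) w) X =
        cmp (smate (idF ?J \<times>\<^sub>f w) (proj2 ?J B) (proj2 ?J B') w) (?j B' \<star> ?u B' \<star> X)"
      using ps(3)[OF w X] iX[OF B' X] sw by (simp add: colim_mor_def)
    \<comment> \<open>First route: the fibre square at \<open>B'\<close> pasted with the change of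
      parameters over the fibre. The second route, \<open>R\<close>, pastes the change of parameters
      over the Grothendieck construction with the fibre square at \<open>B\<close>.\<close>
    then have L: "w \<bullet> cmp (?m B') (?u B' \<star> X) \<cdot>\<^bsub>V B\<^esub> cmp (mstr (colim_mor D ?J \<odot>\<^sub>m pull_mor D (inclusion ?J
      A)) w) X =
        cmp (smate (?j B' \<odot> (idF ?J \<times>\<^sub>f w)) (proj2 ?J B) (?p B') (?s B' \<odot> w)) (?u B' \<star> X)"
      using smate_paste[OF sq[OF B'] square_proj2[OF SFun_idF[OF J] w] uX] by simp
    have eh: "?s B \<bullet> cmp ?sg (?u B' \<star> X) \<in> hom (V B) (?s B \<star> lan_Ob (?p B) ((idF S \<times>\<^sub>f w) \<star> ?u B' \<star> X))
        (?s B \<star> (idF C \<times>\<^sub>f w) \<star> lan_Ob (?p B') (?u B' \<star> X))"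
      by (rule bullet_hom[OF SFun_section_at[OF C B c] smate_hom[OF sl uX]])
    have l: "lan_Ob (?p B') (?u B' \<star> X) \<in> Ob (V (C \<times>\<^sub>c B'))"
      by (rule lan_Ob[OF squareD(3)[OF sl] uX])
    have "cmp (mstr (eval_mor D C c) w) (lan_Ob (?p B') (?u B' \<star> X)) =
        Id (V B) (?s B \<star> (idF C \<times>\<^sub>f w) \<star> lan_Ob (?p B') (?u B' \<star> X))"
      using l sw FunD(2)[OF pull_Fun[OF Cw]] FunD(3)[OF pull_Fun[OF SFun_section_at[OF C B c]]]
      by (simp add: eval_mor_def compF_Ob[OF pull_Fun[OF Cw] l])
    then have "cmp (mstr (eval_mor D C c \<odot>\<^sub>m decomposition D A C F) w) X = ?s B \<bullet> cmp ?sg (?u B' \<star> X)"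
      using es(3)[OF w] X ds(1)[OF B' X] ds(3)[OF w X] Id_comp[OF V_category[OF B] eh] by (simp add:
        eval_mor_def shift_def)
    then have R: "cmp (mstr (eval_mor D C c \<odot>\<^sub>m decomposition D A C F) w) X \<cdot>\<^bsub>V B\<^esub> cmp (?m B) (?u B \<star> (idF A
      \<times>\<^sub>f w) \<star> X) =
        cmp (smate ((idF S \<times>\<^sub>f w) \<odot> ?j B) (proj2 ?J B) (?p B') ((idF C \<times>\<^sub>f w) \<odot> ?s B)) (?u B' \<star> X)"
      using smate_paste[OF sl sq[OF B] uX] uw by simp
    \<comment> \<open>Together with the commutation of sections, this identifies the outer sides of
      the two pasted squares.\<close>
    have "(idF S \<times>\<^sub>f w) \<odot> ?j B = ?j B' \<odot> (idF ?J \<times>\<^sub>f w)"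
      using squareD(5)[OF square_lan[OF j w]] by simp
    then show "onAr (pull D w) (cmp (decomposition_fibre D A C F c B') X) \<cdot>\<^bsub>V B\<^esub>
        cmp (mstr (colim_mor D ?J \<odot>\<^sub>m pull_mor D (inclusion ?J A)) w) X =
      cmp (mstr (eval_mor D C c \<odot>\<^sub>m decomposition D A C F) w) X \<cdot>\<^bsub>V B\<^esub>
        cmp (decomposition_fibre D A C F c B) (onOb (pull (shift D A) w) X)"
      using L R section_at_prodF[OF small_categoryD(1)[OF C] c wF] df[OF X] df[OF wX] by (simp add: shift_def)
  qed
qed

end

section \<open>The filtration of a category over a poset\<close>

text \<open>A subcategory is the record of \<open>A\<close> with its carriers replaced, so the
  operations are literally those of \<open>A\<close>.\<close>

lemma subcategory_simps:
  assumes "subcategory B A"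
  shows "Dom B = Dom A" "Cod B = Cod A" "Id B = Id A" "Comp B = Comp A" "Ob B \<subseteq> Ob A" "Ar B \<subseteq> Ar A" "category
    B"
proof -
  have B: "B = A\<lparr>Ob := Ob B, Ar := Ar B\<rparr>" and r: "Ob B \<subseteq> Ob A" "Ar B \<subseteq> Ar A" "category B"
    using assms by (auto simp: subcategory_def)
  show "Dom B = Dom A" "Cod B = Cod A" "Id B = Id A" "Comp B = Comp A"
    by (subst B, simp)+
  show "Ob B \<subseteq> Ob A" "Ar B \<subseteq> Ar A" "category B" by fact+
qed

lemma inclusion_Fun:
  assumes B: "subcategory B A" and B': "subcategory B' A" and "Ob B \<subseteq> Ob B'" "Ar B \<subseteq> Ar B'"
  shows "inclusion B B' \<in> Fun B B'"
proof (rule FunI)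
  note s = subcategory_simps[OF B] and s' = subcategory_simps[OF B']
  show "category B" "category B'" by (fact s s')+
  fix x y f assume f: "f \<in> hom B x y"
  then show "onAr (inclusion B B') f \<in> hom B' (onOb (inclusion B B') x) (onOb (inclusion B B') y)"
    using hom_Ob[OF s(7) f] assms(4) by (auto simp: inclusion_def hom_iff s s')
  fix z g assume g: "g \<in> hom B y z"
  show "onAr (inclusion B B') (g \<cdot>\<^bsub>B\<^esub> f) = onAr (inclusion B B') g \<cdot>\<^bsub>B'\<^esub> onAr (inclusion B B') f"
    using hom_Ar[OF f] hom_Ar[OF g] hom_Ar[OF comp_hom[OF s(7) f g]] by (simp add: inclusion_def s s')
next
  fix x assume x: "x \<in> Ob B"
  then show "onAr (inclusion B B') (Id B x) = Id B' (onOb (inclusion B B') x)"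
    using hom_Ar[OF Id_hom[OF subcategory_simps(7)[OF B] x]]
    by (simp add: inclusion_def subcategory_simps(3)[OF B] subcategory_simps(3)[OF B'])
qed (use assms in \<open>auto simp: inclusion_def\<close>)

lemma inclusion_comp:
  assumes "Ob B \<subseteq> Ob B'" "Ar B \<subseteq> Ar B'"
  shows "inclusion B' B'' \<odot> inclusion B B' = inclusion B B''"
  using assms by (auto simp: compF_def inclusion_def fun_eq_iff restrict_def)

lemma subcategory_refl: "category A \<Longrightarrow> subcategory A A"
  by (simp add: subcategory_def)

lemma hom_Sub:
  "F \<in> hom (Sub A) B B' \<longleftrightarrow> F \<in> Fun B B' \<and> subcategory B A \<and> subcategory B' A \<and> inclusion B' A \<odot> F = inclusion
    B A"
  by (auto simp: hom_def Sub_def Fun_def)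

lemma category_Sub:
  assumes A: "category A" shows "category (Sub A)"
proof (rule categoryI)
  have sA: "Dom (Sub A) = FSrc" "Cod (Sub A) = FTgt" "Id (Sub A) = idF" "Comp (Sub A) = compF" "Ob (Sub A) =
    {B. subcategory B A}"
    by (auto simp: Sub_def)
  have inc: "inclusion B A \<in> Fun B A" if "subcategory B A" for B
    by (rule inclusion_Fun[OF that subcategory_refl[OF A]]) (use that in \<open>auto simp: subcategory_def\<close>)
  show "Dom (Sub A) f \<in> Ob (Sub A)" "Cod (Sub A) f \<in> Ob (Sub A)" if "f \<in> Ar (Sub A)" for f
    using that by (auto simp: Sub_def)
  show "Id (Sub A) B \<in> hom (Sub A) B B" if "B \<in> Ob (Sub A)" for B
  proof -
    have B: "subcategory B A" using that by (simp add: sA)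
    then show ?thesis
      using idF_Fun[OF subcategory_simps(7)[OF B]] inc[OF B] by (simp add: sA hom_Sub)
  qed
  show "g \<cdot>\<^bsub>Sub A\<^esub> f \<in> hom (Sub A) x z" if f: "f \<in> hom (Sub A) x y" and g: "g \<in> hom (Sub A) y z" for x y z f g
  proof -
    note f = f[unfolded hom_Sub] and g = g[unfolded hom_Sub]
    have "inclusion z A \<odot> (g \<odot> f) = inclusion x A"
      using f g compF_assoc[of f x y g z "inclusion z A" A] inc by simp
    then show ?thesis using f g compF_Fun[of f x y g z] by (simp add: sA hom_Sub)
  qed
  show "f \<cdot>\<^bsub>Sub A\<^esub> Id (Sub A) x = f" "Id (Sub A) y \<cdot>\<^bsub>Sub A\<^esub> f = f" if "f \<in> hom (Sub A) x y" for f x y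
    using that compF_idF[of f x y] by (simp_all add: hom_Sub sA)
  show "h \<cdot>\<^bsub>Sub A\<^esub> (g \<cdot>\<^bsub>Sub A\<^esub> f) = h \<cdot>\<^bsub>Sub A\<^esub> g \<cdot>\<^bsub>Sub A\<^esub> f"
    if "f \<in> hom (Sub A) w x" "g \<in> hom (Sub A) x y" "h \<in> hom (Sub A) y z" for f g h w x y z
    using that compF_assoc[of f w x g y h z] by (simp add: hom_Sub sA)
qed

section \<open>The filtration given by a functor to a poset\<close>

locale functor_to_poset =
  fixes A :: "'u::universe scat" and P :: "'u set" and r :: "'u rel" and f :: "'u sfunc"
  assumes A: "small_category A" and P: "small P" and order: "partial_order_on P r"
    and f: "f \<in> Fun A (poset_cat P r)"
begin

abbreviation "C \<equiv> poset_cat P r"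
abbreviation "F \<equiv> below_filtration P r f"
abbreviation "G \<equiv> groth C F"

lemma r_P: "(p, q) \<in> r \<Longrightarrow> p \<in> P \<and> q \<in> P"
  and r_refl: "p \<in> P \<Longrightarrow> (p, p) \<in> r"
  and r_trans: "(p, q) \<in> r \<Longrightarrow> (q, s) \<in> r \<Longrightarrow> (p, s) \<in> r"
  using order by (auto simp: partial_order_on_def preorder_on_def refl_on_def trans_def)

lemma Ac: "category A"
  by (rule small_categoryD(1)[OF A])

lemma hom_C: "k \<in> hom C p q \<longleftrightarrow> k = \<lblot>p, q\<rblot> \<and> (p, q) \<in> r"
  by (auto simp: hom_def poset_cat_def)

lemma C_simps [simp]: "Ob C = P" "Id C p = \<lblot>p, p\<rblot>" "\<lblot>q', s\<rblot> \<cdot>\<^bsub>C\<^esub> \<lblot>p, q\<rblot> = \<lblot>p, s\<rblot>" "Dom C = p1" "Cod C = p2"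
  by (auto simp: poset_cat_def)

lemma small_C: "small_category C"
  unfolding small_category_def
proof (intro conjI)
  show "category C"
    by (rule categoryI) (auto simp: hom_C r_refl intro: r_trans, auto simp: poset_cat_def dest: r_P)
  show "small (Ob C)" using P by simp
  have "Ar C \<subseteq> {\<lblot>p, q\<rblot> | p q. p \<in> P \<and> q \<in> P}" using r_P by (auto simp: poset_cat_def)
  then show "small (Ar C)" by (rule small_subset[OF small_pairs[OF P P]])
qed

text \<open>Arrows of \<open>poset_cat\<close> are the related pairs. The inequality lets an arrow
  from \<open>x\<close> to \<open>y\<close> lift to one from \<open>(f x, x)\<close> to any
  \<open>(q, y)\<close>, which is what makes \<open>f x\<close> the right stage for the left
  adjoint.\<close>

lemma f_mono: "g \<in> hom A x y \<Longrightarrow> (onOb f x, onOb f y) \<in> r"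
  using Fun_hom[OF f] by (auto simp: hom_C)

lemma f_P: "x \<in> Ob A \<Longrightarrow> onOb f x \<in> P"
  using Fun_Ob[OF f] by simp

lemma Ob_below: "x \<in> Ob (below r f p) \<longleftrightarrow> x \<in> Ob A \<and> (onOb f x, p) \<in> r"
  and hom_below: "g \<in> hom (below r f p) x y \<longleftrightarrow> g \<in> hom A x y \<and> (onOb f x, p) \<in> r \<and> (onOb f y, p) \<in> r"
  and below_simps [simp]: "Id (below r f p) = Id A" "Comp (below r f p) = Comp A" "Dom (below r f p) = Dom A"
    "Cod (below r f p) = Cod A"
  using FunD(2)[OF f] by (auto simp: below_def full_subcategory_def hom_def)

lemma Ar_below: "Ar (below r f p) \<subseteq> Ar A"
  using FunD(2)[OF f] by (auto simp: below_def full_subcategory_def)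

lemma category_below: "category (below r f p)"
proof (rule categoryI)
  fix g assume "g \<in> Ar (below r f p)"
  then have "g \<in> hom (below r f p) (Dom A g) (Cod A g)" using Ar_hom by fastforce
  then show "Dom (below r f p) g \<in> Ob (below r f p)" "Cod (below r f p) g \<in> Ob (below r f p)"
    using hom_Ob[OF Ac] by (auto simp: hom_below Ob_below)
next
  fix w x y z g h k assume "g \<in> hom (below r f p) w x" "h \<in> hom (below r f p) x y" "k \<in> hom (below r f p) y z"
  then show "k \<cdot>\<^bsub>below r f p\<^esub> (h \<cdot>\<^bsub>below r f p\<^esub> g) = k \<cdot>\<^bsub>below r f p\<^esub> h \<cdot>\<^bsub>below r f p\<^esub> g"
    using comp_assoc[OF Ac] by (auto simp: hom_below)
qed (auto simp: hom_below Ob_below Id_hom[OF Ac] comp_hom[OF Ac] comp_Id[OF Ac] Id_comp[OF Ac])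

lemma subcategory_below: "subcategory (below r f p) A"
  unfolding subcategory_def
  using category_below Ar_below FunD(2)[OF f] by (auto simp: Ob_below below_def full_subcategory_def)

lemma small_below: "small_category (below r f p)"
  unfolding small_category_def
  using category_below small_subset[OF small_categoryD(3)[OF A] Ar_below]
    small_subset[OF small_categoryD(2)[OF A] subcategory_simps(5)[OF subcategory_below]] by simp

lemma below_mono:
  assumes "(p, q) \<in> r"
  shows "Ob (below r f p) \<subseteq> Ob (below r f q)" "Ar (below r f p) \<subseteq> Ar (below r f q)"
  using assms r_trans by (auto simp: below_def full_subcategory_def)

lemma F_simps: "p \<in> P \<Longrightarrow> onOb F p = below r f p"
  "(p, q) \<in> r \<Longrightarrow> onAr F \<lblot>p, q\<rblot> = inclusion (below r f p) (below r f q)"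
  by (auto simp: below_filtration_def poset_cat_def)

lemma filtration_below: "filtration A C F"
  unfolding filtration_def
proof (intro conjI small_C FunI)
  show "category C" "category (Sub A)" using small_C category_Sub[OF Ac] by (auto simp: small_category_def)
  show "FSrc F = C" "FTgt F = Sub A" "onOb F \<in> extensional (Ob C)" "onAr F \<in> extensional (Ar C)"
    using FunD(2)[OF f] by (auto simp: below_filtration_def)
  show "onOb F p \<in> Ob (Sub A)" if "p \<in> Ob C" for p
    using that subcategory_below by (simp add: F_simps Sub_def)
  fix p q k assume k: "k \<in> hom C p q"
  then show "onAr F k \<in> hom (Sub A) (onOb F p) (onOb F q)"
    using r_P inclusion_Fun[OF subcategory_below subcategory_below below_mono]
      inclusion_comp[OF below_mono]
    by (auto simp: hom_C F_simps hom_Sub subcategory_below)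
  fix s l assume "l \<in> hom C q s"
  then show "onAr F (l \<cdot>\<^bsub>C\<^esub> k) = onAr F l \<cdot>\<^bsub>Sub A\<^esub> onAr F k"
    using k inclusion_comp[OF below_mono]
    by (auto simp: hom_C F_simps r_trans Sub_def)
next
  fix p assume "p \<in> Ob C"
  then show "onAr F (Id C p) = Id (Sub A) (onOb F p)"
    by (auto simp: F_simps r_refl Sub_def inclusion_def idF_def)
qed

section \<open>The Grothendieck construction of the filtration and its projections\<close>

lemma Ob_G: "z \<in> Ob G \<longleftrightarrow> (\<exists>p x. z = \<lblot>p, x\<rblot> \<and> x \<in> Ob A \<and> (onOb f x, p) \<in> r)"
proof -
  have "z \<in> Ob G \<longleftrightarrow> (\<exists>p x. z = \<lblot>p, x\<rblot> \<and> p \<in> P \<and> x \<in> Ob (onOb F p))" by (simp add: groth_def)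
  also have "\<dots> \<longleftrightarrow> (\<exists>p x. z = \<lblot>p, x\<rblot> \<and> x \<in> Ob A \<and> (onOb f x, p) \<in> r)"
    using r_P by (auto simp: F_simps Ob_below)
  finally show ?thesis .
qed

text \<open>The transition functors are inclusions of full subcategories, so an arrow over
  \<open>p \<le> q\<close> carries no more than an arrow from \<open>x\<close> to \<open>y\<close>
  in \<open>A\<close>.\<close>

lemma hom_G: "k \<in> hom G \<lblot>p, x\<rblot> \<lblot>q, y\<rblot> \<longleftrightarrow> (onOb f x, p) \<in> r \<and> (onOb f y, q) \<in> r \<and> (p, q) \<in> r \<and>
  (\<exists>g \<in> hom A x y. k = \<lblot>\<lblot>p, x\<rblot>, \<lblot>\<lblot>\<lblot>p, q\<rblot>, g\<rblot>, \<lblot>q, y\<rblot>\<rblot>\<rblot>)"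
proof -
  have "k \<in> hom G \<lblot>p, x\<rblot> \<lblot>q, y\<rblot> \<longleftrightarrow> \<lblot>p, x\<rblot> \<in> Ob G \<and> \<lblot>q, y\<rblot> \<in> Ob G \<and> (p, q) \<in> r \<and>
      (\<exists>g \<in> hom (onOb F q) (onOb (onAr F \<lblot>p, q\<rblot>) x) y. k = \<lblot>\<lblot>p, x\<rblot>, \<lblot>\<lblot>\<lblot>p, q\<rblot>, g\<rblot>, \<lblot>q, y\<rblot>\<rblot>\<rblot>)"
    by (auto simp: groth_def hom_labelled_cat hom_C)
  also have "\<dots> \<longleftrightarrow> x \<in> Ob A \<and> y \<in> Ob A \<and> (onOb f x, p) \<in> r \<and> (onOb f y, q) \<in> r \<and> (p, q) \<in> r \<and>
      (\<exists>g \<in> hom (onOb F q) (onOb (onAr F \<lblot>p, q\<rblot>) x) y. k = \<lblot>\<lblot>p, x\<rblot>, \<lblot>\<lblot>\<lblot>p, q\<rblot>, g\<rblot>, \<lblot>q, y\<rblot>\<rblot>\<rblot>)"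
    by (auto simp: Ob_G)
  also have "\<dots> \<longleftrightarrow> x \<in> Ob A \<and> y \<in> Ob A \<and> (onOb f x, p) \<in> r \<and> (onOb f y, q) \<in> r \<and> (p, q) \<in> r \<and>
      (\<exists>g \<in> hom A x y. k = \<lblot>\<lblot>p, x\<rblot>, \<lblot>\<lblot>\<lblot>p, q\<rblot>, g\<rblot>, \<lblot>q, y\<rblot>\<rblot>\<rblot>)"
  proof (intro conj_cong refl)
    assume a: "x \<in> Ob A" "(onOb f x, p) \<in> r" "(onOb f y, q) \<in> r" "(p, q) \<in> r"
    \<comment> \<open>The inclusion is \<open>undefined\<close> outside its source; \<open>x\<close>
      belongs to the source because \<open>f x \<le> p\<close>.\<close>
    then have "onOb (onAr F \<lblot>p, q\<rblot>) x = x" by (simp add: F_simps inclusion_def Ob_below)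
    moreover have "onOb F q = below r f q" using a r_P F_simps by blast
    moreover have "(onOb f x, q) \<in> r" using a r_trans by blast
    ultimately show "(\<exists>g \<in> hom (onOb F q) (onOb (onAr F \<lblot>p, q\<rblot>) x) y. k = \<lblot>\<lblot>p, x\<rblot>, \<lblot>\<lblot>\<lblot>p, q\<rblot>, g\<rblot>, \<lblot>q, y\<rblot>\<rblot>\<rblot>) \<longleftrightarrow>
      (\<exists>g \<in> hom A x y. k = \<lblot>\<lblot>p, x\<rblot>, \<lblot>\<lblot>\<lblot>p, q\<rblot>, g\<rblot>, \<lblot>q, y\<rblot>\<rblot>\<rblot>)"
      using a by (auto simp: hom_below)
  qed
  finally show ?thesis using hom_Ob[OF Ac] by blast
qed

lemma hom_GE:
  assumes "k \<in> hom G z z'"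
  obtains p x q y g where "z = \<lblot>p, x\<rblot>" "z' = \<lblot>q, y\<rblot>" "k = \<lblot>\<lblot>p, x\<rblot>, \<lblot>\<lblot>\<lblot>p, q\<rblot>, g\<rblot>, \<lblot>q, y\<rblot>\<rblot>\<rblot>" "g \<in> hom A x y"
    "(onOb f x, p) \<in> r" "(onOb f y, q) \<in> r" "(p, q) \<in> r"
proof -
  have "z \<in> Ob G" "z' \<in> Ob G" using assms by (auto simp: groth_def hom_labelled_cat)
  then obtain p x q y where z: "z = \<lblot>p, x\<rblot>" "z' = \<lblot>q, y\<rblot>" unfolding Ob_G by blast
  then show thesis using that assms unfolding z hom_G by blast
qed

text \<open>Composition first applies the transition functor to \<open>g\<close>. The hypotheses put
  \<open>g\<close> into the subcategory at \<open>q\<close>, where the inclusion returns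
  \<open>g\<close> and not \<open>undefined\<close>.\<close>

lemma comp_G:
  assumes "g \<in> hom A x y" "(onOb f y, q) \<in> r" "(q, s) \<in> r"
  shows "\<lblot>b, \<lblot>\<lblot>\<lblot>q, s\<rblot>, h\<rblot>, c\<rblot>\<rblot> \<cdot>\<^bsub>G\<^esub> \<lblot>a, \<lblot>\<lblot>\<lblot>p, q\<rblot>, g\<rblot>, b'\<rblot>\<rblot> = \<lblot>a, \<lblot>\<lblot>\<lblot>p, s\<rblot>, h \<cdot>\<^bsub>A\<^esub> g\<rblot>, c\<rblot>\<rblot>"
proof -
  have "g \<in> hom (below r f q) x y" using assms r_trans[OF f_mono[OF assms(1)]] by (auto simp: hom_below)
  then have "onAr (onAr F \<lblot>q, s\<rblot>) g = g" using assms(3) hom_Ar by (fastforce simp: F_simps inclusion_def)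
  moreover have "onOb F s = below r f s" using assms(3) r_P F_simps by blast
  ultimately show ?thesis by (simp add: groth_def)
qed

lemma Id_G: "(onOb f x, p) \<in> r \<Longrightarrow> Id G \<lblot>p, x\<rblot> = \<lblot>\<lblot>p, x\<rblot>, \<lblot>\<lblot>\<lblot>p, p\<rblot>, Id A x\<rblot>, \<lblot>p, x\<rblot>\<rblot>\<rblot>"
  using r_P by (simp add: groth_def F_simps)

lemma category_G: "category G"
proof (rule categoryI)
  fix k assume "k \<in> Ar G"
  then have "k \<in> hom G (Dom G k) (Cod G k)" by (rule Ar_hom)
  then show "Dom G k \<in> Ob G" "Cod G k \<in> Ob G"
    using hom_Ob[OF Ac] by (auto simp: Ob_G elim!: hom_GE)
next
  fix z assume "z \<in> Ob G"
  then show "Id G z \<in> hom G z z" using r_refl r_P Id_hom[OF Ac] by (auto simp: Ob_G Id_G hom_G)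
next
  fix z z' z'' k l assume "k \<in> hom G z z'" "l \<in> hom G z' z''"
  then show "l \<cdot>\<^bsub>G\<^esub> k \<in> hom G z z''"
    by (auto simp: comp_G hom_G elim!: hom_GE intro: r_trans comp_hom[OF Ac])
next
  fix z z' k assume k: "k \<in> hom G z z'"
  then show "k \<cdot>\<^bsub>G\<^esub> Id G z = k"
  proof (rule hom_GE)
    fix p x q y g assume *: "z = \<lblot>p, x\<rblot>" "z' = \<lblot>q, y\<rblot>" "k = \<lblot>\<lblot>p, x\<rblot>, \<lblot>\<lblot>\<lblot>p, q\<rblot>, g\<rblot>, \<lblot>q, y\<rblot>\<rblot>\<rblot>" "g \<in> hom A x y"
      "(onOb f x, p) \<in> r" "(onOb f y, q) \<in> r" "(p, q) \<in> r"
    then show ?thesis using comp_G[OF Id_hom[OF Ac hom_Ob(1)[OF Ac *(4)]] *(5,7)] by (simp add: Id_G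
      comp_Id[OF Ac])
  qed
  from k show "Id G z' \<cdot>\<^bsub>G\<^esub> k = k"
    by (rule hom_GE) (use r_refl r_P in \<open>auto simp: Id_G comp_G Id_comp[OF Ac]\<close>)
next
  fix a b c d k l m assume "k \<in> hom G a b" "l \<in> hom G b c" "m \<in> hom G c d"
  then show "m \<cdot>\<^bsub>G\<^esub> (l \<cdot>\<^bsub>G\<^esub> k) = m \<cdot>\<^bsub>G\<^esub> l \<cdot>\<^bsub>G\<^esub> k"
    by (auto elim!: hom_GE simp: comp_G comp_G[OF comp_hom[OF Ac]] comp_assoc[OF Ac] r_trans)
qed

text \<open>Encoded arrows lie in an iterated set of pairs formed from objects of \<open>G\<close>
  and arrows of \<open>C\<close> and \<open>A\<close>.\<close>

lemma small_G: "small_category G"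
proof -
  have "Ob G \<subseteq> {\<lblot>p, x\<rblot> | p x. p \<in> P \<and> x \<in> Ob A}" using r_P by (auto simp: Ob_G)
  then have O: "small (Ob G)" by (rule small_subset[OF small_pairs[OF P small_categoryD(2)[OF A]]])
  let ?H = "{\<lblot>k, g\<rblot> | k g. k \<in> Ar C \<and> g \<in> Ar A}"
  have "small {\<lblot>z, l\<rblot> | z l. z \<in> Ob G \<and> l \<in> {\<lblot>h, z'\<rblot> | h z'. h \<in> ?H \<and> z' \<in> Ob G}}"
    by (rule small_pairs[OF O small_pairs[OF small_pairs[OF small_categoryD(3)[OF small_C]
      small_categoryD(3)[OF A]] O]])
  moreover have "k \<in> {\<lblot>z, l\<rblot> | z l. z \<in> Ob G \<and> l \<in> {\<lblot>h, z'\<rblot> | h z'. h \<in> ?H \<and> z' \<in> Ob G}}" if "k \<in> Ar G" for k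
    using Ar_hom[OF that]
  proof (rule hom_GE)
    fix p x q y g assume *: "k = \<lblot>\<lblot>p, x\<rblot>, \<lblot>\<lblot>\<lblot>p, q\<rblot>, g\<rblot>, \<lblot>q, y\<rblot>\<rblot>\<rblot>" "g \<in> hom A x y" "(onOb f x, p) \<in> r" "(onOb
      f y, q) \<in> r" "(p, q) \<in> r"
    have "\<lblot>p, x\<rblot> \<in> Ob G" "\<lblot>q, y\<rblot> \<in> Ob G" using * hom_Ob[OF Ac *(2)] by (simp_all add: Ob_G)
    moreover have "\<lblot>p, q\<rblot> \<in> Ar C" using *(5) by (auto simp: poset_cat_def)
    ultimately show ?thesis using *(1) hom_Ar[OF *(2)] by simp
  qed
  ultimately have "small (Ar G)" by (rule small_subset[OF _ subsetI])
  then show ?thesis using category_G O by (simp add: small_category_def)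
qed

lemma groth_to_simps:
  "(onOb f x, p) \<in> r \<Longrightarrow> x \<in> Ob A \<Longrightarrow> onOb (groth_to A C F) \<lblot>p, x\<rblot> = x"
  "\<lblot>z, \<lblot>\<lblot>k, g\<rblot>, z'\<rblot>\<rblot> \<in> hom G a b \<Longrightarrow> onAr (groth_to A C F) \<lblot>z, \<lblot>\<lblot>k, g\<rblot>, z'\<rblot>\<rblot> = g"
  by (auto simp: groth_to_def Ob_G dest: hom_Ar)

lemma groth_proj_simps:
  "(onOb f x, p) \<in> r \<Longrightarrow> x \<in> Ob A \<Longrightarrow> onOb (groth_proj C F) \<lblot>p, x\<rblot> = p"
  "\<lblot>z, \<lblot>\<lblot>k, g\<rblot>, z'\<rblot>\<rblot> \<in> hom G a b \<Longrightarrow> onAr (groth_proj C F) \<lblot>z, \<lblot>\<lblot>k, g\<rblot>, z'\<rblot>\<rblot> = k"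
  by (auto simp: groth_proj_def Ob_G dest: hom_Ar)

lemma groth_to_Fun: "groth_to A C F \<in> Fun G A"
proof (rule FunI[OF category_G Ac])
  fix z z' k assume k: "k \<in> hom G z z'"
  from k show "onAr (groth_to A C F) k \<in> hom A (onOb (groth_to A C F) z) (onOb (groth_to A C F) z')"
    by (rule hom_GE) (use k hom_Ob[OF Ac] groth_to_simps in \<open>fastforce\<close>)
  fix z'' l assume l: "l \<in> hom G z' z''"
  show "onAr (groth_to A C F) (l \<cdot>\<^bsub>G\<^esub> k) = onAr (groth_to A C F) l \<cdot>\<^bsub>A\<^esub> onAr (groth_to A C F) k"
    using k
  proof (rule hom_GE)
    fix p x q y g assume 1: "z = \<lblot>p, x\<rblot>" "z' = \<lblot>q, y\<rblot>" "k = \<lblot>\<lblot>p, x\<rblot>, \<lblot>\<lblot>\<lblot>p, q\<rblot>, g\<rblot>, \<lblot>q, y\<rblot>\<rblot>\<rblot>" "g \<in> hom A x y"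
      "(onOb f y, q) \<in> r"
    obtain s w h where 2: "l = \<lblot>\<lblot>q, y\<rblot>, \<lblot>\<lblot>\<lblot>q, s\<rblot>, h\<rblot>, \<lblot>s, w\<rblot>\<rblot>\<rblot>" "(q, s) \<in> r"
      using l 1(2) by (auto elim!: hom_GE)
    show ?thesis
      using comp_hom[OF category_G k l] k l unfolding 1(3) 2(1) comp_G[OF 1(4,5) 2(2)]
      by (simp add: groth_to_simps)
  qed
next
  fix z assume z: "z \<in> Ob G"
  then show "onOb (groth_to A C F) z \<in> Ob A" by (auto simp: Ob_G groth_to_simps)
  show "onAr (groth_to A C F) (Id G z) = Id A (onOb (groth_to A C F) z)"
    using Id_hom[OF category_G z] z by (auto simp: Ob_G Id_G groth_to_simps)
qed (auto simp: groth_to_def)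

lemma groth_proj_Fun: "groth_proj C F \<in> Fun G C"
proof (rule FunI[OF category_G small_categoryD(1)[OF small_C]])
  fix z z' k assume k: "k \<in> hom G z z'"
  from k show "onAr (groth_proj C F) k \<in> hom C (onOb (groth_proj C F) z) (onOb (groth_proj C F) z')"
    by (rule hom_GE) (use k hom_Ob[OF Ac] groth_proj_simps in \<open>fastforce simp: hom_C\<close>)
  fix z'' l assume l: "l \<in> hom G z' z''"
  show "onAr (groth_proj C F) (l \<cdot>\<^bsub>G\<^esub> k) = onAr (groth_proj C F) l \<cdot>\<^bsub>C\<^esub> onAr (groth_proj C F) k"
    using k
  proof (rule hom_GE)
    fix p x q y g assume 1: "z = \<lblot>p, x\<rblot>" "z' = \<lblot>q, y\<rblot>" "k = \<lblot>\<lblot>p, x\<rblot>, \<lblot>\<lblot>\<lblot>p, q\<rblot>, g\<rblot>, \<lblot>q, y\<rblot>\<rblot>\<rblot>" "g \<in> hom A x y"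
      "(onOb f y, q) \<in> r"
    obtain s w h where 2: "l = \<lblot>\<lblot>q, y\<rblot>, \<lblot>\<lblot>\<lblot>q, s\<rblot>, h\<rblot>, \<lblot>s, w\<rblot>\<rblot>\<rblot>" "(q, s) \<in> r"
      using l 1(2) by (auto elim!: hom_GE)
    show ?thesis
      using comp_hom[OF category_G k l] k l unfolding 1(3) 2(1) comp_G[OF 1(4,5) 2(2)]
      by (simp add: groth_proj_simps)
  qed
next
  fix z assume z: "z \<in> Ob G"
  then show "onOb (groth_proj C F) z \<in> Ob C" using r_P by (auto simp: Ob_G groth_proj_simps)
  show "onAr (groth_proj C F) (Id G z) = Id C (onOb (groth_proj C F) z)"
    using Id_hom[OF category_G z] z by (auto simp: Ob_G Id_G groth_proj_simps)
qed (auto simp: groth_proj_def)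

text \<open>The left adjoint of \<open>(p, x) \<mapsto> x\<close> sends \<open>x\<close> to \<open>(f x, x)\<close>.\<close>

lemma groth_to_universal:
  assumes a: "a \<in> Ob A"
  shows "universal (groth_to A C F) a \<lblot>onOb f a, a\<rblot> (Id A a)"
proof (rule universalI[OF groth_to_Fun])
  note fa = r_refl[OF f_P[OF a]]
  show "\<lblot>onOb f a, a\<rblot> \<in> Ob G" using a fa by (simp add: Ob_G)
  show "Id A a \<in> hom A a (onOb (groth_to A C F) \<lblot>onOb f a, a\<rblot>)"
    using Id_hom[OF Ac a] groth_to_simps(1)[OF fa a] by simp
next
  fix z g assume "z \<in> Ob G" and g: "g \<in> hom A a (onOb (groth_to A C F) z)"
  then obtain q y where z: "z = \<lblot>q, y\<rblot>" "y \<in> Ob A" "(onOb f y, q) \<in> r" unfolding Ob_G by blast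
  then have g: "g \<in> hom A a y" using g by (simp add: groth_to_simps)
  \<comment> \<open>The pair \<open>(f a, q)\<close> is an arrow of the poset because
    \<open>f a \<le> f y \<le> q\<close>.\<close>
  let ?h = "\<lblot>\<lblot>onOb f a, a\<rblot>, \<lblot>\<lblot>\<lblot>onOb f a, q\<rblot>, g\<rblot>, \<lblot>q, y\<rblot>\<rblot>\<rblot>"
  have h: "?h \<in> hom G \<lblot>onOb f a, a\<rblot> z"
    using g z r_refl[OF f_P[OF a]] r_trans[OF f_mono[OF g] z(3)] by (simp add: hom_G)
  then have "onAr (groth_to A C F) ?h \<cdot>\<^bsub>A\<^esub> Id A a = g" by (simp add: groth_to_simps(2)[OF h] comp_Id[OF Ac g])
  with h show "\<exists>h \<in> hom G \<lblot>onOb f a, a\<rblot> z. onAr (groth_to A C F) h \<cdot>\<^bsub>A\<^esub> Id A a = g" by blast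
next
  fix z h h' assume h: "h \<in> hom G \<lblot>onOb f a, a\<rblot> z" and h': "h' \<in> hom G \<lblot>onOb f a, a\<rblot> z"
    and eq: "onAr (groth_to A C F) h \<cdot>\<^bsub>A\<^esub> Id A a = onAr (groth_to A C F) h' \<cdot>\<^bsub>A\<^esub> Id A a"
  \<comment> \<open>Source, target and the arrow of the poset are forced, so an arrow out of
    \<open>(f a, a)\<close> is determined by its component in \<open>A\<close>.\<close>
  obtain q y g where 1: "z = \<lblot>q, y\<rblot>" "h = \<lblot>\<lblot>onOb f a, a\<rblot>, \<lblot>\<lblot>\<lblot>onOb f a, q\<rblot>, g\<rblot>, \<lblot>q, y\<rblot>\<rblot>\<rblot>" "g \<in> hom A a y"
    using h by (auto elim!: hom_GE)
  obtain g' where 2: "h' = \<lblot>\<lblot>onOb f a, a\<rblot>, \<lblot>\<lblot>\<lblot>onOb f a, q\<rblot>, g'\<rblot>, \<lblot>q, y\<rblot>\<rblot>\<rblot>" "g' \<in> hom A a y"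
    using h' 1(1) by (auto elim!: hom_GE)
  show "h = h'"
    using eq groth_to_simps(2)[OF h[unfolded 1(2)]] groth_to_simps(2)[OF h'[unfolded 2(1)]]
    by (simp add: 1 2 comp_Id[OF Ac 1(3)] comp_Id[OF Ac 2(2)])
qed

section \<open>The fibres of the projection to the poset\<close>

lemma groth_fibre_hom:
  assumes p: "p \<in> P" and g: "g \<in> hom (below r f p) x y"
  shows "onAr (groth_fibre C F p) g = \<lblot>\<lblot>p, x\<rblot>, \<lblot>\<lblot>\<lblot>p, p\<rblot>, g\<rblot>, \<lblot>p, y\<rblot>\<rblot>\<rblot>"
    and "onAr (groth_fibre C F p) g \<in> hom G \<lblot>p, x\<rblot> \<lblot>p, y\<rblot>"
proof -
  show e: "onAr (groth_fibre C F p) g = \<lblot>\<lblot>p, x\<rblot>, \<lblot>\<lblot>\<lblot>p, p\<rblot>, g\<rblot>, \<lblot>p, y\<rblot>\<rblot>\<rblot>"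
    using g p by (simp add: groth_fibre_def F_simps hom_iff)
  show "onAr (groth_fibre C F p) g \<in> hom G \<lblot>p, x\<rblot> \<lblot>p, y\<rblot>"
    unfolding e using g p r_refl by (simp add: hom_G hom_below)
qed

lemma groth_fibre_Ob: "p \<in> P \<Longrightarrow> x \<in> Ob (below r f p) \<Longrightarrow> onOb (groth_fibre C F p) x = \<lblot>p, x\<rblot>"
  by (simp add: groth_fibre_def F_simps)

lemma groth_fibre_Fun:
  assumes p: "p \<in> P" shows "groth_fibre C F p \<in> Fun (below r f p) G"
proof (rule FunI[OF category_below category_G])
  fix x y g assume g: "g \<in> hom (below r f p) x y"
  note gh = groth_fibre_hom[OF p g]
  show "onAr (groth_fibre C F p) g \<in> hom G (onOb (groth_fibre C F p) x) (onOb (groth_fibre C F p) y)"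
    using gh hom_Ob[OF category_below g] by (simp add: groth_fibre_Ob[OF p])
  fix z h assume h: "h \<in> hom (below r f p) y z"
  have gA: "g \<in> hom A x y" "(onOb f y, p) \<in> r" using g by (auto simp: hom_below)
  show "onAr (groth_fibre C F p) (h \<cdot>\<^bsub>below r f p\<^esub> g) = onAr (groth_fibre C F p) h \<cdot>\<^bsub>G\<^esub> onAr (groth_fibre C F
    p) g"
    using gh(1) groth_fibre_hom(1)[OF p h] groth_fibre_hom(1)[OF p comp_hom[OF category_below g h]]
      comp_G[OF gA r_refl[OF p]] by simp
next
  fix x assume x: "x \<in> Ob (below r f p)"
  then have "(onOb f x, p) \<in> r" "x \<in> Ob A" by (auto simp: Ob_below)
  then show "onOb (groth_fibre C F p) x \<in> Ob G" using x by (simp add: groth_fibre_Ob[OF p] Ob_G)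
  show "onAr (groth_fibre C F p) (Id (below r f p) x) = Id G (onOb (groth_fibre C F p) x)"
    using groth_fibre_hom(1)[OF p Id_hom[OF category_below x]] x \<open>(onOb f x, p) \<in> r\<close>
    by (simp add: groth_fibre_Ob[OF p] Id_G)
qed (use p in \<open>auto simp: groth_fibre_def F_simps\<close>)

lemma groth_to_fibre:
  assumes p: "p \<in> P" shows "groth_to A C F \<odot> groth_fibre C F p = inclusion (below r f p) A"
proof (rule Fun_eqI[OF compF_Fun[OF groth_fibre_Fun[OF p] groth_to_Fun]])
  note jF = groth_fibre_Fun[OF p]
  show "inclusion (below r f p) A \<in> Fun (below r f p) A"
    by (rule inclusion_Fun[OF subcategory_below subcategory_refl[OF Ac]])
      (use subcategory_simps[OF subcategory_below] in auto)
  show "onOb (groth_to A C F \<odot> groth_fibre C F p) x = onOb (inclusion (below r f p) A) x" if x: "x \<in> Ob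
    (below r f p)" for x
    using x by (simp add: compF_Ob[OF jF x] groth_fibre_Ob[OF p] inclusion_def) (simp add: Ob_below
      groth_to_simps)
  show "onAr (groth_to A C F \<odot> groth_fibre C F p) g = onAr (inclusion (below r f p) A) g" if g: "g \<in> hom
    (below r f p) x y" for g x y
    using groth_fibre_hom[OF p g] hom_Ar[OF g] groth_to_simps(2)
    by (simp add: compF_Ar[OF jF hom_Ar[OF g]] inclusion_def)
qed

lemma groth_proj_fibre:
  assumes p: "p \<in> P" shows "groth_proj C F \<odot> groth_fibre C F p = const (below r f p) C p"
proof (rule Fun_eqI[OF compF_Fun[OF groth_fibre_Fun[OF p] groth_proj_Fun]])
  note jF = groth_fibre_Fun[OF p]
  show "const (below r f p) C p \<in> Fun (below r f p) C"
    by (rule const_Fun[OF category_below small_categoryD(1)[OF small_C]]) (simp add: p)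
  show "onOb (groth_proj C F \<odot> groth_fibre C F p) x = onOb (const (below r f p) C p) x" if x: "x \<in> Ob (below
    r f p)" for x
    using x by (simp add: compF_Ob[OF jF x] groth_fibre_Ob[OF p]) (simp add: Ob_below groth_proj_simps)
  show "onAr (groth_proj C F \<odot> groth_fibre C F p) g = onAr (const (below r f p) C p) g" if g: "g \<in> hom (below
    r f p) x y" for g x y
    using groth_fibre_hom[OF p g] hom_Ar[OF g] groth_proj_simps(2)
    by (simp add: compF_Ar[OF jF hom_Ar[OF g]])
qed

text \<open>The left adjoint to the inclusion of the fibre into \<open>\<pi>/p\<close> sends \<open>((q, x), q \<le> p)\<close> to \<open>x\<close>.\<close>

lemma groth_fibre_final:
  assumes p: "p \<in> P"
  shows "final_at (groth_proj C F) p (groth_fibre C F p) (\<lambda>_. Id C p)"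
proof (rule final_atI[OF groth_proj_Fun groth_fibre_Fun[OF p]])
  let ?j = "groth_fibre C F p" and ?\<pi> = "groth_proj C F" and ?J = "below r f p"
  fix z h assume "z \<in> Ob G" and h: "h \<in> hom C (onOb ?\<pi> z) p"
  then obtain q x where z: "z = \<lblot>q, x\<rblot>" "x \<in> Ob A" "(onOb f x, q) \<in> r" unfolding Ob_G by blast
  then have h: "h = \<lblot>q, p\<rblot>" "(q, p) \<in> r" using h by (simp_all add: groth_proj_simps hom_C)
  note xp = r_trans[OF z(3) h(2)]
  have x: "x \<in> Ob ?J" using z xp by (simp add: Ob_below)
  \<comment> \<open>The unit of the adjunction at \<open>((q, x), q \<le> p)\<close>:
    \<open>x\<close> is pushed from stage \<open>q\<close> to stage \<open>p\<close> by its
    identity.\<close>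
  let ?g = "\<lblot>\<lblot>q, x\<rblot>, \<lblot>\<lblot>\<lblot>q, p\<rblot>, Id A x\<rblot>, \<lblot>p, x\<rblot>\<rblot>\<rblot>"
  have g: "?g \<in> hom G z (onOb ?j x)"
    using z h xp Id_hom[OF Ac z(2)] by (simp add: groth_fibre_Ob[OF p x] hom_G)
  have jt: "onAr ?j t \<cdot>\<^bsub>G\<^esub> ?g = \<lblot>\<lblot>q, x\<rblot>, \<lblot>\<lblot>\<lblot>q, p\<rblot>, t\<rblot>, \<lblot>p, y\<rblot>\<rblot>\<rblot>" if t: "t \<in> hom ?J x y" for t y
  proof -
    have tA: "t \<in> hom A x y" using t by (simp add: hom_below)
    show ?thesis
      using groth_fibre_hom(1)[OF p t] comp_G[OF Id_hom[OF Ac z(2)] xp r_refl[OF p]] comp_Id[OF Ac tA] by simp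
  qed
  \<comment> \<open>An arrow from \<open>(q, x)\<close> to \<open>(p, y)\<close> is given by its
    component in \<open>A\<close>, which is already an arrow of the subcategory at \<open>p\<close>
    because that subcategory is full.\<close>
  have "\<exists>!t. t \<in> hom ?J x y \<and> onAr ?j t \<cdot>\<^bsub>G\<^esub> ?g = g'" if y: "y \<in> Ob ?J" and g': "g' \<in> hom G z (onOb ?j y)"
    for y g'
  proof -
    obtain t where t: "t \<in> hom A x y" "g' = \<lblot>\<lblot>q, x\<rblot>, \<lblot>\<lblot>\<lblot>q, p\<rblot>, t\<rblot>, \<lblot>p, y\<rblot>\<rblot>\<rblot>"
      using g' unfolding z(1) groth_fibre_Ob[OF p y] hom_G by blast
    have t': "t \<in> hom ?J x y" using t y xp by (simp add: hom_below Ob_below)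
    show ?thesis
    proof (rule ex1I[of _ t])
      show "t \<in> hom ?J x y \<and> onAr ?j t \<cdot>\<^bsub>G\<^esub> ?g = g'" using t' jt[OF t'] t(2) by simp
      show "s = t" if "s \<in> hom ?J x y \<and> onAr ?j s \<cdot>\<^bsub>G\<^esub> ?g = g'" for s
        using that jt[of s y] t(2) by simp
    qed
  qed
  moreover have "Id C p \<cdot>\<^bsub>C\<^esub> onAr ?\<pi> ?g = h" using groth_proj_simps(2)[OF g] h by simp
  ultimately show "\<exists>i\<in>Ob ?J. \<exists>g\<in>hom G z (onOb ?j i). Id C p \<cdot>\<^bsub>C\<^esub> onAr ?\<pi> g = h \<and>
       (\<forall>j'\<in>Ob ?J. \<forall>g'\<in>hom G z (onOb ?j j'). Id C p \<cdot>\<^bsub>C\<^esub> onAr ?\<pi> g' = h \<longrightarrow>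
          (\<exists>!t. t \<in> hom ?J i j' \<and> onAr ?j t \<cdot>\<^bsub>G\<^esub> g = g'))"
    using x g by (intro bexI[of _ x] bexI[of _ ?g]) simp_all
qed

lemma groth_SFun: "groth_to A C F \<in> SFun G A" "groth_proj C F \<in> SFun G C"
  "p \<in> P \<Longrightarrow> groth_fibre C F p \<in> SFun (below r f p) G"
  using SFunI small_G A small_C small_below groth_to_Fun groth_proj_Fun groth_fibre_Fun by blast+

text \<open>With an identity as change of parameters, the mate in \<open>smate_proj2_iso\<close> is
  literally \<open>final_map\<close>; the universal arrows are those of
  \<open>groth_to_universal\<close>.\<close>

lemma groth_to_final: "homotopy_final TYPE('o) TYPE('m) (groth_to A C F)"
  unfolding homotopy_final_def
proof (intro allI impI ballI)
  fix D :: "('u, 'o, 'm) prederiv" and B :: "'u scat" and X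
  assume D: "derivator D" and B: "small_category B" and X: "X \<in> Ob (val (shift D (FTgt (groth_to A C F))) B)"
  interpret derivator_on D
    by unfold_locales (use D in \<open>simp_all add: derivator_def\<close>)
  have s: "FSrc (groth_to A C F) = G" "FTgt (groth_to A C F) = A" using FunD[OF groth_to_Fun] by auto
  have X: "X \<in> Ob (V (A \<times>\<^sub>c B))" using X s by (simp add: shift_def)
  show "isomorphism (val D B) (cmp (final_map D (groth_to A C F) B) X)"
    unfolding final_map_def s
    by (rule smate_proj2_iso[OF groth_SFun(1) SFun_idF[OF B] X]) (use groth_to_universal in blast)
qed

end

theorem theorem5p32:
  fixes A :: "'u::universe scat" and P :: "'u set" and r :: "'u rel" and f :: "'u sfunc"
  assumes "small_category A"
    and "small P" and "partial_order_on P r"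
    and "f \<in> Fun A (poset_cat P r)"
  shows "left_filtration TYPE('o) TYPE('m) A (poset_cat P r) (below_filtration P r f) \<and>
    (\<forall>D :: ('u, 'o, 'm) prederiv. derivator D \<longrightarrow>
      (let C = poset_cat P r; F = below_filtration P r f; d = decomposition D A C F in
         derivator_morphism (shift D A) (shift D C) d \<and>
         invertible_modification (shift D A) D
           (colim_mor D C \<odot>\<^sub>m d) (colim_mor D A) (decomposition_colim D A C F) \<and>
         (\<forall>p\<in>P. invertible_modification (shift D A) D
           (colim_mor D (below r f p) \<odot>\<^sub>m pull_mor D (inclusion (below r f p) A)) (eval_mor D C p \<odot>\<^sub>m d)
           (decomposition_fibre D A C F p))))"
proof -
  interpret functor_to_poset A P r f
    by unfold_locales fact+
  have un: "\<exists>Z e. universal (groth_to A C F) a Z e" if "a \<in> Ob A" for a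
    using groth_to_universal[OF that] by blast
  have "left_filtration TYPE('o) TYPE('m) A C F"
    unfolding left_filtration_def using filtration_below groth_to_final by blast
  moreover have "derivator_morphism (shift D A) (shift D C) (decomposition D A C F) \<and>
      invertible_modification (shift D A) D (colim_mor D C \<odot>\<^sub>m decomposition D A C F) (colim_mor D A)
        (decomposition_colim D A C F) \<and>
      (\<forall>p\<in>P. invertible_modification (shift D A) D
        (colim_mor D (below r f p) \<odot>\<^sub>m pull_mor D (inclusion (below r f p) A)) (eval_mor D C p \<odot>\<^sub>m
          decomposition D A C F)
        (decomposition_fibre D A C F p))" if D: "derivator D" for D :: "('u, 'o, 'm) prederiv"
  proof -
    interpret derivator_on D
      by unfold_locales (use D in \<open>simp_all add: derivator_def\<close>)
    \<comment> \<open>The stage \<open>onOb F p\<close> of the filtration is rewritten to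
      \<open>below r f p\<close>; the strict equations for the fibre and its finality discharge the
      remaining premises.\<close>
    have "invertible_modification (shift D A) D
        (colim_mor D (below r f p) \<odot>\<^sub>m pull_mor D (inclusion (below r f p) A)) (eval_mor D C p \<odot>\<^sub>m
          decomposition D A C F)
        (decomposition_fibre D A C F p)" if p: "p \<in> P" for p
      using decomposition_fibre_invertible[OF groth_SFun(1,2), of p] groth_SFun(3)[OF p] p
        groth_proj_fibre[OF p]
        groth_to_fibre[OF p] groth_fibre_final[OF p] F_simps(1)[OF p] by simp
    then show ?thesis
      using decomposition_morphism[OF groth_SFun(1,2)] decomposition_colim_invertible[OF groth_SFun(1,2) un]
        by blast
  qed
  ultimately show ?thesis by (simp add: Let_def)
qed

end
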